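(* Let $M$ be a graded $QS$-manifold whose homological vector field $\hat Q$ has weight $q$ and whose Schouten bracket, with Hamiltonian $S$, has weight $s$, and suppose a linear connection of zero weight on $M$ is given. Let $DM=T^*M$ be the double with homological field $\hat Q_D=X_Q+X_S$ and total weight $W=w+(q-s)d$. Let $Q_D=p_{\hat Q_D}\in C^\infty(T^*DM)$ be the Hamiltonian corresponding to $\hat Q_D$ and let $r=p_aq^a+\Gamma_{ab}{}^cy_cq^bq^a\in C^\infty(T^*DM)$. Then the function $S_D=\frac12\{Q_D,r\}\in C^\infty(T^*DM)$ (canonical Poisson bracket on $T^*DM$) is quadratic in the momenta $p_a,q^a$ and has weight $W(S_D)=s$.
   Context: Everything is $\mathbb Z_2$-graded (manifold means supermanifold); tilde denotes parity. A graded manifold is a supermanifold with a distinguished class of atlases whose coordinates $x^a$ (parity $\tilde a$) carry weights $w(x^a)=w_a\in\mathbb Z$, preserved by coordinate changes, functions being polynomial in coordinates of nonzero weight. A vector field $X=X^a\partial_a$ has weight $w(X)=w(X^a)-w_a$. On a cotangent bundle $T^*N$ with coordinates $z^A$ and momenta $\zeta_A$, the canonical Poisson bracket is $\{f,g\}=(-1)^{\tilde A(\tilde f+1)}\frac{\partial f}{\partial\zeta_A}\frac{\partial g}{\partial z^A}-(-1)^{\tilde A\tilde f}\frac{\partial f}{\partial z^A}\frac{\partial g}{\partial\zeta_A}$; $X_f=\{f,\ \}$; for a vector field $X=X^A\partial_A$ on $N$, $p_X=X^A\zeta_A$. If $N$ carries a weight, the induced weight on $T^*N$ gives $\zeta_A$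 minus the weight of $z^A$. A graded $QS$-manifold is a graded manifold with a homological vector field $\hat Q=Q^a\partial_a$ (odd, $\hat Q^2=0$) and a Schouten bracket $\{f,g\}_S=\{f,\{S,g\}\}$ given by an odd $S=\frac12S^{ab}(x)y_by_a\in C^\infty(T^*M)$, $\{S,S\}=0$, such that $\hat Q$ is a derivation of the bracket; $y_a$ denote the fiber coordinates of $T^*M$ conjugate to $x^a$; $Q=Q^ay_a$; the weight of the bracket is the induced weight of $S$. On $T^*M$, $w$ is the induced weight ($w(y_a)=-w_a$) and $d$ the fiberwise degree ($d(x^a)=0$, $d(y_a)=1$). $T^*DM$ carries the weight induced by $W$, also denoted $W$. $p_a,q^a$ are the momenta on $T^*(T^*M)$ conjugate to $x^a,y_a$. The linear connection acts on sections of $T^*M$ by $\nabla_a\alpha_b=\partial_a\alpha_b-\Gamma_{ab}{}^c\alpha_c$; zero weight means $w(\Gamma_{ab}{}^c)=w_c-w_a-w_b$. The function $r$ is invariantly defined. *)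

theory Defs
  imports "HOL-Analysis.Analysis"
begin

text \<open>
  Supermanifolds are presented by atlases: superdomains with nilpotent coordinates, glued along
  transition morphisms.  Coordinates are indexed by a finite linearly ordered type \<open>'i\<close>, and a
  predicate \<open>p :: 'i \<Rightarrow> bool\<close> says which of them are odd (\<open>True\<close> is parity 1).
  The index type of a cotangent bundle is \<open>'i + 'i\<close>: \<open>Inl A\<close> is the coordinate \<open>z\<^sup>A\<close>, \<open>Inr A\<close> the
  conjugate momentum \<open>\<zeta>\<^sub>A\<close>.
\<close>

instantiation sum :: (linorder, linorder) linorder
begin

definition less_eq_sum :: "'a + 'b \<Rightarrow> 'a + 'b \<Rightarrow> bool" where
  "less_eq_sum u v = (case u of
      Inl a \<Rightarrow> (case v of Inl b \<Rightarrow> a \<le> b | Inr _ \<Rightarrow> True)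
    | Inr a \<Rightarrow> (case v of Inl _ \<Rightarrow> False | Inr b \<Rightarrow> a \<le> b))"

definition less_sum :: "'a + 'b \<Rightarrow> 'a + 'b \<Rightarrow> bool" where
  "less_sum u v = (u \<le> v \<and> \<not> v \<le> u)"

instance
  by standard (auto simp: less_eq_sum_def less_sum_def split: sum.splits)

end


section \<open>Superfunctions\<close>

text \<open>
  The superfunction \<open>f\<close> is \<open>\<Sum>I. f\<^sub>I(x) \<theta>\<^sup>I\<close>, where \<open>\<theta>\<^sup>I\<close> is the product of the odd coordinates in
  \<open>I\<close> in increasing order and \<open>f\<^sub>I = coeff f I\<close>.  Coefficients are total functions on \<open>real ^ 'i\<close>; only
  their values at points whose odd components vanish (see \<open>even_space\<close>) and only the sets \<open>I\<close> of odd
  indices are meaningful.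
\<close>

type_synonym 'i point = "(real, 'i) vec"

typedef (overloaded) ('i::"{finite,linorder}") sfun = "UNIV :: ('i set \<Rightarrow> 'i point \<Rightarrow> real) set"
  morphisms coeff Sfun ..

lemma coeff_Sfun [simp]: "coeff (Sfun F) = F"
  by (simp add: Sfun_inverse)

lemma sfun_eqI: "(\<And>I x. coeff f I x = coeff g I x) \<Longrightarrow> f = g"
  by (metis coeff_inject ext)

text \<open>\<open>\<theta>\<^sup>I \<theta>\<^sup>J = sgn_shuffle I J \<theta>\<^sup>I\<^sup>\<union>\<^sup>J\<close> for disjoint \<open>I\<close>, \<open>J\<close>.\<close>

definition sgn_shuffle :: "('i::{finite,linorder}) set \<Rightarrow> 'i set \<Rightarrow> real" where
  "sgn_shuffle I J = (- 1) ^ card {(i, j). i \<in> I \<and> j \<in> J \<and> j < i}"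

lemma sgn_shuffle_Un_left:
  assumes "A \<inter> B = {}"
  shows "sgn_shuffle (A \<union> B) C = sgn_shuffle A C * sgn_shuffle B C"
proof -
  have "{(i, j). i \<in> A \<union> B \<and> j \<in> C \<and> j < i}
      = {(i, j). i \<in> A \<and> j \<in> C \<and> j < i} \<union> {(i, j). i \<in> B \<and> j \<in> C \<and> j < i}"
    by auto
  moreover have "{(i, j). i \<in> A \<and> j \<in> C \<and> j < i} \<inter> {(i, j). i \<in> B \<and> j \<in> C \<and> j < i} = {}"
    using assms by auto
  ultimately show ?thesis
    by (simp add: sgn_shuffle_def card_Un_disjoint power_add)
qed

lemma sgn_shuffle_Un_right:
  assumes "B \<inter> C = {}"
  shows "sgn_shuffle A (B \<union> C) = sgn_shuffle A B * sgn_shuffle A C"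
proof -
  have "{(i, j). i \<in> A \<and> j \<in> B \<union> C \<and> j < i}
      = {(i, j). i \<in> A \<and> j \<in> B \<and> j < i} \<union> {(i, j). i \<in> A \<and> j \<in> C \<and> j < i}"
    by auto
  moreover have "{(i, j). i \<in> A \<and> j \<in> B \<and> j < i} \<inter> {(i, j). i \<in> A \<and> j \<in> C \<and> j < i} = {}"
    using assms by auto
  ultimately show ?thesis
    by (simp add: sgn_shuffle_def card_Un_disjoint power_add)
qed

lemma sgn_shuffle_empty [simp]: "sgn_shuffle {} J = 1" "sgn_shuffle I {} = 1"
  by (simp_all add: sgn_shuffle_def)

instantiation sfun :: ("{finite,linorder}") real_algebra_1
begin

definition "0 = Sfun (\<lambda>I x. 0)"
definition "1 = Sfun (\<lambda>I x. if I = {} then 1 else 0)"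
definition "f + g = Sfun (\<lambda>I x. coeff f I x + coeff g I x)"
definition "f - g = Sfun (\<lambda>I x. coeff f I x - coeff g I x)"
definition "- f = Sfun (\<lambda>I x. - coeff f I x)"
definition "r *\<^sub>R f = Sfun (\<lambda>I x. r * coeff f I x)"
definition "f * g = Sfun (\<lambda>K x. \<Sum>I\<in>Pow K. sgn_shuffle I (K - I) * coeff f I x * coeff g (K - I) x)"

instance
proof
  fix f g h :: "'a sfun" and a b :: real
  show "f * g * h = f * (g * h)"
  proof (rule sfun_eqI)
    fix K :: "'a set" and x
    let ?t = "\<lambda>A B C. sgn_shuffle A B * sgn_shuffle A C * sgn_shuffle B C
                        * coeff f A x * coeff g B x * coeff h C x"
    have "coeff (f * g * h) K x
        = (\<Sum>I\<in>Pow K. \<Sum>A\<in>Pow I. ?t A (I - A) (K - I))"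
      unfolding times_sfun_def coeff_Sfun sum_distrib_left sum_distrib_right
    proof (intro sum.cong refl)
      fix I A assume "I \<in> Pow K" "A \<in> Pow I"
      then have "sgn_shuffle I (K - I) = sgn_shuffle A (K - I) * sgn_shuffle (I - A) (K - I)"
        using sgn_shuffle_Un_left[of A "I - A" "K - I"] by (simp add: Un_absorb1)
      then show "sgn_shuffle I (K - I) * (sgn_shuffle A (I - A) * coeff f A x * coeff g (I - A) x)
            * coeff h (K - I) x = ?t A (I - A) (K - I)"
        by simp
    qed
    also have "\<dots> = (\<Sum>(I, A)\<in>(SIGMA I:Pow K. Pow I). ?t A (I - A) (K - I))"
      by (rule sum.Sigma) auto
    also have "\<dots> = (\<Sum>(A, B)\<in>(SIGMA A:Pow K. Pow (K - A)). ?t A B (K - A - B))"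
    proof (rule sum.reindex_bij_witness[where i = "\<lambda>(A, B). (A \<union> B, A)" and j = "\<lambda>(I, A). (A, I - A)"])
      fix z assume "z \<in> (SIGMA I:Pow K. Pow I)"
      then obtain I A where z: "z = (I, A)" "A \<subseteq> I" "I \<subseteq> K" by auto
      then have "K - A - (I - A) = K - I" by auto
      then show "(case case z of (I, A) \<Rightarrow> (A, I - A) of (A, B) \<Rightarrow> ?t A B (K - A - B))
          = (case z of (I, A) \<Rightarrow> ?t A (I - A) (K - I))"
        using z(1) by simp
    qed auto
    also have "\<dots> = (\<Sum>A\<in>Pow K. \<Sum>B\<in>Pow (K - A). ?t A B (K - A - B))"
      by (rule sum.Sigma[symmetric]) auto
    also have "\<dots> = coeff (f * (g * h)) K x"
      unfolding times_sfun_def coeff_Sfun sum_distrib_left sum_distrib_right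
    proof (intro sum.cong refl)
      fix A B assume "A \<in> Pow K" "B \<in> Pow (K - A)"
      then have "sgn_shuffle A (K - A) = sgn_shuffle A B * sgn_shuffle A (K - A - B)"
        using sgn_shuffle_Un_right[of B "K - A - B" A] by (simp add: Un_absorb1)
      then show "?t A B (K - A - B) = sgn_shuffle A (K - A) * coeff f A x
            * (sgn_shuffle B (K - A - B) * coeff g B x * coeff h (K - A - B) x)"
        by simp
    qed
    finally show "coeff (f * g * h) K x = coeff (f * (g * h)) K x" .
  qed
  show "1 * f = f"
  proof (rule sfun_eqI)
    fix K :: "'a set" and x
    have "coeff (1 * f) K x = (\<Sum>I\<in>Pow K. if I = {} then coeff f K x else 0)"
      unfolding times_sfun_def one_sfun_def coeff_Sfun by (intro sum.cong) auto
    then show "coeff (1 * f) K x = coeff f K x" by simp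
  qed
  show "f * 1 = f"
  proof (rule sfun_eqI)
    fix K :: "'a set" and x
    have "coeff (f * 1) K x = (\<Sum>I\<in>Pow K. if I = K then coeff f K x else 0)"
      unfolding times_sfun_def one_sfun_def coeff_Sfun by (intro sum.cong) auto
    then show "coeff (f * 1) K x = coeff f K x" by simp
  qed
  show "(0 :: 'a sfun) \<noteq> 1"
  proof
    assume "(0 :: 'a sfun) = 1"
    then have "coeff (0 :: 'a sfun) {} 0 = coeff 1 {} 0" by simp
    then show False by (simp add: zero_sfun_def one_sfun_def)
  qed
  show "(f + g) * h = f * h + g * h" "f * (g + h) = f * g + f * h"
    by (rule sfun_eqI, simp add: times_sfun_def plus_sfun_def distrib_left distrib_right sum.distrib)+
  show "a *\<^sub>R f * g = a *\<^sub>R (f * g)" "f * a *\<^sub>R g = a *\<^sub>R (f * g)"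
    by (rule sfun_eqI, simp add: times_sfun_def scaleR_sfun_def sum_distrib_left mult_ac)+
qed (rule sfun_eqI, simp add: zero_sfun_def plus_sfun_def minus_sfun_def uminus_sfun_def
  scaleR_sfun_def algebra_simps)+

end

definition scalar_fun :: "('i point \<Rightarrow> real) \<Rightarrow> ('i::{finite,linorder}) sfun" where
  "scalar_fun h = Sfun (\<lambda>I. if I = {} then h else (\<lambda>_. 0))"

definition coord :: "('i::{finite,linorder} \<Rightarrow> bool) \<Rightarrow> 'i \<Rightarrow> 'i sfun" where
  "coord p i = (if p i then Sfun (\<lambda>I _. if I = {i} then 1 else 0) else scalar_fun (\<lambda>x. x $ i))"

definition partial :: "'i \<Rightarrow> ('i point \<Rightarrow> real) \<Rightarrow> ('i::finite) point \<Rightarrow> real" where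
  "partial i h x = deriv (\<lambda>t. h (x + t *\<^sub>R axis i 1)) 0"

text \<open>Left derivatives \<open>\<partial>\<^sub>i\<close>.\<close>

definition pd :: "('i::{finite,linorder} \<Rightarrow> bool) \<Rightarrow> 'i \<Rightarrow> 'i sfun \<Rightarrow> 'i sfun" where
  "pd p i f = (if p i
     then Sfun (\<lambda>I x. if i \<in> I then 0 else (- 1) ^ card {j \<in> I. j < i} * coeff f (insert i I) x)
     else Sfun (\<lambda>I. partial i (coeff f I)))"

text \<open>\<open>psign b\<close> is \<open>(-1)\<^sup>b\<close>, and \<open>twist b f\<close> is \<open>(-1)\<^bsup>b f\<^esup> f\<close> (the parity of \<open>f\<close> in the exponent),
  extended linearly to inhomogeneous \<open>f\<close>.\<close>

definition psign :: "bool \<Rightarrow> real" where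
  "psign b = (if b then - 1 else 1)"

definition twist :: "bool \<Rightarrow> 'i sfun \<Rightarrow> ('i::{finite,linorder}) sfun" where
  "twist b f = (if b then Sfun (\<lambda>I x. (- 1) ^ card I * coeff f I x) else f)"

definition even_space :: "('i::finite \<Rightarrow> bool) \<Rightarrow> 'i point set" where
  "even_space p = {x. \<forall>i. p i \<longrightarrow> x $ i = 0}"

definition superdomain :: "('i::finite \<Rightarrow> bool) \<Rightarrow> 'i point set \<Rightarrow> bool" where
  "superdomain p D \<longleftrightarrow> openin (top_of_set (even_space p)) D"

definition eq_on :: "('i::{finite,linorder} \<Rightarrow> bool) \<Rightarrow> 'i point set \<Rightarrow> 'i sfun \<Rightarrow> 'i sfun \<Rightarrow> bool" where
  "eq_on p D f g \<longleftrightarrow> (\<forall>I \<subseteq> {i. p i}. \<forall>x\<in>D. coeff f I x = coeff g I x)"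

definition has_parity :: "('i::{finite,linorder} \<Rightarrow> bool) \<Rightarrow> 'i point set \<Rightarrow> bool \<Rightarrow> 'i sfun \<Rightarrow> bool" where
  "has_parity p D b f \<longleftrightarrow> (\<forall>I \<subseteq> {i. p i}. \<forall>x\<in>D. coeff f I x \<noteq> 0 \<longrightarrow> odd (card I) = b)"

fun iter_partial :: "'i list \<Rightarrow> ('i point \<Rightarrow> real) \<Rightarrow> ('i::finite) point \<Rightarrow> real" where
  "iter_partial [] h = h"
| "iter_partial (i # is) h = partial i (iter_partial is h)"

definition smooth :: "('i::finite \<Rightarrow> bool) \<Rightarrow> 'i point set \<Rightarrow> ('i point \<Rightarrow> real) \<Rightarrow> bool" where
  "smooth p D h \<longleftrightarrow> (\<forall>is. (\<forall>i\<in>set is. \<not> p i) \<longrightarrow> iter_partial is h differentiable_on D)"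

text \<open>
  \<open>weighted_poly p w D P h\<close>: on \<open>D\<close>, \<open>h\<close> is a polynomial in the even coordinates of nonzero weight,
  with exponents \<open>m\<close> satisfying \<open>P\<close> and with coefficients that are smooth functions of the even
  coordinates of weight zero.
\<close>

definition weighted_poly ::
  "('i::finite \<Rightarrow> bool) \<Rightarrow> ('i \<Rightarrow> int) \<Rightarrow> 'i point set \<Rightarrow> (('i \<Rightarrow> nat) \<Rightarrow> bool)
    \<Rightarrow> ('i point \<Rightarrow> real) \<Rightarrow> bool" where
  "weighted_poly p w D P h \<longleftrightarrow> (\<exists>E g. finite E
     \<and> (\<forall>m\<in>E. P m \<and> (\<forall>i. m i \<noteq> 0 \<longrightarrow> \<not> p i \<and> w i \<noteq> 0) \<and> smooth p D (g m)
          \<and> (\<forall>x\<in>D. \<forall>y\<in>D. (\<forall>i. \<not> p i \<and> w i = 0 \<longrightarrow> x $ i = y $ i) \<longrightarrow> g m x = g m y))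
     \<and> (\<forall>x\<in>D. h x = (\<Sum>m\<in>E. g m x * (\<Prod>i\<in>UNIV. (x $ i) ^ m i))))"

definition superfunction ::
  "('i::{finite,linorder} \<Rightarrow> bool) \<Rightarrow> ('i \<Rightarrow> int) \<Rightarrow> 'i point set \<Rightarrow> 'i sfun \<Rightarrow> bool" where
  "superfunction p w D f \<longleftrightarrow> (\<forall>I \<subseteq> {i. p i}. weighted_poly p w D (\<lambda>_. True) (coeff f I))"

definition has_weight ::
  "('i::{finite,linorder} \<Rightarrow> bool) \<Rightarrow> ('i \<Rightarrow> int) \<Rightarrow> 'i point set \<Rightarrow> int \<Rightarrow> 'i sfun \<Rightarrow> bool" where
  "has_weight p w D k f \<longleftrightarrow> (\<forall>I \<subseteq> {i. p i}.
     weighted_poly p w D (\<lambda>m. (\<Sum>i\<in>UNIV. int (m i) * w i) + (\<Sum>i\<in>I. w i) = k) (coeff f I))"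


section \<open>Substitution\<close>

definition body :: "('i \<Rightarrow> 'i sfun) \<Rightarrow> 'i point \<Rightarrow> ('i::{finite,linorder}) point" where
  "body \<phi> x = (\<chi> i. coeff (\<phi> i) {} x)"

definition soul :: "('i \<Rightarrow> 'i sfun) \<Rightarrow> 'i \<Rightarrow> ('i::{finite,linorder}) sfun" where
  "soul \<phi> i = \<phi> i - scalar_fun (coeff (\<phi> i) {})"

definition index_list :: "('i::{finite,linorder} \<Rightarrow> nat) \<Rightarrow> 'i list" where
  "index_list m = concat (map (\<lambda>i. replicate (m i) i) (sorted_list_of_set UNIV))"

text \<open>
  \<open>pullback p \<phi> f\<close> substitutes \<open>\<phi> i\<close> (of the parity of \<open>i\<close>) for the \<open>i\<close>th coordinate, expanding \<open>f\<close>
  in a Taylor series at the body of \<open>\<phi>\<close>; the omitted terms, with some \<open>m i > CARD('i)\<close>, vanish by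
  nilpotency.
\<close>

definition pullback ::
  "('i::{finite,linorder} \<Rightarrow> bool) \<Rightarrow> ('i \<Rightarrow> 'i sfun) \<Rightarrow> 'i sfun \<Rightarrow> 'i sfun" where
  "pullback p \<phi> f =
     (\<Sum>I\<in>Pow {i. p i}. \<Sum>m\<in>{m. \<forall>i. m i \<le> CARD('i) \<and> (p i \<longrightarrow> m i = 0)}.
        scalar_fun (\<lambda>x. iter_partial (index_list m) (coeff f I) (body \<phi> x) / (\<Prod>i\<in>UNIV. fact (m i)))
        * prod_list (map (soul \<phi>) (index_list m))
        * prod_list (map \<phi> (sorted_list_of_set I)))"


section \<open>Graded manifolds\<close>

text \<open>
  A chart \<open>c\<close> has the superdomain \<open>chart_dom c\<close>; the part of it that is glued to chart \<open>d\<close> is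
  \<open>overlap c d\<close>, and \<open>transition c d a\<close> is the \<open>a\<close>th coordinate of \<open>d\<close> as a function of the coordinates
  of \<open>c\<close>.
\<close>

record ('c, 'i::"{finite,linorder}") atlas =
  charts :: "'c set"
  odd_coord :: "'i \<Rightarrow> bool"
  wt :: "'i \<Rightarrow> int"
  chart_dom :: "'c \<Rightarrow> 'i point set"
  overlap :: "'c \<Rightarrow> 'c \<Rightarrow> 'i point set"
  transition :: "'c \<Rightarrow> 'c \<Rightarrow> 'i \<Rightarrow> 'i sfun"

abbreviation transition_body ::
    "('c, 'i::{finite,linorder}) atlas \<Rightarrow> 'c \<Rightarrow> 'c \<Rightarrow> 'i point \<Rightarrow> 'i point" where
  "transition_body M c d \<equiv> body (transition M c d)"

text \<open>The last two conditions say that the glued topological space is Hausdorff and second countable.\<close>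

definition graded_manifold :: "('c, 'i::{finite,linorder}) atlas \<Rightarrow> bool" where
  "graded_manifold M \<longleftrightarrow>
     (\<forall>c\<in>charts M. superdomain (odd_coord M) (chart_dom M c)
        \<and> overlap M c c = chart_dom M c
        \<and> (\<forall>a. eq_on (odd_coord M) (chart_dom M c) (transition M c c a) (coord (odd_coord M) a)))
   \<and> (\<forall>c\<in>charts M. \<forall>d\<in>charts M.
        overlap M c d \<subseteq> chart_dom M c \<and> superdomain (odd_coord M) (overlap M c d)
        \<and> transition_body M c d ` overlap M c d \<subseteq> overlap M d c
        \<and> (\<forall>a. superfunction (odd_coord M) (wt M) (overlap M c d) (transition M c d a)
             \<and> has_parity (odd_coord M) (overlap M c d) (odd_coord M a) (transition M c d a)
             \<and> has_weight (odd_coord M) (wt M) (overlap M c d) (wt M a) (transition M c d a)))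
   \<and> (\<forall>c\<in>charts M. \<forall>d\<in>charts M. \<forall>e\<in>charts M.
        let D = {x \<in> overlap M c d. transition_body M c d x \<in> overlap M d e}
        in D \<subseteq> overlap M c e
           \<and> (\<forall>a. eq_on (odd_coord M) D (transition M c e a)
                    (pullback (odd_coord M) (transition M c d) (transition M d e a))))
   \<and> (\<forall>c\<in>charts M. \<forall>d\<in>charts M. \<forall>x\<in>chart_dom M c. \<forall>y\<in>chart_dom M d.
        \<not> (x \<in> overlap M c d \<and> transition_body M c d x = y) \<longrightarrow>
        (\<exists>U V. open U \<and> open V \<and> x \<in> U \<and> y \<in> V
           \<and> (\<forall>u \<in> U \<inter> overlap M c d. transition_body M c d u \<notin> V)))
   \<and> (\<exists>C \<subseteq> charts M. countable C \<and> (\<forall>c\<in>charts M. chart_dom M c \<subseteq> (\<Union>d\<in>C. overlap M c d)))"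

definition C_inf :: "('c, 'i::{finite,linorder}) atlas \<Rightarrow> ('c \<Rightarrow> 'i sfun) set" where
  "C_inf M = {f. (\<forall>c\<in>charts M. superfunction (odd_coord M) (wt M) (chart_dom M c) (f c))
     \<and> (\<forall>c\<in>charts M. \<forall>d\<in>charts M.
          eq_on (odd_coord M) (overlap M c d) (f c) (pullback (odd_coord M) (transition M c d) (f d)))}"

definition fun_eq ::
    "('c, 'i::{finite,linorder}) atlas \<Rightarrow> ('c \<Rightarrow> 'i sfun) \<Rightarrow> ('c \<Rightarrow> 'i sfun) \<Rightarrow> bool" where
  "fun_eq M f g \<longleftrightarrow> (\<forall>c\<in>charts M. eq_on (odd_coord M) (chart_dom M c) (f c) (g c))"

definition fun_parity :: "('c, 'i::{finite,linorder}) atlas \<Rightarrow> bool \<Rightarrow> ('c \<Rightarrow> 'i sfun) \<Rightarrow> bool" where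
  "fun_parity M b f \<longleftrightarrow> (\<forall>c\<in>charts M. has_parity (odd_coord M) (chart_dom M c) b (f c))"

definition fun_weight :: "('c, 'i::{finite,linorder}) atlas \<Rightarrow> int \<Rightarrow> ('c \<Rightarrow> 'i sfun) \<Rightarrow> bool" where
  "fun_weight M k f \<longleftrightarrow> (\<forall>c\<in>charts M. has_weight (odd_coord M) (wt M) (chart_dom M c) k (f c))"


text \<open>Vector fields \<open>X = X\<^sup>a \<partial>\<^sub>a\<close>, given by their components \<open>X c a\<close> in each chart \<open>c\<close>.\<close>

definition vf_apply ::
    "('i::{finite,linorder} \<Rightarrow> bool) \<Rightarrow> ('i \<Rightarrow> 'i sfun) \<Rightarrow> 'i sfun \<Rightarrow> 'i sfun" where
  "vf_apply p X f = (\<Sum>a\<in>UNIV. X a * pd p a f)"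

definition vector_field :: "('c, 'i::{finite,linorder}) atlas \<Rightarrow> ('c \<Rightarrow> 'i \<Rightarrow> 'i sfun) \<Rightarrow> bool" where
  "vector_field M X \<longleftrightarrow>
     (\<forall>c\<in>charts M. \<forall>a. superfunction (odd_coord M) (wt M) (chart_dom M c) (X c a))
   \<and> (\<forall>c\<in>charts M. \<forall>d\<in>charts M. \<forall>a.
        eq_on (odd_coord M) (overlap M c d) (vf_apply (odd_coord M) (X c) (transition M c d a))
          (pullback (odd_coord M) (transition M c d) (X d a)))"

definition vf_parity ::
    "('c, 'i::{finite,linorder}) atlas \<Rightarrow> bool \<Rightarrow> ('c \<Rightarrow> 'i \<Rightarrow> 'i sfun) \<Rightarrow> bool" where
  "vf_parity M b X \<longleftrightarrow> (\<forall>a. fun_parity M (b \<noteq> odd_coord M a) (\<lambda>c. X c a))"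

definition vf_weight ::
    "('c, 'i::{finite,linorder}) atlas \<Rightarrow> int \<Rightarrow> ('c \<Rightarrow> 'i \<Rightarrow> 'i sfun) \<Rightarrow> bool" where
  "vf_weight M k X \<longleftrightarrow> (\<forall>a. fun_weight M (k + wt M a) (\<lambda>c. X c a))"

definition homological ::
    "('c, 'i::{finite,linorder}) atlas \<Rightarrow> ('c \<Rightarrow> 'i \<Rightarrow> 'i sfun) \<Rightarrow> bool" where
  "homological M X \<longleftrightarrow> vector_field M X \<and> vf_parity M True X
     \<and> (\<forall>f\<in>C_inf M.
          fun_eq M (\<lambda>c. vf_apply (odd_coord M) (X c) (vf_apply (odd_coord M) (X c) (f c))) (\<lambda>_. 0))"


section \<open>Cotangent bundles\<close>

definition base_point :: "('i + 'i) point \<Rightarrow> ('i::finite) point" where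
  "base_point v = (\<chi> a. v $ Inl a)"

definition zero_section :: "'i point \<Rightarrow> ('i + 'i::finite) point" where
  "zero_section x = (\<chi> A. case A of Inl a \<Rightarrow> x $ a | Inr _ \<Rightarrow> 0)"

definition lift :: "'i sfun \<Rightarrow> ('i + 'i::{finite,linorder}) sfun" where
  "lift f = Sfun (\<lambda>I v. if I \<subseteq> range Inl then coeff f (Inl -` I) (base_point v) else 0)"

definition restrict_zero_section :: "('i + 'i) sfun \<Rightarrow> ('i::{finite,linorder}) sfun" where
  "restrict_zero_section F = Sfun (\<lambda>I x. coeff F (Inl ` I) (zero_section x))"

definition cot_odd :: "('i \<Rightarrow> bool) \<Rightarrow> 'i + 'i \<Rightarrow> bool" where
  "cot_odd p A = (case A of Inl a \<Rightarrow> p a | Inr a \<Rightarrow> p a)"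

definition cot_set :: "('i \<Rightarrow> bool) \<Rightarrow> 'i point set \<Rightarrow> (('i + 'i::finite) point) set" where
  "cot_set p D = {v \<in> even_space (cot_odd p). base_point v \<in> D}"

text \<open>Momenta transform by \<open>\<zeta>'\<^sub>a = (\<partial>z\<^sup>b / \<partial>z'\<^sup>a) \<zeta>\<^sub>b\<close>; the weight of \<open>\<zeta>\<^sub>a\<close> is the induced one.\<close>

definition cotangent :: "('c, 'i::{finite,linorder}) atlas \<Rightarrow> ('c, 'i + 'i) atlas" where
  "cotangent M =
    \<lparr> charts = charts M,
      odd_coord = cot_odd (odd_coord M),
      wt = (\<lambda>A. case A of Inl a \<Rightarrow> wt M a | Inr a \<Rightarrow> - wt M a),
      chart_dom = (\<lambda>c. cot_set (odd_coord M) (chart_dom M c)),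
      overlap = (\<lambda>c d. cot_set (odd_coord M) (overlap M c d)),
      transition = (\<lambda>c d A. case A of
          Inl a \<Rightarrow> lift (transition M c d a)
        | Inr a \<Rightarrow> (\<Sum>b\<in>UNIV.
            lift (pullback (odd_coord M) (transition M c d) (pd (odd_coord M) a (transition M d c b)))
            * coord (cot_odd (odd_coord M)) (Inr b))) \<rparr>"

definition poisson ::
    "('i::{finite,linorder} \<Rightarrow> bool) \<Rightarrow> ('i + 'i) sfun \<Rightarrow> ('i + 'i) sfun \<Rightarrow> ('i + 'i) sfun" where
  "poisson p f g = (\<Sum>A\<in>UNIV.
       psign (p A) *\<^sub>R pd (cot_odd p) (Inr A) (twist (p A) f) * pd (cot_odd p) (Inl A) g
     - pd (cot_odd p) (Inl A) (twist (p A) f) * pd (cot_odd p) (Inr A) g)"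

text \<open>\<open>p\<^sub>X = X\<^sup>A \<zeta>\<^sub>A\<close> and, conversely, the components of \<open>X\<^sub>f = {f, }\<close>.\<close>

definition vf_hamiltonian ::
    "('c, 'i::{finite,linorder}) atlas \<Rightarrow> ('c \<Rightarrow> 'i \<Rightarrow> 'i sfun) \<Rightarrow> 'c \<Rightarrow> ('i + 'i) sfun" where
  "vf_hamiltonian N X c = (\<Sum>A\<in>UNIV. lift (X c A) * coord (cot_odd (odd_coord N)) (Inr A))"

definition hamiltonian_vf ::
    "('c, 'i::{finite,linorder}) atlas \<Rightarrow> ('c \<Rightarrow> ('i + 'i) sfun) \<Rightarrow> 'c \<Rightarrow> 'i + 'i \<Rightarrow> ('i + 'i) sfun" where
  "hamiltonian_vf N f c Z = poisson (odd_coord N) (f c) (coord (cot_odd (odd_coord N)) Z)"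

text \<open>\<open>F = 1/2 F\<^sup>A\<^sup>B(z) \<zeta>\<^sub>B \<zeta>\<^sub>A\<close> in each chart, as a function on \<open>cotangent N\<close>.\<close>

definition quadratic_in_momenta ::
    "('c, 'i::{finite,linorder}) atlas \<Rightarrow> ('c \<Rightarrow> ('i + 'i) sfun) \<Rightarrow> bool" where
  "quadratic_in_momenta N F \<longleftrightarrow> (\<forall>c\<in>charts N. \<exists>K.
     (\<forall>A B. superfunction (odd_coord N) (wt N) (chart_dom N c) (K A B))
     \<and> eq_on (cot_odd (odd_coord N)) (cot_set (odd_coord N) (chart_dom N c)) (F c)
         ((1/2) *\<^sub>R (\<Sum>A\<in>UNIV. \<Sum>B\<in>UNIV. lift (K A B)
            * coord (cot_odd (odd_coord N)) (Inr B) * coord (cot_odd (odd_coord N)) (Inr A))))"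


section \<open>Graded QS-manifolds\<close>

text \<open>
  \<open>{f, {S, g}}\<close> is constant along the fibres for fibrewise quadratic \<open>S\<close>; restricting it to the zero
  section turns it into a function on \<open>M\<close>.
\<close>

definition schouten ::
    "('i::{finite,linorder} \<Rightarrow> bool) \<Rightarrow> ('i + 'i) sfun \<Rightarrow> 'i sfun \<Rightarrow> 'i sfun \<Rightarrow> 'i sfun" where
  "schouten p S f g = restrict_zero_section (poisson p (lift f) (poisson p S (lift g)))"

text \<open>The bracket is odd, so an odd derivation of it picks up the sign \<open>(-1)\<^bsup>b + 1\<^esup>\<close> on passing an
  argument of parity \<open>b\<close>.\<close>

definition graded_QS_manifold ::
    "('c, 'i::{finite,linorder}) atlas \<Rightarrow> ('c \<Rightarrow> 'i \<Rightarrow> 'i sfun) \<Rightarrow> ('c \<Rightarrow> ('i + 'i) sfun) \<Rightarrow> bool" where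
  "graded_QS_manifold M Qhat S \<longleftrightarrow>
     graded_manifold M \<and> homological M Qhat
   \<and> S \<in> C_inf (cotangent M) \<and> quadratic_in_momenta M S \<and> fun_parity (cotangent M) True S
   \<and> fun_eq (cotangent M) (\<lambda>c. poisson (odd_coord M) (S c) (S c)) (\<lambda>_. 0)
   \<and> (\<forall>f\<in>C_inf M. \<forall>g\<in>C_inf M. \<forall>b. fun_parity M b f \<longrightarrow>
        fun_eq M (\<lambda>c. vf_apply (odd_coord M) (Qhat c) (schouten (odd_coord M) (S c) (f c) (g c)))
          (\<lambda>c. schouten (odd_coord M) (S c) (vf_apply (odd_coord M) (Qhat c) (f c)) (g c)
             + psign (\<not> b) *\<^sub>R
                 schouten (odd_coord M) (S c) (f c) (vf_apply (odd_coord M) (Qhat c) (g c))))"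


section \<open>Linear connections\<close>

text \<open>\<open>\<Gamma> a b c\<close> is \<open>\<Gamma>\<^sub>a\<^sub>b\<^sup>c\<close>; \<open>\<nabla>\<^sub>a \<alpha>\<^sub>b = \<partial>\<^sub>a \<alpha>\<^sub>b - \<Gamma>\<^sub>a\<^sub>b\<^sup>c \<alpha>\<^sub>c\<close>.\<close>

definition nabla ::
    "('i::{finite,linorder} \<Rightarrow> bool) \<Rightarrow> ('i \<Rightarrow> 'i \<Rightarrow> 'i \<Rightarrow> 'i sfun) \<Rightarrow> ('i \<Rightarrow> 'i sfun) \<Rightarrow> 'i \<Rightarrow> 'i \<Rightarrow> 'i sfun"
where
  "nabla p \<Gamma> \<alpha> a b = pd p a (\<alpha> b) - (\<Sum>c\<in>UNIV. \<Gamma> a b c * \<alpha> c)"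

definition covector_pullback ::
    "('i::{finite,linorder} \<Rightarrow> bool) \<Rightarrow> ('i \<Rightarrow> 'i sfun) \<Rightarrow> ('i \<Rightarrow> 'i sfun) \<Rightarrow> 'i \<Rightarrow> 'i sfun" where
  "covector_pullback p \<phi> \<alpha> b = (\<Sum>b'\<in>UNIV. pd p b (\<phi> b') * pullback p \<phi> (\<alpha> b'))"

text \<open>
  The sign comes from moving \<open>\<nabla>\<^sub>a\<close> past \<open>\<partial>\<^sub>b \<phi>\<^bsup>b'\<^esup>\<close>, as in
  \<open>\<partial>\<^sub>a (\<partial>\<^sub>b \<phi>\<^bsup>b'\<^esup> \<alpha>'\<^bsub>b'\<^esub>) = \<partial>\<^sub>a \<partial>\<^sub>b \<phi>\<^bsup>b'\<^esup> \<alpha>'\<^bsub>b'\<^esub> + (-1)\<^bsup>a (b + b')\<^esup> \<partial>\<^sub>b \<phi>\<^bsup>b'\<^esup> \<partial>\<^sub>a \<alpha>'\<^bsub>b'\<^esub>\<close>.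
\<close>

definition linear_connection ::
    "('c, 'i::{finite,linorder}) atlas \<Rightarrow> ('c \<Rightarrow> 'i \<Rightarrow> 'i \<Rightarrow> 'i \<Rightarrow> 'i sfun) \<Rightarrow> bool" where
  "linear_connection M \<Gamma> \<longleftrightarrow>
     (\<forall>c\<in>charts M. \<forall>a b e.
        superfunction (odd_coord M) (wt M) (chart_dom M c) (\<Gamma> c a b e)
        \<and> has_parity (odd_coord M) (chart_dom M c)
            (odd_coord M a \<noteq> (odd_coord M b \<noteq> odd_coord M e)) (\<Gamma> c a b e))
   \<and> (\<forall>c\<in>charts M. \<forall>d\<in>charts M. \<forall>\<alpha>.
        (\<forall>b. superfunction (odd_coord M) (wt M) (overlap M d c) (\<alpha> b)) \<longrightarrow>
        (\<forall>a b. eq_on (odd_coord M) (overlap M c d)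
           (nabla (odd_coord M) (\<Gamma> c) (covector_pullback (odd_coord M) (transition M c d) \<alpha>) a b)
           (\<Sum>a'\<in>UNIV. \<Sum>b'\<in>UNIV.
              psign (odd_coord M a \<and> odd_coord M b \<noteq> odd_coord M b') *\<^sub>R
                (pd (odd_coord M) b (transition M c d b') * pd (odd_coord M) a (transition M c d a')
                 * pullback (odd_coord M) (transition M c d) (nabla (odd_coord M) (\<Gamma> d) \<alpha> a' b')))))"

definition zero_weight_connection ::
    "('c, 'i::{finite,linorder}) atlas \<Rightarrow> ('c \<Rightarrow> 'i \<Rightarrow> 'i \<Rightarrow> 'i \<Rightarrow> 'i sfun) \<Rightarrow> bool" where
  "zero_weight_connection M \<Gamma> \<longleftrightarrow>
     (\<forall>a b e. fun_weight M (wt M e - wt M a - wt M b) (\<lambda>c. \<Gamma> c a b e))"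


section \<open>The double\<close>

definition fibre_degree :: "'i + 'i \<Rightarrow> int" where
  "fibre_degree A = (case A of Inl _ \<Rightarrow> 0 | Inr _ \<Rightarrow> 1)"

text \<open>\<open>DM = T\<^sup>*M\<close> with the total weight \<open>W = w + (q - s) d\<close>.\<close>

definition double :: "('c, 'i::{finite,linorder}) atlas \<Rightarrow> int \<Rightarrow> int \<Rightarrow> ('c, 'i + 'i) atlas" where
  "double M q s = (cotangent M) \<lparr> wt := (\<lambda>A. wt (cotangent M) A + (q - s) * fibre_degree A) \<rparr>"

definition double_field ::
    "('c, 'i::{finite,linorder}) atlas \<Rightarrow> ('c \<Rightarrow> 'i \<Rightarrow> 'i sfun) \<Rightarrow> ('c \<Rightarrow> ('i + 'i) sfun)
      \<Rightarrow> 'c \<Rightarrow> 'i + 'i \<Rightarrow> ('i + 'i) sfun" where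
  "double_field M Qhat S c Z = hamiltonian_vf M (vf_hamiltonian M Qhat) c Z + hamiltonian_vf M S c Z"

text \<open>Coordinates on \<open>T\<^sup>*(T\<^sup>*M)\<close>: \<open>y\<^sub>a\<close>, and the momenta \<open>p\<^sub>a\<close>, \<open>q\<^sup>a\<close> conjugate to \<open>x\<^sup>a\<close>, \<open>y\<^sub>a\<close>.\<close>

definition coord_y :: "('c, 'i::{finite,linorder}) atlas \<Rightarrow> 'i \<Rightarrow> (('i + 'i) + ('i + 'i)) sfun" where
  "coord_y M a = coord (cot_odd (cot_odd (odd_coord M))) (Inl (Inr a))"

definition coord_p :: "('c, 'i::{finite,linorder}) atlas \<Rightarrow> 'i \<Rightarrow> (('i + 'i) + ('i + 'i)) sfun" where
  "coord_p M a = coord (cot_odd (cot_odd (odd_coord M))) (Inr (Inl a))"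

definition coord_q :: "('c, 'i::{finite,linorder}) atlas \<Rightarrow> 'i \<Rightarrow> (('i + 'i) + ('i + 'i)) sfun" where
  "coord_q M a = coord (cot_odd (cot_odd (odd_coord M))) (Inr (Inr a))"

definition connection_hamiltonian ::
    "('c, 'i::{finite,linorder}) atlas \<Rightarrow> ('c \<Rightarrow> 'i \<Rightarrow> 'i \<Rightarrow> 'i \<Rightarrow> 'i sfun)
      \<Rightarrow> 'c \<Rightarrow> (('i + 'i) + ('i + 'i)) sfun" where
  "connection_hamiltonian M \<Gamma> c = (\<Sum>a\<in>UNIV. coord_p M a * coord_q M a)
     + (\<Sum>a\<in>UNIV. \<Sum>b\<in>UNIV. \<Sum>e\<in>UNIV.
          lift (lift (\<Gamma> c a b e)) * coord_y M e * coord_q M b * coord_q M a)"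

definition double_schouten_hamiltonian ::
    "('c, 'i::{finite,linorder}) atlas \<Rightarrow> ('c \<Rightarrow> 'i \<Rightarrow> 'i sfun) \<Rightarrow> ('c \<Rightarrow> ('i + 'i) sfun)
      \<Rightarrow> ('c \<Rightarrow> 'i \<Rightarrow> 'i \<Rightarrow> 'i \<Rightarrow> 'i sfun) \<Rightarrow> 'c \<Rightarrow> (('i + 'i) + ('i + 'i)) sfun" where
  "double_schouten_hamiltonian M Qhat S \<Gamma> c = (1/2) *\<^sub>R
     poisson (cot_odd (odd_coord M))
       (vf_hamiltonian (cotangent M) (double_field M Qhat S) c)
       (connection_hamiltonian M \<Gamma> c)"

end

theory Submission
  imports Defs
begin

text \<open>
  \<open>Q\<^sub>D\<close> is linear and \<open>r\<close> quadratic in the momenta, so their bracket is quadratic, and its weight is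
  \<open>q + (s - q) = s\<close>.  The weight of \<open>S\<close> for \<open>W\<close> is found by recovering \<open>S\<close> with Euler's formula from its
  second fibre derivatives, which live on the base.  It remains to see that \<open>S\<^sub>D\<close> is globally defined.
  Pullback is multiplicative and satisfies the chain rule, because along one even coordinate it is
  \<open>exp(\<sigma> \<partial>)\<close> with \<open>\<sigma>\<close> nilpotent, followed by evaluation at the body.  The lift of a coordinate change
  to the cotangent bundle preserves the canonical brackets of the coordinates, hence by the chain rule
  all Poisson brackets, so \<open>Q\<^sub>D\<close> is invariant; and \<open>r\<close> is invariant because the inhomogeneous term in
  the transformation of \<open>p\<^sub>a\<close> cancels the one of \<open>\<Gamma>\<close>.
\<close>

section \<open>Partial derivatives on superdomains\<close>

text \<open>Coefficients carry meaning only on odd index sets and over a domain, so identities hold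
  in the sense of \<open>eq_on\<close>; \<open>trunc\<close>, an algebra homomorphism, turns them
  into equations that can be rewritten. Superdomains are relatively open in the even subspace only,
  hence all analysis is done along even axes. The constant in W has a simple origin. If the weights
  of the momenta are shifted by t, then Q, linear in them, gets weight q + t, and S, quadratic, gets
  s + 2t. These agree exactly for t = q - s, and then the field on the double is homogeneous. Two
  cotangent bundles are stacked, so invariance is needed for the lift of a lift. The property of
  being an isomorphism with a given inverse is therefore shown to pass to the lift
  (\<open>cot_isomorphism\<close>), and one theory is applied twice. The delicate canonical bracket
  is that of two lifted momenta: it vanishes because second derivatives of the inverse coordinate
  change commute up to the parity sign.\<close>

lemma superdomain_subset: "superdomain p D \<Longrightarrow> x \<in> D \<Longrightarrow> x \<in> even_space p"
  unfolding superdomain_def using openin_imp_subset by blast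

lemma even_space_add_axis: "x \<in> even_space p \<Longrightarrow> \<not> p i \<Longrightarrow> x + t *\<^sub>R axis i 1 \<in> even_space p"
  by (auto simp: even_space_def axis_def)

lemma superdomain_ball:
  assumes "superdomain p D" "x \<in> D"
  shows "\<exists>e>0. \<forall>y\<in>even_space p. dist y x < e \<longrightarrow> y \<in> D"
proof -
  obtain U where U: "open U" "D = even_space p \<inter> U"
    using assms(1) unfolding superdomain_def openin_open by blast
  then obtain e where "e > 0" "ball x e \<subseteq> U"
    using assms(2) openE by blast
  then show ?thesis
    using U by (auto simp: dist_commute subset_iff)
qed

lemma superdomain_line:
  assumes "superdomain p D" "x \<in> D" "\<not> p i"
  shows "eventually (\<lambda>t. x + t *\<^sub>R axis i 1 \<in> D) (nhds 0)"
proof -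
  obtain e where e: "e > 0" "\<And>y. y \<in> even_space p \<Longrightarrow> dist y x < e \<Longrightarrow> y \<in> D"
    using superdomain_ball[OF assms(1,2)] by blast
  have "x + t *\<^sub>R axis i 1 \<in> D" if "dist t 0 < e" for t
    using that e(2)[OF even_space_add_axis[OF superdomain_subset[OF assms(1,2)] assms(3)]]
    by (simp add: dist_norm)
  then show ?thesis
    unfolding eventually_nhds_metric using e(1) by blast
qed

lemma partial_cong:
  assumes "superdomain p D" "x \<in> D" "\<not> p i" "\<And>y. y \<in> D \<Longrightarrow> h y = g y"
  shows "partial i h x = partial i g x"
  unfolding partial_def
  by (rule deriv_cong_ev)
     (use superdomain_line[OF assms(1-3)] assms(4) in \<open>auto elim: eventually_mono\<close>)

lemma iter_partial_cong:
  assumes "superdomain p D" "x \<in> D" "\<forall>i\<in>set is. \<not> p i" "\<And>y. y \<in> D \<Longrightarrow> h y = g y"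
  shows "iter_partial is h x = iter_partial is g x"
  using assms(2,3)
proof (induction "is" arbitrary: x)
  case (Cons i "is")
  then show ?case
    using partial_cong[OF assms(1), of x i "iter_partial is h" "iter_partial is g"] by auto
qed (simp add: assms(4))

lemma differentiable_on_eq:
  assumes "f differentiable_on S" "\<And>x. x \<in> S \<Longrightarrow> f x = g x"
  shows "g differentiable_on S"
  unfolding differentiable_on_def
proof
  fix x assume "x \<in> S"
  then show "g differentiable at x within S"
    using differentiable_transform_within[OF assms(1)[unfolded differentiable_on_def, rule_format],
        of x 1 g] assms(2) by simp
qed

section \<open>Smooth functions on superdomains\<close>

lemma smooth_cong:
  assumes "superdomain p D" "\<And>y. y \<in> D \<Longrightarrow> h y = g y" "smooth p D h"
  shows "smooth p D g"
proof -
  have "iter_partial is g differentiable_on D" if "\<forall>i\<in>set is. \<not> p i" for "is"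
    using differentiable_on_eq[of "iter_partial is h" D "iter_partial is g"] assms(3) that
      iter_partial_cong[OF assms(1) _ that, of _ h g] assms(2)
    by (auto simp: smooth_def)
  then show ?thesis
    by (auto simp: smooth_def)
qed

lemma smooth_differentiable: "smooth p D h \<Longrightarrow> h differentiable_on D"
  unfolding smooth_def by (metis iter_partial.simps(1) empty_iff list.set(1))

lemma iter_partial_append: "iter_partial (is @ js) h = iter_partial is (iter_partial js h)"
  by (induction "is") auto

lemma smooth_partial: "smooth p D h \<Longrightarrow> \<not> p i \<Longrightarrow> smooth p D (partial i h)"
  unfolding smooth_def
proof (intro allI impI)
  fix "is" assume "\<forall>is. (\<forall>i\<in>set is. \<not> p i) \<longrightarrow> iter_partial is h differentiable_on D"
    "\<not> p i" "\<forall>i\<in>set is. \<not> p i"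
  then have "iter_partial (is @ [i]) h differentiable_on D" by auto
  then show "iter_partial is (partial i h) differentiable_on D"
    by (simp add: iter_partial_append)
qed

lemma smooth_funpow_partial: "smooth p D h \<Longrightarrow> \<not> p i \<Longrightarrow> smooth p D ((partial i ^^ k) h)"
  by (induction k) (auto intro: smooth_partial)

text \<open>Iterated derivatives never leave \<open>C\<close>, up to equality on \<open>D\<close>,
  so only differentiability of the members of \<open>C\<close> remains to be known. The form suits
  composites, whose derivatives are sums of products rather than composites.\<close>

lemma smooth_coinduct:
  assumes "superdomain p D" "h \<in> C"
    and diff: "\<And>h. h \<in> C \<Longrightarrow> h differentiable_on D"
    and step: "\<And>h i. h \<in> C \<Longrightarrow> \<not> p i \<Longrightarrow> \<exists>h'\<in>C. \<forall>x\<in>D. partial i h x = h' x"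
  shows "smooth p D h"
proof -
  have *: "\<exists>h'\<in>C. \<forall>x\<in>D. iter_partial is h x = h' x" if "\<forall>i\<in>set is. \<not> p i" for "is"
    using that
  proof (induction "is")
    case (Cons i "is")
    then obtain h' where h': "h' \<in> C" "\<forall>x\<in>D. iter_partial is h x = h' x" by auto
    obtain h'' where h'': "h'' \<in> C" "\<forall>x\<in>D. partial i h' x = h'' x"
      using step[OF h'(1), of i] Cons.prems by auto
    have "\<forall>x\<in>D. iter_partial (i # is) h x = h'' x"
      using partial_cong[OF assms(1), of _ i "iter_partial is h" h'] Cons.prems h' h'' by auto
    then show ?case using h''(1) by blast
  qed (use assms(2) in auto)
  show ?thesis
    unfolding smooth_def
  proof (intro allI impI)
    fix "is" assume "\<forall>i\<in>set is. \<not> p i"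
    then obtain h' where h': "h' \<in> C" "\<forall>x\<in>D. iter_partial is h x = h' x" using * by blast
    show "iter_partial is h differentiable_on D"
      by (rule differentiable_on_eq[OF diff[OF h'(1)]]) (use h'(2) in auto)
  qed
qed

text \<open>\<open>D\<close> need not be open in \<open>real ^ 'i\<close>, so a derivative within
  \<open>D\<close> need not be unique. Its value on an even axis is: near 0 the line through
  \<open>x\<close> stays in \<open>D\<close>, and composing with it gives an ordinary
  derivative.\<close>

lemma has_derivative_line:
  assumes "superdomain p D" "x \<in> D" "\<not> p i" "(h has_derivative h') (at x within D)"
  shows "((\<lambda>t. h (x + t *\<^sub>R axis i 1)) has_real_derivative h' (axis i 1)) (at 0)"
    and "partial i h x = h' (axis i 1)"
proof -
  define T where "T = {t. x + t *\<^sub>R axis i 1 \<in> D}"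
  have T: "eventually (\<lambda>t. t \<in> T) (nhds 0)"
    using superdomain_line[OF assms(1-3)] by (simp add: T_def)
  then obtain U where U: "open U" "0 \<in> U" "U \<subseteq> T"
    unfolding eventually_nhds by auto
  have 1: "((\<lambda>t. x + t *\<^sub>R axis i 1) has_derivative (\<lambda>t. t *\<^sub>R axis i 1)) (at 0 within U)"
    by (auto intro!: derivative_eq_intros)
  have "(h has_derivative h') (at (x + 0 *\<^sub>R axis i 1) within (\<lambda>t. x + t *\<^sub>R axis i 1) ` U)"
    using has_derivative_subset[OF assms(4), of "(\<lambda>t. x + t *\<^sub>R axis i 1) ` U"] U(3) by (auto simp: T_def)
  then have "((\<lambda>t. h (x + t *\<^sub>R axis i 1)) has_derivative (\<lambda>t. h' (t *\<^sub>R axis i 1))) (at 0 within U)"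
    using has_derivative_in_compose[OF 1, of h h'] by simp
  then have "((\<lambda>t. h (x + t *\<^sub>R axis i 1)) has_derivative (\<lambda>t. h' (t *\<^sub>R axis i 1))) (at 0)"
    using U at_within_open by metis
  moreover have "(\<lambda>t. h' (t *\<^sub>R axis i 1)) = (*) (h' (axis i 1))"
    using has_derivative_linear[OF assms(4)] by (auto simp: linear_scale)
  ultimately show D: "((\<lambda>t. h (x + t *\<^sub>R axis i 1)) has_real_derivative h' (axis i 1)) (at 0)"
    by (simp add: has_field_derivative_def)
  then show "partial i h x = h' (axis i 1)"
    unfolding partial_def by (rule DERIV_imp_deriv)
qed

lemma has_partial:
  assumes "superdomain p D" "x \<in> D" "\<not> p i" "h differentiable_on D"
  shows "((\<lambda>t. h (x + t *\<^sub>R axis i 1)) has_real_derivative partial i h x) (at 0)"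
proof -
  obtain h' where "(h has_derivative h') (at x within D)"
    using assms(2,4) unfolding differentiable_on_def differentiable_def by blast
  from has_derivative_line[OF assms(1-3) this] show ?thesis by simp
qed

lemma has_partial_at:
  assumes "superdomain p D" "x + t *\<^sub>R axis i 1 \<in> D" "\<not> p i" "h differentiable_on D"
  shows "((\<lambda>t. h (x + t *\<^sub>R axis i 1)) has_real_derivative partial i h (x + t *\<^sub>R axis i 1)) (at t)"
proof -
  have "((\<lambda>u. h (x + (u + t) *\<^sub>R axis i 1)) has_real_derivative partial i h (x + t *\<^sub>R axis i 1)) (at 0)"
    using has_partial[OF assms] by (simp add: algebra_simps)
  then show ?thesis
    using DERIV_shift[of "\<lambda>u. h (x + u *\<^sub>R axis i 1)" _ 0 t] by simp
qed

lemma partial_add: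
  assumes "superdomain p D" "x \<in> D" "\<not> p i" "f differentiable_on D" "g differentiable_on D"
  shows "partial i (\<lambda>x. f x + g x) x = partial i f x + partial i g x"
  unfolding partial_def
  by (rule DERIV_imp_deriv)
     (use has_partial[OF assms(1-4)] has_partial[OF assms(1-3,5)] in
       \<open>auto intro!: derivative_eq_intros simp: partial_def\<close>)

lemma partial_mult:
  assumes "superdomain p D" "x \<in> D" "\<not> p i" "f differentiable_on D" "g differentiable_on D"
  shows "partial i (\<lambda>x. f x * g x) x = f x * partial i g x + partial i f x * g x"
proof -
  have "((\<lambda>t. f (x + t *\<^sub>R axis i 1) * g (x + t *\<^sub>R axis i 1)) has_real_derivative
      partial i f x * g x + partial i g x * f x) (at 0)"
    using DERIV_mult[OF has_partial[OF assms(1-4)] has_partial[OF assms(1-3,5)]]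
    by simp
  then show ?thesis
    unfolding partial_def[of i "\<lambda>x. f x * g x"] by (simp add: DERIV_imp_deriv mult.commute)
qed

lemma partial_const [simp]: "partial i (\<lambda>_. c) x = 0"
  by (simp add: partial_def)

lemma partial_component [simp]: "partial i (\<lambda>x. x $ j) x = (if i = j then 1 else 0)"
proof -
  have "((\<lambda>t. x $ j + t * (if i = j then 1 else 0)) has_real_derivative (if i = j then 1 else 0)) (at 0)"
    by (intro derivative_eq_intros) auto
  then show ?thesis
    unfolding partial_def by (simp add: axis_def DERIV_imp_deriv eq_commute)
qed

lemma differentiable_on_component: "(\<lambda>x. x $ j) differentiable_on (D :: (real ^ 'i::finite) set)"
  by (intro linear_imp_differentiable_on bounded_linear.linear bounded_linear_vec_nth)

lemma differentiable_on_vec: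
  fixes f :: "'a::real_normed_vector \<Rightarrow> real ^ 'n::finite"
  assumes "\<And>j. (\<lambda>x. f x $ j) differentiable_on S"
  shows "f differentiable_on S"
  unfolding differentiable_on_def
proof
  fix x assume "x \<in> S"
  then have "\<forall>j. \<exists>F. ((\<lambda>x. f x $ j) has_derivative F) (at x within S)"
    using assms unfolding differentiable_on_def differentiable_def by blast
  then obtain F where F: "\<And>j. ((\<lambda>x. f x $ j) has_derivative F j) (at x within S)"
    unfolding choice_iff by blast
  have "(f has_derivative (\<lambda>v. \<chi> j. F j v)) (at x within S)"
  proof (subst has_derivative_componentwise_within, intro ballI)
    fix b :: "real ^ 'n" assume "b \<in> Basis"
    then obtain j where "b = axis j 1" by (auto simp: Basis_vec_def)
    then show "((\<lambda>x. f x \<bullet> b) has_derivative (\<lambda>v. (\<chi> j. F j v) \<bullet> b)) (at x within S)"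
      using F[of j] by (simp add: inner_axis)
  qed
  then show "f differentiable at x within S"
    by (auto simp: differentiable_def)
qed

text \<open>The derivative of \<open>f\<close> within \<open>D'\<close> is determined on even axes
  only. This suffices because \<open>D'\<close> lies in the even subspace: the odd components of
  \<open>\<beta>\<close> vanish on \<open>D\<close>, so the derivative of \<open>\<beta>\<close>
  along axis \<open>i\<close> is a combination of even axes.\<close>

lemma partial_compose:
  fixes \<beta> :: "(real ^ 'i::finite) \<Rightarrow> real ^ 'j::finite"
  assumes D: "superdomain p D" "x \<in> D" "\<not> p i" and D': "superdomain p' D'"
    and \<beta>: "\<And>j. (\<lambda>x. \<beta> x $ j) differentiable_on D" "\<And>x. x \<in> D \<Longrightarrow> \<beta> x \<in> D'"
    and f: "f differentiable_on D'"
  shows "partial i (\<lambda>x. f (\<beta> x)) x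
    = (\<Sum>j\<in>{j. \<not> p' j}. partial i (\<lambda>x. \<beta> x $ j) x * partial j f (\<beta> x))"
proof -
  have "\<beta> differentiable_on D"
    by (rule differentiable_on_vec) (rule \<beta>(1))
  then obtain B where B: "(\<beta> has_derivative B) (at x within D)"
    using D(2) unfolding differentiable_on_def differentiable_def by blast
  obtain F where F: "(f has_derivative F) (at (\<beta> x) within D')"
    using f \<beta>(2)[OF D(2)] unfolding differentiable_on_def differentiable_def by blast
  have "(f has_derivative F) (at (\<beta> x) within \<beta> ` D)"
    using F has_derivative_subset \<beta>(2) by blast
  from has_derivative_in_compose[OF B this]
  have "partial i (\<lambda>x. f (\<beta> x)) x = F (B (axis i 1))"
    by (rule has_derivative_line(2)[OF D])
  moreover have "B (axis i 1) $ j = partial i (\<lambda>x. \<beta> x $ j) x" for j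
    using has_derivative_line(2)[OF D, of "\<lambda>x. \<beta> x $ j" "\<lambda>v. B v $ j"]
      bounded_linear.has_derivative[OF bounded_linear_vec_nth B] by simp
  moreover have "partial i (\<lambda>x. \<beta> x $ j) x = 0" if "p' j" for j
  proof -
    have "\<beta> y $ j = 0" if "y \<in> D" for y
      using superdomain_subset[OF D' \<beta>(2)[OF that]] \<open>p' j\<close> by (simp add: even_space_def)
    then show ?thesis
      using partial_cong[OF D, of "\<lambda>x. \<beta> x $ j" "\<lambda>_. 0"] by simp
  qed
  ultimately have "B (axis i 1) = (\<Sum>j\<in>{j. \<not> p' j}. partial i (\<lambda>x. \<beta> x $ j) x *\<^sub>R axis j 1)"
    by (auto simp: vec_eq_iff axis_def sum_component if_distrib[of "\<lambda>z. _ * z"] cong: if_cong)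
  moreover have "F (axis j 1) = partial j f (\<beta> x)" if "\<not> p' j" for j
    using has_derivative_line(2)[OF D' \<beta>(2)[OF D(2)] that F] by simp
  ultimately show ?thesis
    using \<open>partial i (\<lambda>x. f (\<beta> x)) x = F (B (axis i 1))\<close> has_derivative_linear[OF F]
    by (simp add: linear_sum linear_scale)
qed

text \<open>The class fed to \<open>smooth_coinduct\<close> to treat composites. When the components
  of \<open>\<beta>\<close> are smooth, it is closed under even partial derivatives by the chain and
  product rules.\<close>

inductive_set smooth_closure ::
    "('i::finite \<Rightarrow> bool) \<Rightarrow> 'i point set \<Rightarrow> ('j::finite \<Rightarrow> bool) \<Rightarrow> 'j point set
      \<Rightarrow> ('i point \<Rightarrow> 'j point) \<Rightarrow> ('i point \<Rightarrow> real) set"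
  for p D p' D' \<beta> where
  base: "smooth p D h \<Longrightarrow> h \<in> smooth_closure p D p' D' \<beta>"
| comp: "smooth p' D' f \<Longrightarrow> (\<lambda>x. f (\<beta> x)) \<in> smooth_closure p D p' D' \<beta>"
| add: "f \<in> smooth_closure p D p' D' \<beta> \<Longrightarrow> g \<in> smooth_closure p D p' D' \<beta>
    \<Longrightarrow> (\<lambda>x. f x + g x) \<in> smooth_closure p D p' D' \<beta>"
| mult: "f \<in> smooth_closure p D p' D' \<beta> \<Longrightarrow> g \<in> smooth_closure p D p' D' \<beta>
    \<Longrightarrow> (\<lambda>x. f x * g x) \<in> smooth_closure p D p' D' \<beta>"

lemma smooth_const [simp]: "smooth p D (\<lambda>_. c)"
proof -
  have "\<exists>c'. iter_partial is (\<lambda>_. c) = (\<lambda>_. c')" for "is" :: "'a list"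
    by (induction "is") auto
  then show ?thesis
    unfolding smooth_def by (metis differentiable_on_const)
qed

lemma smooth_component: "smooth p D (\<lambda>x. x $ j)"
  unfolding smooth_def
proof (intro allI impI)
  fix "is" :: "'a list"
  have "iter_partial is (\<lambda>x. x $ j) = (\<lambda>x. x $ j) \<or> (\<exists>c. iter_partial is (\<lambda>x. x $ j) = (\<lambda>_. c))"
    by (induction "is") auto
  then show "iter_partial is (\<lambda>x. x $ j) differentiable_on D"
    using differentiable_on_component by auto
qed

lemma smooth_closure_smooth:
  assumes D: "superdomain p D" and D': "superdomain p' D'"
    and \<beta>: "\<And>j. smooth p D (\<lambda>x. \<beta> x $ j)" "\<And>x. x \<in> D \<Longrightarrow> \<beta> x \<in> D'"
    and h: "h \<in> smooth_closure p D p' D' \<beta>"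
  shows "smooth p D h"
proof (rule smooth_coinduct[OF D h])
  let ?C = "smooth_closure p D p' D' \<beta>"
  show diff: "h differentiable_on D" if "h \<in> ?C" for h
    using that
  proof induction
    case (comp f)
    have "\<beta> differentiable_on D"
      by (rule differentiable_on_vec) (rule smooth_differentiable[OF \<beta>(1)])
    moreover have "f differentiable_on \<beta> ` D"
      by (rule differentiable_on_subset[OF smooth_differentiable[OF comp]]) (use \<beta>(2) in auto)
    ultimately show ?case
      by (rule differentiable_on_compose)
  qed (auto intro: smooth_differentiable differentiable_on_add differentiable_on_mult)
  show "\<exists>h'\<in>?C. \<forall>x\<in>D. partial i h x = h' x" if "h \<in> ?C" "\<not> p i" for h i
    using that(1)
  proof induction
    case (base h)
    then show ?case using smooth_partial[OF base that(2)] smooth_closure.base by blast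
  next
    case (comp f)
    let ?h = "\<lambda>J x. \<Sum>j\<in>J. partial i (\<lambda>x. \<beta> x $ j) x * partial j f (\<beta> x)"
    have "?h J \<in> ?C" if "J \<subseteq> {j. \<not> p' j}" for J
      using finite[of J] that
    proof induction
      case (insert j J)
      then have "smooth p' D' (partial j f)" "smooth p D (partial i (\<lambda>x. \<beta> x $ j))"
        using comp smooth_partial \<beta>(1) \<open>\<not> p i\<close> by blast+
      then have "(\<lambda>x. partial i (\<lambda>x. \<beta> x $ j) x * partial j f (\<beta> x)) \<in> ?C"
        by (intro smooth_closure.mult smooth_closure.base smooth_closure.comp[of p' D' "partial j f"])
      then show ?case using insert by (simp add: smooth_closure.add)
    qed (simp add: smooth_closure.base)
    then have "?h {j. \<not> p' j} \<in> ?C" by blast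
    then show ?case
      using partial_compose[OF D _ that(2) D' smooth_differentiable[OF \<beta>(1)] \<beta>(2) smooth_differentiable[OF comp]]
      by (intro bexI[of _ "?h {j. \<not> p' j}"]) auto
  next
    case (add f g)
    then obtain f' g' where "f' \<in> ?C" "g' \<in> ?C" "\<forall>x\<in>D. partial i f x = f' x" "\<forall>x\<in>D. partial i g x = g' x"
      by blast
    then show ?case
      using partial_add[OF D _ that(2) diff[OF add(1)] diff[OF add(2)]]
      by (intro bexI[of _ "\<lambda>x. f' x + g' x"]) (auto intro: smooth_closure.add)
  next
    case (mult f g)
    then obtain f' g' where "f' \<in> ?C" "g' \<in> ?C" "\<forall>x\<in>D. partial i f x = f' x" "\<forall>x\<in>D. partial i g x = g' x"
      by blast
    then show ?case
      using partial_mult[OF D _ that(2) diff[OF mult(1)] diff[OF mult(2)]] mult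
      by (intro bexI[of _ "\<lambda>x. f x * g' x + f' x * g x"]) (auto intro: smooth_closure.intros)
  qed
qed

lemma smooth_compose:
  assumes "superdomain p D" "superdomain p' D'" "\<And>j. smooth p D (\<lambda>x. \<beta> x $ j)"
    "\<And>x. x \<in> D \<Longrightarrow> \<beta> x \<in> D'" "smooth p' D' f"
  shows "smooth p D (\<lambda>x. f (\<beta> x))"
  using smooth_closure_smooth[OF assms(1-4) smooth_closure.comp[OF assms(5)]] .

text \<open>A sum belongs to \<open>smooth_closure\<close> with the identity as
  \<open>\<beta>\<close>; products are treated in the same way.\<close>

lemma smooth_add:
  assumes "superdomain p D" "smooth p D f" "smooth p D g"
  shows "smooth p D (\<lambda>x. f x + g x)"
  by (rule smooth_closure_smooth[OF assms(1,1) smooth_component])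
     (auto intro: smooth_closure.intros assms)

lemma smooth_mult:
  assumes "superdomain p D" "smooth p D f" "smooth p D g"
  shows "smooth p D (\<lambda>x. f x * g x)"
  by (rule smooth_closure_smooth[OF assms(1,1) smooth_component])
     (auto intro: smooth_closure.intros assms)

lemma smooth_sum:
  assumes "superdomain p D" "\<And>a. a \<in> A \<Longrightarrow> smooth p D (f a)"
  shows "smooth p D (\<lambda>x. \<Sum>a\<in>A. f a x)"
  using assms(2) by (induction A rule: infinite_finite_induct) (auto intro: smooth_add assms(1))

lemma smooth_power: "superdomain p D \<Longrightarrow> smooth p D f \<Longrightarrow> smooth p D (\<lambda>x. f x ^ n)"
  by (induction n) (auto intro: smooth_mult)

lemma smooth_prod:
  assumes "superdomain p D" "\<And>a. a \<in> A \<Longrightarrow> smooth p D (f a)"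
  shows "smooth p D (\<lambda>x. \<Prod>a\<in>A. f a x)"
  using assms(2) by (induction A rule: infinite_finite_induct) (auto intro: smooth_mult assms(1))

lemma smooth_cmult: "superdomain p D \<Longrightarrow> smooth p D f \<Longrightarrow> smooth p D (\<lambda>x. c * f x)"
  by (rule smooth_mult) auto

lemma partial_cmult:
  assumes "superdomain p D" "x \<in> D" "\<not> p i" "f differentiable_on D"
  shows "partial i (\<lambda>x. c * f x) x = c * partial i f x"
  using partial_mult[OF assms(1-3) differentiable_on_const assms(4)] by simp

lemma partial_sum:
  assumes "superdomain p D" "x \<in> D" "\<not> p i" "\<And>a. a \<in> A \<Longrightarrow> smooth p D (f a)"
  shows "partial i (\<lambda>x. \<Sum>a\<in>A. f a x) x = (\<Sum>a\<in>A. partial i (f a) x)"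
  using assms(4)
proof (induction A rule: infinite_finite_induct)
  case (insert a A)
  then show ?case
    using partial_add[OF assms(1-3), of "f a" "\<lambda>x. \<Sum>a\<in>A. f a x"]
    by (auto intro!: smooth_differentiable smooth_sum assms(1))
qed auto

text \<open>The left-hand side is symmetric in \<open>i\<close> and \<open>j\<close>, so letting \<open>\<delta>\<close> tend to zero gives the symmetry of
  second derivatives.\<close>

lemma second_difference:
  assumes D: "superdomain p D" and ij: "\<not> p i" "\<not> p j" and d: "\<delta> > 0"
    and sq: "\<And>s t. 0 \<le> s \<Longrightarrow> s \<le> \<delta> \<Longrightarrow> 0 \<le> t \<Longrightarrow> t \<le> \<delta> \<Longrightarrow> x + s *\<^sub>R axis i 1 + t *\<^sub>R axis j 1 \<in> D"
    and h: "h differentiable_on D" "partial i h differentiable_on D"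
  obtains s t where "0 < s" "s < \<delta>" "0 < t" "t < \<delta>"
    "h (x + \<delta> *\<^sub>R axis i 1 + \<delta> *\<^sub>R axis j 1) - h (x + \<delta> *\<^sub>R axis i 1) - h (x + \<delta> *\<^sub>R axis j 1) + h x
      = \<delta> * \<delta> * partial j (partial i h) (x + s *\<^sub>R axis i 1 + t *\<^sub>R axis j 1)"
proof -
  let ?i = "axis i (1::real)" and ?j = "axis j (1::real)"
  let ?f = "\<lambda>u. h (x + u *\<^sub>R ?i + \<delta> *\<^sub>R ?j) - h (x + u *\<^sub>R ?i)"
  have eq: "x + u *\<^sub>R ?i + \<delta> *\<^sub>R ?j = (x + \<delta> *\<^sub>R ?j) + u *\<^sub>R ?i" for u by simp
  have "(?f has_real_derivative partial i h (x + u *\<^sub>R ?i + \<delta> *\<^sub>R ?j) - partial i h (x + u *\<^sub>R ?i)) (at u)"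
    if "0 \<le> u" "u \<le> \<delta>" for u
  proof (rule DERIV_diff)
    show "((\<lambda>u. h (x + u *\<^sub>R ?i + \<delta> *\<^sub>R ?j)) has_real_derivative partial i h (x + u *\<^sub>R ?i + \<delta> *\<^sub>R ?j)) (at u)"
      unfolding eq by (rule has_partial_at[OF D _ ij(1) h(1)]) (use sq[of u \<delta>] that d eq in auto)
    show "((\<lambda>u. h (x + u *\<^sub>R ?i)) has_real_derivative partial i h (x + u *\<^sub>R ?i)) (at u)"
      by (rule has_partial_at[OF D _ ij(1) h(1)]) (use sq[of u 0] that d in auto)
  qed
  from MVT2[OF d this] obtain s where s: "0 < s" "s < \<delta>"
    "?f \<delta> - ?f 0 = \<delta> * (partial i h (x + s *\<^sub>R ?i + \<delta> *\<^sub>R ?j) - partial i h (x + s *\<^sub>R ?i))"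
    by auto
  have "((\<lambda>u. partial i h (x + s *\<^sub>R ?i + u *\<^sub>R ?j)) has_real_derivative
      partial j (partial i h) (x + s *\<^sub>R ?i + u *\<^sub>R ?j)) (at u)" if "0 \<le> u" "u \<le> \<delta>" for u
    by (rule has_partial_at[OF D _ ij(2) h(2)]) (use sq[of s u] that s in auto)
  from MVT2[OF d this] obtain t where t: "0 < t" "t < \<delta>"
    "partial i h (x + s *\<^sub>R ?i + \<delta> *\<^sub>R ?j) - partial i h (x + s *\<^sub>R ?i)
      = \<delta> * partial j (partial i h) (x + s *\<^sub>R ?i + t *\<^sub>R ?j)"
    by auto
  show ?thesis
    using that[OF s(1,2) t(1,2)] s(3) t(3) by (simp add: algebra_simps)
qed

lemma partial_commute:
  assumes D: "superdomain p D" "x \<in> D" and ij: "\<not> p i" "\<not> p j" and h: "smooth p D h"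
  shows "partial i (partial j h) x = partial j (partial i h) x"
proof -
  let ?i = "axis i (1::real)" and ?j = "axis j (1::real)"
  let ?f = "partial i (partial j h)" and ?g = "partial j (partial i h)"
  note sm = smooth_partial[OF h ij(1)] smooth_partial[OF h ij(2)]
  have cont: "continuous_on D ?f" "continuous_on D ?g"
    using smooth_partial[OF sm(1) ij(2)] smooth_partial[OF sm(2) ij(1)]
    by (auto intro!: differentiable_imp_continuous_on smooth_differentiable)
  have x: "x \<in> even_space p" using superdomain_subset[OF D] .
  obtain e where e: "e > 0" "\<And>y. y \<in> even_space p \<Longrightarrow> dist y x < e \<Longrightarrow> y \<in> D"
    using superdomain_ball[OF D] by blast
  have "\<bar>?f x - ?g x\<bar> \<le> \<epsilon>" if "\<epsilon> > 0" for \<epsilon>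
  proof -
    obtain d1 where d1: "d1 > 0" "\<And>y. y \<in> D \<Longrightarrow> dist y x < d1 \<Longrightarrow> dist (?f y) (?f x) < \<epsilon> / 2"
      using cont(1) D(2) \<open>\<epsilon> > 0\<close> unfolding continuous_on_iff by (metis half_gt_zero)
    obtain d2 where d2: "d2 > 0" "\<And>y. y \<in> D \<Longrightarrow> dist y x < d2 \<Longrightarrow> dist (?g y) (?g x) < \<epsilon> / 2"
      using cont(2) D(2) \<open>\<epsilon> > 0\<close> unfolding continuous_on_iff by (metis half_gt_zero)
    \<comment> \<open>Points of the square of side \<open>\<delta>\<close> are within
      \<open>2 * \<delta>\<close> of \<open>x\<close>; a third of the least radius keeps this below
      \<open>e\<close>, \<open>d1\<close> and \<open>d2\<close>.\<close>
    define \<delta> where "\<delta> = min e (min d1 d2) / 3"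
    have \<delta>: "\<delta> > 0" "2 * \<delta> < e" "2 * \<delta> < d1" "2 * \<delta> < d2"
      using e(1) d1(1) d2(1) by (auto simp: \<delta>_def)
    have dist: "dist (x + s *\<^sub>R ?i + t *\<^sub>R ?j) x \<le> 2 * \<delta>" if "0 \<le> s" "s \<le> \<delta>" "0 \<le> t" "t \<le> \<delta>" for s t
    proof -
      have "dist (x + s *\<^sub>R ?i + t *\<^sub>R ?j) x = norm (s *\<^sub>R ?i + t *\<^sub>R ?j)"
        by (simp add: dist_norm algebra_simps)
      also have "\<dots> \<le> norm (s *\<^sub>R ?i) + norm (t *\<^sub>R ?j)" by (rule norm_triangle_ineq)
      finally show ?thesis using that by simp
    qed
    have sq: "x + s *\<^sub>R ?i + t *\<^sub>R ?j \<in> D" if "0 \<le> s" "s \<le> \<delta>" "0 \<le> t" "t \<le> \<delta>" for s t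
      using e(2)[OF even_space_add_axis[OF even_space_add_axis[OF x ij(1)] ij(2)]] dist[OF that] \<delta>(2)
      by fastforce
    have sq': "x + s *\<^sub>R ?j + t *\<^sub>R ?i \<in> D" if "0 \<le> s" "s \<le> \<delta>" "0 \<le> t" "t \<le> \<delta>" for s t
      using sq[of t s] that by (simp add: algebra_simps)
    obtain s t where st: "0 < s" "s < \<delta>" "0 < t" "t < \<delta>"
      "h (x + \<delta> *\<^sub>R ?i + \<delta> *\<^sub>R ?j) - h (x + \<delta> *\<^sub>R ?i) - h (x + \<delta> *\<^sub>R ?j) + h x
        = \<delta> * \<delta> * ?g (x + s *\<^sub>R ?i + t *\<^sub>R ?j)"
      by (rule second_difference[OF D(1) ij \<delta>(1) sq smooth_differentiable[OF h] smooth_differentiable[OF sm(1)]])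
    obtain s' t' where st': "0 < s'" "s' < \<delta>" "0 < t'" "t' < \<delta>"
      "h (x + \<delta> *\<^sub>R ?j + \<delta> *\<^sub>R ?i) - h (x + \<delta> *\<^sub>R ?j) - h (x + \<delta> *\<^sub>R ?i) + h x
        = \<delta> * \<delta> * ?f (x + s' *\<^sub>R ?j + t' *\<^sub>R ?i)"
      by (rule second_difference[OF D(1) ij(2,1) \<delta>(1) sq' smooth_differentiable[OF h] smooth_differentiable[OF sm(2)]])
    have "h (x + \<delta> *\<^sub>R ?i + \<delta> *\<^sub>R ?j) = h (x + \<delta> *\<^sub>R ?j + \<delta> *\<^sub>R ?i)"
      by (simp add: add.commute add.left_commute)
    then have "\<delta> * \<delta> * ?g (x + s *\<^sub>R ?i + t *\<^sub>R ?j) = \<delta> * \<delta> * ?f (x + s' *\<^sub>R ?j + t' *\<^sub>R ?i)"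
      using st(5) st'(5) by linarith
    then have "?g (x + s *\<^sub>R ?i + t *\<^sub>R ?j) = ?f (x + t' *\<^sub>R ?i + s' *\<^sub>R ?j)"
      using \<delta>(1) by (simp add: algebra_simps)
    moreover have "dist (?g (x + s *\<^sub>R ?i + t *\<^sub>R ?j)) (?g x) < \<epsilon> / 2"
      using d2(2)[OF sq] dist[of s t] st \<delta>(4) by simp
    moreover have "dist (?f (x + t' *\<^sub>R ?i + s' *\<^sub>R ?j)) (?f x) < \<epsilon> / 2"
      using d1(2)[OF sq] dist[of t' s'] st' \<delta>(3) by simp
    ultimately show ?thesis
      unfolding dist_real_def by linarith
  qed
  then show ?thesis
    using field_le_epsilon[of "\<bar>?f x - ?g x\<bar>" 0] by simp
qed

section \<open>The algebra of superfunctions\<close>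

lemma coeff_zero [simp]: "coeff 0 I x = 0"
  and coeff_add [simp]: "coeff (f + g) I x = coeff f I x + coeff g I x"
  and coeff_diff [simp]: "coeff (f - g) I x = coeff f I x - coeff g I x"
  and coeff_minus [simp]: "coeff (- f) I x = - coeff f I x"
  and coeff_scaleR [simp]: "coeff (r *\<^sub>R f) I x = r * coeff f I x"
  and coeff_one: "coeff 1 I x = (if I = {} then 1 else 0)"
  and coeff_mult: "coeff (f * g) I x = (\<Sum>J\<in>Pow I. sgn_shuffle J (I - J) * coeff f J x * coeff g (I - J) x)"
  by (simp_all add: zero_sfun_def plus_sfun_def minus_sfun_def uminus_sfun_def scaleR_sfun_def
      one_sfun_def times_sfun_def)

lemma coeff_sum [simp]: "coeff (sum f A) I x = (\<Sum>a\<in>A. coeff (f a) I x)"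
  by (induction A rule: infinite_finite_induct) auto

lemma coeff_scalar_fun: "coeff (scalar_fun h) I x = (if I = {} then h x else 0)"
  by (simp add: scalar_fun_def)

lemma coeff_scalar_fun_mult [simp]: "coeff (scalar_fun h * g) I x = h x * coeff g I x"
proof -
  have "coeff (scalar_fun h * g) I x = (\<Sum>J\<in>Pow I. if J = {} then h x * coeff g I x else 0)"
    unfolding coeff_mult by (intro sum.cong) (auto simp: coeff_scalar_fun)
  then show ?thesis by simp
qed

lemma psign_simps [simp]: "psign False = 1" "psign True = - 1" "psign b * psign b = 1"
    "psign (\<not> b) = - psign b"
  by (auto simp: psign_def)

lemma psign_mult: "psign a * psign b = psign (a \<noteq> b)"
  by (auto simp: psign_def)

lemma psign_odd: "psign (odd n) = (- 1) ^ n"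
  by (auto simp: psign_def)

text \<open>A normal form for \<open>eq_on\<close>: the meaningless data are replaced by zero. Since
  \<open>trunc\<close> is linear and multiplicative, congruence reasoning becomes rewriting of
  equations.\<close>

definition trunc :: "('i::{finite,linorder} \<Rightarrow> bool) \<Rightarrow> 'i point set \<Rightarrow> 'i sfun \<Rightarrow> 'i sfun" where
  "trunc p D f = Sfun (\<lambda>I x. if I \<subseteq> {i. p i} \<and> x \<in> D then coeff f I x else 0)"

lemma coeff_trunc: "coeff (trunc p D f) I x = (if I \<subseteq> {i. p i} \<and> x \<in> D then coeff f I x else 0)"
  by (simp add: trunc_def)

lemma eq_on_trunc: "eq_on p D f g \<longleftrightarrow> trunc p D f = trunc p D g"
proof
  assume "trunc p D f = trunc p D g"
  then have "coeff (trunc p D f) I x = coeff (trunc p D g) I x" for I x by simp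
  then show "eq_on p D f g"
    unfolding eq_on_def coeff_trunc by metis
qed (auto simp: eq_on_def intro!: sfun_eqI simp: coeff_trunc)

lemma trunc_zero [simp]: "trunc p D 0 = 0"
  and trunc_add: "trunc p D (f + g) = trunc p D f + trunc p D g"
  and trunc_diff: "trunc p D (f - g) = trunc p D f - trunc p D g"
  and trunc_minus: "trunc p D (- f) = - trunc p D f"
  and trunc_scaleR: "trunc p D (r *\<^sub>R f) = r *\<^sub>R trunc p D f"
  by (auto intro!: sfun_eqI simp: coeff_trunc)

lemma trunc_sum: "trunc p D (sum f A) = (\<Sum>a\<in>A. trunc p D (f a))"
  by (induction A rule: infinite_finite_induct) (auto simp: trunc_add)

text \<open>If \<open>K\<close> contains an even index, so does one of the two parts of every
  splitting of \<open>K\<close>. Hence both sides vanish there, as they do outside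
  \<open>D\<close>.\<close>

lemma trunc_mult: "trunc p D (f * g) = trunc p D f * trunc p D g"
proof (rule sfun_eqI)
  fix K x
  show "coeff (trunc p D (f * g)) K x = coeff (trunc p D f * trunc p D g) K x"
  proof (cases "K \<subseteq> {i. p i} \<and> x \<in> D")
    case True
    then have "J \<subseteq> {i. p i} \<and> K - J \<subseteq> {i. p i}" if "J \<in> Pow K" for J
      using that by blast
    then show ?thesis
      using True unfolding coeff_mult coeff_trunc by (auto intro!: sum.cong)
  next
    case False
    have "coeff (trunc p D f) J x * coeff (trunc p D g) (K - J) x = 0" if "J \<subseteq> K" for J
      using False that by (auto simp: coeff_trunc)
    then have "coeff (trunc p D f * trunc p D g) K x = 0"
      unfolding coeff_mult by (intro sum.neutral) (simp add: mult.assoc)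
    then show ?thesis
      using False by (auto simp: coeff_trunc)
  qed
qed

lemmas trunc_simps = trunc_add trunc_diff trunc_minus trunc_scaleR trunc_sum trunc_mult

lemma eq_on_refl [simp]: "eq_on p D f f"
  by (simp add: eq_on_def)

lemma eq_on_sym: "eq_on p D f g \<Longrightarrow> eq_on p D g f"
  by (simp add: eq_on_def)

lemma eq_on_trans [trans]: "eq_on p D f g \<Longrightarrow> eq_on p D g h \<Longrightarrow> eq_on p D f h"
  by (simp add: eq_on_def)

lemma eq_on_add: "eq_on p D f f' \<Longrightarrow> eq_on p D g g' \<Longrightarrow> eq_on p D (f + g) (f' + g')"
  and eq_on_diff: "eq_on p D f f' \<Longrightarrow> eq_on p D g g' \<Longrightarrow> eq_on p D (f - g) (f' - g')"
  and eq_on_scaleR: "eq_on p D f f' \<Longrightarrow> eq_on p D (r *\<^sub>R f) (r *\<^sub>R f')"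
  and eq_on_mult: "eq_on p D f f' \<Longrightarrow> eq_on p D g g' \<Longrightarrow> eq_on p D (f * g) (f' * g')"
  by (simp_all add: eq_on_trunc trunc_simps)

lemma eq_on_sum: "(\<And>a. a \<in> A \<Longrightarrow> eq_on p D (f a) (g a)) \<Longrightarrow> eq_on p D (sum f A) (sum g A)"
  by (simp add: eq_on_trunc trunc_sum)

lemma eq_on_UNIV: "eq_on (\<lambda>_. True) UNIV f g \<Longrightarrow> f = g"
  by (auto simp: eq_on_def intro: sfun_eqI)

lemma coeff_twist: "coeff (twist b f) I x = psign (b \<and> odd (card I)) * coeff f I x"
  by (cases b; simp add: twist_def psign_def)

lemma twist_False [simp]: "twist False f = f"
  by (simp add: twist_def)

lemma twist_zero [simp]: "twist b 0 = 0"
  and twist_add: "twist b (f + g) = twist b f + twist b g"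
  and twist_diff: "twist b (f - g) = twist b f - twist b g"
  and twist_scaleR: "twist b (r *\<^sub>R f) = r *\<^sub>R twist b f"
  by (auto intro!: sfun_eqI simp: coeff_twist algebra_simps)

lemma twist_sum: "twist b (sum f A) = (\<Sum>a\<in>A. twist b (f a))"
  by (auto intro!: sfun_eqI simp: coeff_twist sum_distrib_left)

lemma twist_twist: "twist b (twist c f) = twist (b \<noteq> c) f"
  by (cases b; cases c; auto intro!: sfun_eqI simp: coeff_twist)

lemma twist_mult: "twist b (f * g) = twist b f * twist b g"
proof (rule sfun_eqI)
  fix K :: "'a set" and x
  have "psign (b \<and> odd (card K)) = psign (b \<and> odd (card I)) * psign (b \<and> odd (card (K - I)))"
    if "I \<subseteq> K" for I
  proof -
    have "card K = card I + card (K - I)"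
      using that by (metis card_Diff_subset card_mono finite le_add_diff_inverse)
    then show ?thesis by (cases b) (auto simp: psign_def)
  qed
  then show "coeff (twist b (f * g)) K x = coeff (twist b f * twist b g) K x"
    by (auto intro!: sum.cong simp: coeff_twist coeff_mult sum_distrib_left)
qed

lemma twist_scalar_fun [simp]: "twist b (scalar_fun h) = scalar_fun h"
  by (auto intro!: sfun_eqI simp: coeff_twist coeff_scalar_fun)

lemma twist_one [simp]: "twist b 1 = 1"
  by (auto intro!: sfun_eqI simp: coeff_twist coeff_one)

lemma trunc_twist: "trunc p D (twist b f) = twist b (trunc p D f)"
  by (auto intro!: sfun_eqI simp: coeff_twist coeff_trunc)

lemma eq_on_twist: "eq_on p D f g \<Longrightarrow> eq_on p D (twist b f) (twist b g)"
  by (simp add: eq_on_trunc trunc_twist)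

text \<open>Parity as an eigenvalue of the automorphism \<open>twist True\<close>. Closure of parity
  under sums and products then follows from linearity and multiplicativity of
  \<open>twist\<close>.\<close>

lemma has_parity_twist_iff: "has_parity p D b f \<longleftrightarrow> eq_on p D (twist True f) (psign b *\<^sub>R f)"
  unfolding has_parity_def eq_on_def coeff_twist coeff_scaleR by (auto simp: psign_def)

lemma has_parity_twist: "has_parity p D b f \<Longrightarrow> eq_on p D (twist c f) (psign (b \<and> c) *\<^sub>R f)"
  by (cases c) (auto simp: has_parity_twist_iff)

lemma has_parity_zero [simp]: "has_parity p D b 0"
  and has_parity_add: "has_parity p D b f \<Longrightarrow> has_parity p D b g \<Longrightarrow> has_parity p D b (f + g)"
  and has_parity_diff: "has_parity p D b f \<Longrightarrow> has_parity p D b g \<Longrightarrow> has_parity p D b (f - g)"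
  and has_parity_scaleR: "has_parity p D b f \<Longrightarrow> has_parity p D b (r *\<^sub>R f)"
  by (auto simp: has_parity_twist_iff eq_on_trunc trunc_simps twist_add twist_diff twist_scaleR algebra_simps)

lemma has_parity_sum: "(\<And>a. a \<in> A \<Longrightarrow> has_parity p D b (f a)) \<Longrightarrow> has_parity p D b (sum f A)"
  by (induction A rule: infinite_finite_induct) (auto intro: has_parity_add)

lemma has_parity_mult:
  assumes "has_parity p D b f" "has_parity p D c g"
  shows "has_parity p D (b \<noteq> c) (f * g)"
  using assms by (simp add: has_parity_twist_iff eq_on_trunc trunc_simps twist_mult psign_mult mult.commute)

lemma has_parity_mult':
  assumes "has_parity p D b f" "has_parity p D c g" "d = (b \<noteq> c)"
  shows "has_parity p D d (f * g)"
  using has_parity_mult[OF assms(1,2)] assms(3) by simp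

lemma has_parity_one [simp]: "has_parity p D False 1"
  and has_parity_scalar_fun [simp]: "has_parity p D False (scalar_fun h)"
  by (auto simp: has_parity_twist_iff)

lemma has_parity_power: "has_parity p D False f \<Longrightarrow> has_parity p D False (f ^ n)"
  by (induction n) (auto intro: has_parity_mult')

text \<open>\<open>I \<times> J\<close> splits into the pairs inverted in the order
  \<open>I\<close>, \<open>J\<close> and those inverted in the order \<open>J\<close>,
  \<open>I\<close>, so the two inversion counts add up to \<open>card I * card J\<close>.\<close>

lemma sgn_shuffle_swap:
  assumes "I \<inter> J = {}"
  shows "sgn_shuffle I J = psign (odd (card I) \<and> odd (card J)) * sgn_shuffle J I"
proof -
  let ?A = "{(i, j). i \<in> I \<and> j \<in> J \<and> j < i}" and ?B = "{(i, j). i \<in> I \<and> j \<in> J \<and> i < j}"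
  have eq: "I \<times> J = ?A \<union> ?B" and disj: "?A \<inter> ?B = {}"
    using assms by (auto simp: not_less_iff_gr_or_eq)
  have "card I * card J = card (?A \<union> ?B)"
    by (simp only: card_cartesian_product flip: eq)
  also have "\<dots> = card ?A + card ?B"
    by (rule card_Un_disjoint[OF finite finite disj])
  finally have "card I * card J = card ?A + card ?B" .
  moreover have "card ?B = card {(i, j). i \<in> J \<and> j \<in> I \<and> j < i}"
    by (rule bij_betw_same_card[of "\<lambda>(i, j). (j, i)"]) (auto simp: bij_betw_def inj_on_def)
  ultimately have "card ?A + card {(i, j). i \<in> J \<and> j \<in> I \<and> j < i} = card I * card J" by simp
  then have "sgn_shuffle I J * sgn_shuffle J I = (- 1) ^ (card I * card J)"
    unfolding sgn_shuffle_def by (simp flip: power_add)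
  moreover have "sgn_shuffle J I * sgn_shuffle J I = 1"
    by (simp add: sgn_shuffle_def flip: power_add)
  moreover have "(- 1 :: real) ^ (card I * card J) = psign (odd (card I) \<and> odd (card J))"
    by (simp flip: psign_odd)
  ultimately show ?thesis
    by (metis mult.assoc mult.right_neutral)
qed

text \<open>Here \<open>g\<close> may be inhomogeneous: \<open>twist b\<close> supplies the sign for
  each of its terms. Passing to complements of index sets turns the sum for \<open>f * g\<close>
  into the one for the opposite order.\<close>

lemma has_parity_commute:
  assumes "has_parity p D b f"
  shows "eq_on p D (f * g) (twist b g * f)"
  unfolding eq_on_def
proof (intro allI impI ballI)
  fix K x assume K: "K \<subseteq> {i. p i}" and x: "x \<in> D"
  have "sgn_shuffle I (K - I) * coeff f I x * coeff g (K - I) x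
      = sgn_shuffle (K - I) I * coeff (twist b g) (K - I) x * coeff f I x" if "I \<subseteq> K" for I
  proof (cases "coeff f I x = 0")
    case False
    then have "odd (card I) = b" using assms K x that by (auto simp: has_parity_def)
    then show ?thesis
      using sgn_shuffle_swap[of I "K - I"] by (simp add: coeff_twist)
  qed auto
  then have "coeff (f * g) K x
      = (\<Sum>I\<in>Pow K. sgn_shuffle (K - I) I * coeff (twist b g) (K - I) x * coeff f I x)"
    unfolding coeff_mult by (intro sum.cong) auto
  also have "\<dots> = coeff (twist b g * f) K x"
    unfolding coeff_mult
    by (rule sum.reindex_bij_witness[of _ "\<lambda>I. K - I" "\<lambda>I. K - I"]) (auto simp: double_diff)
  finally show "coeff (f * g) K x = coeff (twist b g * f) K x" .
qed

lemma supercommute: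
  assumes "has_parity p D b f" "has_parity p D c g"
  shows "eq_on p D (f * g) (psign (b \<and> c) *\<^sub>R (g * f))"
proof -
  have "eq_on p D (f * g) (twist b g * f)" by (rule has_parity_commute[OF assms(1)])
  also have "eq_on p D \<dots> ((psign (c \<and> b) *\<^sub>R g) * f)"
    by (intro eq_on_mult eq_on_refl has_parity_twist assms(2))
  finally show ?thesis by (simp add: conj_commute)
qed

lemma even_commute: "has_parity p D False f \<Longrightarrow> eq_on p D (f * g) (g * f)"
  using has_parity_commute[of p D False f g] by simp

lemma coord_odd: "p i \<Longrightarrow> coord p i = Sfun (\<lambda>I _. if I = {i} then 1 else 0)"
  by (simp add: coord_def)

lemma coord_even: "\<not> p i \<Longrightarrow> coord p i = scalar_fun (\<lambda>x. x $ i)"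
  by (simp add: coord_def)

lemma has_parity_coord [simp]: "has_parity p D (p i) (coord p i)"
  by (cases "p i") (auto simp: has_parity_def coord_odd coord_even coeff_scalar_fun split: if_splits)

lemma twist_coord: "twist b (coord p i) = psign (b \<and> p i) *\<^sub>R coord p i"
  by (cases "p i") (auto simp: coord_even coord_odd coeff_twist intro!: sfun_eqI)

lemma coeff_coord_mult:
  assumes "p i"
  shows "coeff (coord p i * g) K x
    = (if i \<in> K then (- 1) ^ card {j \<in> K. j < i} * coeff g (K - {i}) x else 0)"
proof -
  have "coeff (coord p i * g) K x
      = (\<Sum>J\<in>Pow K. if J = {i} then sgn_shuffle {i} (K - {i}) * coeff g (K - {i}) x else 0)"
    unfolding coeff_mult by (intro sum.cong) (auto simp: coord_odd assms)
  moreover have "sgn_shuffle {i} (K - {i}) = (- 1) ^ card {j \<in> K. j < i}"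
  proof -
    have "card {(i', j). i' \<in> {i} \<and> j \<in> K - {i} \<and> j < i'} = card {j \<in> K. j < i}"
      by (rule bij_betw_same_card[of snd]) (auto simp: bij_betw_def inj_on_def image_iff)
    then show ?thesis by (simp only: sgn_shuffle_def)
  qed
  ultimately show ?thesis by auto
qed

section \<open>Derivatives of superfunctions\<close>

lemma coeff_pd_odd:
  "p i \<Longrightarrow> coeff (pd p i f) I x = (if i \<in> I then 0 else (- 1) ^ card {j \<in> I. j < i} * coeff f (insert i I) x)"
  by (simp add: pd_def)

lemma coeff_pd_even: "\<not> p i \<Longrightarrow> coeff (pd p i f) I = partial i (coeff f I)"
  by (simp add: pd_def)

text \<open>The regularity for which the calculus is carried out: products, derivatives and
  substitutions preserve it, and every superfunction has it. The polynomial condition is treated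
  apart, together with the weights.\<close>

definition smooth_sfun :: "('i::{finite,linorder} \<Rightarrow> bool) \<Rightarrow> 'i point set \<Rightarrow> 'i sfun \<Rightarrow> bool" where
  "smooth_sfun p D f \<longleftrightarrow> (\<forall>I \<subseteq> {i. p i}. smooth p D (coeff f I))"

lemma smooth_sfunD: "smooth_sfun p D f \<Longrightarrow> I \<subseteq> {i. p i} \<Longrightarrow> smooth p D (coeff f I)"
  by (simp add: smooth_sfun_def)

context
  fixes p :: "'i::{finite,linorder} \<Rightarrow> bool" and D
  assumes D: "superdomain p D"
begin

lemma smooth_sfun_zero: "smooth_sfun p D 0"
  and smooth_sfun_one: "smooth_sfun p D 1"
  using smooth_const[of p D] by (simp_all add: smooth_sfun_def zero_sfun_def one_sfun_def)

lemma smooth_sfun_scalar_fun: "smooth p D h \<Longrightarrow> smooth_sfun p D (scalar_fun h)"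
  by (auto simp: smooth_sfun_def scalar_fun_def)

lemma smooth_sfun_coord: "smooth_sfun p D (coord p i)"
  by (cases "p i") (auto simp: coord_odd coord_even smooth_component smooth_sfun_def smooth_sfun_scalar_fun[unfolded smooth_sfun_def])

lemma smooth_sfun_add: "smooth_sfun p D f \<Longrightarrow> smooth_sfun p D g \<Longrightarrow> smooth_sfun p D (f + g)"
  by (simp add: smooth_sfun_def plus_sfun_def smooth_add[OF D])

lemma smooth_sfun_scaleR: "smooth_sfun p D f \<Longrightarrow> smooth_sfun p D (r *\<^sub>R f)"
  by (simp add: smooth_sfun_def scaleR_sfun_def smooth_cmult[OF D])

lemma smooth_sfun_diff: "smooth_sfun p D f \<Longrightarrow> smooth_sfun p D g \<Longrightarrow> smooth_sfun p D (f - g)"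
  using smooth_sfun_add[of f "(- 1) *\<^sub>R g"] smooth_sfun_scaleR[of g "- 1"] by simp

lemma smooth_sfun_sum: "(\<And>a. a \<in> A \<Longrightarrow> smooth_sfun p D (f a)) \<Longrightarrow> smooth_sfun p D (sum f A)"
  by (induction A rule: infinite_finite_induct) (auto intro: smooth_sfun_add smooth_sfun_zero)

lemma smooth_sfun_mult: "smooth_sfun p D f \<Longrightarrow> smooth_sfun p D g \<Longrightarrow> smooth_sfun p D (f * g)"
  unfolding smooth_sfun_def times_sfun_def coeff_Sfun
  by (intro allI impI smooth_sum smooth_mult smooth_const D) (simp_all add: subset_iff)

lemma smooth_sfun_power: "smooth_sfun p D f \<Longrightarrow> smooth_sfun p D (f ^ n)"
  by (induction n) (auto intro: smooth_sfun_mult smooth_sfun_one)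

lemma smooth_sfun_twist: "smooth_sfun p D f \<Longrightarrow> smooth_sfun p D (twist b f)"
  by (cases b) (auto simp: smooth_sfun_def twist_def intro: smooth_cmult[OF D])

lemma smooth_sfun_pd: "smooth_sfun p D f \<Longrightarrow> smooth_sfun p D (pd p i f)"
proof (cases "p i")
  case True
  assume "smooth_sfun p D f"
  then have "smooth p D (\<lambda>x. (- 1) ^ card {j \<in> I. j < i} * coeff f (insert i I) x)" if "I \<subseteq> {i. p i}" for I
    using that True by (intro smooth_cmult[OF D]) (auto simp: smooth_sfun_def)
  moreover have "coeff (pd p i f) I
      = (if i \<in> I then (\<lambda>_. 0) else (\<lambda>x. (- 1) ^ card {j \<in> I. j < i} * coeff f (insert i I) x))" for I
    by (auto simp: coeff_pd_odd True)
  ultimately show ?thesis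
    by (simp add: smooth_sfun_def)
qed (auto simp: smooth_sfun_def pd_def intro!: smooth_partial)

lemmas smooth_sfun_intros = smooth_sfun_zero smooth_sfun_one smooth_sfun_coord smooth_sfun_add
  smooth_sfun_diff smooth_sfun_scaleR smooth_sfun_sum smooth_sfun_mult smooth_sfun_twist smooth_sfun_pd

lemma pd_cong: "eq_on p D f g \<Longrightarrow> eq_on p D (pd p i f) (pd p i g)"
  by (cases "p i") (auto simp: eq_on_def pd_def intro: partial_cong[OF D])

lemma pd_add:
  assumes "smooth_sfun p D f" "smooth_sfun p D g"
  shows "eq_on p D (pd p i (f + g)) (pd p i f + pd p i g)"
proof (cases "p i")
  case False
  then show ?thesis
    unfolding eq_on_def
    by (simp add: coeff_pd_even plus_sfun_def partial_add[OF D _ False]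
        smooth_differentiable[OF smooth_sfunD[OF assms(1)]] smooth_differentiable[OF smooth_sfunD[OF assms(2)]])
qed (auto simp: eq_on_def pd_def algebra_simps)

lemma pd_scaleR:
  assumes "smooth_sfun p D f"
  shows "eq_on p D (pd p i (r *\<^sub>R f)) (r *\<^sub>R pd p i f)"
proof (cases "p i")
  case False
  then show ?thesis
    unfolding eq_on_def
    by (simp add: coeff_pd_even scaleR_sfun_def partial_cmult[OF D _ False]
        smooth_differentiable[OF smooth_sfunD[OF assms]])
qed (auto simp: eq_on_def pd_def algebra_simps)

lemma pd_zero [simp]: "pd p i 0 = 0"
  by (rule sfun_eqI) (auto simp: pd_def zero_sfun_def)

lemma pd_sum:
  assumes "\<And>a. a \<in> A \<Longrightarrow> smooth_sfun p D (f a)"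
  shows "eq_on p D (pd p i (sum f A)) (\<Sum>a\<in>A. pd p i (f a))"
  using assms
proof (induction A rule: infinite_finite_induct)
  case (insert a A)
  have "eq_on p D (pd p i (f a + sum f A)) (pd p i (f a) + pd p i (sum f A))"
    by (intro pd_add smooth_sfun_sum) (auto simp: insert)
  also have "eq_on p D \<dots> (pd p i (f a) + (\<Sum>a\<in>A. pd p i (f a)))"
    by (intro eq_on_add eq_on_refl insert.IH) (auto simp: insert)
  finally show ?case using insert(1,2) by simp
qed auto

lemma pd_twist:
  assumes "smooth_sfun p D f"
  shows "eq_on p D (pd p i (twist b f)) (psign (b \<and> p i) *\<^sub>R twist b (pd p i f))"
proof (cases "p i")
  case False
  have "coeff (twist b f) I = (\<lambda>x. psign (b \<and> odd (card I)) * coeff f I x)" for I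
    by (auto simp: coeff_twist)
  then show ?thesis
    unfolding eq_on_def
    by (simp add: False coeff_pd_even coeff_twist partial_cmult[OF D _ False]
        smooth_differentiable[OF smooth_sfunD[OF assms]])
qed (auto simp: eq_on_def coeff_twist coeff_pd_odd psign_def)

end

lemma pd_coord: "pd p i (coord p j) = (if i = j then 1 else 0)"
proof (rule sfun_eqI)
  fix I x
  show "coeff (pd p i (coord p j)) I x = coeff (if i = j then 1 else 0) I x"
  proof (cases "p i")
    case True
    then show ?thesis
      by (cases "p j") (auto simp: coeff_pd_odd coord_even coord_odd coeff_scalar_fun coeff_one)
  next
    case False
    then show ?thesis
      by (cases "p j") (auto simp: coeff_pd_even coord_even coord_odd scalar_fun_def coeff_one)
  qed
qed

text \<open>Write \<open>f = a + \<theta> * b\<close> and \<open>g = c + \<theta> * d\<close> with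
  \<open>\<theta> = coord p i\<close> and the other letters free of \<open>\<theta>\<close>; the
  derivative picks out \<open>b\<close> and \<open>d\<close>. In the product,
  \<open>\<theta> * \<theta> = 0\<close> removes one term, and moving \<open>\<theta>\<close> to the
  front past \<open>a\<close> produces the twist.\<close>

lemma pd_mult_odd:
  fixes f g :: "'i::{finite,linorder} sfun"
  assumes i: "p i"
  shows "pd p i (f * g) = pd p i f * g + twist True f * pd p i g"
proof -
  define fr where "fr = (\<lambda>h :: 'i sfun. \<forall>I x. i \<in> I \<longrightarrow> coeff h I x = 0)"
  define del where "del = (\<lambda>h :: 'i sfun. Sfun (\<lambda>I x. if i \<in> I then 0 else coeff h I x))"
  let ?\<theta> = "coord p i"
  have decomp: "h = del h + ?\<theta> * pd p i h" for h
  proof (rule sfun_eqI)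
    fix I x
    have "{j \<in> I - {i}. j < i} = {j \<in> I. j < i}" by auto
    then have "i \<in> I \<Longrightarrow> (- 1) ^ card {j \<in> I. j < i} * ((- 1) ^ card {j \<in> I - {i}. j < i} * coeff h I x) = coeff h I x"
      by (simp flip: mult.assoc power_add)
    then show "coeff h I x = coeff (del h + ?\<theta> * pd p i h) I x"
      by (auto simp: del_def coeff_coord_mult coeff_pd_odd i insert_absorb)
  qed
  have fr_del: "fr (del h)" and fr_pd: "fr (pd p i h)" for h
    by (auto simp: fr_def del_def coeff_pd_odd i)
  have fr_mult: "fr (h * k)" if "fr h" "fr k" for h k
    unfolding fr_def coeff_mult
  proof (intro allI impI sum.neutral ballI)
    fix I J :: "'i set" and x assume "i \<in> I" "J \<in> Pow I"
    then show "sgn_shuffle J (I - J) * coeff h J x * coeff k (I - J) x = 0"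
      using that by (cases "i \<in> J") (auto simp: fr_def)
  qed
  have fr_twist: "fr (twist True h)" if "fr h" for h
    using that by (auto simp: fr_def coeff_twist)
  have fr_add: "fr (h + k)" if "fr h" "fr k" for h k
    using that by (auto simp: fr_def)
  have pd: "pd p i (h + ?\<theta> * k) = k" if "fr h" "fr k" for h k
  proof (rule sfun_eqI)
    fix I x
    have "i \<notin> I \<Longrightarrow> {j \<in> insert i I. j < i} = {j \<in> I. j < i}" by auto
    then show "coeff (pd p i (h + ?\<theta> * k)) I x = coeff k I x"
      using that by (auto simp: coeff_pd_odd i coeff_coord_mult fr_def simp flip: mult.assoc power_add)
  qed
  have comm: "h * ?\<theta> = ?\<theta> * twist True h" for h
  proof -
    have "eq_on (\<lambda>_. True) UNIV (?\<theta> * twist True h) (twist True (twist True h) * ?\<theta>)"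
      by (rule has_parity_commute) (auto simp: has_parity_def coord_odd i)
    then show ?thesis
      using eq_on_UNIV by (fastforce simp: twist_twist)
  qed
  have sq: "?\<theta> * ?\<theta> = 0"
  proof (rule sfun_eqI)
    fix I x
    show "coeff (?\<theta> * ?\<theta>) I x = coeff 0 I x"
      by (subst coeff_coord_mult[of p i, OF i]) (auto simp: coord_odd i)
  qed
  obtain a b where f: "f = a + ?\<theta> * b" "fr a" "fr b"
    using decomp fr_del fr_pd by blast
  obtain c d where g: "g = c + ?\<theta> * d" "fr c" "fr d"
    using decomp fr_del fr_pd by blast
  have move: "h * (?\<theta> * k) = ?\<theta> * (twist True h * k)" for h k
    by (simp add: comm[of h] flip: mult.assoc)
  have "?\<theta> * b * (?\<theta> * d) = (?\<theta> * ?\<theta>) * (twist True b * d)"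
    by (simp only: mult.assoc move[of b d])
  then have "?\<theta> * b * (?\<theta> * d) = 0"
    by (simp only: sq mult_zero_left)
  moreover note move[of a d]
  ultimately have "f * g = a * c + ?\<theta> * (b * c + twist True a * d)"
    unfolding f g by (simp add: distrib_left distrib_right mult.assoc add_ac)
  then have 1: "pd p i (f * g) = b * c + twist True a * d"
    using pd f g by (simp add: fr_mult fr_add fr_twist)
  have "b * g + twist True f * d = b * c + twist True a * d"
    unfolding f g by (simp add: distrib_left distrib_right left_diff_distrib move[of b d] twist_add twist_mult twist_coord i mult.assoc)
  then show ?thesis
    using 1 pd f g by simp
qed

lemma pd_mult:
  assumes D: "superdomain p D" and fg: "smooth_sfun p D f" "smooth_sfun p D g"
  shows "eq_on p D (pd p i (f * g)) (pd p i f * g + twist (p i) f * pd p i g)"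
proof (cases "p i")
  case True
  then show ?thesis by (simp add: pd_mult_odd)
next
  case False
  show ?thesis
    unfolding eq_on_def
  proof (intro allI impI ballI)
    fix K x assume K: "K \<subseteq> {i. p i}" and x: "x \<in> D"
    have sm: "smooth p D (coeff f I)" "smooth p D (coeff g (K - I))" if "I \<in> Pow K" for I
      by (intro smooth_sfunD[OF fg(1)] smooth_sfunD[OF fg(2)]; use that K in blast)+
    let ?t = "\<lambda>I x. sgn_shuffle I (K - I) * (coeff f I x * coeff g (K - I) x)"
    have "coeff (f * g) K = (\<lambda>x. \<Sum>I\<in>Pow K. ?t I x)"
      by (auto simp: coeff_mult mult.assoc)
    then have "coeff (pd p i (f * g)) K x = partial i (\<lambda>x. \<Sum>I\<in>Pow K. ?t I x) x"
      by (simp add: coeff_pd_even False)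
    also have "\<dots> = (\<Sum>I\<in>Pow K. partial i (?t I) x)"
      by (intro partial_sum[OF D x False] smooth_mult[OF D] smooth_const sm)
    also have "\<dots> = (\<Sum>I\<in>Pow K. sgn_shuffle I (K - I)
        * (coeff f I x * partial i (coeff g (K - I)) x + partial i (coeff f I) x * coeff g (K - I) x))"
    proof (intro sum.cong refl)
      fix I assume I: "I \<in> Pow K"
      show "partial i (?t I) x = sgn_shuffle I (K - I)
        * (coeff f I x * partial i (coeff g (K - I)) x + partial i (coeff f I) x * coeff g (K - I) x)"
        using sm[OF I] by (simp add: partial_cmult[OF D x False] partial_mult[OF D x False]
            smooth_differentiable smooth_mult[OF D])
    qed
    also have "\<dots> = coeff (pd p i f * g + twist (p i) f * pd p i g) K x"
      by (simp add: False coeff_mult coeff_pd_even distrib_left sum.distrib mult.assoc)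
    finally show "coeff (pd p i (f * g)) K x = coeff (pd p i f * g + twist (p i) f * pd p i g) K x" .
  qed
qed

text \<open>Two odd derivatives anticommute because inserting the smaller index raises the number of
  indices below the larger one, and not conversely. Two even ones reduce to
  \<open>partial_commute\<close>; in the mixed case the sign in the odd derivative is a constant
  factor.\<close>

lemma pd_commute:
  assumes D: "superdomain p D" and f: "smooth_sfun p D f"
  shows "eq_on p D (pd p i (pd p j f)) (psign (p i \<and> p j) *\<^sub>R pd p j (pd p i f))"
proof -
  have mixed: "eq_on p D (pd p i (pd p j f)) (pd p j (pd p i f))" if "p i" "\<not> p j" for i j
    unfolding eq_on_def
  proof (intro allI impI ballI)
    fix K x assume K: "K \<subseteq> {i. p i}" and x: "x \<in> D"
    have "smooth p D (coeff f (insert i K))"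
      using f K that by (auto simp: smooth_sfun_def)
    then have "partial j (\<lambda>x. (- 1) ^ card {k \<in> K. k < i} * coeff f (insert i K) x) x
        = (- 1) ^ card {k \<in> K. k < i} * partial j (coeff f (insert i K)) x"
      by (intro partial_cmult[OF D x that(2)] smooth_differentiable)
    moreover have "coeff (pd p i f) K = (if i \<in> K then (\<lambda>_. 0) else (\<lambda>x. (- 1) ^ card {k \<in> K. k < i} * coeff f (insert i K) x))"
      using that by (auto simp: coeff_pd_odd)
    ultimately show "coeff (pd p i (pd p j f)) K x = coeff (pd p j (pd p i f)) K x"
      using that by (simp add: coeff_pd_odd coeff_pd_even)
  qed
  have odd: "pd p i (pd p j f) = - pd p j (pd p i f)" if "p i" "p j" "i < j" for i j
  proof (rule sfun_eqI)
    fix I x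
    have "{k. (k = i \<or> k \<in> I) \<and> k < j} = insert i {k \<in> I. k < j}"
      "{k. (k = j \<or> k \<in> I) \<and> k < i} = {k \<in> I. k < i}"
      using that(3) by auto
    then show "coeff (pd p i (pd p j f)) I x = coeff (- pd p j (pd p i f)) I x"
      using that by (auto simp: coeff_pd_odd insert_commute)
  qed
  consider "p i" "p j" "i < j" | "p i" "p j" "j < i" | "p i" "i = j" | "p i" "\<not> p j"
    | "\<not> p i" "p j" | "\<not> p i" "\<not> p j"
    by (metis linorder_neqE)
  then show ?thesis
  proof cases
    case 1
    then show ?thesis using odd[of i j] by simp
  next
    case 2
    then show ?thesis using odd[of j i] by simp
  next
    case 3
    then have "pd p i (pd p i f) = 0"
      by (intro sfun_eqI) (simp add: coeff_pd_odd)
    then show ?thesis using 3 by simp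
  next
    case 4
    then show ?thesis using mixed[of i j] by simp
  next
    case 5
    then show ?thesis using eq_on_sym[OF mixed[of j i]] by simp
  next
    case 6
    then show ?thesis
      using partial_commute[OF D _ 6 smooth_sfunD[OF f]] by (simp add: eq_on_def coeff_pd_even)
  qed
qed

section \<open>Pullbacks\<close>

lemma sgn_shuffle_singleton: "sgn_shuffle {i} J = (- 1) ^ card {j \<in> J. j < i}"
proof -
  have "card {(i', j). i' \<in> {i} \<and> j \<in> J \<and> j < i'} = card {j \<in> J. j < i}"
    by (rule bij_betw_same_card[of snd]) (auto simp: bij_betw_def inj_on_def image_iff)
  then show ?thesis by (simp only: sgn_shuffle_def)
qed

text \<open>The Taylor expansion in \<open>pullback\<close>, one even coordinate at a time; \<open>N\<close> is the order of truncation.\<close>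

primrec taylor :: "nat \<Rightarrow> ('i \<Rightarrow> 'i sfun) \<Rightarrow> 'i list \<Rightarrow> ('i point \<Rightarrow> real) \<Rightarrow> ('i::{finite,linorder}) sfun" where
  "taylor N \<phi> [] h = scalar_fun (\<lambda>x. h (body \<phi> x))"
| "taylor N \<phi> (i # L) h = (\<Sum>k\<le>N. (1 / fact k) *\<^sub>R (taylor N \<phi> L ((partial i ^^ k) h) * soul \<phi> i ^ k))"

definition odd_prod :: "('i \<Rightarrow> 'i sfun) \<Rightarrow> 'i set \<Rightarrow> ('i::{finite,linorder}) sfun" where
  "odd_prod \<phi> I = prod_list (map \<phi> (sorted_list_of_set I))"

text \<open>Reversed because \<open>taylor\<close> differentiates by the head of the list first and
  multiplies its factor on the right, whereas \<open>index_list\<close> is increasing.\<close>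

definition even_list :: "('i::{finite,linorder} \<Rightarrow> bool) \<Rightarrow> 'i list" where
  "even_list p = rev (filter (\<lambda>i. \<not> p i) (sorted_list_of_set UNIV))"

lemma even_list: "set (even_list p) = {i. \<not> p i}" "distinct (even_list p)"
  by (auto simp: even_list_def)

lemma iter_partial_replicate: "iter_partial (replicate k i) h = (partial i ^^ k) h"
  by (induction k) auto

lemma prod_list_replicate: "prod_list (replicate k a) = a ^ k"
  by (induction k) auto

text \<open>The exponent of the head is split off: \<open>m\<close> corresponds to the pair of
  \<open>m i\<close> and \<open>m(i := 0)\<close>, the factorials factor accordingly, and the
  resulting nested sum is the recursion of \<open>taylor\<close>.\<close>

lemma taylor_sum:
  fixes \<phi> :: "'i::{finite,linorder} \<Rightarrow> 'i sfun"
  assumes "distinct L"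
  shows "(\<Sum>m\<in>{m. (\<forall>i\<in>set L. m i \<le> N) \<and> (\<forall>i. i \<notin> set L \<longrightarrow> m i = 0)}.
      scalar_fun (\<lambda>x. iter_partial (concat (map (\<lambda>i. replicate (m i) i) (rev L))) h (body \<phi> x)
        / (\<Prod>i\<in>UNIV. fact (m i)))
      * prod_list (map (soul \<phi>) (concat (map (\<lambda>i. replicate (m i) i) (rev L))))) = taylor N \<phi> L h"
  using assms
proof (induction L arbitrary: h)
  case Nil
  have "{m :: 'i \<Rightarrow> nat. \<forall>i. m i = 0} = {\<lambda>_. 0}" by auto
  then show ?case by simp
next
  case (Cons i L)
  let ?M = "\<lambda>L. {m :: 'i \<Rightarrow> nat. (\<forall>i\<in>set L. m i \<le> N) \<and> (\<forall>i. i \<notin> set L \<longrightarrow> m i = 0)}"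
  let ?c = "\<lambda>m L. concat (map (\<lambda>i. replicate (m i) i) (rev L))"
  let ?t = "\<lambda>L h m. scalar_fun (\<lambda>x. iter_partial (?c m L) h (body \<phi> x) / (\<Prod>i\<in>UNIV. fact (m i)))
      * prod_list (map (soul \<phi>) (?c m L))"
  define T where "T = ?t (i # L) h"
  have "(\<Sum>m\<in>?M (i # L). T m) = (\<Sum>(k, m)\<in>{..N} \<times> ?M L. T (m(i := k)))"
  proof (rule sum.reindex_bij_witness[of _ "\<lambda>(k, m). m(i := k)" "\<lambda>m. (m i, m(i := 0))"])
    fix km assume "km \<in> {..N} \<times> ?M L"
    then obtain k m where km: "km = (k, m)" "k \<le> N" "m \<in> ?M L" by blast
    then have "m i = 0" using Cons.prems by auto
    then show "(\<lambda>m. (m i, m(i := 0))) ((\<lambda>(k, m). m(i := k)) km) = km"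
      using km by auto
  qed auto
  also have "\<dots> = (\<Sum>k\<le>N. \<Sum>m\<in>?M L. T (m(i := k)))"
    by (rule sum.cartesian_product[symmetric])
  also have "\<dots> = (\<Sum>k\<le>N. (1 / fact k) *\<^sub>R ((\<Sum>m\<in>?M L. ?t L ((partial i ^^ k) h) m) * soul \<phi> i ^ k))"
    unfolding sum_distrib_right scaleR_sum_right
  proof (intro sum.cong refl)
    fix k m assume m: "m \<in> ?M L"
    have i: "i \<notin> set L" "m i = 0" using Cons.prems m by auto
    have c: "?c (m(i := k)) (i # L) = ?c m L @ replicate k i"
      using i by (auto intro!: arg_cong[of _ _ concat] map_cong)
    have "(\<Prod>j\<in>UNIV. fact ((m(i := k)) j)) = (fact k * (\<Prod>j\<in>UNIV - {i}. fact (m j)) :: real)"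
      by (subst prod.remove[of _ i]) (auto intro!: prod.cong)
    also have "(\<Prod>j\<in>UNIV - {i}. fact (m j)) = (\<Prod>j\<in>UNIV. fact (m j) :: real)"
      by (subst (2) prod.remove[of _ i]) (auto simp: i)
    finally have f: "(\<Prod>j\<in>UNIV. fact ((m(i := k)) j)) = (fact k * (\<Prod>j\<in>UNIV. fact (m j)) :: real)" .
    have s: "scalar_fun (\<lambda>x. a x / (fact k * b)) = (1 / fact k) *\<^sub>R scalar_fun (\<lambda>x. a x / b)"
      for a :: "'i point \<Rightarrow> real" and b
      by (rule sfun_eqI) (simp add: coeff_scalar_fun)
    show "T (m(i := k)) = (1 / fact k) *\<^sub>R (?t L ((partial i ^^ k) h) m * soul \<phi> i ^ k)"
      unfolding T_def c f iter_partial_append iter_partial_replicate s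
      by (simp add: prod_list_replicate mult.assoc)
  qed
  also have "\<dots> = taylor N \<phi> (i # L) h"
    using Cons by simp
  finally show ?case by (simp only: T_def)
qed

text \<open>In \<open>pullback\<close> the exponents of odd coordinates are 0, so these coordinates
  may be dropped from the list, and \<open>taylor_sum\<close> applies for each odd index
  set.\<close>

lemma pullback_taylor:
  fixes \<phi> :: "'i::{finite,linorder} \<Rightarrow> 'i sfun"
  shows "pullback p \<phi> f = (\<Sum>I\<in>Pow {i. p i}. taylor CARD('i) \<phi> (even_list p) (coeff f I) * odd_prod \<phi> I)"
proof -
  have idx: "index_list m = concat (map (\<lambda>i. replicate (m i) i) (rev (even_list p)))"
    if "\<And>i. p i \<Longrightarrow> m i = 0" for m :: "'i \<Rightarrow> nat"
  proof -
    have "concat (map (\<lambda>i. replicate (m i) i) xs) = concat (map (\<lambda>i. replicate (m i) i) (filter (\<lambda>i. \<not> p i) xs))" for xs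
      using that by (induction xs) auto
    then show ?thesis by (simp add: index_list_def even_list_def)
  qed
  have M: "{m. \<forall>i. m i \<le> CARD('i) \<and> (p i \<longrightarrow> m i = 0)}
      = {m. (\<forall>i\<in>set (even_list p). m i \<le> CARD('i)) \<and> (\<forall>i. i \<notin> set (even_list p) \<longrightarrow> m i = 0)}"
    unfolding even_list by (rule Collect_cong) (metis mem_Collect_eq le0)
  show ?thesis
    unfolding pullback_def M taylor_sum[OF even_list(2), symmetric] sum_distrib_right odd_prod_def
    by (intro sum.cong refl arg_cong2[of _ _ _ _ "(*)"] arg_cong[of _ _ prod_list] arg_cong[of _ _ "map _"]
        arg_cong[of _ _ scalar_fun] ext) (simp_all add: idx even_list)
qed

lemma scalar_fun_const [simp]: "scalar_fun (\<lambda>_. 0) = 0" "scalar_fun (\<lambda>_. 1) = 1"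
  by (auto intro!: sfun_eqI simp: coeff_scalar_fun coeff_one)

lemma pd_scalar_fun: "pd p i (scalar_fun h) = (if p i then 0 else scalar_fun (partial i h))"
  by (rule sfun_eqI) (auto simp: coeff_pd_odd coeff_pd_even coeff_scalar_fun scalar_fun_def)

lemma pd_one [simp]: "pd p i 1 = 0"
  using pd_scalar_fun[of p i "\<lambda>_. 1"] by (cases "p i") (auto intro!: sfun_eqI simp: coeff_scalar_fun)

lemma odd_prod_empty [simp]: "odd_prod \<phi> {} = 1"
  by (simp add: odd_prod_def)

lemma odd_prod_insert_min: "(\<And>j. j \<in> I \<Longrightarrow> i < j) \<Longrightarrow> odd_prod \<phi> (insert i I) = \<phi> i * odd_prod \<phi> I"
proof -
  assume *: "\<And>j. j \<in> I \<Longrightarrow> i < j"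
  then have "i \<notin> I" by blast
  then have "sorted_list_of_set (insert i I) = insort i (sorted_list_of_set I)"
    by (simp add: sorted_list_of_set_insert)
  also have "\<dots> = i # sorted_list_of_set I"
    using * by (intro insort_is_Cons) (auto simp: less_imp_le)
  finally show ?thesis by (simp add: odd_prod_def)
qed

text \<open>The filtration by powers of the ideal generated by the odd coordinates. Orders add under
  products, and an order above \<open>CARD('i)\<close> forces zero.\<close>

definition nil_order :: "('i::{finite,linorder} \<Rightarrow> bool) \<Rightarrow> 'i point set \<Rightarrow> nat \<Rightarrow> 'i sfun \<Rightarrow> bool" where
  "nil_order p D n f \<longleftrightarrow> (\<forall>I \<subseteq> {i. p i}. \<forall>x\<in>D. card I < n \<longrightarrow> coeff f I x = 0)"

lemma nil_order_mult:
  assumes "nil_order p D m f" "nil_order p D n g"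
  shows "nil_order p D (m + n) (f * g)"
  unfolding nil_order_def coeff_mult
proof (intro allI impI ballI sum.neutral)
  fix K J x assume K: "K \<subseteq> {i. p i}" "x \<in> D" "card K < m + n" "J \<in> Pow K"
  then have "card J + card (K - J) = card K"
    by (simp add: card_Diff_subset card_mono)
  then have "card J < m \<or> card (K - J) < n" using K by linarith
  moreover have "J \<subseteq> {i. p i}" "K - J \<subseteq> {i. p i}" using K by auto
  ultimately show "sgn_shuffle J (K - J) * coeff f J x * coeff g (K - J) x = 0"
    using assms K(2) unfolding nil_order_def by auto
qed

lemma nil_order_power: "nil_order p D m f \<Longrightarrow> nil_order p D (n * m) (f ^ n)"
  by (induction n) (auto simp: nil_order_def[of _ _ 0] intro: nil_order_mult)

lemma nil_order_zero:
  fixes f :: "'i::{finite,linorder} sfun"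
  assumes "nil_order p D n f" "n > CARD('i)"
  shows "eq_on p D f 0"
proof -
  have "card I < n" for I :: "'i set"
    using card_mono[of UNIV I] assms(2) by simp
  then show ?thesis using assms(1) by (simp add: eq_on_def nil_order_def)
qed

lemma partial_funpow_cong:
  assumes "superdomain p D" "\<not> p i" "\<And>y. y \<in> D \<Longrightarrow> h y = g y" "x \<in> D"
  shows "(partial i ^^ k) h x = (partial i ^^ k) g x"
  using assms(4) by (induction k arbitrary: x) (auto simp: assms(3) intro: partial_cong[OF assms(1) _ assms(2)])

lemma partial_funpow_commute:
  assumes D: "superdomain p D" and ij: "\<not> p i" "\<not> p j" and h: "smooth p D h"
  shows "x \<in> D \<Longrightarrow> partial j ((partial i ^^ k) h) x = (partial i ^^ k) (partial j h) x"
proof (induction k arbitrary: x)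
  case (Suc k)
  have "partial j (partial i ((partial i ^^ k) h)) x = partial i (partial j ((partial i ^^ k) h)) x"
    by (rule partial_commute[OF D Suc.prems ij(2,1) smooth_funpow_partial[OF h ij(1)]])
  also have "\<dots> = partial i ((partial i ^^ k) (partial j h)) x"
    by (rule partial_cong[OF D Suc.prems ij(1) Suc.IH])
  finally show ?case by simp
qed simp

text \<open>Pascal's rule, isolated from the induction step of the Leibniz rule
  \<open>partial_funpow_mult\<close>.\<close>

lemma binomial_convolution:
  fixes X :: "nat \<Rightarrow> nat \<Rightarrow> real"
  shows "(\<Sum>j\<le>k. real (k choose j) * X (Suc j) (k - j)) + (\<Sum>j\<le>k. real (k choose j) * X j (Suc (k - j)))
    = (\<Sum>j\<le>Suc k. real (Suc k choose j) * X j (Suc k - j))"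
proof -
  have "(\<Sum>j\<le>k. real (k choose j) * X j (Suc (k - j))) = (\<Sum>j\<le>Suc k. real (k choose j) * X j (Suc k - j))"
    by (simp add: Suc_diff_le)
  also have "\<dots> = X 0 (Suc k) + (\<Sum>j\<le>k. real (k choose Suc j) * X (Suc j) (k - j))"
    by (subst sum.atMost_Suc_shift) simp
  finally show ?thesis
    using sum.atMost_Suc_shift[of "\<lambda>j. real (Suc k choose j) * X j (Suc k - j)" k]
    by (simp add: distrib_right sum.distrib)
qed

lemma partial_funpow_mult:
  assumes D: "superdomain p D" and i: "\<not> p i" and gh: "smooth p D g" "smooth p D h"
  shows "x \<in> D \<Longrightarrow> (partial i ^^ k) (\<lambda>x. g x * h x) x
    = (\<Sum>j\<le>k. real (k choose j) * ((partial i ^^ j) g x * (partial i ^^ (k - j)) h x))"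
proof (induction k arbitrary: x)
  case (Suc k)
  let ?g = "\<lambda>j. (partial i ^^ j) g" and ?h = "\<lambda>j. (partial i ^^ j) h"
  note sm = smooth_funpow_partial[OF gh(1) i] smooth_funpow_partial[OF gh(2) i]
  have "(partial i ^^ Suc k) (\<lambda>x. g x * h x) x
      = partial i (\<lambda>x. \<Sum>j\<le>k. real (k choose j) * (?g j x * ?h (k - j) x)) x"
    using partial_cong[OF D Suc.prems i Suc.IH] by simp
  also have "\<dots> = (\<Sum>j\<le>k. partial i (\<lambda>x. real (k choose j) * (?g j x * ?h (k - j) x)) x)"
    by (intro partial_sum[OF D Suc.prems i] smooth_cmult smooth_mult sm D)
  also have "\<dots> = (\<Sum>j\<le>k. real (k choose j) * (?g j x * ?h (Suc (k - j)) x + ?g (Suc j) x * ?h (k - j) x))"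
    by (intro sum.cong refl) (simp add: partial_cmult[OF D Suc.prems i] partial_mult[OF D Suc.prems i]
        smooth_differentiable[of p D] smooth_mult[OF D] sm)
  also have "\<dots> = (\<Sum>j\<le>k. real (k choose j) * (?g (Suc j) x * ?h (k - j) x))
      + (\<Sum>j\<le>k. real (k choose j) * (?g j x * ?h (Suc (k - j)) x))"
    by (simp add: distrib_left sum.distrib add.commute)
  also have "\<dots> = (\<Sum>j\<le>Suc k. real (Suc k choose j) * (?g j x * ?h (Suc k - j) x))"
    by (rule binomial_convolution)
  finally show ?case .
qed simp

text \<open>A substitution between two superdomains with the same index type and parities, as the
  coordinate changes between charts of one atlas are.\<close>

locale morphism =
  fixes p :: "'i::{finite,linorder} \<Rightarrow> bool" and D D' :: "'i point set" and \<phi> :: "'i \<Rightarrow> 'i sfun"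
  assumes D: "superdomain p D" and D': "superdomain p D'"
    and smooth_phi: "smooth_sfun p D (\<phi> i)"
    and parity_phi: "has_parity p D (p i) (\<phi> i)"
    and body_phi: "x \<in> D \<Longrightarrow> body \<phi> x \<in> D'"
begin

lemma smooth_body: "smooth p D (\<lambda>x. body \<phi> x $ j)"
  using smooth_sfunD[OF smooth_phi, of "{}" j] by (simp add: body_def)

lemma smooth_compose_body: "smooth p D' h \<Longrightarrow> smooth p D (\<lambda>x. h (body \<phi> x))"
  using smooth_compose[OF D D' smooth_body body_phi] .

lemma soul_parity: "\<not> p i \<Longrightarrow> has_parity p D False (soul \<phi> i)"
  using has_parity_diff[of p D False "\<phi> i"] parity_phi[of i] by (simp add: soul_def)

lemma soul_smooth: "smooth_sfun p D (soul \<phi> i)"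
  unfolding soul_def
  by (intro smooth_sfun_diff[OF D] smooth_phi smooth_sfun_scalar_fun[OF D] smooth_sfunD[OF smooth_phi]) simp

text \<open>The body has been subtracted, and an even function has no terms with an odd number of
  odd coordinates, so its terms start at two.\<close>

lemma soul_nil_order: "\<not> p i \<Longrightarrow> nil_order p D 2 (soul \<phi> i)"
  unfolding nil_order_def
proof (intro allI impI ballI)
  fix I x assume "\<not> p i" and I: "I \<subseteq> {i. p i}" "x \<in> D" "card I < 2"
  show "coeff (soul \<phi> i) I x = 0"
  proof (cases "I = {}")
    case True
    then show ?thesis by (simp add: soul_def coeff_scalar_fun)
  next
    case False
    then have "card I = 1" using I(3) by (metis card_0_eq finite less_2_cases One_nat_def)
    then show ?thesis using soul_parity[OF \<open>\<not> p i\<close>] I by (auto simp: has_parity_def)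
  qed
qed

text \<open>The \<open>k\<close>-th power has order \<open>2 * k\<close>, which exceeds
  \<open>CARD('i)\<close> already for \<open>k = CARD('i)\<close>. This off-by-one lets the chain
  rule discard the top term of a series truncated at \<open>N \<ge> CARD('i)\<close>.\<close>

lemma soul_power_zero: "\<not> p i \<Longrightarrow> k \<ge> CARD('i) \<Longrightarrow> eq_on p D (soul \<phi> i ^ k) 0"
proof (rule nil_order_zero)
  assume "\<not> p i" "k \<ge> CARD('i)"
  then show "nil_order p D (k * 2) (soul \<phi> i ^ k)"
    by (intro nil_order_power soul_nil_order)
  have "CARD('i) > 0" by (simp add: zero_less_card_finite)
  then show "CARD('i) < k * 2" using \<open>k \<ge> CARD('i)\<close> by linarith
qed

section \<open>The Taylor part of a pullback: multiplicativity and chain rule\<close>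

context
  fixes N :: nat
begin

lemma taylor_parity: "set L \<subseteq> {i. \<not> p i} \<Longrightarrow> has_parity p D False (taylor N \<phi> L h)"
  by (induction L arbitrary: h)
     (auto intro!: has_parity_sum has_parity_scaleR has_parity_mult'[of _ _ False _ False] has_parity_power soul_parity)

lemma taylor_smooth: "set L \<subseteq> {i. \<not> p i} \<Longrightarrow> smooth p D' h \<Longrightarrow> smooth_sfun p D (taylor N \<phi> L h)"
proof (induction L arbitrary: h)
  case (Cons i L)
  then show ?case
    by (auto intro!: smooth_sfun_sum[OF D] smooth_sfun_scaleR[OF D] smooth_sfun_mult[OF D]
        smooth_sfun_power[OF D] soul_smooth smooth_funpow_partial)
qed (simp add: smooth_sfun_scalar_fun[OF D] smooth_compose_body)

lemma taylor_cong:
  "set L \<subseteq> {i. \<not> p i} \<Longrightarrow> (\<And>y. y \<in> D' \<Longrightarrow> h y = g y) \<Longrightarrow> eq_on p D (taylor N \<phi> L h) (taylor N \<phi> L g)"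
proof (induction L arbitrary: h g)
  case (Cons i L)
  have "eq_on p D (taylor N \<phi> L ((partial i ^^ k) h)) (taylor N \<phi> L ((partial i ^^ k) g))" for k
    using Cons.prems by (intro Cons.IH partial_funpow_cong[OF D']) auto
  then show ?case
    by (auto intro!: eq_on_sum eq_on_scaleR eq_on_mult)
qed (auto simp: eq_on_def coeff_scalar_fun body_phi)

lemma partial_funpow_const [simp]: "(partial i ^^ k) (\<lambda>_. c) = (if k = 0 then (\<lambda>_. c) else (\<lambda>_. 0))"
  by (induction k) auto

lemma taylor_const [simp]: "taylor N \<phi> L (\<lambda>_. c) = scalar_fun (\<lambda>_. c)"
proof (induction L arbitrary: c)
  case (Cons i L)
  have "(1 / fact k) *\<^sub>R (taylor N \<phi> L ((partial i ^^ k) (\<lambda>_. c)) * soul \<phi> i ^ k)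
      = (if k = 0 then scalar_fun (\<lambda>_. c) else 0)" for k
    by (cases "k = 0") (simp_all add: Cons)
  then have "taylor N \<phi> (i # L) (\<lambda>_. c) = (\<Sum>k\<le>N. if k = 0 then scalar_fun (\<lambda>_. c) else 0)"
    by (simp only: taylor.simps)
  then show ?case by simp
qed simp

lemma taylor_add:
  assumes "set L \<subseteq> {i. \<not> p i}" "smooth p D' h" "smooth p D' g"
  shows "eq_on p D (taylor N \<phi> L (\<lambda>x. h x + g x)) (taylor N \<phi> L h + taylor N \<phi> L g)"
  using assms
proof (induction L arbitrary: h g)
  case (Cons i L)
  let ?d = "\<lambda>k. (partial i ^^ k)"
  have i: "\<not> p i" and L: "set L \<subseteq> {i. \<not> p i}" using Cons.prems by auto
  note sm = smooth_funpow_partial[OF Cons.prems(2) i] smooth_funpow_partial[OF Cons.prems(3) i]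
  have d: "x \<in> D' \<Longrightarrow> ?d k (\<lambda>x. h x + g x) x = ?d k h x + ?d k g x" for k x
  proof (induction k arbitrary: x)
    case (Suc k)
    then show ?case
      using partial_cong[OF D' Suc.prems i, of "?d k (\<lambda>x. h x + g x)" "\<lambda>x. ?d k h x + ?d k g x"]
        partial_add[OF D' Suc.prems i, of "?d k h" "?d k g"] sm
      by (simp add: smooth_differentiable[of p D'])
  qed simp
  have "eq_on p D (taylor N \<phi> L (?d k (\<lambda>x. h x + g x))) (taylor N \<phi> L (?d k h) + taylor N \<phi> L (?d k g))" for k
    using taylor_cong[OF L d] Cons.IH[OF L sm] by (rule eq_on_trans)
  then show ?case
    by (simp add: eq_on_trunc trunc_simps distrib_right scaleR_add_right sum.distrib)
qed (auto simp: eq_on_def coeff_scalar_fun)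

lemma taylor_cmult:
  assumes "set L \<subseteq> {i. \<not> p i}" "smooth p D' h"
  shows "eq_on p D (taylor N \<phi> L (\<lambda>x. c * h x)) (c *\<^sub>R taylor N \<phi> L h)"
  using assms
proof (induction L arbitrary: h)
  case (Cons i L)
  let ?d = "\<lambda>k. (partial i ^^ k)"
  have i: "\<not> p i" and L: "set L \<subseteq> {i. \<not> p i}" using Cons.prems by auto
  note sm = smooth_funpow_partial[OF Cons.prems(2) i]
  have d: "x \<in> D' \<Longrightarrow> ?d k (\<lambda>x. c * h x) x = c * ?d k h x" for k x
  proof (induction k arbitrary: x)
    case (Suc k)
    then show ?case
      using partial_cong[OF D' Suc.prems i, of "?d k (\<lambda>x. c * h x)" "\<lambda>x. c * ?d k h x"]
        partial_cmult[OF D' Suc.prems i, of "?d k h"] sm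
      by (simp add: smooth_differentiable[of p D'])
  qed simp
  have "eq_on p D (taylor N \<phi> L (?d k (\<lambda>x. c * h x))) (c *\<^sub>R taylor N \<phi> L (?d k h))" for k
    using taylor_cong[OF L d] Cons.IH[OF L sm] by (rule eq_on_trans)
  then show ?case
    by (simp add: eq_on_trunc trunc_simps scaleR_sum_right mult.commute)
qed (auto simp: eq_on_def coeff_scalar_fun)

lemma taylor_sum_fun:
  assumes "set L \<subseteq> {i. \<not> p i}" "\<And>a. a \<in> A \<Longrightarrow> smooth p D' (h a)"
  shows "eq_on p D (taylor N \<phi> L (\<lambda>x. \<Sum>a\<in>A. h a x)) (\<Sum>a\<in>A. taylor N \<phi> L (h a))"
  using assms(2)
proof (induction A rule: infinite_finite_induct)
  case (insert a A)
  have "eq_on p D (taylor N \<phi> L (\<lambda>x. h a x + (\<Sum>a\<in>A. h a x)))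
      (taylor N \<phi> L (h a) + taylor N \<phi> L (\<lambda>x. \<Sum>a\<in>A. h a x))"
    by (intro taylor_add assms(1) smooth_sum D') (auto simp: insert)
  also have "eq_on p D \<dots> (taylor N \<phi> L (h a) + (\<Sum>a\<in>A. taylor N \<phi> L (h a)))"
    by (intro eq_on_add eq_on_refl insert.IH) (auto simp: insert)
  finally show ?case using insert(1,2) by simp
qed (auto simp: taylor_const eq_on_def coeff_scalar_fun)

text \<open>The truncated form of exp(\<sigma>\<partial>)(gh) = exp(\<sigma>\<partial>)(g)
  exp(\<sigma>\<partial>)(h). The Leibniz rule gives a sum over the triangle
  \<open>j + l \<le> N\<close>, the product of the two series a sum over a square; the extra terms
  contain \<open>soul \<phi> i ^ (j + l)\<close> with \<open>j + l > N\<close> and vanish.\<close>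

lemma taylor_mult:
  assumes N: "N \<ge> CARD('i)"
  assumes "set L \<subseteq> {i. \<not> p i}" "smooth p D' g" "smooth p D' h"
  shows "eq_on p D (taylor N \<phi> L (\<lambda>x. g x * h x)) (taylor N \<phi> L g * taylor N \<phi> L h)"
  using assms(2-)
proof (induction L arbitrary: h g)
  case (Cons i L)
  let ?d = "\<lambda>k. (partial i ^^ k)" and ?s = "soul \<phi> i" and ?U = "taylor N \<phi> L" and ?t = "trunc p D"
  have i: "\<not> p i" and L: "set L \<subseteq> {i. \<not> p i}" using Cons.prems by auto
  note sm = smooth_funpow_partial[OF Cons.prems(2) i] smooth_funpow_partial[OF Cons.prems(3) i]
  have U: "?t (?U (?d k (\<lambda>x. g x * h x)))
      = (\<Sum>j\<le>k. real (k choose j) *\<^sub>R (?t (?U (?d j g)) * ?t (?U (?d (k - j) h))))" for k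
  proof -
    have "eq_on p D (?U (?d k (\<lambda>x. g x * h x)))
        (?U (\<lambda>x. \<Sum>j\<le>k. real (k choose j) * (?d j g x * ?d (k - j) h x)))"
      by (intro taylor_cong L partial_funpow_mult[OF D' i] Cons.prems)
    also have "eq_on p D \<dots> (\<Sum>j\<le>k. ?U (\<lambda>x. real (k choose j) * (?d j g x * ?d (k - j) h x)))"
      by (intro taylor_sum_fun L smooth_cmult smooth_mult D' sm)
    also have "eq_on p D \<dots> (\<Sum>j\<le>k. real (k choose j) *\<^sub>R ?U (\<lambda>x. ?d j g x * ?d (k - j) h x))"
      by (intro eq_on_sum taylor_cmult L smooth_mult D' sm)
    also have "eq_on p D \<dots> (\<Sum>j\<le>k. real (k choose j) *\<^sub>R (?U (?d j g) * ?U (?d (k - j) h)))"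
      by (intro eq_on_sum eq_on_scaleR Cons.IH L sm)
    finally show ?thesis by (simp add: eq_on_trunc trunc_simps)
  qed
  \<comment> \<open>The common summand of both sums: \<open>1 / fact k\<close> and
    \<open>k choose j\<close> combine to \<open>1 / (fact j * fact (k - j))\<close>.\<close>
  define F where "F = (\<lambda>j l. (1 / (fact j * fact l)) *\<^sub>R (?t (?U (?d j g)) * ?t (?U (?d l h)) * ?t (?s ^ (j + l))))"
  have "?t (taylor N \<phi> (i # L) (\<lambda>x. g x * h x))
      = (\<Sum>k\<le>N. \<Sum>j\<le>k. (1 / fact k) *\<^sub>R real (k choose j) *\<^sub>R (?t (?U (?d j g)) * ?t (?U (?d (k - j) h)) * ?t (?s ^ k)))"
    by (simp add: trunc_simps U scaleR_sum_right sum_distrib_right)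
  also have "\<dots> = (\<Sum>k\<le>N. \<Sum>j\<le>k. F j (k - j))"
    by (intro sum.cong refl) (simp add: F_def binomial_fact)
  also have "\<dots> = (\<Sum>(j, l)\<in>{(j, l). j + l \<le> N}. F j l)"
    by (rule sum.triangle_reindex_eq[symmetric])
  also have "\<dots> = (\<Sum>(j, l)\<in>{..N} \<times> {..N}. F j l)"
  proof (rule sum.mono_neutral_left)
    show "\<forall>jl\<in>{..N} \<times> {..N} - {(j, l). j + l \<le> N}. (case jl of (j, l) \<Rightarrow> F j l) = 0"
    proof
      fix jl assume "jl \<in> {..N} \<times> {..N} - {(j, l). j + l \<le> N}"
      then obtain j l where jl: "jl = (j, l)" "\<not> j + l \<le> N" by blast
      then have "?t (?s ^ (j + l)) = 0"
        using soul_power_zero[OF i, of "j + l"] N by (simp add: eq_on_trunc)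
      then show "(case jl of (j, l) \<Rightarrow> F j l) = 0" by (simp add: F_def jl(1))
    qed
  qed auto
  also have "\<dots> = (\<Sum>j\<le>N. \<Sum>l\<le>N. F j l)"
    by (rule sum.cartesian_product[symmetric])
  also have "\<dots> = (\<Sum>j\<le>N. \<Sum>l\<le>N. ((1 / fact j) *\<^sub>R (?t (?U (?d j g)) * ?t (?s ^ j)))
      * ((1 / fact l) *\<^sub>R (?t (?U (?d l h)) * ?t (?s ^ l))))"
  proof (intro sum.cong refl)
    fix j l
    have "?t (?s ^ j) * ?t (?U (?d l h)) = ?t (?U (?d l h)) * ?t (?s ^ j)"
      using even_commute[OF has_parity_power[OF soul_parity[OF i]], of j "?U (?d l h)"]
      by (simp add: eq_on_trunc trunc_simps)
    then have "?t (?U (?d j g)) * ?t (?s ^ j) * (?t (?U (?d l h)) * ?t (?s ^ l))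
        = ?t (?U (?d j g)) * ?t (?U (?d l h)) * (?t (?s ^ j) * ?t (?s ^ l))"
      by (simp add: mult.assoc) (simp flip: mult.assoc)
    also have "?t (?s ^ j) * ?t (?s ^ l) = ?t (?s ^ (j + l))"
      by (simp add: power_add trunc_mult)
    finally show "F j l = ((1 / fact j) *\<^sub>R (?t (?U (?d j g)) * ?t (?s ^ j)))
      * ((1 / fact l) *\<^sub>R (?t (?U (?d l h)) * ?t (?s ^ l)))"
      by (simp add: F_def)
  qed
  also have "\<dots> = ?t (taylor N \<phi> (i # L) g * taylor N \<phi> (i # L) h)"
    by (simp add: trunc_simps sum_product)
  finally show ?case
    by (simp only: eq_on_trunc)
qed (auto simp: eq_on_def coeff_scalar_fun)

lemma pd_power:
  assumes "smooth_sfun p D f" "has_parity p D False f"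
  shows "eq_on p D (pd p i (f ^ k)) (real k *\<^sub>R (pd p i f * f ^ (k - 1)))"
proof (induction k)
  case 0
  show ?case by simp
next
  case (Suc k)
  let ?t = "trunc p D"
  have "?t (twist (p i) f) = ?t f"
    using has_parity_twist[OF assms(2), of "p i"] by (simp add: eq_on_trunc)
  moreover have "?t f * ?t (pd p i f) = ?t (pd p i f) * ?t f"
    using even_commute[OF assms(2)] by (simp add: eq_on_trunc trunc_mult)
  moreover have "?t (pd p i (f * f ^ k)) = ?t (pd p i f * f ^ k + twist (p i) f * pd p i (f ^ k))"
    using pd_mult[OF D assms(1) smooth_sfun_power[OF D assms(1)]] by (simp only: eq_on_trunc)
  ultimately have "?t (pd p i (f * f ^ k)) = ?t (pd p i f) * ?t (f ^ k)
      + real k *\<^sub>R (?t (pd p i f) * (?t f * ?t (f ^ (k - 1))))"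
    using Suc by (simp add: eq_on_trunc trunc_simps) (simp flip: mult.assoc)
  also have "real k *\<^sub>R (?t (pd p i f) * (?t f * ?t (f ^ (k - 1)))) = real k *\<^sub>R (?t (pd p i f) * ?t (f ^ k))"
    by (cases k) (simp_all add: trunc_mult)
  finally show ?case
    by (simp add: eq_on_trunc trunc_simps algebra_simps)
qed

text \<open>The induction runs over the coordinates already expanded. For \<open>j\<close> outside
  \<open>L\<close> only the body of \<open>\<phi> j\<close> has been substituted, so only the body
  is differentiated; expanding \<open>i0\<close> adds the derivative of its soul and so completes
  the body to \<open>\<phi> i0\<close>. The empty list is the ordinary chain rule for the body
  map.\<close>

lemma taylor_chain:
  assumes N: "N \<ge> CARD('i)"
  assumes "set L \<subseteq> {i. \<not> p i}" "distinct L" "smooth p D' h"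
  shows "eq_on p D (pd p i (taylor N \<phi> L h))
    (\<Sum>j\<in>{j. \<not> p j}. pd p i (if j \<in> set L then \<phi> j else scalar_fun (coeff (\<phi> j) {})) * taylor N \<phi> L (partial j h))"
  using assms(2-)
proof (induction L arbitrary: h)
  case Nil
  show ?case
  proof (cases "p i")
    case True
    then show ?thesis by (simp add: pd_scalar_fun)
  next
    case False
    then show ?thesis
      using partial_compose[OF D _ False D' smooth_differentiable[OF smooth_body] body_phi smooth_differentiable[OF Nil(3)]]
      by (auto simp: eq_on_def pd_scalar_fun coeff_scalar_fun body_def)
  qed
next
  case (Cons i0 L)
  let ?d = "\<lambda>k. (partial i0 ^^ k)" and ?s = "soul \<phi> i0" and ?U = "taylor N \<phi> L" and ?t = "trunc p D"
  let ?V = "taylor N \<phi> (i0 # L)" and ?E = "{j. \<not> p j}"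
  let ?xi = "\<lambda>j. if j \<in> set L then \<phi> j else scalar_fun (coeff (\<phi> j) {})"
  have i0: "\<not> p i0" "i0 \<notin> set L" and L: "set L \<subseteq> {i. \<not> p i}" "distinct L" using Cons.prems by auto
  note sm = smooth_funpow_partial[OF Cons.prems(3) i0(1)]
  note smU = taylor_smooth[OF L(1)]
  have V: "?t (?V h) = (\<Sum>k\<le>N. (1 / fact k) *\<^sub>R (?t (?U (?d k h)) * ?t (?s ^ k)))" for h
    by (simp add: trunc_simps)
  have UC: "?t (?U h) * ?t g = ?t g * ?t (?U h)" for h g
    using even_commute[OF taylor_parity[OF L(1)]] by (simp add: eq_on_trunc trunc_mult)
  have UT: "?t (twist b (?U h)) = ?t (?U h)" for b h
    using has_parity_twist[OF taylor_parity[OF L(1)], of b] by (simp add: eq_on_trunc)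
  have IH: "?t (pd p i (?U (?d k h))) = (\<Sum>j\<in>?E. ?t (pd p i (?xi j)) * ?t (?U (?d k (partial j h))))" for k
  proof -
    have "?t (pd p i (?U (?d k h))) = (\<Sum>j\<in>?E. ?t (pd p i (?xi j)) * ?t (?U (partial j (?d k h))))"
      using Cons.IH[OF L sm] by (simp add: eq_on_trunc trunc_simps)
    moreover have "?t (?U (partial j (?d k h))) = ?t (?U (?d k (partial j h)))" if "j \<in> ?E" for j
      using taylor_cong[OF L(1) partial_funpow_commute[OF D' i0(1) _ Cons.prems(3)]] that
      by (simp add: eq_on_trunc)
    ultimately show ?thesis by simp
  qed
  have "?t (pd p i (?V h)) = (\<Sum>k\<le>N. ?t (pd p i ((1 / fact k) *\<^sub>R (?U (?d k h) * ?s ^ k))))"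
    unfolding taylor.simps trunc_sum[symmetric] eq_on_trunc[symmetric]
    by (intro pd_sum[OF D] smooth_sfun_scaleR[OF D] smooth_sfun_mult[OF D] smU sm smooth_sfun_power[OF D] soul_smooth)
  also have "\<dots> = (\<Sum>k\<le>N. (1 / fact k) *\<^sub>R ?t (pd p i (?U (?d k h) * ?s ^ k)))"
    unfolding trunc_scaleR[symmetric]
    by (intro sum.cong refl pd_scaleR[OF D, unfolded eq_on_trunc] smooth_sfun_mult[OF D] smU sm smooth_sfun_power[OF D] soul_smooth)
  also have "\<dots> = (\<Sum>k\<le>N. (1 / fact k) *\<^sub>R (?t (pd p i (?U (?d k h))) * ?t (?s ^ k)
      + ?t (pd p i ?s) * (real k *\<^sub>R (?t (?U (?d k h)) * ?t (?s ^ (k - 1))))))"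
  proof (intro sum.cong refl arg_cong[of _ _ "\<lambda>z. _ *\<^sub>R z"])
    fix k
    have "?t (pd p i (?U (?d k h) * ?s ^ k))
        = ?t (pd p i (?U (?d k h)) * ?s ^ k + twist (p i) (?U (?d k h)) * pd p i (?s ^ k))"
      using pd_mult[OF D smU[OF sm] smooth_sfun_power[OF D soul_smooth]] by (simp only: eq_on_trunc)
    also have "\<dots> = ?t (pd p i (?U (?d k h))) * ?t (?s ^ k)
      + ?t (?U (?d k h)) * (real k *\<^sub>R (?t (pd p i ?s) * ?t (?s ^ (k - 1))))"
      using pd_power[OF soul_smooth soul_parity[OF i0(1)], of i k]
      by (simp add: eq_on_trunc trunc_simps UT)
    also have "?t (?U (?d k h)) * (real k *\<^sub>R (?t (pd p i ?s) * ?t (?s ^ (k - 1))))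
        = ?t (pd p i ?s) * (real k *\<^sub>R (?t (?U (?d k h)) * ?t (?s ^ (k - 1))))"
      using UC[of "?d k h" "pd p i ?s"] by (simp flip: mult.assoc)
    finally show "?t (pd p i (?U (?d k h) * ?s ^ k)) = ?t (pd p i (?U (?d k h))) * ?t (?s ^ k)
      + ?t (pd p i ?s) * (real k *\<^sub>R (?t (?U (?d k h)) * ?t (?s ^ (k - 1))))" .
  qed
  also have "\<dots> = (\<Sum>k\<le>N. (1 / fact k) *\<^sub>R (?t (pd p i (?U (?d k h))) * ?t (?s ^ k)))
      + ?t (pd p i ?s) * (\<Sum>k\<le>N. (real k / fact k) *\<^sub>R (?t (?U (?d k h)) * ?t (?s ^ (k - 1))))"
    by (simp add: scaleR_add_right sum.distrib sum_distrib_left)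
  also have "(\<Sum>k\<le>N. (1 / fact k) *\<^sub>R (?t (pd p i (?U (?d k h))) * ?t (?s ^ k)))
      = (\<Sum>j\<in>?E. ?t (pd p i (?xi j)) * ?t (?V (partial j h)))"
    unfolding IH V sum_distrib_right sum_distrib_left scaleR_sum_right
    by (subst sum.swap) (simp add: mult.assoc)
  \<comment> \<open>Differentiating the power of the soul lowers its exponent by one, and one of the
    derivatives of \<open>h\<close> is then read as belonging to \<open>partial i0 h\<close>. After
    the index shift the series for \<open>partial i0 h\<close> lacks only its top term, which is
    zero by nilpotency.\<close>
  also have "(\<Sum>k\<le>N. (real k / fact k) *\<^sub>R (?t (?U (?d k h)) * ?t (?s ^ (k - 1)))) = ?t (?V (partial i0 h))"
  proof -
    obtain n where n: "N = Suc n" "n \<ge> 0"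
      using N zero_less_card_finite[where 'a='i] by (metis gr0_conv_Suc le_zero_eq not_gr_zero le0)
    have "?t (?s ^ N) = 0"
      using soul_power_zero[OF i0(1) N] by (simp add: eq_on_trunc)
    then have "?t (?V (partial i0 h)) = (\<Sum>k\<le>n. (1 / fact k) *\<^sub>R (?t (?U (?d k (partial i0 h))) * ?t (?s ^ k)))"
      unfolding V by (simp add: n)
    moreover have "?d k (partial i0 h) = ?d (Suc k) h" for k
      by (simp add: funpow_swap1)
    moreover have "real (Suc k) / fact (Suc k) = 1 / fact k" for k
      unfolding fact_Suc of_nat_mult[symmetric] by (simp del: of_nat_Suc)
    ultimately show ?thesis
      unfolding n(1) by (subst sum.atMost_Suc_shift) (simp del: funpow.simps fact_Suc)
  qed
  finally have *: "?t (pd p i (?V h)) = (\<Sum>j\<in>?E. ?t (pd p i (?xi j)) * ?t (?V (partial j h)))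
      + ?t (pd p i ?s) * ?t (?V (partial i0 h))" .
  have phi: "?t (pd p i (\<phi> i0)) = ?t (pd p i (?xi i0)) + ?t (pd p i ?s)"
  proof -
    have "eq_on p D (pd p i (scalar_fun (coeff (\<phi> i0) {}) + ?s))
        (pd p i (scalar_fun (coeff (\<phi> i0) {})) + pd p i ?s)"
      by (intro pd_add[OF D] soul_smooth smooth_sfun_scalar_fun[OF D] smooth_sfunD[OF smooth_phi]) simp
    then show ?thesis using i0 by (simp add: soul_def eq_on_trunc trunc_simps)
  qed
  let ?xi' = "\<lambda>j. if j \<in> set (i0 # L) then \<phi> j else scalar_fun (coeff (\<phi> j) {})"
  have "(\<Sum>j\<in>?E. ?t (pd p i (?xi' j)) * ?t (?V (partial j h)))
      = (\<Sum>j\<in>?E. ?t (pd p i (?xi j)) * ?t (?V (partial j h)) + (if j = i0 then ?t (pd p i ?s) * ?t (?V (partial i0 h)) else 0))"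
    using i0 phi by (intro sum.cong refl) (auto simp: distrib_right)
  also have "\<dots> = ?t (pd p i (?V h))"
    unfolding * sum.distrib using i0 by simp
  finally show ?case
    by (simp only: eq_on_trunc trunc_sum trunc_mult)
qed

lemma partial_component_fun: "partial i (\<lambda>x. x $ j) = (\<lambda>_. if i = j then 1 else 0)"
  by auto

text \<open>Only the orders 0 and 1 in coordinate \<open>j\<close> survive; they give the body and
  the soul of \<open>\<phi> j\<close>.\<close>

lemma taylor_coord:
  assumes "set L \<subseteq> {i. \<not> p i}" "distinct L" "N > 0"
  shows "taylor N \<phi> L (\<lambda>x. x $ j) = (if j \<in> set L then \<phi> j else scalar_fun (coeff (\<phi> j) {}))"
  using assms
proof (induction L)
  case Nil
  then show ?case by (simp add: body_def)
next
  case (Cons i L)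
  have d: "(partial i ^^ Suc k) (\<lambda>x. x $ j) = (\<lambda>_. if k = 0 \<and> i = j then 1 else 0)" for k
    unfolding funpow_Suc_right o_def partial_component_fun by simp
  obtain n where n: "N = Suc n" using Cons.prems(3) by (cases N) auto
  have "taylor N \<phi> (i # L) (\<lambda>x. x $ j) = taylor N \<phi> L (\<lambda>x. x $ j)
      + (\<Sum>k\<le>n. (1 / fact (Suc k)) *\<^sub>R (taylor N \<phi> L ((partial i ^^ Suc k) (\<lambda>x. x $ j)) * soul \<phi> i ^ Suc k))"
    by (simp only: taylor.simps n sum.atMost_Suc_shift) simp
  also have "(\<Sum>k\<le>n. (1 / fact (Suc k)) *\<^sub>R (taylor N \<phi> L ((partial i ^^ Suc k) (\<lambda>x. x $ j)) * soul \<phi> i ^ Suc k))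
      = (\<Sum>k\<le>n. if k = 0 then (if i = j then soul \<phi> i else 0) else 0)"
    by (intro sum.cong refl) (simp add: d taylor_const del: funpow.simps)
  also have "\<dots> = (if i = j then soul \<phi> i else 0)" by simp
  finally show ?case
    using Cons by (auto simp: soul_def)
qed

end

end

lemma coeff_zero_fun: "coeff 0 I = (\<lambda>_. 0)"
  and coeff_one_fun: "coeff 1 I = (\<lambda>_. if I = {} then 1 else 0)"
  and coeff_add_fun: "coeff (f + g) I = (\<lambda>x. coeff f I x + coeff g I x)"
  and coeff_scaleR_fun: "coeff (r *\<^sub>R f) I = (\<lambda>x. r * coeff f I x)"
  by (auto simp: coeff_one)

lemma has_parity_pd:
  assumes D: "superdomain p D" and f: "smooth_sfun p D f" "has_parity p D b f"
  shows "has_parity p D (b \<noteq> p i) (pd p i f)"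
  unfolding has_parity_twist_iff
proof -
  have "eq_on p D (pd p i (twist True f)) (pd p i (psign b *\<^sub>R f))"
    using pd_cong[OF D] f(2) unfolding has_parity_twist_iff .
  also have "eq_on p D \<dots> (psign b *\<^sub>R pd p i f)"
    by (rule pd_scaleR[OF D f(1)])
  finally have "psign (p i) *\<^sub>R trunc p D (pd p i (twist True f)) = psign (b \<noteq> p i) *\<^sub>R trunc p D (pd p i f)"
    using psign_mult[of "p i" b] by (simp add: eq_on_trunc trunc_simps eq_commute[of "p i"])
  moreover have "psign (p i) *\<^sub>R trunc p D (pd p i (twist True f)) = trunc p D (twist True (pd p i f))"
    using pd_twist[OF D f(1), of i True] by (simp add: eq_on_trunc trunc_simps)
  ultimately show "eq_on p D (twist True (pd p i f)) (psign (b \<noteq> p i) *\<^sub>R pd p i f)"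
    by (simp add: eq_on_trunc trunc_simps)
qed

lemma has_parity_pd':
  "superdomain p D \<Longrightarrow> smooth_sfun p D f \<Longrightarrow> has_parity p D b f \<Longrightarrow> c = (b \<noteq> p i) \<Longrightarrow> has_parity p D c (pd p i f)"
  using has_parity_pd by blast

section \<open>Products of odd components\<close>

context morphism
begin

lemma odd_prod_parity: "I \<subseteq> {i. p i} \<Longrightarrow> has_parity p D (odd (card I)) (odd_prod \<phi> I)"
  using finite[of I]
proof (induction I rule: finite_linorder_min_induct)
  case (insert b A)
  then have "b \<notin> A" "p b" by auto
  then show ?case
    using insert parity_phi[of b] by (auto simp: odd_prod_insert_min intro!: has_parity_mult')
qed simp

lemma odd_prod_smooth: "smooth_sfun p D (odd_prod \<phi> I)"
  using finite[of I]
  by (induction I rule: finite_linorder_min_induct)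
     (auto simp: odd_prod_insert_min smooth_sfun_one[OF D] intro!: smooth_sfun_mult[OF D] smooth_phi)

lemma odd_square: "p i \<Longrightarrow> eq_on p D (\<phi> i * \<phi> i) 0"
proof -
  assume "p i"
  then have "eq_on p D (\<phi> i * \<phi> i) ((- 1) *\<^sub>R (\<phi> i * \<phi> i))"
    using supercommute[OF parity_phi[of i] parity_phi[of i]] by simp
  then show ?thesis
    by (auto simp: eq_on_def)
qed

text \<open>Moving \<open>\<phi> i\<close> to its place costs a sign for each smaller factor it
  passes, which makes up the shuffle sign; meeting another copy of itself gives zero.\<close>

lemma odd_prod_mult_single:
  assumes "p i" "J \<subseteq> {i. p i}"
  shows "eq_on p D (\<phi> i * odd_prod \<phi> J)
    (if i \<in> J then 0 else sgn_shuffle {i} J *\<^sub>R odd_prod \<phi> (insert i J))"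
  using finite[of J] assms(2)
proof (induction J rule: finite_linorder_min_induct)
  case empty
  then show ?case using odd_prod_insert_min[of "{}" i \<phi>] by simp
next
  case (insert b A)
  have bA: "b \<notin> A" "p b" "A \<subseteq> {i. p i}" and m: "odd_prod \<phi> (insert b A) = \<phi> b * odd_prod \<phi> A"
    using insert by (auto simp: odd_prod_insert_min)
  let ?t = "trunc p D"
  consider "i < b" | "i = b" | "b < i" by force
  then show ?case
  proof cases
    case 1
    then have "i \<notin> insert b A" and e: "{j \<in> insert b A. j < i} = {}" and "\<And>j. j \<in> insert b A \<Longrightarrow> i < j"
      using insert(2) by fastforce+
    moreover have "sgn_shuffle {i} (insert b A) = 1"
      by (simp only: sgn_shuffle_singleton e card.empty power_0)
    ultimately show ?thesis using odd_prod_insert_min[of "insert b A" i \<phi>] by simp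
  next
    case 2
    then show ?thesis
      using eq_on_mult[OF odd_square[OF assms(1)] eq_on_refl[of p D "odd_prod \<phi> A"]] m by (simp add: mult.assoc)
  next
    case 3
    have "?t (\<phi> i) * ?t (\<phi> b) = - (?t (\<phi> b) * ?t (\<phi> i))"
      using supercommute[OF parity_phi[of i] parity_phi[of b]] assms bA by (simp add: eq_on_trunc trunc_simps)
    then have "?t (\<phi> i * odd_prod \<phi> (insert b A)) = - (?t (\<phi> b) * ?t (\<phi> i * odd_prod \<phi> A))"
      unfolding m by (simp add: trunc_mult flip: mult.assoc)
    also have "?t (\<phi> i * odd_prod \<phi> A) = ?t (if i \<in> A then 0 else sgn_shuffle {i} A *\<^sub>R odd_prod \<phi> (insert i A))"
      using insert.IH[OF bA(3)] by (simp only: eq_on_trunc)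
    finally have *: "?t (\<phi> i * odd_prod \<phi> (insert b A))
        = - (?t (\<phi> b) * ?t (if i \<in> A then 0 else sgn_shuffle {i} A *\<^sub>R odd_prod \<phi> (insert i A)))" .
    show ?thesis
    proof (cases "i \<in> A")
      case True
      then show ?thesis using * by (simp add: eq_on_trunc)
    next
      case False
      have "{j \<in> insert b A. j < i} = insert b {j \<in> A. j < i}" using 3 by auto
      then have "sgn_shuffle {i} (insert b A) = - sgn_shuffle {i} A"
        using bA by (simp add: sgn_shuffle_singleton)
      moreover have "odd_prod \<phi> (insert b (insert i A)) = \<phi> b * odd_prod \<phi> (insert i A)"
        using 3 insert(2) by (intro odd_prod_insert_min) auto
      ultimately show ?thesis
        using * False 3 by (auto simp: eq_on_trunc trunc_simps insert_commute)
    qed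
  qed
qed

lemma odd_prod_mult:
  assumes "I \<subseteq> {i. p i}" "J \<subseteq> {i. p i}"
  shows "eq_on p D (odd_prod \<phi> I * odd_prod \<phi> J)
    (if I \<inter> J = {} then sgn_shuffle I J *\<^sub>R odd_prod \<phi> (I \<union> J) else 0)"
  using finite[of I] assms(1)
proof (induction I rule: finite_linorder_min_induct)
  case (insert b A)
  have bA: "b \<notin> A" "p b" "A \<subseteq> {i. p i}" and m: "odd_prod \<phi> (insert b A) = \<phi> b * odd_prod \<phi> A"
    using insert by (auto simp: odd_prod_insert_min)
  have "eq_on p D (odd_prod \<phi> (insert b A) * odd_prod \<phi> J) (\<phi> b * (odd_prod \<phi> A * odd_prod \<phi> J))"
    by (simp add: m mult.assoc)
  also have "eq_on p D \<dots> (\<phi> b * (if A \<inter> J = {} then sgn_shuffle A J *\<^sub>R odd_prod \<phi> (A \<union> J) else 0))"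
    by (intro eq_on_mult eq_on_refl insert.IH bA)
  also have "eq_on p D \<dots> (if insert b A \<inter> J = {} then sgn_shuffle (insert b A) J *\<^sub>R odd_prod \<phi> (insert b A \<union> J) else 0)"
  proof (cases "A \<inter> J = {}")
    case True
    have "eq_on p D (sgn_shuffle A J *\<^sub>R (\<phi> b * odd_prod \<phi> (A \<union> J)))
        (sgn_shuffle A J *\<^sub>R (if b \<in> A \<union> J then 0 else sgn_shuffle {b} (A \<union> J) *\<^sub>R odd_prod \<phi> (insert b (A \<union> J))))"
      using assms(2) bA by (intro eq_on_scaleR odd_prod_mult_single) auto
    moreover have "sgn_shuffle {b} (A \<union> J) = sgn_shuffle {b} J"
    proof -
      have e: "{j \<in> A. j < b} = {}" using insert(2) by fastforce
      have "sgn_shuffle {b} A = 1"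
        by (simp only: sgn_shuffle_singleton e card.empty power_0)
      then show ?thesis
        using sgn_shuffle_Un_right[OF True, of "{b}"] by simp
    qed
    moreover have "sgn_shuffle (insert b A) J = sgn_shuffle {b} J * sgn_shuffle A J"
      using sgn_shuffle_Un_left[of "{b}" A J] bA by simp
    ultimately show ?thesis
      using True bA by (auto simp: mult.commute)
  qed auto
  finally show ?case .
qed simp

text \<open>Carrying the derivative over \<open>\<phi> b\<close> costs \<open>psign (p i)\<close>,
  and moving \<open>\<phi> b\<close> across the derivative of \<open>\<phi> j\<close> costs
  \<open>- psign (p i)\<close>. Together this is one factor -1 for each factor below
  \<open>j\<close>, whatever the parity of \<open>i\<close>.\<close>

lemma pd_odd_prod:
  assumes "I \<subseteq> {i. p i}"
  shows "eq_on p D (pd p i (odd_prod \<phi> I))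
    (\<Sum>j\<in>I. (- 1) ^ card {k \<in> I. k < j} *\<^sub>R (pd p i (\<phi> j) * odd_prod \<phi> (I - {j})))"
  using finite[of I] assms
proof (induction I rule: finite_linorder_min_induct)
  case (insert b A)
  let ?t = "trunc p D"
  have bA: "b \<notin> A" "p b" "A \<subseteq> {i. p i}" and m: "odd_prod \<phi> (insert b A) = \<phi> b * odd_prod \<phi> A"
    using insert by (auto simp: odd_prod_insert_min)
  have tw: "?t (twist (p i) (\<phi> b)) = psign (p i) *\<^sub>R ?t (\<phi> b)"
    using has_parity_twist[OF parity_phi, of "p i" b] bA by (simp add: eq_on_trunc trunc_simps)
  have IH: "?t (pd p i (odd_prod \<phi> A))
      = (\<Sum>j\<in>A. (- 1) ^ card {k \<in> A. k < j} *\<^sub>R (?t (pd p i (\<phi> j)) * ?t (odd_prod \<phi> (A - {j}))))"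
    using insert.IH[OF bA(3)] by (simp add: eq_on_trunc trunc_simps)
  have "?t (pd p i (odd_prod \<phi> (insert b A)))
      = ?t (pd p i (\<phi> b)) * ?t (odd_prod \<phi> A) + ?t (twist (p i) (\<phi> b)) * ?t (pd p i (odd_prod \<phi> A))"
    using pd_mult[OF D smooth_phi odd_prod_smooth, of i b A] by (simp add: m eq_on_trunc trunc_simps)
  also have "?t (twist (p i) (\<phi> b)) * ?t (pd p i (odd_prod \<phi> A))
    = (\<Sum>j\<in>A. (- 1) ^ card {k \<in> insert b A. k < j} *\<^sub>R (?t (pd p i (\<phi> j)) * ?t (odd_prod \<phi> (insert b A - {j}))))"
    unfolding tw IH sum_distrib_left
  proof (intro sum.cong refl)
    fix j assume j: "j \<in> A"
    then have "b < j" "p j" "j \<noteq> b" using insert bA by auto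
    then have "{k \<in> insert b A. k < j} = insert b {k \<in> A. k < j}" by auto
    then have c: "(- 1 :: real) ^ card {k \<in> insert b A. k < j} = - ((- 1) ^ card {k \<in> A. k < j})"
      using bA by simp
    have "insert b A - {j} = insert b (A - {j})" using \<open>j \<noteq> b\<close> by auto
    then have mj: "odd_prod \<phi> (insert b A - {j}) = \<phi> b * odd_prod \<phi> (A - {j})"
      using odd_prod_insert_min[of "A - {j}" b \<phi>] insert(2) by auto
    have "?t (\<phi> b) * ?t (pd p i (\<phi> j)) = - psign (p i) *\<^sub>R (?t (pd p i (\<phi> j)) * ?t (\<phi> b))"
      using supercommute[OF parity_phi[of b] has_parity_pd[OF D smooth_phi[of j] parity_phi[of j], of i]] \<open>p b\<close> \<open>p j\<close>
      by (simp add: eq_on_trunc trunc_simps)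
    then have "?t (\<phi> b) * (?t (pd p i (\<phi> j)) * ?t (odd_prod \<phi> (A - {j})))
        = - psign (p i) *\<^sub>R (?t (pd p i (\<phi> j)) * (?t (\<phi> b) * ?t (odd_prod \<phi> (A - {j}))))"
      by (simp flip: mult.assoc)
    then show "psign (p i) *\<^sub>R ?t (\<phi> b) * ((- 1) ^ card {k \<in> A. k < j} *\<^sub>R (?t (pd p i (\<phi> j)) * ?t (odd_prod \<phi> (A - {j}))))
      = (- 1) ^ card {k \<in> insert b A. k < j} *\<^sub>R (?t (pd p i (\<phi> j)) * ?t (odd_prod \<phi> (insert b A - {j})))"
      by (simp only: c mj trunc_mult) (cases "p i"; simp)
  qed
  finally have "?t (pd p i (odd_prod \<phi> (insert b A))) = ?t (pd p i (\<phi> b)) * ?t (odd_prod \<phi> A)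
    + (\<Sum>j\<in>A. (- 1) ^ card {k \<in> insert b A. k < j} *\<^sub>R (?t (pd p i (\<phi> j)) * ?t (odd_prod \<phi> (insert b A - {j}))))" .
  moreover have "(- 1 :: real) ^ card {k \<in> insert b A. k < b} = 1"
  proof -
    have e: "{k \<in> insert b A. k < b} = {}" using insert(2) by fastforce
    show ?thesis unfolding e by simp
  qed
  moreover have "insert b A - {b} = A" using bA by auto
  ultimately show ?case
    unfolding eq_on_trunc trunc_simps sum.insert[OF insert(1) bA(1)] by (simp only: scaleR_one)
qed simp

section \<open>Pullback of superfunctions: algebra, parity and chain rule\<close>

abbreviation tay :: "('i point \<Rightarrow> real) \<Rightarrow> 'i sfun" where
  "tay \<equiv> taylor CARD('i) \<phi> (even_list p)"

abbreviation pb :: "'i sfun \<Rightarrow> 'i sfun" where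
  "pb \<equiv> pullback p \<phi>"

lemma evens: "set (even_list p) \<subseteq> {i. \<not> p i}"
  by (simp add: even_list)

lemma trunc_pb: "trunc p D (pb f) = (\<Sum>I\<in>Pow {i. p i}. trunc p D (tay (coeff f I)) * trunc p D (odd_prod \<phi> I))"
  by (simp add: pullback_taylor trunc_simps)

lemma tay_commute: "trunc p D (tay h) * trunc p D g = trunc p D g * trunc p D (tay h)"
  using even_commute[OF taylor_parity[OF evens]] by (simp add: eq_on_trunc trunc_mult)

lemma pb_cong: "eq_on p D' f g \<Longrightarrow> eq_on p D (pb f) (pb g)"
  unfolding pullback_taylor
  by (intro eq_on_sum eq_on_mult taylor_cong evens eq_on_refl) (auto simp: eq_on_def)

lemma pb_smooth: "smooth_sfun p D' f \<Longrightarrow> smooth_sfun p D (pb f)"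
  unfolding pullback_taylor
  by (intro smooth_sfun_sum[OF D] smooth_sfun_mult[OF D] taylor_smooth evens odd_prod_smooth) (auto simp: smooth_sfun_def)

lemma pb_add:
  assumes "smooth_sfun p D' f" "smooth_sfun p D' g"
  shows "eq_on p D (pb (f + g)) (pb f + pb g)"
proof -
  have "trunc p D (tay (coeff (f + g) I)) = trunc p D (tay (coeff f I)) + trunc p D (tay (coeff g I))"
    if "I \<in> Pow {i. p i}" for I
    using taylor_add[OF evens, of "coeff f I" "coeff g I"] that smooth_sfunD[OF assms(1)] smooth_sfunD[OF assms(2)]
    by (simp add: eq_on_trunc trunc_simps coeff_add_fun)
  then show ?thesis
    by (simp add: eq_on_trunc trunc_add trunc_pb distrib_right sum.distrib)
qed

lemma pb_scaleR:
  assumes "smooth_sfun p D' f"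
  shows "eq_on p D (pb (r *\<^sub>R f)) (r *\<^sub>R pb f)"
proof -
  have "trunc p D (tay (coeff (r *\<^sub>R f) I)) = r *\<^sub>R trunc p D (tay (coeff f I))"
    if "I \<in> Pow {i. p i}" for I
    using taylor_cmult[OF evens, of "coeff f I"] that smooth_sfunD[OF assms(1)]
    by (simp add: eq_on_trunc trunc_simps coeff_scaleR_fun)
  then show ?thesis
    by (simp add: eq_on_trunc trunc_scaleR trunc_pb scaleR_sum_right)
qed

lemma pb_zero [simp]: "pb 0 = 0"
  by (simp add: pullback_taylor coeff_zero_fun)

lemma pb_sum:
  assumes "\<And>a. a \<in> A \<Longrightarrow> smooth_sfun p D' (f a)"
  shows "eq_on p D (pb (sum f A)) (\<Sum>a\<in>A. pb (f a))"
  using assms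
proof (induction A rule: infinite_finite_induct)
  case (insert a A)
  have "eq_on p D (pb (f a + sum f A)) (pb (f a) + pb (sum f A))"
    by (intro pb_add smooth_sfun_sum[OF D']) (auto simp: insert)
  also have "eq_on p D \<dots> (pb (f a) + (\<Sum>a\<in>A. pb (f a)))"
    by (intro eq_on_add eq_on_refl insert.IH) (auto simp: insert)
  finally show ?case using insert(1,2) by simp
qed auto

lemma pb_coord: "pb (coord p i) = \<phi> i"
proof (cases "p i")
  case True
  have "pb (coord p i) = (\<Sum>I\<in>Pow {i. p i}. if I = {i} then \<phi> i else 0)"
    unfolding pullback_taylor
    using odd_prod_insert_min[of "{}" i \<phi>] by (intro sum.cong refl) (auto simp: coord_odd True)
  then show ?thesis using True by simp
next
  case False
  have "taylor CARD('i) \<phi> (even_list p) (\<lambda>x. x $ i) = \<phi> i"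
    using taylor_coord[OF evens even_list(2)] False by (simp add: zero_less_card_finite even_list(1))
  then have "pb (coord p i) = (\<Sum>I\<in>Pow {i. p i}. if I = {} then \<phi> i else 0)"
    unfolding pullback_taylor by (intro sum.cong refl) (auto simp: coord_even False scalar_fun_def)
  then show ?thesis by simp
qed

lemma pb_one [simp]: "pb 1 = 1"
proof -
  have "pb 1 = (\<Sum>I\<in>Pow {i. p i}. if I = {} then 1 else 0)"
    unfolding pullback_taylor by (intro sum.cong refl) (simp add: coeff_one_fun)
  then show ?thesis by simp
qed

lemma pb_twist:
  assumes "smooth_sfun p D' f"
  shows "eq_on p D (pb (twist b f)) (twist b (pb f))"
proof -
  have "trunc p D (tay (coeff (twist b f) I)) * trunc p D (odd_prod \<phi> I)
      = trunc p D (twist b (tay (coeff f I))) * trunc p D (twist b (odd_prod \<phi> I))"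
    if I: "I \<in> Pow {i. p i}" for I
  proof -
    have "coeff (twist b f) I = (\<lambda>x. psign (b \<and> odd (card I)) * coeff f I x)"
      by (auto simp: coeff_twist)
    moreover have "trunc p D (tay (\<lambda>x. psign (b \<and> odd (card I)) * coeff f I x))
        = psign (b \<and> odd (card I)) *\<^sub>R trunc p D (tay (coeff f I))"
      using taylor_cmult[OF evens smooth_sfunD[OF assms(1)]] I by (simp add: eq_on_trunc trunc_simps)
    moreover have "trunc p D (twist b (tay (coeff f I))) = trunc p D (tay (coeff f I))"
      using has_parity_twist[OF taylor_parity[OF evens], of b] by (simp add: eq_on_trunc)
    moreover have "trunc p D (twist b (odd_prod \<phi> I)) = psign (b \<and> odd (card I)) *\<^sub>R trunc p D (odd_prod \<phi> I)"
      using has_parity_twist[OF odd_prod_parity, of I b] I by (simp add: eq_on_trunc trunc_simps conj_commute)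
    ultimately show ?thesis by simp
  qed
  then show ?thesis
    unfolding eq_on_trunc trunc_pb by (simp add: pullback_taylor trunc_simps twist_sum twist_mult)
qed

lemma pb_parity:
  assumes "smooth_sfun p D' f" "has_parity p D' b f"
  shows "has_parity p D b (pb f)"
  unfolding has_parity_twist_iff
proof -
  have "eq_on p D (twist True (pb f)) (pb (twist True f))"
    by (rule eq_on_sym[OF pb_twist[OF assms(1)]])
  also have "eq_on p D \<dots> (pb (psign b *\<^sub>R f))"
    using assms(2) unfolding has_parity_twist_iff by (rule pb_cong)
  also have "eq_on p D \<dots> (psign b *\<^sub>R pb f)"
    by (rule pb_scaleR[OF assms(1)])
  finally show "eq_on p D (twist True (pb f)) (psign b *\<^sub>R pb f)" .
qed

text \<open>Coefficients multiply by \<open>taylor_mult\<close> and odd monomials by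
  \<open>odd_prod_mult\<close>, with the same shuffle sign as in the product of superfunctions. The
  sum over disjoint pairs \<open>I\<close>, \<open>J\<close> extends to all pairs because an odd
  \<open>\<phi> i\<close> squares to zero.\<close>

lemma pb_mult:
  assumes fg: "smooth_sfun p D' f" "smooth_sfun p D' g"
  shows "eq_on p D (pb (f * g)) (pb f * pb g)"
proof -
  let ?t = "trunc p D" and ?O = "{i. p i}"
  let ?F = "\<lambda>I J. sgn_shuffle I J *\<^sub>R (?t (tay (coeff f I)) * ?t (tay (coeff g J)) * ?t (odd_prod \<phi> (I \<union> J)))"
  have U: "?t (tay (coeff (f * g) K))
      = (\<Sum>I\<in>Pow K. sgn_shuffle I (K - I) *\<^sub>R (?t (tay (coeff f I)) * ?t (tay (coeff g (K - I)))))"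
    if "K \<in> Pow ?O" for K
  proof -
    have sm: "smooth p D' (coeff f I)" "smooth p D' (coeff g (K - I))" if "I \<in> Pow K" for I
      by (intro smooth_sfunD[OF fg(1)] smooth_sfunD[OF fg(2)]; use that \<open>K \<in> Pow ?O\<close> in blast)+
    have "eq_on p D (tay (coeff (f * g) K)) (tay (\<lambda>x. \<Sum>I\<in>Pow K. sgn_shuffle I (K - I) * (coeff f I x * coeff g (K - I) x)))"
      by (intro taylor_cong evens) (simp add: coeff_mult mult.assoc)
    also have "eq_on p D \<dots> (\<Sum>I\<in>Pow K. tay (\<lambda>x. sgn_shuffle I (K - I) * (coeff f I x * coeff g (K - I) x)))"
      by (intro taylor_sum_fun evens smooth_cmult smooth_mult D' sm)
    also have "eq_on p D \<dots> (\<Sum>I\<in>Pow K. sgn_shuffle I (K - I) *\<^sub>R tay (\<lambda>x. coeff f I x * coeff g (K - I) x))"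
      by (intro eq_on_sum taylor_cmult evens smooth_mult D' sm)
    also have "eq_on p D \<dots> (\<Sum>I\<in>Pow K. sgn_shuffle I (K - I) *\<^sub>R (tay (coeff f I) * tay (coeff g (K - I))))"
      by (intro eq_on_sum eq_on_scaleR taylor_mult evens sm order_refl)
    finally show ?thesis by (simp add: eq_on_trunc trunc_simps)
  qed
  have "?t (pb (f * g)) = (\<Sum>K\<in>Pow ?O. \<Sum>I\<in>Pow K. ?F I (K - I))"
    unfolding trunc_pb
  proof (intro sum.cong refl)
    fix K assume "K \<in> Pow ?O"
    then show "?t (tay (coeff (f * g) K)) * ?t (odd_prod \<phi> K) = (\<Sum>I\<in>Pow K. ?F I (K - I))"
      by (auto simp: U sum_distrib_right Un_absorb1 intro!: sum.cong)
  qed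
  also have "\<dots> = (\<Sum>(K, I)\<in>(SIGMA K:Pow ?O. Pow K). ?F I (K - I))"
    by (rule sum.Sigma) auto
  also have "\<dots> = (\<Sum>(I, J)\<in>(SIGMA I:Pow ?O. Pow (?O - I)). ?F I J)"
    by (rule sum.reindex_bij_witness[where i = "\<lambda>(I, J). (I \<union> J, I)" and j = "\<lambda>(K, I). (I, K - I)"]) auto
  also have "\<dots> = (\<Sum>I\<in>Pow ?O. \<Sum>J\<in>Pow (?O - I). ?F I J)"
    by (rule sum.Sigma[symmetric]) auto
  also have "\<dots> = (\<Sum>I\<in>Pow ?O. \<Sum>J\<in>Pow ?O. (?t (tay (coeff f I)) * ?t (odd_prod \<phi> I)) * (?t (tay (coeff g J)) * ?t (odd_prod \<phi> J)))"
  proof (rule sum.cong[OF refl])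
    fix I assume I: "I \<in> Pow ?O"
    have *: "(?t (tay (coeff f I)) * ?t (odd_prod \<phi> I)) * (?t (tay (coeff g J)) * ?t (odd_prod \<phi> J))
        = (if I \<inter> J = {} then ?F I J else 0)" if J: "J \<in> Pow ?O" for J
    proof -
      have "(?t (tay (coeff f I)) * ?t (odd_prod \<phi> I)) * (?t (tay (coeff g J)) * ?t (odd_prod \<phi> J))
          = ?t (tay (coeff f I)) * (?t (odd_prod \<phi> I) * ?t (tay (coeff g J))) * ?t (odd_prod \<phi> J)"
        by (simp only: mult.assoc)
      also have "\<dots> = ?t (tay (coeff f I)) * ?t (tay (coeff g J)) * ?t (odd_prod \<phi> I * odd_prod \<phi> J)"
        by (simp only: tay_commute[of "coeff g J" "odd_prod \<phi> I", symmetric] mult.assoc trunc_mult)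
      also have "?t (odd_prod \<phi> I * odd_prod \<phi> J) = ?t (if I \<inter> J = {} then sgn_shuffle I J *\<^sub>R odd_prod \<phi> (I \<union> J) else 0)"
        using odd_prod_mult[of I J] I J by (simp add: eq_on_trunc)
      finally show ?thesis by (auto simp: trunc_scaleR)
    qed
    have "(\<Sum>J\<in>Pow (?O - I). ?F I J) = (\<Sum>J\<in>Pow ?O. if I \<inter> J = {} then ?F I J else 0)"
      by (rule sum.mono_neutral_cong_left) auto
    then show "(\<Sum>J\<in>Pow (?O - I). ?F I J)
        = (\<Sum>J\<in>Pow ?O. (?t (tay (coeff f I)) * ?t (odd_prod \<phi> I)) * (?t (tay (coeff g J)) * ?t (odd_prod \<phi> J)))"
      by (rule trans[OF _ sum.cong[OF refl *[symmetric]]])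
  qed
  also have "\<dots> = ?t (pb f * pb g)"
    by (simp add: trunc_mult trunc_pb sum_product)
  finally show ?thesis by (simp only: eq_on_trunc)
qed

text \<open>The derivative falls either on the Taylor part, which yields the even \<open>j\<close>
  by \<open>taylor_chain\<close>, or on the odd product, which yields the odd \<open>j\<close>:
  removing the factor \<open>\<phi> j\<close> from the monomial of \<open>I\<close> matches the
  coefficient of \<open>pd p j f\<close> at \<open>I - {j}\<close>.\<close>

lemma pb_chain:
  assumes f: "smooth_sfun p D' f"
  shows "eq_on p D (pd p i (pb f)) (\<Sum>j\<in>UNIV. pd p i (\<phi> j) * pb (pd p j f))"
proof -
  let ?t = "trunc p D" and ?O = "{i. p i}" and ?E = "{i. \<not> p i}"
  note sm = smooth_sfunD[OF f]
  have "?t (pd p i (pb f)) = (\<Sum>I\<in>Pow ?O. ?t (pd p i (tay (coeff f I) * odd_prod \<phi> I)))"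
    unfolding pullback_taylor trunc_sum[symmetric] eq_on_trunc[symmetric]
    by (intro pd_sum[OF D] smooth_sfun_mult[OF D] taylor_smooth evens odd_prod_smooth sm) simp
  also have "\<dots> = (\<Sum>I\<in>Pow ?O. ?t (pd p i (tay (coeff f I))) * ?t (odd_prod \<phi> I)
      + ?t (tay (coeff f I)) * ?t (pd p i (odd_prod \<phi> I)))"
  proof (intro sum.cong refl)
    fix I assume "I \<in> Pow ?O"
    then have "smooth_sfun p D (tay (coeff f I))" by (intro taylor_smooth evens sm) simp
    from pd_mult[OF D this odd_prod_smooth, of i I] show "?t (pd p i (tay (coeff f I) * odd_prod \<phi> I))
        = ?t (pd p i (tay (coeff f I))) * ?t (odd_prod \<phi> I) + ?t (tay (coeff f I)) * ?t (pd p i (odd_prod \<phi> I))"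
      using has_parity_twist[OF taylor_parity[OF evens], of "p i"] by (simp add: eq_on_trunc trunc_simps)
  qed
  also have "\<dots> = (\<Sum>I\<in>Pow ?O. ?t (pd p i (tay (coeff f I))) * ?t (odd_prod \<phi> I))
      + (\<Sum>I\<in>Pow ?O. ?t (tay (coeff f I)) * ?t (pd p i (odd_prod \<phi> I)))"
    by (rule sum.distrib)
  also have "(\<Sum>I\<in>Pow ?O. ?t (pd p i (tay (coeff f I))) * ?t (odd_prod \<phi> I))
      = (\<Sum>j\<in>?E. ?t (pd p i (\<phi> j)) * ?t (pb (pd p j f)))"
  proof -
    have "?t (pd p i (tay (coeff f I))) = (\<Sum>j\<in>?E. ?t (pd p i (\<phi> j)) * ?t (tay (coeff (pd p j f) I)))"
      if "I \<in> Pow ?O" for I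
      using taylor_chain[OF order_refl evens even_list(2) sm, of I i] that
      by (auto simp: eq_on_trunc trunc_simps even_list coeff_pd_even intro!: sum.cong)
    then have "(\<Sum>I\<in>Pow ?O. ?t (pd p i (tay (coeff f I))) * ?t (odd_prod \<phi> I))
        = (\<Sum>I\<in>Pow ?O. \<Sum>j\<in>?E. ?t (pd p i (\<phi> j)) * (?t (tay (coeff (pd p j f) I)) * ?t (odd_prod \<phi> I)))"
      by (auto simp: sum_distrib_right mult.assoc intro!: sum.cong)
    also have "\<dots> = (\<Sum>j\<in>?E. ?t (pd p i (\<phi> j)) * ?t (pb (pd p j f)))"
      unfolding trunc_pb sum_distrib_left by (rule sum.swap)
    finally show ?thesis .
  qed
  also have "(\<Sum>I\<in>Pow ?O. ?t (tay (coeff f I)) * ?t (pd p i (odd_prod \<phi> I)))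
      = (\<Sum>j\<in>?O. ?t (pd p i (\<phi> j)) * ?t (pb (pd p j f)))"
  proof -
    let ?G = "\<lambda>I j. (- 1) ^ card {k \<in> I. k < j} *\<^sub>R
      (?t (pd p i (\<phi> j)) * (?t (tay (coeff f I)) * ?t (odd_prod \<phi> (I - {j}))))"
    have "(\<Sum>I\<in>Pow ?O. ?t (tay (coeff f I)) * ?t (pd p i (odd_prod \<phi> I))) = (\<Sum>I\<in>Pow ?O. \<Sum>j\<in>{j\<in>?O. j \<in> I}. ?G I j)"
    proof (intro sum.cong refl)
      fix I assume I: "I \<in> Pow ?O"
      have "?t (tay (coeff f I)) * ?t (pd p i (odd_prod \<phi> I)) = (\<Sum>j\<in>I. ?G I j)"
        using pd_odd_prod[of I i] I
        by (simp add: eq_on_trunc trunc_simps sum_distrib_left)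
           (simp add: tay_commute[where g = "pd p i (\<phi> j)" for j] flip: mult.assoc)
      moreover have "{j\<in>?O. j \<in> I} = I" using I by auto
      ultimately show "?t (tay (coeff f I)) * ?t (pd p i (odd_prod \<phi> I)) = (\<Sum>j\<in>{j\<in>?O. j \<in> I}. ?G I j)"
        by simp
    qed
    also have "\<dots> = (\<Sum>j\<in>?O. \<Sum>I\<in>{I\<in>Pow ?O. j \<in> I}. ?G I j)"
      by (rule sum.swap_restrict) auto
    also have "\<dots> = (\<Sum>j\<in>?O. ?t (pd p i (\<phi> j)) * ?t (pb (pd p j f)))"
    proof (intro sum.cong refl)
      fix j assume "j \<in> ?O"
      then have j: "p j" by simp
      have "?t (pb (pd p j f)) = (\<Sum>I\<in>{I\<in>Pow ?O. j \<notin> I}. ?t (tay (coeff (pd p j f) I)) * ?t (odd_prod \<phi> I))"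
        unfolding trunc_pb
      proof (rule sum.mono_neutral_right)
        show "\<forall>I\<in>Pow ?O - {I\<in>Pow ?O. j \<notin> I}. ?t (tay (coeff (pd p j f) I)) * ?t (odd_prod \<phi> I) = 0"
        proof
          fix I assume "I \<in> Pow ?O - {I\<in>Pow ?O. j \<notin> I}"
          then have "coeff (pd p j f) I = (\<lambda>_. 0)" using j by (auto simp: coeff_pd_odd)
          then show "?t (tay (coeff (pd p j f) I)) * ?t (odd_prod \<phi> I) = 0" by simp
        qed
      qed auto
      also have "\<dots> = (\<Sum>I\<in>{I\<in>Pow ?O. j \<in> I}. (- 1) ^ card {k \<in> I. k < j} *\<^sub>R
          (?t (tay (coeff f I)) * ?t (odd_prod \<phi> (I - {j}))))"
      \<comment> \<open>Adding \<open>j\<close> identifies the index sets of \<open>pd p j f\<close>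
        with those of \<open>f\<close> that contain \<open>j\<close>; the signs agree because
        \<open>j\<close> is not counted below itself.\<close>
      proof (rule sum.reindex_bij_witness[where i = "\<lambda>I. I - {j}" and j = "insert j"])
        fix I assume I: "I \<in> {I\<in>Pow ?O. j \<notin> I}"
        have "coeff (pd p j f) I = (\<lambda>x. (- 1) ^ card {k \<in> I. k < j} * coeff f (insert j I) x)"
          using I j by (auto simp: coeff_pd_odd)
        moreover have "{k \<in> insert j I. k < j} = {k \<in> I. k < j}" "insert j I - {j} = I" using I by auto
        moreover have "smooth p D' (coeff f (insert j I))" using I j by (intro sm) auto
        ultimately show "(- 1) ^ card {k \<in> insert j I. k < j} *\<^sub>R
            (?t (tay (coeff f (insert j I))) * ?t (odd_prod \<phi> (insert j I - {j})))
          = ?t (tay (coeff (pd p j f) I)) * ?t (odd_prod \<phi> I)"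
          using taylor_cmult[OF evens, of "coeff f (insert j I)"] by (simp add: eq_on_trunc trunc_simps)
      qed (use j in auto)
      finally show "(\<Sum>I\<in>{I\<in>Pow ?O. j \<in> I}. ?G I j) = ?t (pd p i (\<phi> j)) * ?t (pb (pd p j f))"
        by (simp add: sum_distrib_left)
    qed
    finally show ?thesis .
  qed
  also have "(\<Sum>j\<in>?E. ?t (pd p i (\<phi> j)) * ?t (pb (pd p j f))) + (\<Sum>j\<in>?O. ?t (pd p i (\<phi> j)) * ?t (pb (pd p j f)))
      = (\<Sum>j\<in>UNIV. ?t (pd p i (\<phi> j)) * ?t (pb (pd p j f)))"
    by (subst sum.union_disjoint[symmetric]) (auto intro: sum.cong)
  finally show ?thesis
    by (simp only: eq_on_trunc trunc_simps)
qed

end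

section \<open>Lifts to the cotangent bundle\<close>

lemma less_sum_simps [simp]:
  "(Inl a :: 'a::linorder + 'b::linorder) < Inl b \<longleftrightarrow> a < b"
  "(Inr c :: 'a::linorder + 'b::linorder) < Inr d \<longleftrightarrow> c < d"
  "(Inl a :: 'a::linorder + 'b::linorder) < Inr d"
  "\<not> (Inr c :: 'a::linorder + 'b::linorder) < Inl b"
  "(Inl a :: 'a::linorder + 'b::linorder) \<le> Inl b \<longleftrightarrow> a \<le> b"
  "(Inr c :: 'a::linorder + 'b::linorder) \<le> Inr d \<longleftrightarrow> c \<le> d"
  "(Inl a :: 'a::linorder + 'b::linorder) \<le> Inr d"
  by (auto simp: less_sum_def less_eq_sum_def)

lemma cot_odd_simps [simp]: "cot_odd p (Inl a) = p a" "cot_odd p (Inr a) = p a"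
  by (simp_all add: cot_odd_def)

lemma sum_UNIV_Plus: "(\<Sum>X\<in>UNIV. h X) = (\<Sum>a\<in>UNIV. h (Inl a)) + (\<Sum>a\<in>UNIV. h (Inr a))"
  for h :: "'a::finite + 'b::finite \<Rightarrow> 'c::comm_monoid_add"
  by (simp add: sum.Plus flip: UNIV_Plus_UNIV)

lemma base_point_component [simp]: "base_point v $ a = v $ Inl a"
  by (simp add: base_point_def)

lemma base_point_add_Inl [simp]: "base_point (v + t *\<^sub>R axis (Inl i) 1) = base_point v + t *\<^sub>R axis i 1"
  and base_point_add_Inr [simp]: "base_point (v + t *\<^sub>R axis (Inr i) 1) = base_point v"
  by (auto simp: vec_eq_iff axis_def)

lemma partial_base_point_Inl: "partial (Inl i) (\<lambda>v. h (base_point v)) = (\<lambda>v. partial i h (base_point v))"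
  and partial_base_point_Inr: "partial (Inr i) (\<lambda>v. h (base_point v)) = (\<lambda>_. 0)"
  by (auto simp: partial_def)

lemma partial_funpow_base_point:
  "(partial (Inl i) ^^ k) (\<lambda>v. h (base_point v)) = (\<lambda>v. (partial i ^^ k) h (base_point v))"
  "(partial (Inr i) ^^ k) (\<lambda>v. h (base_point v)) = (if k = 0 then (\<lambda>v. h (base_point v)) else (\<lambda>_. 0))"
proof -
  show "(partial (Inl i) ^^ k) (\<lambda>v. h (base_point v)) = (\<lambda>v. (partial i ^^ k) h (base_point v))"
    by (induction k) (auto simp: partial_base_point_Inl)
  show "(partial (Inr i) ^^ k) (\<lambda>v. h (base_point v)) = (if k = 0 then (\<lambda>v. h (base_point v)) else (\<lambda>_. 0))"
    by (induction k) (auto simp: partial_base_point_Inr)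
qed

lemma coeff_lift: "coeff (lift f) I v = (if I \<subseteq> range Inl then coeff f (Inl -` I) (base_point v) else 0)"
  by (simp add: lift_def)

lemma coeff_lift_fun: "coeff (lift f) I
    = (if I \<subseteq> range Inl then (\<lambda>v. coeff f (Inl -` I) (base_point v)) else (\<lambda>_. 0))"
  by (rule ext) (simp add: coeff_lift)

lemma vimage_Inl_empty_iff: "I \<subseteq> range Inl \<Longrightarrow> Inl -` I = {} \<longleftrightarrow> I = {}"
  by auto

lemma card_vimage_Inl: "I \<subseteq> range Inl \<Longrightarrow> card (Inl -` I) = card I"
  by (rule card_vimage_inj) auto

lemma lift_zero [simp]: "lift 0 = 0"
  and lift_one [simp]: "lift 1 = 1"
  and lift_add: "lift (f + g) = lift f + lift g"
  and lift_diff: "lift (f - g) = lift f - lift g"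
  and lift_scaleR: "lift (r *\<^sub>R f) = r *\<^sub>R lift f"
  and lift_scalar_fun: "lift (scalar_fun h) = scalar_fun (\<lambda>v. h (base_point v))"
  and lift_twist: "lift (twist b f) = twist b (lift f)"
  by (auto intro!: sfun_eqI simp: coeff_lift coeff_one coeff_scalar_fun coeff_twist vimage_Inl_empty_iff card_vimage_Inl)

lemma lift_sum: "lift (sum f A) = (\<Sum>a\<in>A. lift (f a))"
  by (induction A rule: infinite_finite_induct) (auto simp: lift_add)

lemma sgn_shuffle_Inl: "sgn_shuffle (Inl ` I) (Inl ` J :: ('i::{finite,linorder} + 'i) set) = sgn_shuffle I J"
proof -
  have "card {(i, j). i \<in> Inl ` I \<and> j \<in> (Inl ` J :: ('i + 'i) set) \<and> j < i} = card {(i, j). i \<in> I \<and> j \<in> J \<and> j < i}"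
    by (rule bij_betw_same_card[symmetric, of "map_prod Inl Inl"]) (auto simp: bij_betw_def inj_on_def)
  then show ?thesis by (simp add: sgn_shuffle_def)
qed

text \<open>\<open>Inl\<close> preserves the order of indices and hence the shuffle signs; if a set
  leaves \<open>range Inl\<close>, so does a part of every splitting of it.\<close>

lemma lift_mult: "lift (f * g) = lift f * lift g"
proof (rule sfun_eqI)
  fix K :: "('a + 'a) set" and v
  show "coeff (lift (f * g)) K v = coeff (lift f * lift g) K v"
  proof (cases "K \<subseteq> range Inl")
    case True
    have "coeff (lift f * lift g) K v
        = (\<Sum>J\<in>Pow (Inl -` K). sgn_shuffle J (Inl -` K - J) * coeff f J (base_point v) * coeff g (Inl -` K - J) (base_point v))"
      unfolding coeff_mult
    proof (rule sum.reindex_bij_witness[of _ "(`) Inl" "(-`) Inl"])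
      fix J assume "J \<in> Pow K"
      then have J: "J \<subseteq> range Inl" "K - J \<subseteq> range Inl" "J \<subseteq> K" using True by auto
      then show "Inl ` (Inl -` J) = J" by auto
      have "Inl -` K - Inl -` J = Inl -` (K - J)" by auto
      moreover have "sgn_shuffle (Inl -` J) (Inl -` (K - J)) = sgn_shuffle J (K - J)"
        using sgn_shuffle_Inl[of "Inl -` J" "Inl -` (K - J)"] J by (simp add: image_vimage_eq Int_absorb2)
      ultimately show "sgn_shuffle (Inl -` J) (Inl -` K - Inl -` J) * coeff f (Inl -` J) (base_point v)
          * coeff g (Inl -` K - Inl -` J) (base_point v)
        = sgn_shuffle J (K - J) * coeff (lift f) J v * coeff (lift g) (K - J) v"
        using J by (simp add: coeff_lift)
    qed auto
    then show ?thesis using True by (simp add: coeff_lift coeff_mult)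
  next
    case False
    have "coeff (lift f) J v * coeff (lift g) (K - J) v = 0" for J
      using False by (auto simp: coeff_lift)
    then have "coeff (lift f * lift g) K v = 0"
      unfolding coeff_mult by (intro sum.neutral) (simp add: mult.assoc)
    then show ?thesis
      using False by (simp add: coeff_lift)
  qed
qed

lemma lift_power: "lift (f ^ n) = lift f ^ n"
  by (induction n) (auto simp: lift_mult)

lemma lift_prod_list: "lift (prod_list xs) = prod_list (map lift xs)"
  by (induction xs) (auto simp: lift_mult)

lemma lift_coord: "lift (coord p i) = coord (cot_odd p) (Inl i)"
proof (cases "p i")
  case True
  show ?thesis
  proof (rule sfun_eqI)
    fix I :: "('a + 'a) set" and v
    have iff: "I \<subseteq> range Inl \<and> Inl -` I = {i} \<longleftrightarrow> I = {Inl i}" by (auto simp: set_eq_iff subset_iff)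
    have "coeff (lift (coord p i)) I v = (if I \<subseteq> range Inl \<and> Inl -` I = {i} then 1 else 0)"
      by (simp add: coeff_lift coord_odd[of p, OF True])
    then show "coeff (lift (coord p i)) I v = coeff (coord (cot_odd p) (Inl i)) I v"
      unfolding iff by (simp add: coord_odd[of "cot_odd p"] True)
  qed
next
  case False
  then show ?thesis
    using coord_even[of "cot_odd p" "Inl i"] by (simp add: coord_even lift_scalar_fun)
qed

lemma pd_lift_Inl: "pd (cot_odd p) (Inl i) (lift f) = lift (pd p i f)"
proof (rule sfun_eqI)
  fix I v
  show "coeff (pd (cot_odd p) (Inl i) (lift f)) I v = coeff (lift (pd p i f)) I v"
  proof (cases "p i")
    case True
    have c: "card {j \<in> I. j < Inl i} = card {j \<in> Inl -` I. j < i}" if "I \<subseteq> range Inl"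
    proof -
      have "Inl -` {j \<in> I. j < Inl i} = {j \<in> Inl -` I. j < i}" by auto
      moreover have "{j \<in> I. j < Inl i} \<subseteq> range Inl" using that by auto
      ultimately show ?thesis using card_vimage_Inl by metis
    qed
    have "insert (Inl i) I \<subseteq> range Inl \<longleftrightarrow> I \<subseteq> range Inl" "Inl -` insert (Inl i) I = insert i (Inl -` I)" by auto
    then show ?thesis
      using True c by (simp add: coeff_pd_odd[of "cot_odd p"] coeff_pd_odd[of p] coeff_lift)
  next
    case False
    then show ?thesis
      by (simp add: coeff_pd_even[of "cot_odd p"] coeff_pd_even[of p] coeff_lift coeff_lift_fun partial_base_point_Inl)
  qed
qed

lemma pd_lift_Inr: "pd (cot_odd p) (Inr i) (lift f) = 0"
proof (rule sfun_eqI)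
  fix I :: "('a + 'a) set" and v
  have "Inr i \<notin> (range Inl :: ('a + 'a) set)" by auto
  then show "coeff (pd (cot_odd p) (Inr i) (lift f)) I v = coeff 0 I v"
    by (cases "p i") (simp_all add: coeff_pd_odd[of "cot_odd p"] coeff_pd_even[of "cot_odd p"] coeff_lift coeff_lift_fun partial_base_point_Inr)
qed

section \<open>Domains and index lists of the cotangent bundle\<close>

lemma cot_set_base_point: "v \<in> cot_set p D \<Longrightarrow> base_point v \<in> D"
  by (simp add: cot_set_def)

lemma subset_cot_odd: "I \<subseteq> {A. cot_odd p A} \<Longrightarrow> Inl -` I \<subseteq> {i. p i}"
  by auto

lemma eq_on_lift: "eq_on p D f g \<Longrightarrow> eq_on (cot_odd p) (cot_set p D) (lift f) (lift g)"
  unfolding eq_on_def coeff_lift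
proof (intro allI impI ballI)
  fix I v
  assume *: "\<forall>I\<subseteq>{i. p i}. \<forall>x\<in>D. coeff f I x = coeff g I x"
    and I: "I \<subseteq> {A. cot_odd p A}" and v: "v \<in> cot_set p D"
  from * subset_cot_odd[OF I] cot_set_base_point[OF v]
  show "(if I \<subseteq> range Inl then coeff f (Inl -` I) (base_point v) else 0)
    = (if I \<subseteq> range Inl then coeff g (Inl -` I) (base_point v) else 0)"
    by simp
qed

lemma has_parity_lift: "has_parity p D b f \<Longrightarrow> has_parity (cot_odd p) (cot_set p D) b (lift f)"
  unfolding has_parity_twist_iff
  using eq_on_lift[of p D "twist True f" "psign b *\<^sub>R f"] by (simp add: lift_twist lift_scaleR)

lemma superdomain_cot_set:
  assumes "superdomain p D"
  shows "superdomain (cot_odd p) (cot_set p D)"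
proof -
  obtain U where U: "open U" "D = even_space p \<inter> U"
    using assms unfolding superdomain_def openin_open by blast
  have "continuous_on UNIV base_point"
    unfolding base_point_def by (intro continuous_intros)
  then have "open (base_point -` U)"
    using U(1) open_vimage by blast
  moreover have "cot_set p D = even_space (cot_odd p) \<inter> base_point -` U"
    unfolding cot_set_def U(2) by (auto simp: even_space_def)
  ultimately show ?thesis
    unfolding superdomain_def openin_open by blast
qed

lemma smooth_base_point:
  assumes "superdomain p D" "smooth p D h"
  shows "smooth (cot_odd p) (cot_set p D) (\<lambda>v. h (base_point v))"
  by (rule smooth_compose[OF superdomain_cot_set[OF assms(1)] assms(1) _ cot_set_base_point assms(2)])
     (simp_all add: smooth_component)

lemma smooth_sfun_lift:
  assumes "superdomain p D" "smooth_sfun p D f"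
  shows "smooth_sfun (cot_odd p) (cot_set p D) (lift f)"
  unfolding smooth_sfun_def coeff_lift_fun
  using smooth_base_point[OF assms(1) smooth_sfunD[OF assms(2) subset_cot_odd]] by auto

lemma sorted_list_of_set_eqI: "sorted xs \<Longrightarrow> distinct xs \<Longrightarrow> set xs = A \<Longrightarrow> sorted_list_of_set A = xs"
  using sorted_list_of_set.idem_if_sorted_distinct by blast

lemma sorted_list_of_set_Inl: "sorted_list_of_set (Inl ` I :: ('i::{finite,linorder} + 'i) set) = map Inl (sorted_list_of_set I)"
  by (rule sorted_list_of_set_eqI) (auto simp: sorted_map distinct_map)

lemma sorted_list_of_set_Plus: "sorted_list_of_set (UNIV :: ('i::{finite,linorder} + 'i) set)
    = map Inl (sorted_list_of_set UNIV) @ map Inr (sorted_list_of_set UNIV)"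
  by (rule sorted_list_of_set_eqI) (auto simp: sorted_append sorted_map distinct_map UNIV_sum)

lemma even_list_cot: "even_list (cot_odd p) = map Inr (even_list p) @ map Inl (even_list p)"
  by (simp add: even_list_def sorted_list_of_set_Plus filter_map o_def rev_map)

lemma delta_mult_sum:
  fixes X :: "'a::finite \<Rightarrow> 'b::semiring_1"
  shows "(\<Sum>e\<in>UNIV. (if a = e then 1 else 0) * X e) = X a"
    and "(\<Sum>e\<in>UNIV. X e * (if e = a then 1 else 0)) = X a"
  by (simp_all add: if_distrib[of "\<lambda>z. z * _"] if_distrib[of "\<lambda>z. _ * z"] cong: if_cong)

text \<open>Associativity of matrix products. Entries need not commute, so factors are regrouped but
  never exchanged.\<close>

lemma sum_mult_assoc:
  fixes A :: "'a::finite \<Rightarrow> 'c::semiring_0"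
  shows "(\<Sum>c\<in>UNIV. A c * (\<Sum>e\<in>(UNIV :: 'b::finite set). B c e * C e)) = (\<Sum>e\<in>UNIV. (\<Sum>c\<in>UNIV. A c * B c e) * C e)"
  unfolding sum_distrib_left sum_distrib_right mult.assoc by (rule sum.swap)

text \<open>A map of cotangent superdomains covering \<open>\<phi>\<close>, with any momentum
  components; covering is what makes substitution commute with the bundle projection.\<close>

locale lifted_morphism =
  base: morphism p D D' \<phi> + morphism "cot_odd p" "cot_set p D" "cot_set p D'" \<Phi>
  for p :: "'i::{finite,linorder} \<Rightarrow> bool" and D D' \<phi> \<Phi> +
  assumes Phi_Inl: "\<Phi> (Inl a) = lift (\<phi> a)"
begin

lemma soul_lift: "soul \<Phi> (Inl i) = lift (soul \<phi> i)"
  by (simp add: soul_def Phi_Inl lift_diff lift_scalar_fun coeff_lift_fun)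

text \<open>A function of the base point has no momentum derivatives, so each momentum expansion
  keeps only its term of order 0.\<close>

lemma taylor_Inr: "taylor N \<Phi> (map Inr L @ K) (\<lambda>v. h (base_point v)) = taylor N \<Phi> K (\<lambda>v. h (base_point v))"
proof (induction L)
  case (Cons i L)
  have "(1 / fact k) *\<^sub>R (taylor N \<Phi> (map Inr L @ K) ((partial (Inr i) ^^ k) (\<lambda>v. h (base_point v))) * soul \<Phi> (Inr i) ^ k)
      = (if k = 0 then taylor N \<Phi> K (\<lambda>v. h (base_point v)) else 0)" for k
    using Cons by (cases "k = 0") (simp_all add: partial_funpow_base_point)
  then show ?case by simp
qed simp

text \<open>The cotangent bundle has twice as many coordinates and therefore a longer truncation.
  The extra orders vanish because the powers of the base souls are zero from \<open>CARD('i)\<close>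
  on.\<close>

lemma taylor_Inl:
  assumes "set L \<subseteq> {i. \<not> p i}" "N \<ge> CARD('i)"
  shows "eq_on (cot_odd p) (cot_set p D) (taylor N \<Phi> (map Inl L) (\<lambda>v. h (base_point v))) (lift (taylor CARD('i) \<phi> L h))"
  using assms(1)
proof (induction L arbitrary: h)
  case Nil
  have "base_point (body \<Phi> v) = body \<phi> (base_point v)" for v
    by (simp add: vec_eq_iff body_def Phi_Inl coeff_lift)
  then show ?case by (simp add: lift_scalar_fun)
next
  case (Cons i L)
  let ?t = "trunc (cot_odd p) (cot_set p D)"
  let ?f = "\<lambda>k. (1 / fact k) *\<^sub>R ?t (lift (taylor CARD('i) \<phi> L ((partial i ^^ k) h) * soul \<phi> i ^ k))"
  have IH: "?t (taylor N \<Phi> (map Inl L) ((partial (Inl i) ^^ k) (\<lambda>v. h (base_point v))))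
      = ?t (lift (taylor CARD('i) \<phi> L ((partial i ^^ k) h)))" for k
    using Cons by (simp add: partial_funpow_base_point eq_on_trunc)
  have "?t (taylor N \<Phi> (map Inl (i # L)) (\<lambda>v. h (base_point v))) = (\<Sum>k\<le>N. ?f k)"
    by (simp add: trunc_simps IH soul_lift lift_mult lift_power)
  also have "\<dots> = (\<Sum>k\<le>CARD('i). ?f k)"
  proof (rule sum.mono_neutral_right)
    show "\<forall>k\<in>{..N} - {..CARD('i)}. ?f k = 0"
    proof
      fix k assume k: "k \<in> {..N} - {..CARD('i)}"
      have "\<not> p i" using Cons.prems by simp
      then have "?t (lift (soul \<phi> i ^ k)) = 0"
        using eq_on_lift[OF base.soul_power_zero[of i k]] k by (simp add: eq_on_trunc)
      then show "?f k = 0" by (simp add: lift_mult trunc_mult)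
    qed
  qed (use assms(2) in auto)
  also have "\<dots> = ?t (lift (taylor CARD('i) \<phi> (i # L) h))"
    by (simp add: lift_sum lift_scaleR trunc_sum trunc_scaleR)
  finally show ?case by (simp only: eq_on_trunc)
qed

text \<open>A lift has no terms in odd momenta, so only index sets in the image of
  \<open>Inl\<close> contribute. As \<open>even_list_cot\<close> puts the even momenta first,
  \<open>taylor_Inr\<close> strips them off and \<open>taylor_Inl\<close> treats the rest.\<close>

lemma pb_lift: "eq_on (cot_odd p) (cot_set p D) (pb (lift f)) (lift (base.pb f))"
proof -
  let ?t = "trunc (cot_odd p) (cot_set p D)"
  have C: "CARD('i + 'i) \<ge> CARD('i)" by simp
  have prod: "odd_prod \<Phi> (Inl ` I) = lift (odd_prod \<phi> I)" for I
    by (simp add: odd_prod_def sorted_list_of_set_Inl lift_prod_list Phi_Inl o_def)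
  have "?t (pb (lift f)) = (\<Sum>I\<in>Pow {A. cot_odd p A}. ?t (tay (coeff (lift f) I)) * ?t (odd_prod \<Phi> I))"
    by (rule trunc_pb)
  also have "\<dots> = (\<Sum>I\<in>(`) Inl ` Pow {i. p i}. ?t (tay (coeff (lift f) I)) * ?t (odd_prod \<Phi> I))"
  proof (rule sum.mono_neutral_right)
    show "\<forall>I\<in>Pow {A. cot_odd p A} - (`) Inl ` Pow {i. p i}. ?t (tay (coeff (lift f) I)) * ?t (odd_prod \<Phi> I) = 0"
    proof
      fix I assume I: "I \<in> Pow {A. cot_odd p A} - (`) Inl ` Pow {i. p i}"
      have "\<not> I \<subseteq> range Inl"
      proof
        assume "I \<subseteq> range Inl"
        then have "I = Inl ` (Inl -` I)" by auto
        moreover have "Inl -` I \<in> Pow {i. p i}" using I by auto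
        ultimately show False using I by blast
      qed
      then show "?t (tay (coeff (lift f) I)) * ?t (odd_prod \<Phi> I) = 0" by (simp add: coeff_lift_fun)
    qed
  qed auto
  also have "\<dots> = (\<Sum>I\<in>Pow {i. p i}. ?t (tay (coeff (lift f) (Inl ` I))) * ?t (odd_prod \<Phi> (Inl ` I)))"
    by (subst sum.reindex) (auto intro!: inj_onI simp: inj_image_eq_iff)
  also have "\<dots> = (\<Sum>I\<in>Pow {i. p i}. ?t (lift (base.tay (coeff f I))) * ?t (lift (odd_prod \<phi> I)))"
  proof (intro sum.cong refl arg_cong2[of _ _ _ _ "(*)"])
    fix I
    have "coeff (lift f) (Inl ` I) = (\<lambda>v. coeff f I (base_point v))"
      by (simp add: coeff_lift_fun inj_vimage_image_eq image_mono)
    then have "tay (coeff (lift f) (Inl ` I)) = taylor CARD('i + 'i) \<Phi> (map Inl (even_list p)) (\<lambda>v. coeff f I (base_point v))"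
      by (simp only: even_list_cot taylor_Inr)
    then show "?t (tay (coeff (lift f) (Inl ` I))) = ?t (lift (base.tay (coeff f I)))"
      using taylor_Inl[OF base.evens C] by (simp only: eq_on_trunc)
  qed (simp add: prod)
  also have "\<dots> = ?t (lift (base.pb f))"
    by (simp add: pullback_taylor lift_sum lift_mult trunc_simps)
  finally show ?thesis by (simp only: eq_on_trunc)
qed

end

section \<open>Cotangent lifts of isomorphisms\<close>

text \<open>The transitions of \<open>cotangent\<close> freed from the atlas, with
  \<open>\<psi>\<close> standing for the inverse of \<open>\<phi>\<close>. In this form the
  construction can be applied to its own result.\<close>

definition cot_map ::
    "('i::{finite,linorder} \<Rightarrow> bool) \<Rightarrow> ('i \<Rightarrow> 'i sfun) \<Rightarrow> ('i \<Rightarrow> 'i sfun) \<Rightarrow> 'i + 'i \<Rightarrow> ('i + 'i) sfun" where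
  "cot_map p \<phi> \<psi> A = (case A of Inl a \<Rightarrow> lift (\<phi> a)
    | Inr a \<Rightarrow> (\<Sum>b\<in>UNIV. lift (pullback p \<phi> (pd p a (\<psi> b))) * coord (cot_odd p) (Inr b)))"

lemma cot_map_simps [simp]:
  "cot_map p \<phi> \<psi> (Inl a) = lift (\<phi> a)"
  "cot_map p \<phi> \<psi> (Inr a) = (\<Sum>b\<in>UNIV. lift (pullback p \<phi> (pd p a (\<psi> b))) * coord (cot_odd p) (Inr b))"
  by (simp_all add: cot_map_def)

text \<open>The inverse is part of the data because momenta transform by its Jacobian.\<close>

locale isomorphism =
  morphism p D D' \<phi> + opp: morphism p D' D \<psi>
  for p :: "'i::{finite,linorder} \<Rightarrow> bool" and D D' \<phi> \<psi> +
  assumes inverse: "eq_on p D (pullback p \<phi> (\<psi> i)) (coord p i)"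
    and opp_inverse: "eq_on p D' (pullback p \<psi> (\<phi> i)) (coord p i)"
begin

lemma isomorphism_sym: "isomorphism p D' D \<psi> \<phi>"
  by unfold_locales (rule opp_inverse inverse)+

abbreviation jac :: "'i \<Rightarrow> 'i \<Rightarrow> 'i sfun" where
  "jac a b \<equiv> pd p a (\<phi> b)"

text \<open>The Jacobian of the inverse map, expressed in the source coordinates. It is inverse to
  \<open>jac\<close> on either side by \<open>jac_jinv\<close> and \<open>jinv_jac\<close>.\<close>

abbreviation jinv :: "'i \<Rightarrow> 'i \<Rightarrow> 'i sfun" where
  "jinv a b \<equiv> pb (pd p a (\<psi> b))"

lemma jac_smooth: "smooth_sfun p D (jac a b)"
  by (intro smooth_sfun_pd[OF D] smooth_phi)

lemma jac_parity: "has_parity p D (p a \<noteq> p b) (jac a b)"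
  by (rule has_parity_pd'[OF D smooth_phi parity_phi]) auto

lemma jinv_smooth: "smooth_sfun p D (jinv a b)"
  by (intro pb_smooth smooth_sfun_pd[OF D'] opp.smooth_phi)

lemma jinv_parity: "has_parity p D (p a \<noteq> p b) (jinv a b)"
  by (intro pb_parity smooth_sfun_pd[OF D'] opp.smooth_phi has_parity_pd'[OF D' opp.smooth_phi opp.parity_phi]) auto

text \<open>The chain rule for \<open>\<psi>\<close> after \<open>\<phi>\<close>, which is the
  identity.\<close>

lemma jac_jinv: "eq_on p D (\<Sum>c\<in>UNIV. jac a c * jinv c b) (if a = b then 1 else 0)"
proof -
  have "eq_on p D (\<Sum>c\<in>UNIV. jac a c * jinv c b) (pd p a (pb (\<psi> b)))"
    by (rule eq_on_sym[OF pb_chain[OF opp.smooth_phi]])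
  also have "eq_on p D \<dots> (pd p a (coord p b))"
    by (rule pd_cong[OF D inverse])
  finally show ?thesis by (simp add: pd_coord)
qed

text \<open>A matrix argument. For \<open>X = pb (opp.pb jac)\<close> one has
  \<open>jinv X = 1\<close>, by pulling back \<open>jac_jinv\<close> for the inverse isomorphism.
  With \<open>jac jinv = 1\<close> this gives
  \<open>X = (jac jinv) X = jac (jinv X) = jac\<close>.\<close>

lemma pb_opp_jac: "eq_on p D (pb (opp.pb (jac a b))) (jac a b)"
proof -
  interpret inv: isomorphism p D' D \<psi> \<phi> by (rule isomorphism_sym)
  let ?t = "trunc p D" and ?X = "\<lambda>a b. pb (opp.pb (jac a b))"
  have *: "eq_on p D (\<Sum>c\<in>UNIV. jinv a c * ?X c b) (if a = b then 1 else 0)" for a b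
  proof -
    have sm: "smooth_sfun p D' (pd p a (\<psi> c) * opp.pb (jac c b))" for c
      by (intro smooth_sfun_mult[OF D'] inv.jac_smooth inv.jinv_smooth)
    have "eq_on p D (\<Sum>c\<in>UNIV. jinv a c * ?X c b) (\<Sum>c\<in>UNIV. pb (pd p a (\<psi> c) * opp.pb (jac c b)))"
      by (intro eq_on_sum eq_on_sym[OF pb_mult] inv.jac_smooth inv.jinv_smooth)
    also have "eq_on p D \<dots> (pb (\<Sum>c\<in>UNIV. pd p a (\<psi> c) * opp.pb (jac c b)))"
      by (rule eq_on_sym[OF pb_sum]) (rule sm)
    also have "eq_on p D \<dots> (pb (if a = b then 1 else 0))"
      by (rule pb_cong[OF inv.jac_jinv])
    finally show ?thesis by (cases "a = b") simp_all
  qed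
  have "eq_on p D (\<Sum>c\<in>UNIV. jac a c * (\<Sum>e\<in>UNIV. jinv c e * ?X e b)) (\<Sum>c\<in>UNIV. jac a c * (if c = b then 1 else 0))"
    by (intro eq_on_sum eq_on_mult eq_on_refl *)
  moreover have "eq_on p D (\<Sum>e\<in>UNIV. (\<Sum>c\<in>UNIV. jac a c * jinv c e) * ?X e b) (\<Sum>e\<in>UNIV. (if a = e then 1 else 0) * ?X e b)"
    by (intro eq_on_sum eq_on_mult eq_on_refl jac_jinv)
  ultimately show ?thesis
    unfolding sum_mult_assoc delta_mult_sum by (simp add: eq_on_trunc)
qed

text \<open>The pullback of \<open>jac_jinv\<close> for the inverse isomorphism; the factor
  \<open>pb (opp.pb jac)\<close> that appears in it is \<open>jac\<close> by
  \<open>pb_opp_jac\<close>.\<close>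

lemma jinv_jac: "eq_on p D (\<Sum>c\<in>UNIV. jinv a c * jac c b) (if a = b then 1 else 0)"
proof -
  interpret inv: isomorphism p D' D \<psi> \<phi> by (rule isomorphism_sym)
  have "eq_on p D (\<Sum>c\<in>UNIV. jinv a c * jac c b) (\<Sum>c\<in>UNIV. jinv a c * pb (opp.pb (jac c b)))"
    by (intro eq_on_sum eq_on_mult eq_on_refl eq_on_sym[OF pb_opp_jac])
  also have "eq_on p D \<dots> (\<Sum>c\<in>UNIV. pb (pd p a (\<psi> c) * opp.pb (jac c b)))"
    by (intro eq_on_sum eq_on_sym[OF pb_mult] inv.jac_smooth inv.jinv_smooth)
  also have "eq_on p D \<dots> (pb (\<Sum>c\<in>UNIV. pd p a (\<psi> c) * opp.pb (jac c b)))"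
    by (rule eq_on_sym[OF pb_sum]) (intro smooth_sfun_mult[OF D'] inv.jac_smooth inv.jinv_smooth)
  also have "eq_on p D \<dots> (pb (if a = b then 1 else 0))"
    by (rule pb_cong[OF inv.jac_jinv])
  finally show ?thesis by (cases "a = b") simp_all
qed

text \<open>The chain rule solved by the inverse Jacobian: derivatives in the target are expressed
  by derivatives in the source.\<close>

lemma jinv_pd_pb:
  assumes "smooth_sfun p D' f"
  shows "eq_on p D (\<Sum>c\<in>UNIV. jinv a c * pd p c (pb f)) (pb (pd p a f))"
proof -
  have "eq_on p D (\<Sum>c\<in>UNIV. jinv a c * pd p c (pb f)) (\<Sum>c\<in>UNIV. jinv a c * (\<Sum>e\<in>UNIV. jac c e * pb (pd p e f)))"
    by (intro eq_on_sum eq_on_mult eq_on_refl pb_chain assms)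
  also have "\<dots> = (\<Sum>e\<in>UNIV. (\<Sum>c\<in>UNIV. jinv a c * jac c e) * pb (pd p e f))"
    by (rule sum_mult_assoc)
  also have "eq_on p D \<dots> (\<Sum>e\<in>UNIV. (if a = e then 1 else 0) * pb (pd p e f))"
    by (intro eq_on_sum eq_on_mult eq_on_refl jinv_jac)
  finally show ?thesis by (simp only: delta_mult_sum)
qed

section \<open>The canonical lift to the cotangent bundles\<close>

abbreviation P :: "'i + 'i \<Rightarrow> bool" where "P \<equiv> cot_odd p"
abbreviation E :: "('i + 'i) point set" where "E \<equiv> cot_set p D"
abbreviation E' :: "('i + 'i) point set" where "E' \<equiv> cot_set p D'"
abbreviation \<Phi> :: "'i + 'i \<Rightarrow> ('i + 'i) sfun" where "\<Phi> \<equiv> cot_map p \<phi> \<psi>"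
abbreviation \<Psi> :: "'i + 'i \<Rightarrow> ('i + 'i) sfun" where "\<Psi> \<equiv> cot_map p \<psi> \<phi>"
abbreviation \<zeta> :: "'i \<Rightarrow> ('i + 'i) sfun" where "\<zeta> a \<equiv> coord P (Inr a)"

text \<open>The body lands in \<open>E'\<close> because parity kills the body of every odd
  component, while the even momenta are not constrained by \<open>cot_set\<close>.\<close>

lemma cot_morphism: "morphism P E E' \<Phi>"
proof
  show E: "superdomain P E" and "superdomain P E'"
    using superdomain_cot_set D D' by blast+
  show "smooth_sfun P E (\<Phi> A)" for A
    by (cases A) (auto intro!: smooth_sfun_lift[OF D] smooth_phi jinv_smooth smooth_sfun_sum[OF E] smooth_sfun_mult[OF E] smooth_sfun_coord[OF E])
  show par: "has_parity P E (P A) (\<Phi> A)" for A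
  proof (cases A)
    case (Inr a)
    have "has_parity P E (p b) (\<zeta> b)" for b
      using has_parity_coord[of P E "Inr b"] by simp
    then show ?thesis
      unfolding Inr cot_map_simps cot_odd_simps
      by (intro has_parity_sum has_parity_mult'[OF has_parity_lift[OF jinv_parity]]) auto
  qed (simp add: has_parity_lift parity_phi)
  show "body \<Phi> v \<in> E'" if v: "v \<in> E" for v
  proof -
    have "base_point (body \<Phi> v) = body \<phi> (base_point v)"
      by (simp add: vec_eq_iff body_def coeff_lift)
    moreover have "body \<Phi> v \<in> even_space P"
      using par v by (fastforce simp: even_space_def body_def has_parity_def)
    ultimately show ?thesis
      using body_phi v by (simp add: cot_set_def)
  qed
qed

sublocale cot: lifted_morphism p D D' \<phi> \<Phi>
proof -
  interpret c: morphism P E E' \<Phi> by (rule cot_morphism)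
  show "lifted_morphism p D D' \<phi> \<Phi>"
    by unfold_locales simp
qed

text \<open>On momenta the pullback turns the coefficients \<open>opp.pb (jac a b)\<close> into
  \<open>jac a b\<close>, which then cancels against the \<open>jinv\<close> contained in
  \<open>\<Phi>\<close>.\<close>

lemma pb_cot_inverse: "eq_on P E (cot.pb (\<Psi> A)) (coord P A)"
proof (cases A)
  case (Inl a)
  have "eq_on P E (cot.pb (lift (\<psi> a))) (lift (pb (\<psi> a)))"
    by (rule cot.pb_lift)
  also have "eq_on P E \<dots> (lift (coord p a))"
    by (rule eq_on_lift[OF inverse])
  finally show ?thesis by (simp add: Inl lift_coord)
next
  case (Inr a)
  interpret inv: isomorphism p D' D \<psi> \<phi> by (rule isomorphism_sym)
  let ?b = "\<lambda>b. opp.pb (jac a b)"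
  have sm: "smooth_sfun P E' (lift (?b b))" "smooth_sfun P E' (\<zeta> b)" for b
    by (intro smooth_sfun_lift[OF D'] inv.jinv_smooth, rule smooth_sfun_coord[OF cot.D'])
  have "eq_on P E (cot.pb (\<Psi> A)) (\<Sum>b\<in>UNIV. cot.pb (lift (?b b) * \<zeta> b))"
    unfolding Inr cot_map_simps by (rule cot.pb_sum) (intro smooth_sfun_mult[OF cot.D'] sm)
  also have "eq_on P E \<dots> (\<Sum>b\<in>UNIV. cot.pb (lift (?b b)) * cot.pb (\<zeta> b))"
    by (intro eq_on_sum cot.pb_mult sm)
  also have "eq_on P E \<dots> (\<Sum>b\<in>UNIV. lift (pb (?b b)) * \<Phi> (Inr b))"
    unfolding cot.pb_coord by (intro eq_on_sum eq_on_mult cot.pb_lift eq_on_refl)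
  also have "eq_on P E \<dots> (\<Sum>b\<in>UNIV. lift (jac a b) * (\<Sum>c\<in>UNIV. lift (jinv b c) * \<zeta> c))"
    unfolding cot_map_simps by (intro eq_on_sum eq_on_mult eq_on_lift pb_opp_jac eq_on_refl)
  also have "\<dots> = (\<Sum>c\<in>UNIV. lift (\<Sum>b\<in>UNIV. jac a b * jinv b c) * \<zeta> c)"
    by (simp only: sum_mult_assoc lift_sum lift_mult)
  also have "eq_on P E \<dots> (\<Sum>c\<in>UNIV. lift (if a = c then 1 else 0) * \<zeta> c)"
    by (intro eq_on_sum eq_on_mult eq_on_lift jac_jinv eq_on_refl)
  also have "\<dots> = (\<Sum>c\<in>UNIV. (if a = c then 1 else 0) * \<zeta> c)"
    by (intro sum.cong) auto
  finally show ?thesis by (simp only: delta_mult_sum Inr)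
qed

text \<open>Makes the construction iterable: what is proved for \<open>\<phi>\<close> and its lift
  \<open>\<Phi>\<close> also holds for \<open>\<Phi>\<close> and its lift to the second cotangent
  bundle.\<close>

lemma cot_isomorphism: "isomorphism P E E' \<Phi> \<Psi>"
proof -
  interpret inv: isomorphism p D' D \<psi> \<phi> by (rule isomorphism_sym)
  interpret c: morphism P E E' \<Phi> by (rule cot_morphism)
  interpret d: morphism P E' E \<Psi> by (rule inv.cot_morphism)
  show ?thesis
    by unfold_locales (rule pb_cot_inverse inv.pb_cot_inverse)+
qed

end

section \<open>Invariance of the Poisson bracket\<close>

text \<open>The table of the canonical brackets \<open>{X, Y}\<close> of the coordinates. The
  bracket of a position with its momentum differs from the opposite one by minus the parity sign, as
  the bracket is even.\<close>

definition poisson_coord :: "('i \<Rightarrow> bool) \<Rightarrow> 'i + 'i \<Rightarrow> 'i + 'i \<Rightarrow> real" where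
  "poisson_coord p X Y = (case X of
      Inl a \<Rightarrow> (case Y of Inl b \<Rightarrow> 0 | Inr b \<Rightarrow> if a = b then - psign (p a) else 0)
    | Inr a \<Rightarrow> (case Y of Inl b \<Rightarrow> if a = b then 1 else 0 | Inr b \<Rightarrow> 0))"

lemma poisson_coord_simps [simp]:
  "poisson_coord p (Inl a) (Inl b) = 0" "poisson_coord p (Inr a) (Inr b) = 0"
  "poisson_coord p (Inl a) (Inr b) = (if a = b then - psign (p a) else 0)"
  "poisson_coord p (Inr a) (Inl b) = (if a = b then 1 else 0)"
  by (simp_all add: poisson_coord_def)

text \<open>The bracket as a constant bivector with positions and momenta on the same footing, so
  that invariance becomes a statement about the brackets of new coordinates. The sign undoes the
  effect of \<open>twist\<close> on a coordinate function.\<close>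

lemma poisson_eq_sum:
  "poisson p f g = (\<Sum>X\<in>UNIV. \<Sum>Y\<in>UNIV. (psign (cot_odd p X \<and> cot_odd p Y) * poisson_coord p X Y) *\<^sub>R
    (pd (cot_odd p) X (twist (cot_odd p Y) f) * pd (cot_odd p) Y g))"
  unfolding poisson_def sum_UNIV_Plus
  by (simp add: if_distrib[of "\<lambda>z. _ * z"] if_distrib[of "\<lambda>z. z *\<^sub>R _"] sum_subtractf sum_negf cong: if_cong)

lemma poisson_coord_right:
  "poisson p f (coord (cot_odd p) (Inl a)) = psign (p a) *\<^sub>R pd (cot_odd p) (Inr a) (twist (p a) f)"
  "poisson p f (coord (cot_odd p) (Inr a)) = - pd (cot_odd p) (Inl a) (twist (p a) f)"
  unfolding poisson_def pd_coord
  by (simp_all add: if_distrib[of "\<lambda>z. _ * z"] sum_negf cong: if_cong)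

text \<open>The field \<open>{f, }\<close> applied to \<open>g\<close>. It turns the transformation
  rule for the components of a Hamiltonian field into brackets with transition functions.\<close>

lemma poisson_vf_apply: "poisson p f g = (\<Sum>Z\<in>UNIV. poisson p f (coord (cot_odd p) Z) * pd (cot_odd p) Z g)"
  unfolding sum_UNIV_Plus poisson_coord_right by (simp add: poisson_def sum_subtractf sum_negf)

lemma poisson_cong:
  assumes "superdomain (cot_odd p) E" "eq_on (cot_odd p) E f f'" "eq_on (cot_odd p) E g g'"
  shows "eq_on (cot_odd p) E (poisson p f g) (poisson p f' g')"
  unfolding poisson_def
  by (intro eq_on_sum eq_on_diff eq_on_mult eq_on_scaleR pd_cong[OF assms(1)] eq_on_twist assms(2,3))

lemma poisson_smooth:
  assumes "superdomain (cot_odd p) E" "smooth_sfun (cot_odd p) E f" "smooth_sfun (cot_odd p) E g"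
  shows "smooth_sfun (cot_odd p) E (poisson p f g)"
  unfolding poisson_def
  by (intro smooth_sfun_intros[OF assms(1)] assms(2,3))

text \<open>Serves to merge the two parts of the field on the double into the Hamiltonian field of
  the single function \<open>Q + S\<close>.\<close>

lemma poisson_add_left:
  assumes E: "superdomain (cot_odd p) E" and sm: "smooth_sfun (cot_odd p) E f" "smooth_sfun (cot_odd p) E f'"
  shows "eq_on (cot_odd p) E (poisson p (f + f') g) (poisson p f g + poisson p f' g)"
proof -
  have "eq_on (cot_odd p) E (pd (cot_odd p) X (twist b (f + f'))) (pd (cot_odd p) X (twist b f) + pd (cot_odd p) X (twist b f'))" for X b
    unfolding twist_add by (intro pd_add[OF E] smooth_sfun_twist[OF E] sm)
  then show ?thesis
    unfolding poisson_def sum.distrib[symmetric]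
    by (simp add: eq_on_trunc trunc_simps algebra_simps)
qed

section \<open>Derivatives of fibrewise linear functions\<close>

context
  fixes p :: "'i::{finite,linorder} \<Rightarrow> bool" and D
  assumes D: "superdomain p D"
begin

private lemma E: "superdomain (cot_odd p) (cot_set p D)"
  by (rule superdomain_cot_set[OF D])

lemma pd_Inr_lift_mult:
  assumes "smooth_sfun p D f"
  shows "eq_on (cot_odd p) (cot_set p D) (pd (cot_odd p) (Inr a) (lift f * coord (cot_odd p) (Inr c)))
    (if a = c then twist (p a) (lift f) else 0)"
  using pd_mult[OF E smooth_sfun_lift[OF D assms] smooth_sfun_coord[OF E], of "Inr a" "Inr c"]
  by (simp add: pd_lift_Inr pd_coord if_distrib[of "\<lambda>z. _ * z"] cong: if_cong)

lemma pd_Inl_lift_mult: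
  assumes "smooth_sfun p D f"
  shows "eq_on (cot_odd p) (cot_set p D) (pd (cot_odd p) (Inl a) (lift f * coord (cot_odd p) (Inr c)))
    (lift (pd p a f) * coord (cot_odd p) (Inr c))"
  using pd_mult[OF E smooth_sfun_lift[OF D assms] smooth_sfun_coord[OF E], of "Inl a" "Inr c"]
  by (simp add: pd_lift_Inl pd_coord)

lemma pd_Inr_linear:
  assumes "\<And>c. smooth_sfun p D (f c)"
  shows "eq_on (cot_odd p) (cot_set p D) (pd (cot_odd p) (Inr a) (\<Sum>c\<in>UNIV. lift (f c) * coord (cot_odd p) (Inr c)))
    (twist (p a) (lift (f a)))"
proof -
  have "eq_on (cot_odd p) (cot_set p D) (pd (cot_odd p) (Inr a) (\<Sum>c\<in>UNIV. lift (f c) * coord (cot_odd p) (Inr c)))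
      (\<Sum>c\<in>UNIV. pd (cot_odd p) (Inr a) (lift (f c) * coord (cot_odd p) (Inr c)))"
    by (intro pd_sum[OF E] smooth_sfun_mult[OF E] smooth_sfun_lift[OF D] smooth_sfun_coord[OF E] assms)
  also have "eq_on (cot_odd p) (cot_set p D) \<dots> (\<Sum>c\<in>UNIV. if a = c then twist (p a) (lift (f c)) else 0)"
    by (intro eq_on_sum pd_Inr_lift_mult assms)
  finally show ?thesis by simp
qed

lemma pd_Inl_linear:
  assumes "\<And>c. smooth_sfun p D (f c)"
  shows "eq_on (cot_odd p) (cot_set p D) (pd (cot_odd p) (Inl a) (\<Sum>c\<in>UNIV. lift (f c) * coord (cot_odd p) (Inr c)))
    (\<Sum>c\<in>UNIV. lift (pd p a (f c)) * coord (cot_odd p) (Inr c))"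
proof -
  have "eq_on (cot_odd p) (cot_set p D) (pd (cot_odd p) (Inl a) (\<Sum>c\<in>UNIV. lift (f c) * coord (cot_odd p) (Inr c)))
      (\<Sum>c\<in>UNIV. pd (cot_odd p) (Inl a) (lift (f c) * coord (cot_odd p) (Inr c)))"
    by (intro pd_sum[OF E] smooth_sfun_mult[OF E] smooth_sfun_lift[OF D] smooth_sfun_coord[OF E] assms)
  also have "eq_on (cot_odd p) (cot_set p D) \<dots> (\<Sum>c\<in>UNIV. lift (pd p a (f c)) * coord (cot_odd p) (Inr c))"
    by (intro eq_on_sum pd_Inl_lift_mult assms)
  finally show ?thesis .
qed

end

section \<open>Canonical brackets under the lift\<close>

context isomorphism
begin

abbreviation tE :: "('i + 'i) sfun \<Rightarrow> ('i + 'i) sfun" where "tE \<equiv> trunc P E"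

lemma tE_lift_cong: "eq_on p D f g \<Longrightarrow> tE (lift f) = tE (lift g)"
  using eq_on_lift by (simp add: eq_on_trunc)

lemma tE_commute:
  assumes "has_parity P E b f" "has_parity P E c g"
  shows "tE f * tE g = psign (b \<and> c) *\<^sub>R (tE g * tE f)"
  using supercommute[OF assms] by (simp add: eq_on_trunc trunc_simps)

lemma zeta_parity: "has_parity P E (p a) (\<zeta> a)"
  using has_parity_coord[of P E "Inr a"] by simp

lemma tE_pd_twist_Phi:
  "tE (pd P X (twist b (\<Phi> Y))) = psign (b \<and> P Y) *\<^sub>R tE (pd P X (\<Phi> Y))"
proof -
  have "eq_on P E (pd P X (twist b (\<Phi> Y))) (pd P X (psign (P Y \<and> b) *\<^sub>R \<Phi> Y))"
    by (rule pd_cong[OF cot.D has_parity_twist[OF cot.parity_phi]])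
  also have "eq_on P E \<dots> (psign (P Y \<and> b) *\<^sub>R pd P X (\<Phi> Y))"
    by (rule pd_scaleR[OF cot.D cot.smooth_phi])
  finally show ?thesis by (simp add: eq_on_trunc trunc_scaleR conj_commute)
qed

lemma tE_pd_Inr_Phi: "tE (pd P (Inr A) (\<Phi> (Inr a))) = psign (p A \<and> p A \<noteq> p a) *\<^sub>R tE (lift (jinv a A))"
proof -
  have "tE (pd P (Inr A) (\<Phi> (Inr a))) = tE (twist (p A) (lift (jinv a A)))"
    using pd_Inr_linear[OF D, of "jinv a" A] jinv_smooth by (simp add: eq_on_trunc)
  also have "\<dots> = psign ((p a \<noteq> p A) \<and> p A) *\<^sub>R tE (lift (jinv a A))"
    using has_parity_twist[OF has_parity_lift[OF jinv_parity], of "p A" a A] by (simp add: eq_on_trunc trunc_scaleR)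
  also have "((p a \<noteq> p A) \<and> p A) = (p A \<and> p A \<noteq> p a)" by auto
  finally show ?thesis .
qed

lemma tE_pd_Inl_Phi: "tE (pd P (Inl A) (\<Phi> (Inr a))) = (\<Sum>c\<in>UNIV. tE (lift (pd p A (jinv a c))) * tE (\<zeta> c))"
  using pd_Inl_linear[OF D, of "jinv a" A] jinv_smooth by (simp add: eq_on_trunc trunc_simps)

lemma tE_poisson: "tE (poisson p f g) = (\<Sum>A\<in>UNIV.
    psign (p A) *\<^sub>R (tE (pd P (Inr A) (twist (p A) f)) * tE (pd P (Inl A) g))
    - tE (pd P (Inl A) (twist (p A) f)) * tE (pd P (Inr A) g))"
  by (simp add: poisson_def trunc_simps)

text \<open>Two positions contain no momenta. A momentum and a position give the product of the
  inverse Jacobian with the Jacobian. Two momenta give the difference of two contractions, which are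
  second derivatives of \<open>\<psi>\<close> in opposite orders.\<close>

lemma poisson_Phi: "eq_on P E (poisson p (\<Phi> X) (\<Phi> Y)) (poisson_coord p X Y *\<^sub>R 1)"
proof -
  have "tE (poisson p (\<Phi> X) (\<Phi> Y)) = poisson_coord p X Y *\<^sub>R tE 1"
  proof (cases X; cases Y)
    fix a b assume "X = Inl a" "Y = Inl b"
    then show ?thesis
      by (simp add: poisson_def pd_lift_Inr flip: lift_twist)
  next
    fix a b assume XY: "X = Inr a" "Y = Inl b"
    have "tE (poisson p (\<Phi> X) (\<Phi> Y)) = (\<Sum>A\<in>UNIV. tE (lift (jinv a A)) * tE (lift (jac A b)))"
      unfolding XY tE_poisson tE_pd_twist_Phi tE_pd_Inr_Phi
      by (intro sum.cong refl) (simp add: pd_lift_Inr pd_lift_Inl psign_def)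
    also have "\<dots> = tE (lift (\<Sum>A\<in>UNIV. jinv a A * jac A b))"
      by (simp add: lift_sum lift_mult trunc_simps)
    also have "\<dots> = tE (lift (if a = b then 1 else 0))"
      by (rule tE_lift_cong[OF jinv_jac])
    finally show ?thesis by (simp add: XY)
  next
    fix a b assume XY: "X = Inl a" "Y = Inr b"
    have "tE (poisson p (\<Phi> X) (\<Phi> Y))
        = - psign (p a \<and> p b) *\<^sub>R (\<Sum>A\<in>UNIV. tE (lift (jinv b A)) * tE (lift (jac A a)))"
      unfolding XY tE_poisson tE_pd_twist_Phi tE_pd_Inr_Phi scaleR_sum_right
    proof (intro sum.cong refl)
      fix A
      have "tE (lift (jac A a)) * tE (lift (jinv b A))
          = psign ((p A \<noteq> p a) \<and> (p b \<noteq> p A)) *\<^sub>R (tE (lift (jinv b A)) * tE (lift (jac A a)))"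
        by (rule tE_commute[OF has_parity_lift[OF jac_parity] has_parity_lift[OF jinv_parity]])
      then show "psign (p A) *\<^sub>R (psign (p A \<and> P (Inl a)) *\<^sub>R tE (pd P (Inr A) (\<Phi> (Inl a))) * tE (pd P (Inl A) (\<Phi> (Inr b))))
          - psign (p A \<and> P (Inl a)) *\<^sub>R tE (pd P (Inl A) (\<Phi> (Inl a))) * (psign (p A \<and> p A \<noteq> p b) *\<^sub>R tE (lift (jinv b A)))
        = - psign (p a \<and> p b) *\<^sub>R (tE (lift (jinv b A)) * tE (lift (jac A a)))"
        by (cases "p a"; cases "p b"; cases "p A"; simp add: pd_lift_Inr pd_lift_Inl)
    qed
    also have "(\<Sum>A\<in>UNIV. tE (lift (jinv b A)) * tE (lift (jac A a))) = tE (lift (\<Sum>A\<in>UNIV. jinv b A * jac A a))"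
      by (simp add: lift_sum lift_mult trunc_simps)
    also have "\<dots> = tE (lift (if b = a then 1 else 0))"
      by (rule tE_lift_cong[OF jinv_jac])
    finally show ?thesis by (auto simp: XY)
  next
    fix a b assume XY: "X = Inr a" "Y = Inr b"
    \<comment> \<open>By \<open>jinv_pd_pb\<close>, \<open>?e a b\<close> is the second derivative
      of \<open>\<psi>\<close> by \<open>a\<close> and \<open>b\<close>, pulled back and paired with
      the momenta.\<close>
    let ?e = "\<lambda>a b. \<Sum>c\<in>UNIV. tE (lift (\<Sum>A\<in>UNIV. jinv a A * pd p A (jinv b c))) * tE (\<zeta> c)"
    have e: "?e a b = (\<Sum>A\<in>UNIV. tE (lift (jinv a A)) * (\<Sum>c\<in>UNIV. tE (lift (pd p A (jinv b c))) * tE (\<zeta> c)))" for a b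
      by (simp only: sum_mult_assoc lift_sum lift_mult trunc_sum trunc_mult)
    have e2: "?e a b = (\<Sum>c\<in>UNIV. tE (lift (pb (pd p a (pd p b (\<psi> c))))) * tE (\<zeta> c))" for a b
      by (simp only: tE_lift_cong[OF jinv_pd_pb[OF smooth_sfun_pd[OF D' opp.smooth_phi]]])
    have "tE (poisson p (\<Phi> X) (\<Phi> Y)) = (\<Sum>A\<in>UNIV.
        tE (lift (jinv a A)) * (\<Sum>c\<in>UNIV. tE (lift (pd p A (jinv b c))) * tE (\<zeta> c))
        - psign (p a \<and> p b) *\<^sub>R (tE (lift (jinv b A)) * (\<Sum>c\<in>UNIV. tE (lift (pd p A (jinv a c))) * tE (\<zeta> c))))"
      unfolding XY tE_poisson tE_pd_twist_Phi tE_pd_Inr_Phi tE_pd_Inl_Phi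
    proof (intro sum.cong[OF refl])
      fix A
      let ?S = "\<lambda>a. \<Sum>c\<in>UNIV. lift (pd p A (jinv a c)) * \<zeta> c"
      have par: "has_parity P E (p a \<noteq> p A) (?S a)"
        by (intro has_parity_sum has_parity_mult'[OF has_parity_lift[OF has_parity_pd[OF D jinv_smooth jinv_parity]] zeta_parity]) auto
      have "tE (?S a) * tE (lift (jinv b A)) = psign ((p a \<noteq> p A) \<and> (p b \<noteq> p A)) *\<^sub>R (tE (lift (jinv b A)) * tE (?S a))"
        by (rule tE_commute[OF par has_parity_lift[OF jinv_parity]])
      moreover have "tE (?S a) = (\<Sum>c\<in>UNIV. tE (lift (pd p A (jinv a c))) * tE (\<zeta> c))" for a
        by (simp add: trunc_simps)
      ultimately have comm: "(\<Sum>c\<in>UNIV. tE (lift (pd p A (jinv a c))) * tE (\<zeta> c)) * tE (lift (jinv b A))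
        = psign ((p a \<noteq> p A) \<and> (p b \<noteq> p A)) *\<^sub>R (tE (lift (jinv b A)) * (\<Sum>c\<in>UNIV. tE (lift (pd p A (jinv a c))) * tE (\<zeta> c)))"
        by simp
      show "psign (p A) *\<^sub>R (psign (p A \<and> P (Inr a)) *\<^sub>R psign (p A \<and> p A \<noteq> p a) *\<^sub>R tE (lift (jinv a A))
            * (\<Sum>c\<in>UNIV. tE (lift (pd p A (jinv b c))) * tE (\<zeta> c)))
          - psign (p A \<and> P (Inr a)) *\<^sub>R (\<Sum>c\<in>UNIV. tE (lift (pd p A (jinv a c))) * tE (\<zeta> c))
            * (psign (p A \<and> p A \<noteq> p b) *\<^sub>R tE (lift (jinv b A)))
        = tE (lift (jinv a A)) * (\<Sum>c\<in>UNIV. tE (lift (pd p A (jinv b c))) * tE (\<zeta> c))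
          - psign (p a \<and> p b) *\<^sub>R (tE (lift (jinv b A)) * (\<Sum>c\<in>UNIV. tE (lift (pd p A (jinv a c))) * tE (\<zeta> c)))"
        using comm by (cases "p a"; cases "p b"; cases "p A"; simp)
    qed
    also have "\<dots> = ?e a b - psign (p a \<and> p b) *\<^sub>R ?e b a"
      by (simp only: e sum_subtractf flip: scaleR_sum_right)
    also have "psign (p a \<and> p b) *\<^sub>R ?e b a = ?e a b"
    proof -
      have "tE (lift (pb (pd p b (pd p a (\<psi> c))))) = psign (p a \<and> p b) *\<^sub>R tE (lift (pb (pd p a (pd p b (\<psi> c)))))" for c
      proof -
        have "eq_on p D (pb (pd p b (pd p a (\<psi> c)))) (pb (psign (p b \<and> p a) *\<^sub>R pd p a (pd p b (\<psi> c))))"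
          by (rule pb_cong[OF pd_commute[OF D' opp.smooth_phi]])
        also have "eq_on p D \<dots> (psign (p b \<and> p a) *\<^sub>R pb (pd p a (pd p b (\<psi> c))))"
          by (intro pb_scaleR smooth_sfun_pd[OF D'] opp.smooth_phi)
        finally show ?thesis
          using tE_lift_cong by (fastforce simp: lift_scaleR trunc_scaleR conj_commute)
      qed
      then show ?thesis
        unfolding e2 by (simp add: scaleR_sum_right)
    qed
    finally show ?thesis by (simp add: XY)
  qed
  then show ?thesis by (simp add: eq_on_trunc trunc_scaleR)
qed

text \<open>The chain rule in both arguments produces two Jacobians of \<open>\<Phi>\<close>. Once
  one of them has been moved next to the other, \<open>poisson_Phi\<close> contracts the pair to the
  constant matrix \<open>poisson_coord\<close>.\<close>

lemma poisson_pb: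
  assumes f: "smooth_sfun P E' f" and g: "smooth_sfun P E' g"
  shows "eq_on P E (poisson p (cot.pb f) (cot.pb g)) (cot.pb (poisson p f g))"
proof -
  let ?c = "\<lambda>Z W. psign (P Z \<and> P W) * poisson_coord p Z W"
  let ?F = "\<lambda>X Y. cot.pb (pd P X (twist (P Y) f))" and ?G = "\<lambda>Y. cot.pb (pd P Y g)"
  note smf = smooth_sfun_twist[OF cot.D' f]
  have f1: "tE (pd P Z (twist b (cot.pb f))) = (\<Sum>X\<in>UNIV. tE (pd P Z (\<Phi> X)) * tE (cot.pb (pd P X (twist b f))))" for Z b
  proof -
    have "eq_on P E (pd P Z (twist b (cot.pb f))) (pd P Z (cot.pb (twist b f)))"
      by (rule pd_cong[OF cot.D eq_on_sym[OF cot.pb_twist[OF f]]])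
    also have "eq_on P E \<dots> (\<Sum>X\<in>UNIV. pd P Z (\<Phi> X) * cot.pb (pd P X (twist b f)))"
      by (rule cot.pb_chain[OF smf])
    finally show ?thesis by (simp add: eq_on_trunc trunc_simps)
  qed
  have g1: "tE (pd P W (cot.pb g)) = (\<Sum>Y\<in>UNIV. tE (pd P W (\<Phi> Y)) * tE (?G Y))" for W
    using cot.pb_chain[OF g] by (simp add: eq_on_trunc trunc_simps)
  \<comment> \<open>The Jacobian entry has parity \<open>P Y \<noteq> P W\<close>; moving it across
    changes the inner twist from \<open>P W\<close> to \<open>P Y\<close>, the one belonging to the
    bracket in the target coordinates.\<close>
  have move: "tE (?F X W) * tE (pd P W (\<Phi> Y)) = psign (P X \<and> (P Y \<noteq> P W)) *\<^sub>R (tE (pd P W (\<Phi> Y)) * tE (?F X Y))" for X Y W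
  proof -
    let ?b = "P Y \<noteq> P W"
    have tw: "tE (twist ?b (?F X W)) = psign (P X \<and> ?b) *\<^sub>R tE (?F X Y)"
    proof -
      have "eq_on P E (twist ?b (?F X W)) (cot.pb (twist ?b (pd P X (twist (P W) f))))"
        by (rule eq_on_sym[OF cot.pb_twist[OF smooth_sfun_pd[OF cot.D' smf]]])
      also have "eq_on P E \<dots> (cot.pb (psign (?b \<and> P X) *\<^sub>R pd P X (twist ?b (twist (P W) f))))"
      proof (rule cot.pb_cong)
        have "trunc P E' (pd P X (twist ?b (twist (P W) f))) = psign (?b \<and> P X) *\<^sub>R trunc P E' (twist ?b (pd P X (twist (P W) f)))"
          using pd_twist[OF cot.D' smf, of X ?b "P W"] by (simp add: eq_on_trunc trunc_scaleR)
        then show "eq_on P E' (twist ?b (pd P X (twist (P W) f))) (psign (?b \<and> P X) *\<^sub>R pd P X (twist ?b (twist (P W) f)))"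
          by (simp only: eq_on_trunc trunc_scaleR) simp
      qed
      also have "twist ?b (twist (P W) f) = twist (P Y) f"
        unfolding twist_twist by (rule arg_cong[of _ _ "\<lambda>b. twist b f"]) auto
      also have "eq_on P E (cot.pb (psign (?b \<and> P X) *\<^sub>R pd P X (twist (P Y) f))) (psign (?b \<and> P X) *\<^sub>R ?F X Y)"
        by (rule cot.pb_scaleR[OF smooth_sfun_pd[OF cot.D' smf]])
      finally show ?thesis by (simp add: eq_on_trunc trunc_scaleR conj_commute)
    qed
    have "has_parity P E ?b (pd P W (\<Phi> Y))"
      by (rule has_parity_pd[OF cot.D cot.smooth_phi cot.parity_phi])
    from has_parity_commute[OF this, of "twist ?b (?F X W)"]
    have "tE (pd P W (\<Phi> Y)) * tE (twist ?b (?F X W)) = tE (?F X W) * tE (pd P W (\<Phi> Y))"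
      by (simp add: eq_on_trunc trunc_mult twist_twist)
    then show ?thesis unfolding tw by simp
  qed
  \<comment> \<open>This is \<open>poisson_Phi\<close> multiplied by
    \<open>psign (P X \<and> P Y)\<close>, so that the signs produced by \<open>move\<close> appear
    under the sum.\<close>
  have br: "(\<Sum>Z\<in>UNIV. \<Sum>W\<in>UNIV. (?c Z W * psign (P X \<and> (P Y \<noteq> P W))) *\<^sub>R (tE (pd P Z (\<Phi> X)) * tE (pd P W (\<Phi> Y))))
      = (psign (P X \<and> P Y) * poisson_coord p X Y) *\<^sub>R tE 1" for X Y
  proof -
    have "poisson_coord p X Y *\<^sub>R tE 1 = tE (poisson p (\<Phi> X) (\<Phi> Y))"
      using poisson_Phi by (simp add: eq_on_trunc trunc_scaleR)
    also have "\<dots> = (\<Sum>Z\<in>UNIV. \<Sum>W\<in>UNIV. (?c Z W * psign (P W \<and> P X)) *\<^sub>R (tE (pd P Z (\<Phi> X)) * tE (pd P W (\<Phi> Y))))"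
      by (simp add: poisson_eq_sum trunc_simps tE_pd_twist_Phi)
    finally have "(psign (P X \<and> P Y) * poisson_coord p X Y) *\<^sub>R tE 1 = (\<Sum>Z\<in>UNIV. \<Sum>W\<in>UNIV.
        (psign (P X \<and> P Y) * (?c Z W * psign (P W \<and> P X))) *\<^sub>R (tE (pd P Z (\<Phi> X)) * tE (pd P W (\<Phi> Y))))"
      by (simp add: scaleR_sum_right flip: scaleR_scaleR)
    moreover have "psign (P X \<and> P Y) * (?c Z W * psign (P W \<and> P X)) = ?c Z W * psign (P X \<and> (P Y \<noteq> P W))" for Z W
      by (cases "P X"; cases "P Y"; cases "P W"; simp)
    ultimately show ?thesis by simp
  qed
  have "tE (poisson p (cot.pb f) (cot.pb g)) = (\<Sum>Z\<in>UNIV. \<Sum>W\<in>UNIV. \<Sum>X\<in>UNIV. \<Sum>Y\<in>UNIV.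
      ?c Z W *\<^sub>R (tE (pd P Z (\<Phi> X)) * (tE (?F X W) * tE (pd P W (\<Phi> Y))) * tE (?G Y)))"
    by (simp add: poisson_eq_sum trunc_simps f1 g1 sum_product scaleR_sum_right mult.assoc)
  also have "\<dots> = (\<Sum>Z\<in>UNIV. \<Sum>W\<in>UNIV. \<Sum>X\<in>UNIV. \<Sum>Y\<in>UNIV.
      ((?c Z W * psign (P X \<and> (P Y \<noteq> P W))) *\<^sub>R (tE (pd P Z (\<Phi> X)) * tE (pd P W (\<Phi> Y)))) * (tE (?F X Y) * tE (?G Y)))"
    unfolding move by (simp add: mult.assoc)
  also have "\<dots> = (\<Sum>X\<in>UNIV. \<Sum>Y\<in>UNIV. \<Sum>Z\<in>UNIV. \<Sum>W\<in>UNIV.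
      ((?c Z W * psign (P X \<and> (P Y \<noteq> P W))) *\<^sub>R (tE (pd P Z (\<Phi> X)) * tE (pd P W (\<Phi> Y)))) * (tE (?F X Y) * tE (?G Y)))"
    unfolding sum.cartesian_product
    by (rule sum.reindex_bij_witness[of _ "\<lambda>(X, Y, Z, W). (Z, W, X, Y)" "\<lambda>(Z, W, X, Y). (X, Y, Z, W)"]) auto
  also have "\<dots> = (\<Sum>X\<in>UNIV. \<Sum>Y\<in>UNIV. ((psign (P X \<and> P Y) * poisson_coord p X Y) *\<^sub>R tE 1) * (tE (?F X Y) * tE (?G Y)))"
    unfolding sum_distrib_right[symmetric] br ..
  also have "\<dots> = (\<Sum>X\<in>UNIV. \<Sum>Y\<in>UNIV. (psign (P X \<and> P Y) * poisson_coord p X Y) *\<^sub>R tE (?F X Y * ?G Y))"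
  proof -
    have "tE 1 * (tE u * tE v) = tE (u * v)" for u v
      using trunc_mult[of P E 1 "u * v"] by (simp add: trunc_mult)
    then show ?thesis by simp
  qed
  also have "\<dots> = tE (cot.pb (poisson p f g))"
  proof -
    let ?h = "\<lambda>X Y. pd P X (twist (P Y) f) * pd P Y g"
    have sm: "smooth_sfun P E' (?h X Y)" for X Y
      by (intro smooth_sfun_mult[OF cot.D'] smooth_sfun_pd[OF cot.D'] smf g)
    have 1: "tE (cot.pb (poisson p f g)) = (\<Sum>X\<in>UNIV. tE (cot.pb (\<Sum>Y\<in>UNIV. ?c X Y *\<^sub>R ?h X Y)))"
      unfolding poisson_eq_sum trunc_sum[symmetric] eq_on_trunc[symmetric]
      by (intro cot.pb_sum smooth_sfun_sum[OF cot.D'] smooth_sfun_scaleR[OF cot.D'] sm)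
    have 2: "tE (cot.pb (\<Sum>Y\<in>UNIV. ?c X Y *\<^sub>R ?h X Y)) = (\<Sum>Y\<in>UNIV. tE (cot.pb (?c X Y *\<^sub>R ?h X Y)))" for X
      unfolding trunc_sum[symmetric] eq_on_trunc[symmetric]
      by (intro cot.pb_sum smooth_sfun_scaleR[OF cot.D'] sm)
    have 3: "tE (cot.pb (?c X Y *\<^sub>R ?h X Y)) = ?c X Y *\<^sub>R tE (cot.pb (?h X Y))" for X Y
      unfolding trunc_scaleR[symmetric] eq_on_trunc[symmetric]
      by (rule cot.pb_scaleR[OF sm])
    have 4: "tE (cot.pb (?h X Y)) = tE (?F X Y * ?G Y)" for X Y
      unfolding eq_on_trunc[symmetric]
      by (intro cot.pb_mult smooth_sfun_pd[OF cot.D'] smf g)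
    show ?thesis unfolding 1 2 3 4 ..
  qed
  finally show ?thesis by (simp only: eq_on_trunc)
qed

text \<open>Components transform by \<open>jac\<close> and momenta by \<open>jinv\<close>, and the
  two cancel.\<close>

lemma vf_hamiltonian_pb:
  assumes Y: "\<And>a. smooth_sfun p D' (Y a)"
    and XY: "\<And>a. eq_on p D (\<Sum>b\<in>UNIV. X b * jac b a) (pb (Y a))"
  shows "eq_on P E (\<Sum>a\<in>UNIV. lift (X a) * \<zeta> a) (cot.pb (\<Sum>a\<in>UNIV. lift (Y a) * \<zeta> a))"
proof -
  have sm: "smooth_sfun P E' (lift (Y a))" "smooth_sfun P E' (\<zeta> a)" for a
    by (intro smooth_sfun_lift[OF D'] Y, rule smooth_sfun_coord[OF cot.D'])
  have "eq_on P E (cot.pb (\<Sum>a\<in>UNIV. lift (Y a) * \<zeta> a)) (\<Sum>a\<in>UNIV. cot.pb (lift (Y a) * \<zeta> a))"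
    by (intro cot.pb_sum smooth_sfun_mult[OF cot.D'] sm)
  also have "eq_on P E \<dots> (\<Sum>a\<in>UNIV. cot.pb (lift (Y a)) * cot.pb (\<zeta> a))"
    by (intro eq_on_sum cot.pb_mult sm)
  also have "eq_on P E \<dots> (\<Sum>a\<in>UNIV. lift (pb (Y a)) * \<Phi> (Inr a))"
    unfolding cot.pb_coord by (intro eq_on_sum eq_on_mult cot.pb_lift eq_on_refl)
  also have "eq_on P E \<dots> (\<Sum>a\<in>UNIV. lift (\<Sum>b\<in>UNIV. X b * jac b a) * (\<Sum>c\<in>UNIV. lift (jinv a c) * \<zeta> c))"
    unfolding cot_map_simps by (intro eq_on_sum eq_on_mult eq_on_refl eq_on_lift eq_on_sym[OF XY])
  also have "\<dots> = (\<Sum>c\<in>UNIV. lift (\<Sum>b\<in>UNIV. X b * (\<Sum>a\<in>UNIV. jac b a * jinv a c)) * \<zeta> c)"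
    by (simp only: sum_mult_assoc lift_sum lift_mult)
  also have "eq_on P E \<dots> (\<Sum>c\<in>UNIV. lift (\<Sum>b\<in>UNIV. X b * (if b = c then 1 else 0)) * \<zeta> c)"
    by (intro eq_on_sum eq_on_mult eq_on_refl eq_on_lift jac_jinv)
  finally show ?thesis
    unfolding delta_mult_sum by (rule eq_on_sym)
qed

end

section \<open>Invariance of the function of a connection\<close>

definition connection_function ::
    "('i::{finite,linorder} \<Rightarrow> bool) \<Rightarrow> ('i \<Rightarrow> 'i \<Rightarrow> 'i \<Rightarrow> 'i sfun) \<Rightarrow> (('i + 'i) + ('i + 'i)) sfun" where
  "connection_function p \<Gamma> =
     (\<Sum>a\<in>UNIV. coord (cot_odd (cot_odd p)) (Inr (Inl a)) * coord (cot_odd (cot_odd p)) (Inr (Inr a)))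
     + (\<Sum>a\<in>UNIV. \<Sum>b\<in>UNIV. \<Sum>e\<in>UNIV. lift (lift (\<Gamma> a b e)) * coord (cot_odd (cot_odd p)) (Inl (Inr e))
          * coord (cot_odd (cot_odd p)) (Inr (Inr b)) * coord (cot_odd (cot_odd p)) (Inr (Inr a)))"

lemma connection_hamiltonian_eq: "connection_hamiltonian M \<Gamma> c = connection_function (odd_coord M) (\<Gamma> c)"
  by (simp add: connection_hamiltonian_def connection_function_def coord_p_def coord_q_def coord_y_def)

text \<open>Three exchanges bring \<open>u\<close> and \<open>w\<close>, in the application two
  Jacobian entries, to the front; each contributes its own sign.\<close>

lemma rearrange_signs:
  fixes x u v w z :: "'a::real_algebra"
  assumes "x * u = s1 *\<^sub>R (u * x)" "v * w = s2 *\<^sub>R (w * v)" "x * w = s3 *\<^sub>R (w * x)"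
  shows "x * (u * v) * (w * z) = (s1 * s2 * s3) *\<^sub>R (u * w * x * v * z)"
proof -
  have "x * (u * v) * (w * z) = (x * u) * (v * w) * z" by (simp only: mult.assoc)
  also have "\<dots> = (s1 * s2) *\<^sub>R (u * (x * w) * v * z)"
    unfolding assms(1,2) by (simp add: mult.assoc)
  also have "\<dots> = (s1 * s2 * s3) *\<^sub>R (u * w * x * v * z)"
    unfolding assms(3) by (simp add: mult.assoc)
  finally show ?thesis .
qed

text \<open>The signs of a term with \<open>\<Gamma>'\<close>: two come from the transformation of
  the momenta \<open>q\<close> in \<open>cot_jinv_Inr_Inr\<close>, three from
  \<open>rearrange_signs\<close>. What remains is the sign in the transformation law of a
  connection.\<close>

lemma sign_identity:
  "psign (b \<and> b \<noteq> b') * (psign (a \<and> a \<noteq> a')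
      * (psign ((a \<noteq> b) \<and> (b' \<noteq> b)) * psign (b' \<and> (a' \<noteq> a)) * psign ((a \<noteq> b) \<and> (a' \<noteq> a))))
    = psign (a' \<and> b' \<noteq> b)"
  by (cases a; cases b; cases a'; cases b'; simp)

section \<open>Blocks of the inverse Jacobian of the lift, and the function \<open>r\<close>\<close>

context isomorphism
begin

lemma cot_jinv_Inl_Inl: "eq_on P E (cot.pb (pd P (Inl a) (\<Psi> (Inl b)))) (lift (jinv a b))"
  using cot.pb_lift by (simp add: pd_lift_Inl)

text \<open>The source of the inhomogeneous term: lifted momenta depend on the base through the
  Jacobian, so second derivatives of \<open>\<phi>\<close> enter the transformation of
  \<open>p_a\<close>, paired with the transformed momenta \<open>\<Phi> (Inr e)\<close>.\<close>

lemma cot_jinv_Inl_Inr: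
  "eq_on P E (cot.pb (pd P (Inl a) (\<Psi> (Inr b))))
    (\<Sum>e\<in>UNIV. lift (\<Sum>d\<in>UNIV. jinv a d * pd p d (jac b e)) * \<Phi> (Inr e))"
proof -
  interpret inv: isomorphism p D' D \<psi> \<phi> by (rule isomorphism_sym)
  let ?h = "\<lambda>e. pd p a (opp.pb (jac b e))"
  have sm: "smooth_sfun P E' (lift (?h e))" "smooth_sfun P E' (\<zeta> e)" for e
    by (intro smooth_sfun_lift[OF D'] smooth_sfun_pd[OF D'] inv.jinv_smooth, rule smooth_sfun_coord[OF cot.D'])
  have "eq_on P E (cot.pb (pd P (Inl a) (\<Psi> (Inr b)))) (cot.pb (\<Sum>e\<in>UNIV. lift (?h e) * \<zeta> e))"
    unfolding cot_map_simps by (intro cot.pb_cong pd_Inl_linear[OF D'] inv.jinv_smooth)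
  also have "eq_on P E \<dots> (\<Sum>e\<in>UNIV. cot.pb (lift (?h e) * \<zeta> e))"
    by (intro cot.pb_sum smooth_sfun_mult[OF cot.D'] sm)
  also have "eq_on P E \<dots> (\<Sum>e\<in>UNIV. cot.pb (lift (?h e)) * cot.pb (\<zeta> e))"
    by (intro eq_on_sum cot.pb_mult sm)
  also have "eq_on P E \<dots> (\<Sum>e\<in>UNIV. lift (pb (?h e)) * \<Phi> (Inr e))"
    unfolding cot.pb_coord by (intro eq_on_sum eq_on_mult cot.pb_lift eq_on_refl)
  also have "eq_on P E \<dots> (\<Sum>e\<in>UNIV. lift (\<Sum>d\<in>UNIV. jinv a d * pd p d (jac b e)) * \<Phi> (Inr e))"
  proof (intro eq_on_sum eq_on_mult eq_on_lift eq_on_refl)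
    fix e
    have "eq_on p D (pb (?h e)) (\<Sum>d\<in>UNIV. jinv a d * pd p d (pb (opp.pb (jac b e))))"
      by (rule eq_on_sym[OF jinv_pd_pb[OF inv.jinv_smooth]])
    also have "eq_on p D \<dots> (\<Sum>d\<in>UNIV. jinv a d * pd p d (jac b e))"
      by (intro eq_on_sum eq_on_mult eq_on_refl pd_cong[OF D] pb_opp_jac)
    finally show "eq_on p D (pb (?h e)) (\<Sum>d\<in>UNIV. jinv a d * pd p d (jac b e))" .
  qed
  finally show ?thesis .
qed

text \<open>Positions do not depend on momenta; hence the momenta \<open>q\<close> transform among
  themselves.\<close>

lemma cot_jinv_Inr_Inl: "cot.pb (pd P (Inr a) (\<Psi> (Inl b))) = 0"
  by (simp add: pd_lift_Inr)

lemma cot_jinv_Inr_Inr: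
  "eq_on P E (cot.pb (pd P (Inr a) (\<Psi> (Inr b)))) (psign (p a \<and> p a \<noteq> p b) *\<^sub>R lift (jac b a))"
proof -
  interpret inv: isomorphism p D' D \<psi> \<phi> by (rule isomorphism_sym)
  have "eq_on P E (cot.pb (pd P (Inr a) (\<Psi> (Inr b)))) (cot.pb (twist (p a) (lift (opp.pb (jac b a)))))"
    unfolding cot_map_simps by (intro cot.pb_cong pd_Inr_linear[OF D'] inv.jinv_smooth)
  also have "eq_on P E \<dots> (lift (pb (twist (p a) (opp.pb (jac b a)))))"
    unfolding lift_twist[symmetric] by (rule cot.pb_lift)
  also have "eq_on P E \<dots> (lift (psign ((p b \<noteq> p a) \<and> p a) *\<^sub>R jac b a))"
  proof (rule eq_on_lift)
    have "eq_on p D (pb (twist (p a) (opp.pb (jac b a)))) (twist (p a) (pb (opp.pb (jac b a))))"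
      by (rule pb_twist[OF inv.jinv_smooth])
    also have "eq_on p D \<dots> (twist (p a) (jac b a))"
      by (rule eq_on_twist[OF pb_opp_jac])
    also have "eq_on p D \<dots> (psign ((p b \<noteq> p a) \<and> p a) *\<^sub>R jac b a)"
      by (rule has_parity_twist[OF jac_parity])
    finally show "eq_on p D (pb (twist (p a) (opp.pb (jac b a)))) (psign ((p b \<noteq> p a) \<and> p a) *\<^sub>R jac b a)" .
  qed
  also have "((p b \<noteq> p a) \<and> p a) = (p a \<and> p a \<noteq> p b)" by auto
  finally show ?thesis by (simp add: lift_scaleR)
qed

text \<open>The premise \<open>law\<close> is the transformation rule of the connection tested on
  one coordinate covector, whence \<open>- \<Gamma>'\<close>. Solved for \<open>\<Gamma>\<close> it
  contains the second derivatives \<open>pd p a (jac b e)\<close>; the same ones enter through the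
  transformation of \<open>p_a\<close>.\<close>

lemma connection_function_pb:
  assumes smG: "\<And>a b e. smooth_sfun p D' (\<Gamma>' a b e)"
    and parG: "\<And>a b e. has_parity p D' (p a \<noteq> (p b \<noteq> p e)) (\<Gamma>' a b e)"
    and law: "\<And>a b e. eq_on p D (pd p a (jac b e) - (\<Sum>c\<in>UNIV. \<Gamma> a b c * jac c e))
      (\<Sum>a'\<in>UNIV. \<Sum>b'\<in>UNIV. psign (p a \<and> p b \<noteq> p b') *\<^sub>R (jac b b' * jac a a' * pb (- \<Gamma>' a' b' e)))"
  shows "eq_on (cot_odd P) (cot_set P E) (connection_function p \<Gamma>)
    (pullback (cot_odd P) (cot_map P \<Phi> \<Psi>) (connection_function p \<Gamma>'))"
proof -
  interpret c2: isomorphism P E E' \<Phi> \<Psi> by (rule cot_isomorphism)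
  let ?t = "trunc (cot_odd P) (cot_set P E)" and ?\<Phi> = "cot_map P \<Phi> \<Psi>"
  let ?L = "\<lambda>f. ?t (lift (lift f))" and ?c = "coord (cot_odd P)"
  define J where "J = (\<lambda>a b. ?L (jac a b))"
  define B where "B = (\<lambda>a b. ?L (jinv a b))"
  define H where "H = (\<lambda>d b e. ?L (pd p d (jac b e)))"
  define G where "G = (\<lambda>a b e. ?L (pb (\<Gamma>' a b e)))"
  define y where "y = (\<lambda>b. ?t (?c (Inl (Inr b))))"
  define q where "q = (\<lambda>b. ?t (?c (Inr (Inr b))))"
  define k where "k = (\<lambda>b. ?t (?c (Inr (Inl b))))"
  define Y where "Y = (\<lambda>e. ?t (lift (\<Phi> (Inr e))))"
  have Lcong: "?L f = ?L g" if "eq_on p D f g" for f g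
    using eq_on_lift[OF eq_on_lift[OF that]] by (simp add: eq_on_trunc)
  have Lmult: "?L (f * g) = ?L f * ?L g" for f g by (simp add: lift_mult trunc_mult)
  have Lsum: "?L (sum f A) = (\<Sum>a\<in>A. ?L (f a))" for f :: "'i \<Rightarrow> _" and A by (simp add: lift_sum trunc_sum)
  have Ldelta: "?L (if a = b then 1 else 0) * ?t z = (if a = b then ?t z else 0)" for a b :: 'i and z
    by (simp flip: trunc_mult)
  have yl: "?c (Inl (Inr b)) = lift (\<zeta> b)" for b by (simp add: lift_coord)
  have Ysum: "Y e = (\<Sum>b\<in>UNIV. B e b * y b)" for e
    by (simp add: Y_def B_def y_def yl lift_sum lift_mult trunc_simps)
  have JB: "(\<Sum>a\<in>UNIV. J b a * B a d) * ?t z = (if b = d then ?t z else 0)" for b d z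
    using Lcong[OF jac_jinv[of b d]] Ldelta[of b d z] unfolding J_def B_def Lsum Lmult by simp
  have ysum: "y c = (\<Sum>e\<in>UNIV. J c e * Y e)" for c
    unfolding Ysum sum_mult_assoc using JB by (simp add: y_def)
  have parJ: "has_parity (cot_odd P) (cot_set P E) (p a \<noteq> p b) (lift (lift (jac a b)))" for a b
    by (intro has_parity_lift jac_parity)
  have parB: "has_parity (cot_odd P) (cot_set P E) (p a \<noteq> p b) (lift (lift (jinv a b)))" for a b
    by (intro has_parity_lift jinv_parity)
  have parH: "has_parity (cot_odd P) (cot_set P E) ((p b \<noteq> p e) \<noteq> p d) (lift (lift (pd p d (jac b e))))" for b d e
    by (intro has_parity_lift has_parity_pd[OF D jac_smooth jac_parity])
  have parGL: "has_parity (cot_odd P) (cot_set P E) (p a \<noteq> (p b \<noteq> p e)) (lift (lift (pb (\<Gamma>' a b e))))" for a b e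
    by (intro has_parity_lift pb_parity smG parG)
  have parY: "has_parity (cot_odd P) (cot_set P E) (p e) (lift (\<Phi> (Inr e)))" for e
    using has_parity_lift[OF cot.parity_phi[of "Inr e"]] by (simp only: cot_odd_simps)
  have parq: "has_parity (cot_odd P) (cot_set P E) (p a) (?c (Inr (Inr a)))" for a
    using has_parity_coord[of "cot_odd P" "cot_set P E" "Inr (Inr a)"] by (simp only: cot_odd_simps)
  have park: "has_parity (cot_odd P) (cot_set P E) (p a) (?c (Inr (Inl a)))" for a
    using has_parity_coord[of "cot_odd P" "cot_set P E" "Inr (Inl a)"] by (simp only: cot_odd_simps)
  \<comment> \<open>The transformed \<open>p_a\<close> is the inverse Jacobian applied to
    \<open>Z\<close>; thus \<open>Z d\<close> is \<open>p_d\<close> together with its inhomogeneous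
    part.\<close>
  define Z where "Z = (\<lambda>d. ?c (Inr (Inl d))
      + (\<Sum>b\<in>UNIV. \<Sum>e\<in>UNIV. lift (lift (pd p d (jac b e))) * lift (\<Phi> (Inr e)) * ?c (Inr (Inr b))))"
  have tZ: "?t (Z d) = k d + (\<Sum>b\<in>UNIV. (\<Sum>e\<in>UNIV. H d b e * Y e) * q b)" for d
    by (simp only: Z_def k_def H_def Y_def q_def trunc_simps sum_distrib_right)
  have parZ: "has_parity (cot_odd P) (cot_set P E) (p d) (Z d)" for d
    unfolding Z_def
    by (intro has_parity_add park has_parity_sum has_parity_mult'[OF has_parity_mult[OF parH parY] parq]) auto
  have K: "?t (?\<Phi> (Inr (Inl a))) = (\<Sum>d\<in>UNIV. B a d * ?t (Z d))" for a
  proof -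
    have "?t (?\<Phi> (Inr (Inl a))) = (\<Sum>b\<in>UNIV. ?t (lift (cot.pb (pd P (Inl a) (\<Psi> (Inl b))))) * k b)
        + (\<Sum>b\<in>UNIV. ?t (lift (cot.pb (pd P (Inl a) (\<Psi> (Inr b))))) * q b)"
      by (simp only: cot_map_simps(2)[of P \<Phi> \<Psi>] sum_UNIV_Plus trunc_simps k_def q_def)
    moreover have "?t (lift (cot.pb (pd P (Inl a) (\<Psi> (Inl b))))) = B a b" for b
      unfolding B_def by (rule c2.tE_lift_cong[OF cot_jinv_Inl_Inl])
    moreover have "?t (lift (cot.pb (pd P (Inl a) (\<Psi> (Inr b))))) = (\<Sum>e\<in>UNIV. (\<Sum>d\<in>UNIV. B a d * H d b e) * Y e)" for b
      unfolding c2.tE_lift_cong[OF cot_jinv_Inl_Inr]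
      by (simp only: lift_sum lift_mult trunc_simps B_def H_def Y_def)
    moreover have "(\<Sum>b\<in>UNIV. (\<Sum>e\<in>UNIV. (\<Sum>d\<in>UNIV. B a d * H d b e) * Y e) * q b)
        = (\<Sum>d\<in>UNIV. B a d * (\<Sum>b\<in>UNIV. (\<Sum>e\<in>UNIV. H d b e * Y e) * q b))"
      by (simp only: sum_mult_assoc[symmetric])
    ultimately show ?thesis
      by (simp only: tZ distrib_left sum.distrib)
  qed
  have Q: "?t (?\<Phi> (Inr (Inr a))) = (\<Sum>b\<in>UNIV. psign (p a \<and> p a \<noteq> p b) *\<^sub>R (J b a * q b))" for a
  proof -
    have "?t (?\<Phi> (Inr (Inr a))) = (\<Sum>b\<in>UNIV. ?t (lift (cot.pb (pd P (Inr a) (\<Psi> (Inl b))))) * k b)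
        + (\<Sum>b\<in>UNIV. ?t (lift (cot.pb (pd P (Inr a) (\<Psi> (Inr b))))) * q b)"
      by (simp only: cot_map_simps(2)[of P \<Phi> \<Psi>] sum_UNIV_Plus trunc_simps k_def q_def)
    moreover have "?t (lift (cot.pb (pd P (Inr a) (\<Psi> (Inr b))))) = psign (p a \<and> p a \<noteq> p b) *\<^sub>R J b a" for b
      unfolding c2.tE_lift_cong[OF cot_jinv_Inr_Inr] by (simp only: lift_scaleR trunc_scaleR J_def)
    ultimately show ?thesis by (simp only: cot_jinv_Inr_Inl) simp
  qed
  \<comment> \<open>\<open>Z\<close> and \<open>q\<close> are contracted through the inverse
    Jacobian and the Jacobian, which cancel; the sign in the transformation of \<open>q\<close> is
    the one for moving the Jacobian to the front.\<close>
  have S1: "(\<Sum>a\<in>UNIV. ?t (?\<Phi> (Inr (Inl a))) * ?t (?\<Phi> (Inr (Inr a)))) = (\<Sum>b\<in>UNIV. ?t (Z b) * q b)"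
  proof -
    have comm: "B a d * ?t (Z d) * J b a = psign (p a \<and> p a \<noteq> p b) *\<^sub>R (J b a * (B a d * ?t (Z d)))" for a b d
    proof -
      have "has_parity (cot_odd P) (cot_set P E) (p a) (lift (lift (jinv a d)) * Z d)"
        by (rule has_parity_mult'[OF parB parZ]) auto
      then have "?t (lift (lift (jinv a d)) * Z d) * J b a
          = psign (p a \<and> p b \<noteq> p a) *\<^sub>R (J b a * ?t (lift (lift (jinv a d)) * Z d))"
        unfolding J_def by (rule c2.tE_commute[OF _ parJ])
      then show ?thesis by (simp add: trunc_mult B_def eq_commute[of "p b"])
    qed
    have "(\<Sum>a\<in>UNIV. ?t (?\<Phi> (Inr (Inl a))) * ?t (?\<Phi> (Inr (Inr a))))
        = (\<Sum>a\<in>UNIV. \<Sum>d\<in>UNIV. \<Sum>b\<in>UNIV. psign (p a \<and> p a \<noteq> p b) *\<^sub>R (B a d * ?t (Z d) * J b a * q b))"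
      by (simp only: K Q sum_product mult_scaleR_right mult.assoc)
    also have "\<dots> = (\<Sum>a\<in>UNIV. \<Sum>d\<in>UNIV. \<Sum>b\<in>UNIV. J b a * B a d * ?t (Z d) * q b)"
      unfolding comm by (simp add: mult.assoc)
    also have "\<dots> = (\<Sum>b\<in>UNIV. \<Sum>d\<in>UNIV. \<Sum>a\<in>UNIV. J b a * B a d * ?t (Z d) * q b)"
      unfolding sum.cartesian_product
      by (rule sum.reindex_bij_witness[of _ "\<lambda>(b, d, a). (a, d, b)" "\<lambda>(a, d, b). (b, d, a)"]) auto
    also have "\<dots> = (\<Sum>b\<in>UNIV. \<Sum>d\<in>UNIV. (if b = d then ?t (Z d) else 0) * q b)"
      by (simp only: sum_distrib_right[symmetric] JB)
    also have "\<dots> = (\<Sum>b\<in>UNIV. ?t (Z b) * q b)"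
      by (simp add: if_distrib[of "\<lambda>z. z * _"] cong: if_cong)
    finally show ?thesis .
  qed
  let ?W = "\<lambda>a2 b2 e a b. psign (p a2 \<and> p b2 \<noteq> p b) *\<^sub>R (J b2 b * J a2 a * (G a b e * Y e) * q b2 * q a2)"
  have S2: "(\<Sum>a\<in>UNIV. \<Sum>b\<in>UNIV. \<Sum>e\<in>UNIV. G a b e * Y e * ?t (?\<Phi> (Inr (Inr b))) * ?t (?\<Phi> (Inr (Inr a))))
      = (\<Sum>a2\<in>UNIV. \<Sum>b2\<in>UNIV. \<Sum>e\<in>UNIV. \<Sum>a\<in>UNIV. \<Sum>b\<in>UNIV. ?W a2 b2 e a b)"
  proof -
    have tm: "G a b e * Y e * (psign (p b \<and> p b \<noteq> p b2) *\<^sub>R (J b2 b * q b2)) * (psign (p a \<and> p a \<noteq> p a2) *\<^sub>R (J a2 a * q a2))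
        = ?W a2 b2 e a b" for a b e a2 b2
    proof -
      have pGY: "has_parity (cot_odd P) (cot_set P E) (p a \<noteq> p b) (lift (lift (pb (\<Gamma>' a b e))) * lift (\<Phi> (Inr e)))"
        by (rule has_parity_mult'[OF parGL parY]) auto
      have GY: "G a b e * Y e = ?t (lift (lift (pb (\<Gamma>' a b e))) * lift (\<Phi> (Inr e)))"
        by (simp only: G_def Y_def trunc_mult)
      have c1: "(G a b e * Y e) * J b2 b = psign ((p a \<noteq> p b) \<and> (p b2 \<noteq> p b)) *\<^sub>R (J b2 b * (G a b e * Y e))"
        unfolding GY J_def by (rule c2.tE_commute[OF pGY parJ])
      have c2: "q b2 * J a2 a = psign (p b2 \<and> (p a2 \<noteq> p a)) *\<^sub>R (J a2 a * q b2)"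
        unfolding q_def J_def by (rule c2.tE_commute[OF parq parJ])
      have c3: "(G a b e * Y e) * J a2 a = psign ((p a \<noteq> p b) \<and> (p a2 \<noteq> p a)) *\<^sub>R (J a2 a * (G a b e * Y e))"
        unfolding GY J_def by (rule c2.tE_commute[OF pGY parJ])
      have "G a b e * Y e * (psign (p b \<and> p b \<noteq> p b2) *\<^sub>R (J b2 b * q b2)) * (psign (p a \<and> p a \<noteq> p a2) *\<^sub>R (J a2 a * q a2))
          = psign (p b \<and> p b \<noteq> p b2) *\<^sub>R psign (p a \<and> p a \<noteq> p a2) *\<^sub>R (G a b e * Y e * (J b2 b * q b2) * (J a2 a * q a2))"
        by (simp only: mult_scaleR_left mult_scaleR_right) (rule scaleR_left_commute)
      then show ?thesis
        unfolding rearrange_signs[OF c1 c2 c3, of "q a2"] scaleR_scaleR sign_identity .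
    qed
    have "(\<Sum>a\<in>UNIV. \<Sum>b\<in>UNIV. \<Sum>e\<in>UNIV. G a b e * Y e * ?t (?\<Phi> (Inr (Inr b))) * ?t (?\<Phi> (Inr (Inr a))))
        = (\<Sum>a\<in>UNIV. \<Sum>b\<in>UNIV. \<Sum>e\<in>UNIV. \<Sum>b2\<in>UNIV. \<Sum>a2\<in>UNIV. ?W a2 b2 e a b)"
      unfolding Q by (simp only: sum_distrib_left[of "G _ _ _ * Y _"] sum_product tm)
    also have "\<dots> = (\<Sum>a2\<in>UNIV. \<Sum>b2\<in>UNIV. \<Sum>e\<in>UNIV. \<Sum>a\<in>UNIV. \<Sum>b\<in>UNIV. ?W a2 b2 e a b)"
      unfolding sum.cartesian_product
      by (rule sum.reindex_bij_witness[of _ "\<lambda>(a2, b2, e, a, b). (a, b, e, b2, a2)" "\<lambda>(a, b, e, b2, a2). (a2, b2, e, a, b)"]) auto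
    finally show ?thesis .
  qed
  \<comment> \<open>The law solved for \<open>\<Gamma>\<close> times the Jacobian: an inhomogeneous
    part \<open>H\<close> and a tensorial part with \<open>G\<close>.\<close>
  have Gam: "(\<Sum>c\<in>UNIV. ?L (\<Gamma> a b c) * J c e) = H a b e
      + (\<Sum>a'\<in>UNIV. \<Sum>b'\<in>UNIV. psign (p a \<and> p b \<noteq> p b') *\<^sub>R (J b b' * J a a' * G a' b' e))" for a b e
  proof -
    have "?L (pb ((- 1) *\<^sub>R \<Gamma>' a' b' e)) = (- 1) *\<^sub>R ?L (pb (\<Gamma>' a' b' e))" for a' b'
      by (simp only: Lcong[OF pb_scaleR[OF smG]] lift_scaleR trunc_scaleR)
    then have "?L (pb (- \<Gamma>' a' b' e)) = - G a' b' e" for a' b'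
      by (simp add: G_def)
    moreover have "?L (pd p a (jac b e) - (\<Sum>c\<in>UNIV. \<Gamma> a b c * jac c e))
        = H a b e - (\<Sum>c\<in>UNIV. ?L (\<Gamma> a b c) * J c e)"
      by (simp only: lift_diff trunc_diff Lsum Lmult H_def J_def)
    moreover have "?L (pd p a (jac b e) - (\<Sum>c\<in>UNIV. \<Gamma> a b c * jac c e))
        = (\<Sum>a'\<in>UNIV. \<Sum>b'\<in>UNIV. psign (p a \<and> p b \<noteq> p b') *\<^sub>R (J b b' * J a a' * ?L (pb (- \<Gamma>' a' b' e))))"
      unfolding Lcong[OF law] by (simp only: Lsum lift_scaleR trunc_scaleR Lmult J_def)
    ultimately show ?thesis
      by (simp add: sum_negf algebra_simps)
  qed
  have "?t (connection_function p \<Gamma>) = (\<Sum>a\<in>UNIV. k a * q a)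
      + (\<Sum>a\<in>UNIV. \<Sum>b\<in>UNIV. (\<Sum>c\<in>UNIV. ?L (\<Gamma> a b c) * y c) * q b * q a)"
    by (simp only: connection_function_def trunc_simps k_def q_def y_def sum_distrib_right)
  moreover have "(\<Sum>c\<in>UNIV. ?L (\<Gamma> a b c) * y c) = (\<Sum>e\<in>UNIV. H a b e * Y e) + (\<Sum>e\<in>UNIV. \<Sum>a'\<in>UNIV. \<Sum>b'\<in>UNIV.
      psign (p a \<and> p b \<noteq> p b') *\<^sub>R (J b b' * J a a' * (G a' b' e * Y e)))" for a b
    unfolding ysum sum_mult_assoc Gam
    by (simp add: distrib_right sum.distrib sum_distrib_right mult.assoc)
  \<comment> \<open>The \<open>H\<close> terms join the momenta \<open>k\<close> to form
    \<open>Z\<close>, which is the right side of \<open>S1\<close>; the \<open>G\<close> terms are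
    the right side of \<open>S2\<close>.\<close>
  moreover have "(\<Sum>a\<in>UNIV. k a * q a) + (\<Sum>a\<in>UNIV. \<Sum>b\<in>UNIV. ((\<Sum>e\<in>UNIV. H a b e * Y e) + (\<Sum>e\<in>UNIV. \<Sum>a'\<in>UNIV. \<Sum>b'\<in>UNIV.
      psign (p a \<and> p b \<noteq> p b') *\<^sub>R (J b b' * J a a' * (G a' b' e * Y e)))) * q b * q a)
    = (\<Sum>b\<in>UNIV. ?t (Z b) * q b) + (\<Sum>a2\<in>UNIV. \<Sum>b2\<in>UNIV. \<Sum>e\<in>UNIV. \<Sum>a\<in>UNIV. \<Sum>b\<in>UNIV. ?W a2 b2 e a b)"
    unfolding tZ by (simp add: distrib_right sum.distrib sum_distrib_right)
  moreover have "(\<Sum>b\<in>UNIV. ?t (Z b) * q b) + (\<Sum>a2\<in>UNIV. \<Sum>b2\<in>UNIV. \<Sum>e\<in>UNIV. \<Sum>a\<in>UNIV. \<Sum>b\<in>UNIV. ?W a2 b2 e a b)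
      = ?t (pullback (cot_odd P) ?\<Phi> (connection_function p \<Gamma>'))"
  proof -
    note D2 = c2.cot.D'
    have smL: "smooth_sfun (cot_odd P) (cot_set P E') (lift (lift (\<Gamma>' a b e)))" for a b e
      by (intro smooth_sfun_lift[OF cot.D'] smooth_sfun_lift[OF D'] smG)
    note sm = smooth_sfun_coord[OF D2] smL
    note smi = smooth_sfun_sum[OF D2] smooth_sfun_mult[OF D2] sm
    have pL: "?t (c2.cot.pb (lift (lift (\<Gamma>' a b e)))) = G a b e" for a b e
    proof -
      have "eq_on (cot_odd P) (cot_set P E) (c2.cot.pb (lift (lift (\<Gamma>' a b e)))) (lift (cot.pb (lift (\<Gamma>' a b e))))"
        by (rule c2.cot.pb_lift)
      also have "eq_on (cot_odd P) (cot_set P E) \<dots> (lift (lift (pb (\<Gamma>' a b e))))"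
        by (rule eq_on_lift[OF cot.pb_lift])
      finally show ?thesis by (simp add: eq_on_trunc G_def)
    qed
    have pm: "?t (c2.cot.pb (f * g)) = ?t (c2.cot.pb f) * ?t (c2.cot.pb g)"
      if "smooth_sfun (cot_odd P) (cot_set P E') f" "smooth_sfun (cot_odd P) (cot_set P E') g" for f g
      using c2.cot.pb_mult[OF that] by (simp add: eq_on_trunc trunc_mult)
    have ps: "?t (c2.cot.pb (sum f A)) = (\<Sum>a\<in>A. ?t (c2.cot.pb (f a)))"
      if "\<And>a. a \<in> A \<Longrightarrow> smooth_sfun (cot_odd P) (cot_set P E') (f a)" for f :: "'i \<Rightarrow> _" and A
      using c2.cot.pb_sum[OF that] by (simp add: eq_on_trunc trunc_sum)
    have pa: "?t (c2.cot.pb (f + g)) = ?t (c2.cot.pb f) + ?t (c2.cot.pb g)"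
      if "smooth_sfun (cot_odd P) (cot_set P E') f" "smooth_sfun (cot_odd P) (cot_set P E') g" for f g
      using c2.cot.pb_add[OF that] by (simp add: eq_on_trunc trunc_add)
    have "?t (c2.cot.pb (connection_function p \<Gamma>'))
        = (\<Sum>a\<in>UNIV. ?t (?\<Phi> (Inr (Inl a))) * ?t (?\<Phi> (Inr (Inr a))))
          + (\<Sum>a\<in>UNIV. \<Sum>b\<in>UNIV. \<Sum>e\<in>UNIV. G a b e * Y e * ?t (?\<Phi> (Inr (Inr b))) * ?t (?\<Phi> (Inr (Inr a))))"
      unfolding connection_function_def
      by (simp add: pa ps pm smi pL c2.cot.pb_coord Y_def del: cot_map_simps(2))
    then show ?thesis unfolding S1 S2 by simp
  qed
  ultimately show ?thesis by (simp only: eq_on_trunc)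
qed

end

section \<open>Weights\<close>

definition wt_degree :: "('i::finite \<Rightarrow> int) \<Rightarrow> ('i \<Rightarrow> nat) \<Rightarrow> int" where
  "wt_degree w m = (\<Sum>i\<in>UNIV. int (m i) * w i)"

definition monomial :: "('i::finite \<Rightarrow> nat) \<Rightarrow> 'i point \<Rightarrow> real" where
  "monomial m x = (\<Prod>i\<in>UNIV. (x $ i) ^ m i)"

lemma monomial_zero [simp]: "monomial (\<lambda>_. 0) x = 1"
  by (simp add: monomial_def)

lemma monomial_add: "monomial (\<lambda>i. m i + n i) x = monomial m x * monomial n x"
  by (simp add: monomial_def power_add prod.distrib)

lemma wt_degree_zero [simp]: "wt_degree w (\<lambda>_. 0) = 0"
  by (simp add: wt_degree_def)

lemma wt_degree_add: "wt_degree w (\<lambda>i. m i + n i) = wt_degree w m + wt_degree w n"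
  by (simp add: wt_degree_def distrib_right sum.distrib)

lemma monomial_upd: "monomial m x = (x $ i) ^ m i * monomial (m(i := 0)) x"
proof -
  have "monomial (m(i := 0)) x = (\<Prod>j\<in>UNIV - {i}. (x $ j) ^ m j)"
    unfolding monomial_def by (subst prod.remove[of _ i]) (auto intro!: prod.cong)
  then show ?thesis
    by (simp add: monomial_def prod.remove[of UNIV i "\<lambda>j. (x $ j) ^ m j"])
qed

lemma wt_degree_upd: "wt_degree w m = int (m i) * w i + wt_degree w (m(i := 0))"
proof -
  have "wt_degree w (m(i := 0)) = (\<Sum>j\<in>UNIV - {i}. int (m j) * w j)"
    unfolding wt_degree_def by (subst sum.remove[of _ i]) (auto intro!: sum.cong)
  then show ?thesis
    by (simp add: wt_degree_def sum.remove[of UNIV i "\<lambda>j. int (m j) * w j"])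
qed

lemma partial_monomial: "partial i (monomial m) x = real (m i) * monomial (m(i := m i - 1)) x"
proof -
  have "monomial (m(i := 0)) (x + t *\<^sub>R axis i 1) = monomial (m(i := 0)) x" for t
    unfolding monomial_def by (intro prod.cong refl) (auto simp: axis_def)
  then have "monomial m (x + t *\<^sub>R axis i 1) = (x $ i + t) ^ m i * monomial (m(i := 0)) x" for t
    using monomial_upd[of m "x + t *\<^sub>R axis i 1" i] by (simp add: axis_def)
  moreover have "((\<lambda>t. (x $ i + t) ^ m i * monomial (m(i := 0)) x) has_real_derivative
      real (m i) * (x $ i) ^ (m i - 1) * monomial (m(i := 0)) x) (at 0)"
    by (auto intro!: derivative_eq_intros)
  ultimately have "partial i (monomial m) x = real (m i) * (x $ i) ^ (m i - 1) * monomial (m(i := 0)) x"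
    unfolding partial_def by (simp add: DERIV_imp_deriv)
  then show ?thesis
    using monomial_upd[of "m(i := m i - 1)" x i] by simp
qed

lemma smooth_monomial: "superdomain p D \<Longrightarrow> smooth p D (monomial m)"
  unfolding monomial_def by (intro smooth_prod smooth_power smooth_component)

text \<open>\<open>weighted_poly\<close> with its exponents and coefficients exposed, so that a
  chosen representation can be passed on and its conditions obtained as rules.\<close>

definition weighted_repr ::
  "('i::finite \<Rightarrow> bool) \<Rightarrow> ('i \<Rightarrow> int) \<Rightarrow> 'i point set \<Rightarrow> (('i \<Rightarrow> nat) \<Rightarrow> bool)
    \<Rightarrow> ('i point \<Rightarrow> real) \<Rightarrow> ('i \<Rightarrow> nat) set \<Rightarrow> (('i \<Rightarrow> nat) \<Rightarrow> 'i point \<Rightarrow> real) \<Rightarrow> bool" where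
  "weighted_repr p w D Q h E g \<longleftrightarrow> finite E
     \<and> (\<forall>m\<in>E. Q m \<and> (\<forall>i. m i \<noteq> 0 \<longrightarrow> \<not> p i \<and> w i \<noteq> 0) \<and> smooth p D (g m)
          \<and> (\<forall>x\<in>D. \<forall>y\<in>D. (\<forall>i. \<not> p i \<and> w i = 0 \<longrightarrow> x $ i = y $ i) \<longrightarrow> g m x = g m y))
     \<and> (\<forall>x\<in>D. h x = (\<Sum>m\<in>E. g m x * monomial m x))"

lemma weighted_poly_repr: "weighted_poly p w D Q h \<longleftrightarrow> (\<exists>E g. weighted_repr p w D Q h E g)"
  unfolding weighted_poly_def weighted_repr_def monomial_def ..

lemma weighted_reprD:
  assumes "weighted_repr p w D Q h E g"
  shows "finite E"
    and "\<And>m. m \<in> E \<Longrightarrow> Q m"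
    and "\<And>m j. m \<in> E \<Longrightarrow> m j \<noteq> 0 \<Longrightarrow> \<not> p j \<and> w j \<noteq> 0"
    and "\<And>m. m \<in> E \<Longrightarrow> smooth p D (g m)"
    and "\<And>m x y. m \<in> E \<Longrightarrow> x \<in> D \<Longrightarrow> y \<in> D \<Longrightarrow> (\<And>i. \<not> p i \<Longrightarrow> w i = 0 \<Longrightarrow> x $ i = y $ i) \<Longrightarrow> g m x = g m y"
    and "\<And>x. x \<in> D \<Longrightarrow> h x = (\<Sum>m\<in>E. g m x * monomial m x)"
  using assms unfolding weighted_repr_def by blast+

lemma weighted_polyI:
  assumes "finite E" "\<And>m. m \<in> E \<Longrightarrow> Q m" "\<And>m j. m \<in> E \<Longrightarrow> m j \<noteq> 0 \<Longrightarrow> \<not> p j \<and> w j \<noteq> 0"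
     "\<And>m. m \<in> E \<Longrightarrow> smooth p D (g m)"
     "\<And>m x y. m \<in> E \<Longrightarrow> x \<in> D \<Longrightarrow> y \<in> D \<Longrightarrow> (\<And>i. \<not> p i \<Longrightarrow> w i = 0 \<Longrightarrow> x $ i = y $ i) \<Longrightarrow> g m x = g m y"
     "\<And>x. x \<in> D \<Longrightarrow> h x = (\<Sum>m\<in>E. g m x * monomial m x)"
  shows "weighted_poly p w D Q h"
  unfolding weighted_poly_repr weighted_repr_def
  by (intro exI[of _ E] exI[of _ g] conjI ballI allI impI) (use assms in \<open>blast+\<close>)

lemma weighted_poly_mono:
  assumes "weighted_poly p w D Q h" "\<And>m. Q m \<Longrightarrow> R m"
  shows "weighted_poly p w D R h"
proof -
  obtain E g where "weighted_repr p w D Q h E g"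
    using assms(1) unfolding weighted_poly_repr by blast
  note E = weighted_reprD[OF this]
  show ?thesis
    by (rule weighted_polyI[OF E(1) assms(2)[OF E(2)] E(3-6)])
qed

lemma weighted_poly_cong:
  assumes "\<And>x. x \<in> D \<Longrightarrow> h x = k x" "weighted_poly p w D Q h"
  shows "weighted_poly p w D Q k"
proof -
  obtain E g where "weighted_repr p w D Q h E g"
    using assms(2) unfolding weighted_poly_repr by blast
  note E = weighted_reprD[OF this]
  show ?thesis
    by (rule weighted_polyI[OF E(1-5) trans[OF assms(1)[symmetric] E(6)]])
qed

lemma weighted_poly_smooth:
  assumes D: "superdomain p D" and "weighted_poly p w D Q h"
  shows "smooth p D h"
proof -
  obtain E g where "weighted_repr p w D Q h E g"
    using assms(2) unfolding weighted_poly_repr by blast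
  note E = weighted_reprD[OF this]
  have "smooth p D (\<lambda>x. \<Sum>m\<in>E. g m x * monomial m x)"
    by (intro smooth_sum smooth_mult D E(4) smooth_monomial)
  from smooth_cong[OF D _ this, of h] E(6) show ?thesis by simp
qed

lemma weighted_poly_zero: "weighted_poly p w D Q (\<lambda>_. 0)"
  by (rule weighted_polyI[of "{}"]) auto

lemma weighted_poly_monomial:
  assumes "Q m" "\<And>i. m i \<noteq> 0 \<Longrightarrow> \<not> p i \<and> w i \<noteq> 0" "smooth p D g"
    "\<And>x y. x \<in> D \<Longrightarrow> y \<in> D \<Longrightarrow> (\<And>i. \<not> p i \<Longrightarrow> w i = 0 \<Longrightarrow> x $ i = y $ i) \<Longrightarrow> g x = g y"
  shows "weighted_poly p w D Q (\<lambda>x. g x * monomial m x)"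
proof (rule weighted_polyI[where E = "{m}" and g = "\<lambda>_. g"])
  show "g x = g y" if "x \<in> D" "y \<in> D" "\<And>i. \<not> p i \<Longrightarrow> w i = 0 \<Longrightarrow> x $ i = y $ i" for x y
    by (rule assms(4)[OF that])
qed (use assms(1-3) in auto)

lemma weighted_poly_add:
  assumes D: "superdomain p D" and "weighted_poly p w D Q h" "weighted_poly p w D Q k"
  shows "weighted_poly p w D Q (\<lambda>x. h x + k x)"
proof -
  obtain E g where "weighted_repr p w D Q h E g"
    using assms(2) unfolding weighted_poly_repr by blast
  note E = weighted_reprD[OF this]
  obtain F f where "weighted_repr p w D Q k F f"
    using assms(3) unfolding weighted_poly_repr by blast
  note F = weighted_reprD[OF this]
  define G where "G = (\<lambda>m x. (if m \<in> E then g m x else 0) + (if m \<in> F then f m x else 0))"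
  have sm: "smooth p D (G m)" for m
  proof -
    have "smooth p D (if m \<in> E then g m else (\<lambda>_. 0))" "smooth p D (if m \<in> F then f m else (\<lambda>_. 0))"
      using E(4) F(4) by auto
    from smooth_add[OF D this] show ?thesis
      unfolding G_def by (simp add: if_distrib[of "\<lambda>h. h _"])
  qed
  have "h x + k x = (\<Sum>m\<in>E \<union> F. G m x * monomial m x)" if "x \<in> D" for x
  proof -
    have "(\<Sum>m\<in>E. g m x * monomial m x) = (\<Sum>m\<in>E \<union> F. (if m \<in> E then g m x else 0) * monomial m x)"
      by (rule sum.mono_neutral_cong_left) (use E(1) F(1) in auto)
    moreover have "(\<Sum>m\<in>F. f m x * monomial m x) = (\<Sum>m\<in>E \<union> F. (if m \<in> F then f m x else 0) * monomial m x)"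
      by (rule sum.mono_neutral_cong_left) (use E(1) F(1) in auto)
    ultimately show ?thesis
      using E(6) F(6) that by (simp add: G_def distrib_right sum.distrib)
  qed
  moreover have "G m x = G m y" if "x \<in> D" "y \<in> D" "\<And>i. \<not> p i \<Longrightarrow> w i = 0 \<Longrightarrow> x $ i = y $ i" for m x y
    using E(5)[OF _ that] F(5)[OF _ that] by (simp add: G_def)
  ultimately show ?thesis
    using E(1-3) F(1-3) sm by (intro weighted_polyI[of "E \<union> F" _ _ _ _ G]) blast+
qed

lemma weighted_poly_sum:
  assumes D: "superdomain p D" and "\<And>a. a \<in> A \<Longrightarrow> weighted_poly p w D Q (h a)"
  shows "weighted_poly p w D Q (\<lambda>x. \<Sum>a\<in>A. h a x)"
  using assms(2)
  by (induction A rule: infinite_finite_induct) (auto intro: weighted_poly_add[OF D] weighted_poly_zero)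

lemma weighted_poly_mult:
  assumes D: "superdomain p D" and "weighted_poly p w D Q h" "weighted_poly p w D R k"
    and QR: "\<And>m n. Q m \<Longrightarrow> R n \<Longrightarrow> T (\<lambda>i. m i + n i)"
  shows "weighted_poly p w D T (\<lambda>x. h x * k x)"
proof -
  obtain E g where "weighted_repr p w D Q h E g"
    using assms(2) unfolding weighted_poly_repr by blast
  note E = weighted_reprD[OF this]
  obtain F f where "weighted_repr p w D R k F f"
    using assms(3) unfolding weighted_poly_repr by blast
  note F = weighted_reprD[OF this]
  have "weighted_poly p w D T (\<lambda>x. (g m x * f n x) * monomial (\<lambda>i. m i + n i) x)" if m: "m \<in> E" and n: "n \<in> F" for m n
  proof (rule weighted_poly_monomial)
    show "T (\<lambda>i. m i + n i)" by (rule QR[OF E(2)[OF m] F(2)[OF n]])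
    show "\<And>i. m i + n i \<noteq> 0 \<Longrightarrow> \<not> p i \<and> w i \<noteq> 0" using E(3)[OF m] F(3)[OF n] by auto
    show "smooth p D (\<lambda>x. g m x * f n x)" by (rule smooth_mult[OF D E(4)[OF m] F(4)[OF n]])
    fix x y assume xy: "x \<in> D" "y \<in> D" "\<And>i. \<not> p i \<Longrightarrow> w i = 0 \<Longrightarrow> x $ i = y $ i"
    show "g m x * f n x = g m y * f n y"
      using E(5)[OF m xy] F(5)[OF n xy] by simp
  qed
  then have "weighted_poly p w D T (\<lambda>x. \<Sum>m\<in>E. \<Sum>n\<in>F. (g m x * f n x) * monomial (\<lambda>i. m i + n i) x)"
    by (intro weighted_poly_sum[OF D])
  moreover have "(\<Sum>m\<in>E. \<Sum>n\<in>F. (g m x * f n x) * monomial (\<lambda>i. m i + n i) x) = h x * k x" if "x \<in> D" for x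
    unfolding E(6)[OF that] F(6)[OF that] sum_product monomial_add
    by (intro sum.cong refl) (simp add: mult_ac)
  ultimately show ?thesis
    by (rule weighted_poly_cong[rotated])
qed

lemma weighted_poly_cmult:
  assumes D: "superdomain p D" and "weighted_poly p w D Q h"
  shows "weighted_poly p w D Q (\<lambda>x. c * h x)"
proof -
  have "weighted_poly p w D (\<lambda>m. m = (\<lambda>_. 0)) (\<lambda>_. c)"
    using weighted_poly_monomial[of "\<lambda>m. m = (\<lambda>_. 0)" "\<lambda>_. 0" p w D "\<lambda>_. c"] by simp
  then show ?thesis
    by (rule weighted_poly_mult[OF D _ assms(2)]) simp
qed

text \<open>If \<open>w i = 0\<close>, coordinate \<open>i\<close> occurs in no monomial and the
  derivative acts on the coefficients; otherwise the coefficients are constant along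
  \<open>i\<close> and it lowers an exponent. Either way the weight drops by
  \<open>w i\<close>.\<close>

lemma weighted_poly_partial:
  assumes D: "superdomain p D" and h: "weighted_poly p w D Q h" and i: "\<not> p i"
    and QR: "\<And>m n. Q m \<Longrightarrow> wt_degree w n = wt_degree w m - w i \<Longrightarrow> R n"
  shows "weighted_poly p w D R (partial i h)"
proof -
  obtain E g where "weighted_repr p w D Q h E g"
    using h unfolding weighted_poly_repr by blast
  note E = weighted_reprD[OF this]
  have "weighted_poly p w D R (partial i (\<lambda>x. g m x * monomial m x))" if m: "m \<in> E" for m
  proof (cases "w i = 0")
    case True
    then have "m i = 0" using E(3)[OF m, of i] by auto
    then have eq: "g m x * partial i (monomial m) x + partial i (g m) x * monomial m x = partial i (g m) x * monomial m x" for x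
      by (simp add: partial_monomial)
    have "weighted_poly p w D R (\<lambda>x. partial i (g m) x * monomial m x)"
    proof (rule weighted_poly_monomial)
      show "R m" using QR[OF E(2)[OF m]] True by simp
      show "smooth p D (partial i (g m))" by (rule smooth_partial[OF E(4)[OF m] i])
      fix x y assume xy: "x \<in> D" "y \<in> D" "\<And>i. \<not> p i \<Longrightarrow> w i = 0 \<Longrightarrow> x $ i = y $ i"
      \<comment> \<open>The coefficient takes equal values at \<open>x\<close> and \<open>y\<close>
        shifted by the same small amount, hence equal derivatives at the two points.\<close>
      have "eventually (\<lambda>t. x + t *\<^sub>R axis i 1 \<in> D \<and> y + t *\<^sub>R axis i 1 \<in> D) (nhds 0)"
        using superdomain_line[OF D xy(1) i] superdomain_line[OF D xy(2) i] by (rule eventually_conj)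
      then show "partial i (g m) x = partial i (g m) y"
        unfolding partial_def
        by (intro deriv_cong_ev refl) (auto elim!: eventually_mono intro!: E(5)[OF m] simp: xy(3))
    qed (use E(3)[OF m] in auto)
    then show ?thesis
      by (rule weighted_poly_cong[rotated])
         (simp add: partial_mult[OF D _ i] smooth_differentiable[OF E(4)[OF m]] smooth_differentiable[OF smooth_monomial[OF D]] eq)
  next
    case False
    have z: "partial i (g m) x = 0" if "x \<in> D" for x
    proof -
      have "deriv (\<lambda>t. g m (x + t *\<^sub>R axis i 1)) 0 = deriv (\<lambda>t. g m x) 0"
      proof (rule deriv_cong_ev[OF _ refl], rule eventually_mono[OF superdomain_line[OF D that i]])
        fix t assume t: "x + t *\<^sub>R axis i 1 \<in> D"
        show "g m (x + t *\<^sub>R axis i 1) = g m x"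
          by (rule E(5)[OF m t that]) (use False in \<open>auto simp: axis_def\<close>)
      qed
      then show ?thesis by (simp add: partial_def)
    qed
    have "weighted_poly p w D R (\<lambda>x. g m x * (real (m i) * monomial (m(i := m i - 1)) x))"
    proof (cases "m i = 0")
      case True
      then show ?thesis by (simp add: weighted_poly_zero)
    next
      case mi: False
      have "weighted_poly p w D R (\<lambda>x. (real (m i) * g m x) * monomial (m(i := m i - 1)) x)"
      proof (rule weighted_poly_monomial)
        have "wt_degree w (m(i := m i - 1)) = wt_degree w m - w i"
          using wt_degree_upd[of w m i] wt_degree_upd[of w "m(i := m i - 1)" i] mi
          by (simp add: of_nat_diff algebra_simps)
        then show "R (m(i := m i - 1))" by (rule QR[OF E(2)[OF m]])
        show "\<not> p j \<and> w j \<noteq> 0" if "(m(i := m i - 1)) j \<noteq> 0" for j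
          using that E(3)[OF m, of j] False i by (auto split: if_splits)
        show "smooth p D (\<lambda>x. real (m i) * g m x)" by (rule smooth_cmult[OF D E(4)[OF m]])
        show "real (m i) * g m x = real (m i) * g m y"
          if "x \<in> D" "y \<in> D" "\<And>i. \<not> p i \<Longrightarrow> w i = 0 \<Longrightarrow> x $ i = y $ i" for x y
          by (rule arg_cong[OF E(5)[OF m that]])
      qed
      then show ?thesis by (simp add: mult_ac)
    qed
    then show ?thesis
      by (rule weighted_poly_cong[rotated])
         (simp add: partial_mult[OF D _ i] smooth_differentiable[OF E(4)[OF m]] smooth_differentiable[OF smooth_monomial[OF D]] z partial_monomial)
  qed
  then have "weighted_poly p w D R (\<lambda>x. \<Sum>m\<in>E. partial i (\<lambda>x. g m x * monomial m x) x)"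
    by (intro weighted_poly_sum[OF D])
  moreover have "(\<Sum>m\<in>E. partial i (\<lambda>x. g m x * monomial m x) x) = partial i h x" if x: "x \<in> D" for x
  proof -
    have "partial i h x = partial i (\<lambda>x. \<Sum>m\<in>E. g m x * monomial m x) x"
      by (rule partial_cong[OF D x i E(6)])
    also have "\<dots> = (\<Sum>m\<in>E. partial i (\<lambda>x. g m x * monomial m x) x)"
      by (intro partial_sum[OF D x i] smooth_mult[OF D] E(4) smooth_monomial[OF D])
    finally show ?thesis ..
  qed
  ultimately show ?thesis by (rule weighted_poly_cong[rotated])
qed

text \<open>Superfunctions all of whose terms have weight in \<open>K\<close>; this covers both \<open>has_weight\<close>, for a
  singleton, and \<open>superfunction\<close>, for \<open>UNIV\<close>.\<close>

definition weights_in ::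
    "('i::{finite,linorder} \<Rightarrow> bool) \<Rightarrow> ('i \<Rightarrow> int) \<Rightarrow> 'i point set \<Rightarrow> int set \<Rightarrow> 'i sfun \<Rightarrow> bool" where
  "weights_in p w D K f \<longleftrightarrow> (\<forall>I \<subseteq> {i. p i}.
     weighted_poly p w D (\<lambda>m. wt_degree w m + (\<Sum>i\<in>I. w i) \<in> K) (coeff f I))"

lemma has_weight_iff: "has_weight p w D k f \<longleftrightarrow> weights_in p w D {k} f"
  by (simp add: has_weight_def weights_in_def wt_degree_def)

lemma superfunction_iff: "superfunction p w D f \<longleftrightarrow> weights_in p w D UNIV f"
  by (simp add: superfunction_def weights_in_def)

lemma weights_in_mono: "weights_in p w D K f \<Longrightarrow> K \<subseteq> K' \<Longrightarrow> weights_in p w D K' f"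
  unfolding weights_in_def by (auto intro: weighted_poly_mono)

lemma weights_in_cong:
  assumes "eq_on p D f g" "weights_in p w D K f"
  shows "weights_in p w D K g"
  unfolding weights_in_def
proof (intro allI impI)
  fix I assume I: "I \<subseteq> {i. p i}"
  show "weighted_poly p w D (\<lambda>m. wt_degree w m + (\<Sum>i\<in>I. w i) \<in> K) (coeff g I)"
    by (rule weighted_poly_cong[of D "coeff f I"])
       (use assms I in \<open>auto simp: eq_on_def weights_in_def\<close>)
qed

lemma weights_in_smooth: "superdomain p D \<Longrightarrow> weights_in p w D K f \<Longrightarrow> smooth_sfun p D f"
  unfolding weights_in_def smooth_sfun_def using weighted_poly_smooth by blast

section \<open>Weights under algebraic operations and derivatives\<close>

context
  fixes p :: "'i::{finite,linorder} \<Rightarrow> bool" and w :: "'i \<Rightarrow> int" and D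
  assumes D: "superdomain p D"
begin

lemma weights_in_zero: "weights_in p w D K 0"
  by (simp add: weights_in_def coeff_zero_fun weighted_poly_zero)

lemma weighted_poly_const:
  assumes "Q (\<lambda>_. 0)"
  shows "weighted_poly p w D Q (\<lambda>_. c)"
  using weighted_poly_monomial[of Q "\<lambda>_. 0" p w D "\<lambda>_. c"] assms by simp

lemma weights_in_one: "0 \<in> K \<Longrightarrow> weights_in p w D K 1"
  by (auto simp: weights_in_def coeff_one_fun weighted_poly_zero intro!: weighted_poly_const)

lemma weights_in_add: "weights_in p w D K f \<Longrightarrow> weights_in p w D K g \<Longrightarrow> weights_in p w D K (f + g)"
  by (simp add: weights_in_def coeff_add_fun weighted_poly_add[OF D])

lemma weights_in_scaleR: "weights_in p w D K f \<Longrightarrow> weights_in p w D K (r *\<^sub>R f)"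
  by (simp add: weights_in_def coeff_scaleR_fun weighted_poly_cmult[OF D])

lemma weights_in_diff: "weights_in p w D K f \<Longrightarrow> weights_in p w D K g \<Longrightarrow> weights_in p w D K (f - g)"
  using weights_in_add[of K f "(- 1) *\<^sub>R g"] weights_in_scaleR[of K g "- 1"] by simp

lemma weights_in_sum: "(\<And>a. a \<in> A \<Longrightarrow> weights_in p w D K (f a)) \<Longrightarrow> weights_in p w D K (sum f A)"
  by (induction A rule: infinite_finite_induct) (auto intro: weights_in_add weights_in_zero)

lemma weights_in_twist: "weights_in p w D K f \<Longrightarrow> weights_in p w D K (twist b f)"
proof -
  have "coeff (twist b f) I = (\<lambda>x. psign (b \<and> odd (card I)) * coeff f I x)" for I
    by (auto simp: coeff_twist)
  then show "weights_in p w D K f \<Longrightarrow> weights_in p w D K (twist b f)"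
    by (simp add: weights_in_def weighted_poly_cmult[OF D])
qed

lemma weights_in_mult:
  assumes "weights_in p w D K f" "weights_in p w D L g" "\<And>k l. k \<in> K \<Longrightarrow> l \<in> L \<Longrightarrow> k + l \<in> M"
  shows "weights_in p w D M (f * g)"
  unfolding weights_in_def
proof (intro allI impI)
  fix I assume I: "I \<subseteq> {i. p i}"
  let ?Q = "\<lambda>K I m. wt_degree w m + (\<Sum>i\<in>I. w i) \<in> K"
  have "weighted_poly p w D (?Q M I) (\<lambda>x. sgn_shuffle J (I - J) * (coeff f J x * coeff g (I - J) x))"
    if J: "J \<in> Pow I" for J
  proof (intro weighted_poly_cmult[OF D] weighted_poly_mult[OF D])
    have "J \<subseteq> {i. p i}" "I - J \<subseteq> {i. p i}" using I J by auto
    then show "weighted_poly p w D (?Q K J) (coeff f J)" "weighted_poly p w D (?Q L (I - J)) (coeff g (I - J))"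
      using assms(1,2) unfolding weights_in_def by blast+
    fix m n assume "?Q K J m" "?Q L (I - J) n"
    from assms(3)[OF this] show "?Q M I (\<lambda>i. m i + n i)"
      using sum.subset_diff[of J I w] J by (simp add: wt_degree_add algebra_simps)
  qed
  then have "weighted_poly p w D (?Q M I) (\<lambda>x. \<Sum>J\<in>Pow I. sgn_shuffle J (I - J) * (coeff f J x * coeff g (I - J) x))"
    by (intro weighted_poly_sum[OF D])
  then show "weighted_poly p w D (?Q M I) (coeff (f * g) I)"
    by (rule weighted_poly_cong[rotated]) (simp add: coeff_mult mult.assoc)
qed

lemma weights_in_coord:
  assumes "w i \<in> K"
  shows "weights_in p w D K (coord p i)"
proof (cases "p i")
  case True
  have "coeff (coord p i) I = (if I = {i} then (\<lambda>_. 1) else (\<lambda>_. 0))" for I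
    using True by (auto simp: coord_odd)
  then show ?thesis
    using assms by (auto simp: weights_in_def weighted_poly_zero intro!: weighted_poly_const)
next
  case False
  have "weighted_poly p w D (\<lambda>m. wt_degree w m \<in> K) (\<lambda>x. x $ i)"
  proof (cases "w i = 0")
    case True
    then show ?thesis
      using weighted_poly_monomial[of "\<lambda>m. wt_degree w m \<in> K" "\<lambda>_. 0" p w D "\<lambda>x. x $ i"] assms False
      by (simp add: smooth_component)
  next
    case wi: False
    let ?m = "(\<lambda>_. 0)(i := 1) :: 'i \<Rightarrow> nat"
    have e: "?m(i := 0) = (\<lambda>_. 0)" by (rule ext) simp
    have "monomial ?m x = x $ i" "wt_degree w ?m = w i" for x
      using monomial_upd[of ?m x i] wt_degree_upd[of w ?m i] unfolding e by simp_all
    then show ?thesis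
      using weighted_poly_monomial[of "\<lambda>m. wt_degree w m \<in> K" ?m p w D "\<lambda>_. 1"] assms False wi
      by (simp split: if_splits)
  qed
  moreover have "coeff (coord p i) I = (if I = {} then (\<lambda>x. x $ i) else (\<lambda>_. 0))" for I
    using False by (auto simp: coord_even scalar_fun_def)
  ultimately show ?thesis
    by (auto simp: weights_in_def weighted_poly_zero)
qed

lemma weights_in_pd:
  assumes "weights_in p w D K f" "\<And>k. k \<in> K \<Longrightarrow> k - w i \<in> L"
  shows "weights_in p w D L (pd p i f)"
  unfolding weights_in_def
proof (intro allI impI)
  fix I assume I: "I \<subseteq> {i. p i}"
  show "weighted_poly p w D (\<lambda>m. wt_degree w m + (\<Sum>i\<in>I. w i) \<in> L) (coeff (pd p i f) I)"
  proof (cases "p i")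
    case True
    have eq: "coeff (pd p i f) I = (if i \<in> I then (\<lambda>_. 0)
        else (\<lambda>x. (- 1) ^ card {j \<in> I. j < i} * coeff f (insert i I) x))"
      by (auto simp: coeff_pd_odd True)
    show ?thesis
    proof (cases "i \<in> I")
      case False
      have "weighted_poly p w D (\<lambda>m. wt_degree w m + (\<Sum>i\<in>insert i I. w i) \<in> K) (coeff f (insert i I))"
        using assms(1) I True unfolding weights_in_def by simp
      then have "weighted_poly p w D (\<lambda>m. wt_degree w m + (\<Sum>i\<in>I. w i) \<in> L) (coeff f (insert i I))"
        by (rule weighted_poly_mono) (use assms(2) False in \<open>fastforce simp: algebra_simps\<close>)
      then show ?thesis
        unfolding eq using False by (simp add: weighted_poly_cmult[OF D])
    qed (simp add: eq weighted_poly_zero)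
  next
    case False
    have "weighted_poly p w D (\<lambda>m. wt_degree w m + (\<Sum>i\<in>I. w i) \<in> K) (coeff f I)"
      using assms(1) I unfolding weights_in_def by blast
    then show ?thesis
      unfolding coeff_pd_even[of p i, OF False]
    proof (rule weighted_poly_partial[OF D _ False])
      fix m n assume m: "wt_degree w m + (\<Sum>i\<in>I. w i) \<in> K" and n: "wt_degree w n = wt_degree w m - w i"
      have "wt_degree w n + (\<Sum>i\<in>I. w i) = wt_degree w m + (\<Sum>i\<in>I. w i) - w i" using n by simp
      then show "wt_degree w n + (\<Sum>i\<in>I. w i) \<in> L"
        by (simp only: assms(2)[OF m])
    qed
  qed
qed

end

section \<open>Weights of functions lifted to the cotangent bundle\<close>

lemma zero_section_component: "zero_section x $ A = (case A of Inl a \<Rightarrow> x $ a | Inr a \<Rightarrow> 0)"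
  by (simp add: zero_section_def)

lemma prod_UNIV_Plus: "(\<Prod>X\<in>UNIV. h X) = (\<Prod>a\<in>UNIV. h (Inl a)) * (\<Prod>a\<in>UNIV. h (Inr a))"
  for h :: "'a::finite + 'b::finite \<Rightarrow> 'c::comm_monoid_mult"
  by (simp add: prod.Plus flip: UNIV_Plus_UNIV)

text \<open>Exponents are extended by 0 on the momenta. \<open>W\<close> is prescribed on the base
  only, so that several gradings of the fibres are covered at once.\<close>

lemma weighted_poly_base_point:
  assumes D: "superdomain p D" and W: "\<And>a. W (Inl a) = w a" and h: "weighted_poly p w D Q h"
    and QR: "\<And>m n. Q m \<Longrightarrow> wt_degree W n = wt_degree w m \<Longrightarrow> R n"
  shows "weighted_poly (cot_odd p) W (cot_set p D) R (\<lambda>v. h (base_point v))"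
proof -
  obtain E g where "weighted_repr p w D Q h E g"
    using h unfolding weighted_poly_repr by blast
  note E = weighted_reprD[OF this]
  have "weighted_poly (cot_odd p) W (cot_set p D) R (\<lambda>v. g m (base_point v) * monomial (case_sum m (\<lambda>_. 0)) v)"
    if m: "m \<in> E" for m
  proof (rule weighted_poly_monomial)
    show "R (case_sum m (\<lambda>_. 0))"
      by (rule QR[OF E(2)[OF m]]) (simp add: wt_degree_def sum_UNIV_Plus W)
    show "smooth (cot_odd p) (cot_set p D) (\<lambda>v. g m (base_point v))"
      by (rule smooth_base_point[OF D E(4)[OF m]])
    show "\<not> cot_odd p A \<and> W A \<noteq> 0" if "case_sum m (\<lambda>_. 0) A \<noteq> 0" for A
      using that E(3)[OF m] W by (cases A) auto
    fix u v assume uv: "u \<in> cot_set p D" "v \<in> cot_set p D"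
      "\<And>A. \<not> cot_odd p A \<Longrightarrow> W A = 0 \<Longrightarrow> u $ A = v $ A"
    show "g m (base_point u) = g m (base_point v)"
      by (rule E(5)[OF m cot_set_base_point[OF uv(1)] cot_set_base_point[OF uv(2)]]) (use uv(3) W in auto)
  qed
  then have "weighted_poly (cot_odd p) W (cot_set p D) R (\<lambda>v. \<Sum>m\<in>E. g m (base_point v) * monomial (case_sum m (\<lambda>_. 0)) v)"
    by (intro weighted_poly_sum[OF superdomain_cot_set[OF D]])
  then show ?thesis
    by (rule weighted_poly_cong[rotated])
       (simp add: E(6) cot_set_base_point monomial_def prod_UNIV_Plus)
qed

text \<open>On the zero section every monomial containing a momentum vanishes, and coefficients that
  involve momenta of weight zero are evaluated at 0.\<close>

lemma weighted_poly_zero_section: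
  assumes D: "superdomain p D" and W: "\<And>a. W (Inl a) = w a" and h: "weighted_poly (cot_odd p) W (cot_set p D) Q h"
    and QR: "\<And>m n. Q m \<Longrightarrow> wt_degree w n = wt_degree W m \<Longrightarrow> R n"
  shows "weighted_poly p w D R (\<lambda>x. h (zero_section x))"
proof -
  obtain E g where "weighted_repr (cot_odd p) W (cot_set p D) Q h E g"
    using h unfolding weighted_poly_repr by blast
  note E = weighted_reprD[OF this]
  have zs: "zero_section x \<in> cot_set p D" if "x \<in> D" for x
  proof -
    have "base_point (zero_section x) = x" by (simp add: vec_eq_iff zero_section_component)
    moreover have "zero_section x \<in> even_space (cot_odd p)"
      using superdomain_subset[OF D that] by (auto simp: even_space_def zero_section_component split: sum.splits)
    ultimately show ?thesis using that by (simp add: cot_set_def)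
  qed
  have zc: "smooth p D (\<lambda>x. zero_section x $ A)" for A
    by (cases A) (simp_all add: zero_section_component smooth_component)
  have sm: "smooth p D (\<lambda>x. g m (zero_section x))" if "m \<in> E" for m
    by (rule smooth_compose[where \<beta> = zero_section, OF D superdomain_cot_set[OF D] zc zs E(4)[OF that]])
  have "weighted_poly p w D R (\<lambda>x. g m (zero_section x) * monomial m (zero_section x))"
    if m: "m \<in> E" for m
  proof (cases "\<forall>a. m (Inr a) = 0")
    case True
    then have "monomial m (zero_section x) = monomial (\<lambda>a. m (Inl a)) x" for x
      by (simp add: monomial_def prod_UNIV_Plus zero_section_component)
    moreover have "weighted_poly p w D R (\<lambda>x. g m (zero_section x) * monomial (\<lambda>a. m (Inl a)) x)"
    proof (rule weighted_poly_monomial[OF _ _ sm[OF m]])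
      show "R (\<lambda>a. m (Inl a))"
        by (rule QR[OF E(2)[OF m]]) (simp add: wt_degree_def sum_UNIV_Plus W True)
      show "\<not> p j \<and> w j \<noteq> 0" if "m (Inl j) \<noteq> 0" for j
        using E(3)[OF m that] W by simp
      fix x y assume xy: "x \<in> D" "y \<in> D" "\<And>i. \<not> p i \<Longrightarrow> w i = 0 \<Longrightarrow> x $ i = y $ i"
      show "g m (zero_section x) = g m (zero_section y)"
        by (rule E(5)[OF m zs[OF xy(1)] zs[OF xy(2)]])
           (use xy(3) W in \<open>auto simp: zero_section_component split: sum.splits\<close>)
    qed
    ultimately show ?thesis by simp
  next
    case False
    then obtain a where "m (Inr a) \<noteq> 0" by blast
    then have "monomial m (zero_section x) = 0" for x
      using monomial_upd[of m "zero_section x" "Inr a"] by (simp add: zero_section_component)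
    then show ?thesis by (simp add: weighted_poly_zero)
  qed
  then have "weighted_poly p w D R (\<lambda>x. \<Sum>m\<in>E. g m (zero_section x) * monomial m (zero_section x))"
    by (intro weighted_poly_sum[OF D])
  then show ?thesis
    by (rule weighted_poly_cong[rotated]) (simp add: E(6) zs)
qed

lemma sum_vimage_Inl:
  assumes "I \<subseteq> range Inl"
  shows "(\<Sum>A\<in>I. W A) = (\<Sum>a\<in>Inl -` I. W (Inl a))"
proof -
  have "I = Inl ` (Inl -` I)" using assms by auto
  then show ?thesis by (metis (no_types, lifting) inj_Inl inj_on_subset subset_UNIV sum.reindex_cong)
qed

text \<open>A function is recovered from its lift by restriction to the zero section. Applied to two
  gradings that agree on the base, the equivalence carries the weight of a lift from one to the
  other.\<close>

lemma weights_in_lift_iff: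
  assumes D: "superdomain p D" and W: "\<And>a. W (Inl a) = w a"
  shows "weights_in (cot_odd p) W (cot_set p D) K (lift f) \<longleftrightarrow> weights_in p w D K f"
proof
  assume f: "weights_in p w D K f"
  show "weights_in (cot_odd p) W (cot_set p D) K (lift f)"
    unfolding weights_in_def
  proof (intro allI impI)
    fix I assume I: "I \<subseteq> {A. cot_odd p A}"
    show "weighted_poly (cot_odd p) W (cot_set p D) (\<lambda>m. wt_degree W m + (\<Sum>i\<in>I. W i) \<in> K) (coeff (lift f) I)"
    proof (cases "I \<subseteq> range Inl")
      case True
      have "weighted_poly p w D (\<lambda>m. wt_degree w m + (\<Sum>i\<in>Inl -` I. w i) \<in> K) (coeff f (Inl -` I))"
        using f subset_cot_odd[OF I] unfolding weights_in_def by blast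
      from weighted_poly_base_point[where w = w and W = W, OF D W this] show ?thesis
        using True by (simp add: coeff_lift_fun sum_vimage_Inl W)
    qed (simp add: coeff_lift_fun weighted_poly_zero)
  qed
next
  assume f: "weights_in (cot_odd p) W (cot_set p D) K (lift f)"
  show "weights_in p w D K f"
    unfolding weights_in_def
  proof (intro allI impI)
    fix I assume I: "I \<subseteq> {i. p i}"
    have "Inl ` I \<subseteq> {A. cot_odd p A}" using I by auto
    then have "weighted_poly (cot_odd p) W (cot_set p D) (\<lambda>m. wt_degree W m + (\<Sum>i\<in>Inl ` I. W i) \<in> K) (coeff (lift f) (Inl ` I))"
      using f unfolding weights_in_def by blast
    then have "weighted_poly p w D (\<lambda>m. wt_degree w m + (\<Sum>i\<in>I. w i) \<in> K) (\<lambda>x. coeff (lift f) (Inl ` I) (zero_section x))"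
      by (rule weighted_poly_zero_section[where w = w and W = W, OF D W]) (simp add: sum.reindex W)
    moreover have "coeff (lift f) (Inl ` I) (zero_section x) = coeff f I x" for x
    proof -
      have "base_point (zero_section x) = x" by (simp add: vec_eq_iff zero_section_component)
      then show ?thesis by (simp add: coeff_lift_fun inj_vimage_image_eq image_mono)
    qed
    ultimately show "weighted_poly p w D (\<lambda>m. wt_degree w m + (\<Sum>i\<in>I. w i) \<in> K) (coeff f I)" by simp
  qed
qed

text \<open>Each term removes one coordinate and its conjugate momentum, so the weight drops by
  \<open>\<kappa>\<close>: this is q - s on the double, and 0 for the induced grading of a cotangent
  bundle.\<close>

lemma weights_in_poisson:
  assumes E: "superdomain (cot_odd p) E" and W: "\<And>a. W (Inl a) + W (Inr a) = \<kappa>"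
    and f: "weights_in (cot_odd p) W E {k} f" and g: "weights_in (cot_odd p) W E {l} g"
  shows "weights_in (cot_odd p) W E {k + l - \<kappa>} (poisson p f g)"
  unfolding poisson_def
proof (intro weights_in_sum[OF E] weights_in_diff[OF E] weights_in_mult[OF E])
  fix A
  show "weights_in (cot_odd p) W E {k - W (Inr A)} (psign (p A) *\<^sub>R pd (cot_odd p) (Inr A) (twist (p A) f))"
    by (intro weights_in_scaleR[OF E] weights_in_pd[OF E weights_in_twist[OF E f]]) simp
  show "weights_in (cot_odd p) W E {k - W (Inl A)} (pd (cot_odd p) (Inl A) (twist (p A) f))"
    by (intro weights_in_pd[OF E weights_in_twist[OF E f]]) simp
  show "weights_in (cot_odd p) W E {l - W (Inl A)} (pd (cot_odd p) (Inl A) g)"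
    "weights_in (cot_odd p) W E {l - W (Inr A)} (pd (cot_odd p) (Inr A) g)"
    by (intro weights_in_pd[OF E g]; simp)+
  show "a + b \<in> {k + l - \<kappa>}" if "a \<in> {k - W (Inr A)}" "b \<in> {l - W (Inl A)}" for a b
    using that W[of A] by auto
  show "a + b \<in> {k + l - \<kappa>}" if "a \<in> {k - W (Inl A)}" "b \<in> {l - W (Inr A)}" for a b
    using that W[of A] by auto
qed

section \<open>Fibrewise polynomial functions\<close>

text \<open>A notion for a single chart; \<open>weights_in\<close> with \<open>UNIV\<close> says
  that the coefficient is a superfunction of the base. The same holds for the linear and quadratic
  versions.\<close>

definition fibre_constant ::
  "('i::{finite,linorder} \<Rightarrow> bool) \<Rightarrow> ('i \<Rightarrow> int) \<Rightarrow> 'i point set \<Rightarrow> ('i + 'i) sfun \<Rightarrow> bool" where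
  "fibre_constant p w D F \<longleftrightarrow>
     (\<exists>f. weights_in p w D UNIV f \<and> eq_on (cot_odd p) (cot_set p D) F (lift f))"

definition fibre_linear ::
  "('i::{finite,linorder} \<Rightarrow> bool) \<Rightarrow> ('i \<Rightarrow> int) \<Rightarrow> 'i point set \<Rightarrow> ('i + 'i) sfun \<Rightarrow> bool" where
  "fibre_linear p w D F \<longleftrightarrow> (\<exists>f. (\<forall>a. weights_in p w D UNIV (f a))
     \<and> eq_on (cot_odd p) (cot_set p D) F (\<Sum>a\<in>UNIV. lift (f a) * coord (cot_odd p) (Inr a)))"

definition fibre_quadratic ::
  "('i::{finite,linorder} \<Rightarrow> bool) \<Rightarrow> ('i \<Rightarrow> int) \<Rightarrow> 'i point set \<Rightarrow> ('i + 'i) sfun \<Rightarrow> bool" where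
  "fibre_quadratic p w D F \<longleftrightarrow> (\<exists>f. (\<forall>a b. weights_in p w D UNIV (f a b))
     \<and> eq_on (cot_odd p) (cot_set p D) F
         (\<Sum>a\<in>UNIV. \<Sum>b\<in>UNIV. lift (f a b) * coord (cot_odd p) (Inr b) * coord (cot_odd p) (Inr a)))"

section \<open>Calculus of fibrewise linear and quadratic functions\<close>

context
  fixes p :: "'i::{finite,linorder} \<Rightarrow> bool" and w :: "'i \<Rightarrow> int" and D
  assumes D: "superdomain p D"
begin

private abbreviation (input) "P \<equiv> cot_odd p"
private abbreviation (input) "E \<equiv> cot_set p D"
private abbreviation (input) "z a \<equiv> coord P (Inr a)"
private abbreviation (input) "tE \<equiv> trunc P E"

private lemma cot_dom: "superdomain P E"
  by (rule superdomain_cot_set[OF D])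

private lemma sm: "weights_in p w D K f \<Longrightarrow> smooth_sfun p D f"
  by (rule weights_in_smooth[OF D])

private lemma z_parity: "has_parity P E (p a) (z a)"
  using has_parity_coord[of P E "Inr a"] by simp

private lemma z_lift: "tE (z a) * tE (lift f) = tE (lift (twist (p a) f)) * tE (z a)"
  using has_parity_commute[OF z_parity, of a "lift f"] by (simp add: eq_on_trunc trunc_mult lift_twist)

private lemma z_commute: "psign (p a \<and> p b) *\<^sub>R (tE (z a) * tE (z b)) = tE (z b) * tE (z a)"
  using supercommute[OF z_parity z_parity, of a b] by (simp add: eq_on_trunc trunc_mult trunc_scaleR)

lemma fibre_quadratic_zero: "fibre_quadratic p w D 0"
  unfolding fibre_quadratic_def by (intro exI[of _ "\<lambda>_ _. 0"]) (simp add: weights_in_zero[OF D])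

lemma fibre_quadratic_add:
  assumes "fibre_quadratic p w D F" "fibre_quadratic p w D G"
  shows "fibre_quadratic p w D (F + G)"
proof -
  obtain f where f: "\<And>a b. weights_in p w D UNIV (f a b)"
    "eq_on P E F (\<Sum>a\<in>UNIV. \<Sum>b\<in>UNIV. lift (f a b) * z b * z a)"
    using assms(1) unfolding fibre_quadratic_def by blast
  obtain g where g: "\<And>a b. weights_in p w D UNIV (g a b)"
    "eq_on P E G (\<Sum>a\<in>UNIV. \<Sum>b\<in>UNIV. lift (g a b) * z b * z a)"
    using assms(2) unfolding fibre_quadratic_def by blast
  show ?thesis
    unfolding fibre_quadratic_def
    using eq_on_add[OF f(2) g(2)] weights_in_add[OF D f(1) g(1)]
    by (intro exI[of _ "\<lambda>a b. f a b + g a b"]) (simp add: lift_add distrib_right sum.distrib)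
qed

lemma fibre_quadratic_scaleR:
  assumes "fibre_quadratic p w D F"
  shows "fibre_quadratic p w D (r *\<^sub>R F)"
proof -
  obtain f where f: "\<And>a b. weights_in p w D UNIV (f a b)"
    "eq_on P E F (\<Sum>a\<in>UNIV. \<Sum>b\<in>UNIV. lift (f a b) * z b * z a)"
    using assms(1) unfolding fibre_quadratic_def by blast
  show ?thesis
    unfolding fibre_quadratic_def
    using eq_on_scaleR[OF f(2), of r] weights_in_scaleR[OF D f(1)]
    by (intro exI[of _ "\<lambda>a b. r *\<^sub>R f a b"]) (simp add: lift_scaleR scaleR_sum_right)
qed

lemma fibre_quadratic_diff:
  "fibre_quadratic p w D F \<Longrightarrow> fibre_quadratic p w D G \<Longrightarrow> fibre_quadratic p w D (F - G)"
  using fibre_quadratic_add[of F "(- 1) *\<^sub>R G"] fibre_quadratic_scaleR[of G "- 1"] by simp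

lemma fibre_quadratic_sum: "(\<And>a. a \<in> A \<Longrightarrow> fibre_quadratic p w D (F a)) \<Longrightarrow> fibre_quadratic p w D (sum F A)"
  by (induction A rule: infinite_finite_induct) (auto intro: fibre_quadratic_add fibre_quadratic_zero)

lemma fibre_linear_coord: "fibre_linear p w D (z A)"
proof -
  have "(\<Sum>a\<in>UNIV. lift (if A = a then 1 else 0) * z a) = (\<Sum>a\<in>UNIV. (if A = a then 1 else 0) * z a)"
    by (intro sum.cong) auto
  then show ?thesis
    unfolding fibre_linear_def
    by (intro exI[of _ "\<lambda>a. if A = a then 1 else 0"])
       (simp add: delta_mult_sum weights_in_zero[OF D] weights_in_one[OF D])
qed

text \<open>The momenta of the first factor cross the coefficients of the second, which thereby get
  twisted.\<close>

lemma fibre_linear_mult: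
  assumes "fibre_linear p w D F" "fibre_linear p w D G"
  shows "fibre_quadratic p w D (F * G)"
proof -
  obtain f where f: "\<And>a. weights_in p w D UNIV (f a)" "eq_on P E F (\<Sum>a\<in>UNIV. lift (f a) * z a)"
    using assms(1) unfolding fibre_linear_def by blast
  obtain g where g: "\<And>a. weights_in p w D UNIV (g a)" "eq_on P E G (\<Sum>a\<in>UNIV. lift (g a) * z a)"
    using assms(2) unfolding fibre_linear_def by blast
  have "tE (F * G) = (\<Sum>b\<in>UNIV. \<Sum>a\<in>UNIV. tE (lift (f b)) * (tE (z b) * tE (lift (g a))) * tE (z a))"
    using f(2) g(2) by (simp add: eq_on_trunc trunc_simps sum_product mult.assoc)
  also have "\<dots> = (\<Sum>a\<in>UNIV. \<Sum>b\<in>UNIV. tE (lift (f b)) * (tE (z b) * tE (lift (g a))) * tE (z a))"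
    by (rule sum.swap)
  also have "\<dots> = tE (\<Sum>a\<in>UNIV. \<Sum>b\<in>UNIV. lift (f b * twist (p b) (g a)) * z b * z a)"
    unfolding z_lift by (simp add: trunc_simps lift_mult mult.assoc)
  finally have "eq_on P E (F * G) (\<Sum>a\<in>UNIV. \<Sum>b\<in>UNIV. lift (f b * twist (p b) (g a)) * z b * z a)"
    by (simp only: eq_on_trunc)
  moreover have "weights_in p w D UNIV (f b * twist (p b) (g a))" for a b
    by (rule weights_in_mult[OF D f(1) weights_in_twist[OF D g(1)]]) simp
  ultimately show ?thesis
    unfolding fibre_quadratic_def by (intro exI[of _ "\<lambda>a b. f b * twist (p b) (g a)"]) simp
qed

lemma fibre_constant_mult_quadratic:
  assumes "fibre_constant p w D F" "fibre_quadratic p w D G"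
  shows "fibre_quadratic p w D (F * G)"
proof -
  obtain f where f: "weights_in p w D UNIV f" "eq_on P E F (lift f)"
    using assms(1) unfolding fibre_constant_def by blast
  obtain g where g: "\<And>a b. weights_in p w D UNIV (g a b)"
    "eq_on P E G (\<Sum>a\<in>UNIV. \<Sum>b\<in>UNIV. lift (g a b) * z b * z a)"
    using assms(2) unfolding fibre_quadratic_def by blast
  have "weights_in p w D UNIV (f * g a b)" for a b
    by (rule weights_in_mult[OF D f(1) g(1)]) simp
  then show ?thesis
    unfolding fibre_quadratic_def
    using eq_on_mult[OF f(2) g(2)]
    by (intro exI[of _ "\<lambda>a b. f * g a b"]) (simp add: lift_mult sum_distrib_left mult.assoc)
qed

lemma fibre_linear_twist:
  assumes "fibre_linear p w D F"
  shows "fibre_linear p w D (twist b F)"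
proof -
  obtain f where f: "\<And>a. weights_in p w D UNIV (f a)" "eq_on P E F (\<Sum>a\<in>UNIV. lift (f a) * z a)"
    using assms(1) unfolding fibre_linear_def by blast
  have "weights_in p w D UNIV (psign (b \<and> p a) *\<^sub>R twist b (f a))" for a
    by (intro weights_in_scaleR[OF D] weights_in_twist[OF D] f(1))
  then show ?thesis
    unfolding fibre_linear_def
    using eq_on_twist[OF f(2), of b]
    by (intro exI[of _ "\<lambda>a. psign (b \<and> p a) *\<^sub>R twist b (f a)"])
       (simp add: twist_sum twist_mult twist_coord lift_scaleR lift_twist)
qed

lemma fibre_linear_pd_Inl:
  assumes "fibre_linear p w D F"
  shows "fibre_linear p w D (pd P (Inl A) F)"
proof -
  obtain f where f: "\<And>a. weights_in p w D UNIV (f a)" "eq_on P E F (\<Sum>a\<in>UNIV. lift (f a) * z a)"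
    using assms(1) unfolding fibre_linear_def by blast
  have "eq_on P E (pd P (Inl A) F) (\<Sum>a\<in>UNIV. lift (pd p A (f a)) * z a)"
    using pd_cong[OF cot_dom f(2)] pd_Inl_linear[OF D sm[OF f(1)]] by (rule eq_on_trans)
  moreover have "weights_in p w D UNIV (pd p A (f a))" for a
    by (rule weights_in_pd[OF D f(1)]) simp
  ultimately show ?thesis
    unfolding fibre_linear_def by (intro exI[of _ "\<lambda>a. pd p A (f a)"]) simp
qed

lemma fibre_linear_pd_Inr:
  assumes "fibre_linear p w D F"
  shows "fibre_constant p w D (pd P (Inr A) F)"
proof -
  obtain f where f: "\<And>a. weights_in p w D UNIV (f a)" "eq_on P E F (\<Sum>a\<in>UNIV. lift (f a) * z a)"
    using assms(1) unfolding fibre_linear_def by blast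
  have "eq_on P E (pd P (Inr A) F) (twist (p A) (lift (f A)))"
    using pd_cong[OF cot_dom f(2)] pd_Inr_linear[OF D sm[OF f(1)]] by (rule eq_on_trans)
  then show ?thesis
    unfolding fibre_constant_def
    by (intro exI[of _ "twist (p A) (f A)"]) (simp add: lift_twist weights_in_twist[OF D f(1)])
qed

private lemma smooth_term:
  assumes "smooth_sfun p D f"
  shows "smooth_sfun P E (lift f)" "smooth_sfun P E (z a)" "smooth_sfun P E (lift f * z b)"
    "smooth_sfun P E (lift f * z b * z a)"
  by (intro smooth_sfun_mult[OF cot_dom] smooth_sfun_lift[OF D assms] smooth_sfun_coord[OF cot_dom])+

private lemma tE_pd_quadratic:
  assumes F: "eq_on P E F (\<Sum>a\<in>UNIV. \<Sum>b\<in>UNIV. lift (f a b) * z b * z a)" and f: "\<And>a b. weights_in p w D K (f a b)"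
  shows "tE (pd P X F) = (\<Sum>a\<in>UNIV. \<Sum>b\<in>UNIV. tE (pd P X (lift (f a b) * z b)) * tE (z a)
    + tE (twist (P X) (lift (f a b) * z b)) * tE (pd P X (z a)))"
proof -
  note st = smooth_term[OF sm[OF f]]
  have "tE (pd P X F) = tE (pd P X (\<Sum>a\<in>UNIV. \<Sum>b\<in>UNIV. lift (f a b) * z b * z a))"
    using pd_cong[OF cot_dom F] by (simp add: eq_on_trunc)
  also have "\<dots> = (\<Sum>a\<in>UNIV. tE (pd P X (\<Sum>b\<in>UNIV. lift (f a b) * z b * z a)))"
    unfolding trunc_sum[symmetric] eq_on_trunc[symmetric]
    by (intro pd_sum[OF cot_dom] smooth_sfun_sum[OF cot_dom] st)
  also have "\<dots> = (\<Sum>a\<in>UNIV. \<Sum>b\<in>UNIV. tE (pd P X (lift (f a b) * z b * z a)))"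
    unfolding trunc_sum[symmetric] eq_on_trunc[symmetric]
    by (intro eq_on_trans[OF eq_on_sum[OF pd_sum[OF cot_dom st(4)]] eq_on_refl] eq_on_sum)
  also have "\<dots> = (\<Sum>a\<in>UNIV. \<Sum>b\<in>UNIV. tE (pd P X (lift (f a b) * z b)) * tE (z a)
    + tE (twist (P X) (lift (f a b) * z b)) * tE (pd P X (z a)))"
    using pd_mult[OF cot_dom st(3) st(2)] by (intro sum.cong refl) (simp add: eq_on_trunc trunc_simps)
  finally show ?thesis .
qed

lemma fibre_quadratic_pd_Inl:
  assumes "fibre_quadratic p w D F"
  shows "fibre_quadratic p w D (pd P (Inl A) F)"
proof -
  obtain f where f: "\<And>a b. weights_in p w D UNIV (f a b)"
    "eq_on P E F (\<Sum>a\<in>UNIV. \<Sum>b\<in>UNIV. lift (f a b) * z b * z a)"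
    using assms(1) unfolding fibre_quadratic_def by blast
  have "tE (pd P (Inl A) (lift (f a b) * z b)) = tE (lift (pd p A (f a b)) * z b)" for a b
    using pd_Inl_lift_mult[OF D sm[OF f(1)]] by (simp add: eq_on_trunc)
  then have "tE (pd P (Inl A) F) = tE (\<Sum>a\<in>UNIV. \<Sum>b\<in>UNIV. lift (pd p A (f a b)) * z b * z a)"
    unfolding tE_pd_quadratic[OF f(2,1)] by (simp add: pd_coord trunc_simps)
  moreover have "weights_in p w D UNIV (pd p A (f a b))" for a b
    by (rule weights_in_pd[OF D f(1)]) simp
  ultimately show ?thesis
    unfolding fibre_quadratic_def eq_on_trunc by (intro exI[of _ "\<lambda>a b. pd p A (f a b)"]) simp
qed

text \<open>Either momentum of a quadratic term can be the differentiated one; if it is the right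
  one, the derivative first crosses the left one, which gives the sign.\<close>

private lemma tE_pd_Inr_quadratic:
  assumes F: "eq_on P E F (\<Sum>a\<in>UNIV. \<Sum>b\<in>UNIV. lift (f a b) * z b * z a)" and f: "\<And>a b. weights_in p w D K (f a b)"
  shows "tE (pd P (Inr A) F)
    = (\<Sum>c\<in>UNIV. tE (lift (twist (p A) (f c A + psign (p A \<and> p c) *\<^sub>R f A c))) * tE (z c))"
proof -
  have 1: "tE (pd P (Inr A) (lift (f a b) * z b)) = (if A = b then tE (lift (twist (p A) (f a b))) else 0)" for a b
    using pd_Inr_lift_mult[OF D sm[OF f], of A a b b] by (auto simp: eq_on_trunc lift_twist)
  have 2: "tE (twist (p A) (lift (f a b) * z b)) * tE (pd P (Inr A) (z a))
      = (if A = a then psign (p A \<and> p b) *\<^sub>R (tE (lift (twist (p A) (f a b))) * tE (z b)) else 0)" for a b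
    using trunc_mult[of P E _ 1] by (simp add: pd_coord twist_mult twist_coord lift_twist trunc_simps)
       (simp flip: trunc_mult trunc_scaleR)
  have "tE (pd P (Inr A) F) = (\<Sum>a\<in>UNIV. \<Sum>b\<in>UNIV. (if A = b then tE (lift (twist (p A) (f a b))) * tE (z a) else 0))
      + (\<Sum>a\<in>UNIV. \<Sum>b\<in>UNIV. (if A = a then psign (p A \<and> p b) *\<^sub>R (tE (lift (twist (p A) (f a b))) * tE (z b)) else 0))"
    unfolding tE_pd_quadratic[OF F f] cot_odd_simps 1 2 sum.distrib
    by (simp add: if_distrib[of "\<lambda>x. x * _"] cong: if_cong)
  also have "(\<Sum>a\<in>UNIV. \<Sum>b\<in>UNIV. (if A = a then psign (p A \<and> p b) *\<^sub>R (tE (lift (twist (p A) (f a b))) * tE (z b)) else 0))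
      = (\<Sum>b\<in>UNIV. psign (p A \<and> p b) *\<^sub>R (tE (lift (twist (p A) (f A b))) * tE (z b)))"
    by (subst sum.swap) simp
  finally show ?thesis
    by (simp add: twist_add twist_scaleR lift_add lift_scaleR trunc_simps distrib_right sum.distrib)
qed

lemma fibre_quadratic_pd_Inr:
  assumes "fibre_quadratic p w D F"
  shows "fibre_linear p w D (pd P (Inr A) F)"
proof -
  obtain f where f: "\<And>a b. weights_in p w D UNIV (f a b)"
    "eq_on P E F (\<Sum>a\<in>UNIV. \<Sum>b\<in>UNIV. lift (f a b) * z b * z a)"
    using assms(1) unfolding fibre_quadratic_def by blast
  have "weights_in p w D UNIV (twist (p A) (f c A + psign (p A \<and> p c) *\<^sub>R f A c))" for c
    by (intro weights_in_twist[OF D] weights_in_add[OF D] weights_in_scaleR[OF D] f(1))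
  then show ?thesis
    unfolding fibre_linear_def eq_on_trunc tE_pd_Inr_quadratic[OF f(2,1)]
    by (intro exI[of _ "\<lambda>c. twist (p A) (f c A + psign (p A \<and> p c) *\<^sub>R f A c)"]) (simp add: trunc_simps)
qed

lemma fibre_quadratic_poisson:
  assumes "fibre_linear p w D F" "fibre_quadratic p w D G"
  shows "fibre_quadratic p w D (poisson p F G)"
  unfolding poisson_def mult_scaleR_left
  by (intro fibre_quadratic_sum fibre_quadratic_diff fibre_quadratic_scaleR fibre_linear_mult
      fibre_constant_mult_quadratic fibre_linear_pd_Inr fibre_linear_pd_Inl fibre_quadratic_pd_Inl
      fibre_quadratic_pd_Inr fibre_linear_twist assms)

text \<open>The left derivative twists the coefficient, and moving \<open>z A\<close> back across
  the coefficient twists it again, which restores \<open>f A\<close>.\<close>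

lemma euler_linear:
  assumes "fibre_linear p w D F"
  shows "eq_on P E (\<Sum>A\<in>UNIV. z A * pd P (Inr A) F) F"
proof -
  obtain f where f: "\<And>a. weights_in p w D UNIV (f a)" "eq_on P E F (\<Sum>a\<in>UNIV. lift (f a) * z a)"
    using assms(1) unfolding fibre_linear_def by blast
  have "eq_on P E (pd P (Inr A) F) (twist (p A) (lift (f A)))" for A
    using pd_cong[OF cot_dom f(2)] pd_Inr_linear[OF D sm[OF f(1)]] by (rule eq_on_trans)
  then have "tE (pd P (Inr A) F) = tE (lift (twist (p A) (f A)))" for A
    by (simp add: eq_on_trunc lift_twist)
  then have "tE (\<Sum>A\<in>UNIV. z A * pd P (Inr A) F) = tE (\<Sum>a\<in>UNIV. lift (f a) * z a)"
    by (simp add: trunc_simps z_lift twist_twist)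
  then show ?thesis using f(2) by (simp add: eq_on_trunc)
qed

text \<open>Of the two terms of the derivative, one reproduces \<open>F\<close> with the summation
  indices exchanged; in the other, reordering the two momenta absorbs the sign. Each gives
  \<open>F\<close> once.\<close>

lemma euler_quadratic:
  assumes "fibre_quadratic p w D F"
  shows "eq_on P E (\<Sum>A\<in>UNIV. z A * pd P (Inr A) F) (2 *\<^sub>R F)"
proof -
  obtain f where f: "\<And>a b. weights_in p w D UNIV (f a b)"
    "eq_on P E F (\<Sum>a\<in>UNIV. \<Sum>b\<in>UNIV. lift (f a b) * z b * z a)"
    using assms(1) unfolding fibre_quadratic_def by blast
  let ?F = "\<Sum>a\<in>UNIV. \<Sum>b\<in>UNIV. tE (lift (f a b)) * tE (z b) * tE (z a)"
  have F: "tE F = ?F" using f(2) by (simp add: eq_on_trunc trunc_simps)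
  have "tE (\<Sum>A\<in>UNIV. z A * pd P (Inr A) F) = (\<Sum>A\<in>UNIV. \<Sum>c\<in>UNIV.
      (tE (z A) * tE (lift (twist (p A) (f c A + psign (p A \<and> p c) *\<^sub>R f A c)))) * tE (z c))"
    by (simp only: trunc_simps tE_pd_Inr_quadratic[OF f(2,1)] sum_distrib_left mult.assoc)
  also have "\<dots> = (\<Sum>A\<in>UNIV. \<Sum>c\<in>UNIV. tE (lift (f c A)) * tE (z A) * tE (z c)
      + tE (lift (f A c)) * (psign (p A \<and> p c) *\<^sub>R (tE (z A) * tE (z c))))"
    unfolding z_lift by (simp add: twist_twist lift_add lift_scaleR trunc_simps distrib_right mult.assoc)
  also have "\<dots> = (\<Sum>A\<in>UNIV. \<Sum>c\<in>UNIV. tE (lift (f c A)) * tE (z A) * tE (z c)) + ?F"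
    unfolding z_commute by (simp add: sum.distrib mult.assoc)
  also have "(\<Sum>A\<in>UNIV. \<Sum>c\<in>UNIV. tE (lift (f c A)) * tE (z A) * tE (z c)) = ?F"
    by (rule sum.swap)
  finally show ?thesis
    unfolding eq_on_trunc trunc_scaleR F by (simp only: scaleR_2)
qed

text \<open>By Euler's formula a fibrewise quadratic function is recovered from its second fibre
  derivatives, which are pulled back from the base; so its weight for one grading of the fibres
  determines its weight for any other.\<close>

lemma fibre_quadratic_weight:
  assumes F: "fibre_quadratic p w D F"
    and W: "\<And>a. W (Inl a) = w a" "\<And>a. W (Inr a) = - w a" "weights_in P W E {s} F"
    and W': "\<And>a. W' (Inl a) = w a" "\<And>a. W' (Inr a) = \<kappa> - w a"
  shows "weights_in P W' E {s + 2 * \<kappa>} F"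
proof -
  let ?H = "\<lambda>A B. pd P (Inr B) (pd P (Inr A) F)"
  \<comment> \<open>In the induced grading each fibre derivative adds the weight of the conjugate
    base coordinate; as the result is a lift, its weight is the same for \<open>W'\<close>.\<close>
  have H: "weights_in P W' E {s + w A + w B} (?H A B)" for A B
  proof -
    obtain f where f: "eq_on P E (?H A B) (lift f)"
      using fibre_linear_pd_Inr[OF fibre_quadratic_pd_Inr[OF F]] unfolding fibre_constant_def by blast
    have "weights_in P W E {s + w A + w B} (?H A B)"
      by (intro weights_in_pd[OF cot_dom, where K = "{s + w A}"] weights_in_pd[OF cot_dom W(3)]) (simp_all add: W(2))
    then have "weights_in P W E {s + w A + w B} (lift f)"
      by (rule weights_in_cong[OF f])
    then have "weights_in P W' E {s + w A + w B} (lift f)"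
      using weights_in_lift_iff[OF D, of W w] weights_in_lift_iff[OF D, of W' w] W(1) W'(1) by simp
    then show ?thesis
      by (rule weights_in_cong[OF eq_on_sym[OF f]])
  qed
  have "eq_on P E (\<Sum>A\<in>UNIV. z A * (\<Sum>B\<in>UNIV. z B * ?H A B)) (\<Sum>A\<in>UNIV. z A * pd P (Inr A) F)"
    by (intro eq_on_sum eq_on_mult eq_on_refl euler_linear fibre_quadratic_pd_Inr F)
  also have "eq_on P E \<dots> (2 *\<^sub>R F)"
    by (rule euler_quadratic[OF F])
  finally have "eq_on P E ((1/2) *\<^sub>R (\<Sum>A\<in>UNIV. z A * (\<Sum>B\<in>UNIV. z B * ?H A B))) ((1/2) *\<^sub>R 2 *\<^sub>R F)"
    by (rule eq_on_scaleR)
  then have *: "eq_on P E ((1/2) *\<^sub>R (\<Sum>A\<in>UNIV. z A * (\<Sum>B\<in>UNIV. z B * ?H A B))) F"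
    by simp
  have "weights_in P W' E {W' (Inr A)} (z A)" for A
    by (rule weights_in_coord[OF cot_dom]) simp
  \<comment> \<open>The weights add up as
    \<open>(\<kappa> - w A) + (\<kappa> - w B) + (s + w A + w B)\<close>.\<close>
  then have "weights_in P W' E {s + 2 * \<kappa>} (z A * (\<Sum>B\<in>UNIV. z B * ?H A B))" for A
    by (intro weights_in_mult[OF cot_dom, of _ "{W' (Inr A)}" _ "{s + w A + \<kappa>}"] weights_in_sum[OF cot_dom]
        weights_in_mult[OF cot_dom _ H]) (auto simp: W')
  then have "weights_in P W' E {s + 2 * \<kappa>} ((1/2) *\<^sub>R (\<Sum>A\<in>UNIV. z A * (\<Sum>B\<in>UNIV. z B * ?H A B)))"
    by (intro weights_in_scaleR[OF cot_dom] weights_in_sum[OF cot_dom])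
  then show ?thesis
    by (rule weights_in_cong[OF *])
qed

end

section \<open>The double\<close>

lemma smooth_subset: "smooth p D h \<Longrightarrow> D' \<subseteq> D \<Longrightarrow> smooth p D' h"
  unfolding smooth_def using differentiable_on_subset by blast

lemma smooth_sfun_subset: "smooth_sfun p D f \<Longrightarrow> D' \<subseteq> D \<Longrightarrow> smooth_sfun p D' f"
  unfolding smooth_sfun_def using smooth_subset by blast

lemma has_parity_subset: "has_parity p D b f \<Longrightarrow> D' \<subseteq> D \<Longrightarrow> has_parity p D' b f"
  unfolding has_parity_def by blast

lemma eq_on_subset: "eq_on p D f g \<Longrightarrow> D' \<subseteq> D \<Longrightarrow> eq_on p D' f g"
  unfolding eq_on_def by blast

lemma cot_set_mono: "D' \<subseteq> D \<Longrightarrow> cot_set p D' \<subseteq> cot_set p D"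
  by (auto simp: cot_set_def)

lemma superfunction_smooth: "superdomain p D \<Longrightarrow> superfunction p w D f \<Longrightarrow> smooth_sfun p D f"
  unfolding superfunction_iff by (rule weights_in_smooth)

lemma cotangent_simps [simp]:
  "charts (cotangent M) = charts M"
  "odd_coord (cotangent M) = cot_odd (odd_coord M)"
  "chart_dom (cotangent M) c = cot_set (odd_coord M) (chart_dom M c)"
  "overlap (cotangent M) c d = cot_set (odd_coord M) (overlap M c d)"
  "wt (cotangent M) (Inl a) = wt M a"
  "wt (cotangent M) (Inr a) = - wt M a"
  by (simp_all add: cotangent_def)

lemma transition_cotangent:
  "transition (cotangent M) c d = cot_map (odd_coord M) (transition M c d) (transition M d c)"
  by (auto simp: cotangent_def cot_map_def)

lemma double_simps [simp]:
  "charts (double M q s) = charts M"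
  "odd_coord (double M q s) = cot_odd (odd_coord M)"
  "chart_dom (double M q s) c = cot_set (odd_coord M) (chart_dom M c)"
  "overlap (double M q s) c d = cot_set (odd_coord M) (overlap M c d)"
  "transition (double M q s) c d = cot_map (odd_coord M) (transition M c d) (transition M d c)"
  "wt (double M q s) (Inl a) = wt M a"
  "wt (double M q s) (Inr a) = q - s - wt M a"
  by (simp_all add: double_def fibre_degree_def transition_cotangent)

lemma graded_manifold_superdomain:
  "graded_manifold M \<Longrightarrow> c \<in> charts M \<Longrightarrow> superdomain (odd_coord M) (chart_dom M c)"
  unfolding graded_manifold_def by blast

section \<open>Coordinate changes of a graded manifold\<close>

context
  fixes M :: "('c, 'i::{finite,linorder}) atlas" and c d
  assumes M: "graded_manifold M" and c: "c \<in> charts M" and d: "d \<in> charts M"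
begin

lemma graded_manifold_overlap: "overlap M c d \<subseteq> chart_dom M c"
  using M c d unfolding graded_manifold_def by blast

lemma graded_manifold_morphism:
  "morphism (odd_coord M) (overlap M c d) (overlap M d c) (transition M c d)"
proof
  show D: "superdomain (odd_coord M) (overlap M c d)" and "superdomain (odd_coord M) (overlap M d c)"
    using M c d unfolding graded_manifold_def by blast+
  show "smooth_sfun (odd_coord M) (overlap M c d) (transition M c d i)" for i
    using M c d unfolding graded_manifold_def by (intro superfunction_smooth[OF D]) blast
  show "has_parity (odd_coord M) (overlap M c d) (odd_coord M i) (transition M c d i)" for i
    using M c d unfolding graded_manifold_def by blast
  show "body (transition M c d) x \<in> overlap M d c" if "x \<in> overlap M c d" for x
    using M c d that unfolding graded_manifold_def by blast
qed

text \<open>The cocycle condition for the triple \<open>c\<close>, \<open>d\<close>,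
  \<open>c\<close>, together with the normalisation of the transition from \<open>c\<close> to
  itself.\<close>

lemma graded_manifold_inverse:
  "eq_on (odd_coord M) (overlap M c d)
    (pullback (odd_coord M) (transition M c d) (transition M d c i)) (coord (odd_coord M) i)"
proof -
  have D: "{x \<in> overlap M c d. transition_body M c d x \<in> overlap M d c} = overlap M c d"
    using morphism.body_phi[OF graded_manifold_morphism] by blast
  have "\<forall>c\<in>charts M. \<forall>d\<in>charts M. \<forall>e\<in>charts M.
        let D = {x \<in> overlap M c d. transition_body M c d x \<in> overlap M d e}
        in D \<subseteq> overlap M c e
           \<and> (\<forall>a. eq_on (odd_coord M) D (transition M c e a)
                    (pullback (odd_coord M) (transition M c d) (transition M d e a)))"
    using M unfolding graded_manifold_def by (elim conjE)
  from this[THEN bspec, OF c, THEN bspec, OF d, THEN bspec, OF c]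
  have "eq_on (odd_coord M) (overlap M c d) (transition M c c i)
      (pullback (odd_coord M) (transition M c d) (transition M d c i))"
    unfolding D Let_def by blast
  moreover have "eq_on (odd_coord M) (overlap M c d) (transition M c c i) (coord (odd_coord M) i)"
    using M c by (intro eq_on_subset[OF _ graded_manifold_overlap]) (simp add: graded_manifold_def)
  ultimately show ?thesis
    using eq_on_trans[OF eq_on_sym] by blast
qed

end

lemma graded_manifold_isomorphism:
  assumes "graded_manifold M" "c \<in> charts M" "d \<in> charts M"
  shows "isomorphism (odd_coord M) (overlap M c d) (overlap M d c) (transition M c d) (transition M d c)"
proof -
  interpret a: morphism "odd_coord M" "overlap M c d" "overlap M d c" "transition M c d"
    by (rule graded_manifold_morphism[OF assms])
  interpret b: morphism "odd_coord M" "overlap M d c" "overlap M c d" "transition M d c"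
    by (rule graded_manifold_morphism[OF assms(1,3,2)])
  show ?thesis
    by unfold_locales (rule graded_manifold_inverse assms)+
qed

text \<open>The defining property is tested on the constant covector whose only component is
  \<open>e\<close>: its pullback is a column of the Jacobian, and its covariant derivative is
  \<open>- \<Gamma>\<close>.\<close>

lemma connection_transformation:
  fixes M :: "('c, 'i::{finite,linorder}) atlas"
  assumes M: "graded_manifold M" and G: "linear_connection M \<Gamma>" and c: "c \<in> charts M" and d: "d \<in> charts M"
  shows "eq_on (odd_coord M) (overlap M c d)
    (pd (odd_coord M) a (pd (odd_coord M) b (transition M c d e))
      - (\<Sum>k\<in>UNIV. \<Gamma> c a b k * pd (odd_coord M) k (transition M c d e)))
    (\<Sum>a'\<in>UNIV. \<Sum>b'\<in>UNIV. psign (odd_coord M a \<and> odd_coord M b \<noteq> odd_coord M b') *\<^sub>R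
      (pd (odd_coord M) b (transition M c d b') * pd (odd_coord M) a (transition M c d a')
        * pullback (odd_coord M) (transition M c d) (- \<Gamma> d a' b' e)))"
proof -
  interpret morphism "odd_coord M" "overlap M c d" "overlap M d c" "transition M c d"
    by (rule graded_manifold_morphism[OF M c d])
  let ?p = "odd_coord M"
  define \<alpha> :: "'i \<Rightarrow> 'i sfun" where "\<alpha> = (\<lambda>k. if k = e then 1 else 0)"
  have "\<forall>b. superfunction ?p (wt M) (overlap M d c) (\<alpha> b)"
    by (simp add: \<alpha>_def superfunction_iff weights_in_one[OF D'] weights_in_zero[OF D'])
  then have *: "eq_on ?p (overlap M c d)
       (nabla ?p (\<Gamma> c) (covector_pullback ?p (transition M c d) \<alpha>) a b)
       (\<Sum>a'\<in>UNIV. \<Sum>b'\<in>UNIV. psign (?p a \<and> ?p b \<noteq> ?p b') *\<^sub>R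
            (pd ?p b (transition M c d b') * pd ?p a (transition M c d a')
             * pullback ?p (transition M c d) (nabla ?p (\<Gamma> d) \<alpha> a' b')))"
    using G c d unfolding linear_connection_def by blast
  have "pb (\<alpha> k) = (if k = e then 1 else 0)" for k
    by (simp add: \<alpha>_def)
  then have "covector_pullback ?p (transition M c d) \<alpha> b = pd ?p b (transition M c d e)" for b
    by (simp add: covector_pullback_def delta_mult_sum)
  moreover have "nabla ?p (\<Gamma> d) \<alpha> a' b' = - \<Gamma> d a' b' e" for a' b'
    by (simp add: nabla_def \<alpha>_def delta_mult_sum pd_zero[OF D])
  ultimately show ?thesis
    using * by (simp add: nabla_def)
qed

lemma vf_hamiltonian_eq: "vf_hamiltonian M X c
    = (\<Sum>a\<in>UNIV. lift (X c a) * coord (cot_odd (odd_coord M)) (Inr a))"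
  by (simp add: vf_hamiltonian_def)

lemma double_field_eq: "double_field M Qhat S c Z
    = poisson (odd_coord M) (vf_hamiltonian M Qhat c) (coord (cot_odd (odd_coord M)) Z)
      + poisson (odd_coord M) (S c) (coord (cot_odd (odd_coord M)) Z)"
  by (simp add: double_field_def hamiltonian_vf_def)

section \<open>The Hamiltonian of the double and its coordinate changes\<close>

context
  fixes M :: "('c, 'i::{finite,linorder}) atlas"
    and Qhat :: "'c \<Rightarrow> 'i \<Rightarrow> 'i sfun"
    and S :: "'c \<Rightarrow> ('i + 'i) sfun"
    and \<Gamma> :: "'c \<Rightarrow> 'i \<Rightarrow> 'i \<Rightarrow> 'i \<Rightarrow> 'i sfun"
  assumes QS: "graded_QS_manifold M Qhat S" and G: "linear_connection M \<Gamma>"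
begin

private lemma M: "graded_manifold M"
  and Qhat: "vector_field M Qhat"
  and S: "S \<in> C_inf (cotangent M)" "quadratic_in_momenta M S"
  using QS unfolding graded_QS_manifold_def homological_def by blast+

private abbreviation (input) "p \<equiv> odd_coord M"

private lemma Qhat_smooth:
  assumes "c \<in> charts M"
  shows "smooth_sfun p (chart_dom M c) (Qhat c a)"
proof (rule superfunction_smooth[OF graded_manifold_superdomain[OF M assms]])
  show "superfunction p (wt M) (chart_dom M c) (Qhat c a)"
    using Qhat assms unfolding vector_field_def by blast
qed

private lemma S_smooth:
  assumes "c \<in> charts M"
  shows "smooth_sfun (cot_odd p) (cot_set p (chart_dom M c)) (S c)"
proof (rule superfunction_smooth[OF superdomain_cot_set[OF graded_manifold_superdomain[OF M assms]]])
  show "superfunction (cot_odd p) (wt (cotangent M)) (cot_set p (chart_dom M c)) (S c)"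
    using S(1) assms by (simp add: C_inf_def)
qed

private lemma Gamma_smooth:
  assumes "c \<in> charts M"
  shows "smooth_sfun p (chart_dom M c) (\<Gamma> c a b e)"
proof (rule superfunction_smooth[OF graded_manifold_superdomain[OF M assms]])
  show "superfunction p (wt M) (chart_dom M c) (\<Gamma> c a b e)"
    using G assms unfolding linear_connection_def by blast
qed

lemma double_schouten_hamiltonian_transformation:
  assumes c: "c \<in> charts M" and d: "d \<in> charts M"
  shows "eq_on (cot_odd (cot_odd p)) (cot_set (cot_odd p) (cot_set p (overlap M c d)))
    (double_schouten_hamiltonian M Qhat S \<Gamma> c)
    (pullback (cot_odd (cot_odd p))
      (cot_map (cot_odd p) (cot_map p (transition M c d) (transition M d c)) (cot_map p (transition M d c) (transition M c d)))
      (double_schouten_hamiltonian M Qhat S \<Gamma> d))"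
proof -
  let ?D = "overlap M c d" and ?D' = "overlap M d c"
  interpret isomorphism p ?D ?D' "transition M c d" "transition M d c"
    by (rule graded_manifold_isomorphism[OF M c d])
  interpret c2: isomorphism P E E' \<Phi> \<Psi> by (rule cot_isomorphism)
  have sub: "?D \<subseteq> chart_dom M c" "?D' \<subseteq> chart_dom M d"
    using graded_manifold_overlap[OF M c d] graded_manifold_overlap[OF M d c] .
  let ?Q = "vf_hamiltonian M Qhat"
  have smQ: "smooth_sfun p ?D (Qhat c a)" "smooth_sfun p ?D' (Qhat d a)" for a
    using smooth_sfun_subset[OF Qhat_smooth[OF c] sub(1)] smooth_sfun_subset[OF Qhat_smooth[OF d] sub(2)] .
  have smS: "smooth_sfun P E (S c)" "smooth_sfun P E' (S d)"
    using smooth_sfun_subset[OF S_smooth[OF c] cot_set_mono[OF sub(1)]]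
      smooth_sfun_subset[OF S_smooth[OF d] cot_set_mono[OF sub(2)]] .
  have smH: "smooth_sfun P E (?Q c)" "smooth_sfun P E' (?Q d)"
    unfolding vf_hamiltonian_eq
    by (intro smooth_sfun_sum[OF cot.D] smooth_sfun_mult[OF cot.D] smooth_sfun_lift[OF D] smQ smooth_sfun_coord[OF cot.D])
       (intro smooth_sfun_sum[OF cot.D'] smooth_sfun_mult[OF cot.D'] smooth_sfun_lift[OF D'] smQ smooth_sfun_coord[OF cot.D'])
  note smHS = smooth_sfun_add[OF cot.D' smH(2) smS(2)]
  have Qpb: "eq_on P E (?Q c) (cot.pb (?Q d))"
    unfolding vf_hamiltonian_eq
  proof (rule vf_hamiltonian_pb[OF smQ(2)])
    show "eq_on p ?D (\<Sum>b\<in>UNIV. Qhat c b * jac b a) (pb (Qhat d a))" for a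
      using Qhat c d unfolding vector_field_def vf_apply_def by blast
  qed
  have Spb: "eq_on P E (S c) (cot.pb (S d))"
  proof -
    have "\<forall>c\<in>charts (cotangent M). \<forall>d\<in>charts (cotangent M).
        eq_on (odd_coord (cotangent M)) (overlap (cotangent M) c d) (S c)
        (pullback (odd_coord (cotangent M)) (transition (cotangent M) c d) (S d))"
      using S(1) unfolding C_inf_def by blast
    then show ?thesis
      unfolding cotangent_simps transition_cotangent using c d by blast
  qed
  have HS: "eq_on P E (?Q c + S c) (cot.pb (?Q d + S d))"
    by (rule eq_on_trans[OF eq_on_add[OF Qpb Spb] eq_on_sym[OF cot.pb_add[OF smH(2) smS(2)]]])
  let ?X = "double_field M Qhat S"
  have X: "eq_on P E (?X c Z) (poisson p (?Q c + S c) (coord P Z))" for Z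
    unfolding double_field_eq by (rule eq_on_sym[OF poisson_add_left[OF cot.D smH(1) smS(1)]])
  have X': "eq_on P E' (?X d Z) (poisson p (?Q d + S d) (coord P Z))" for Z
    unfolding double_field_eq by (rule eq_on_sym[OF poisson_add_left[OF cot.D' smH(2) smS(2)]])
  have smX: "smooth_sfun P E' (?X d Z)" for Z
    unfolding double_field_eq
    by (intro smooth_sfun_add[OF cot.D'] poisson_smooth[OF cot.D'] smH smS smooth_sfun_coord[OF cot.D'])
  \<comment> \<open>The components obey the rule of a vector field: by
    \<open>poisson_vf_apply\<close> the left side is the bracket of \<open>Q + S\<close> with
    \<open>\<Phi> A\<close>, and \<open>\<Phi> A\<close> is the pullback of a coordinate.\<close>
  have "eq_on P E (\<Sum>Z\<in>UNIV. ?X c Z * c2.jac Z A) (cot.pb (?X d A))" for A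
  proof -
    have "eq_on P E (\<Sum>Z\<in>UNIV. ?X c Z * c2.jac Z A) (\<Sum>Z\<in>UNIV. poisson p (?Q c + S c) (coord P Z) * c2.jac Z A)"
      by (intro eq_on_sum eq_on_mult X eq_on_refl)
    also have "\<dots> = poisson p (?Q c + S c) (\<Phi> A)"
      by (rule poisson_vf_apply[symmetric])
    also have "eq_on P E \<dots> (poisson p (cot.pb (?Q d + S d)) (cot.pb (coord P A)))"
      unfolding cot.pb_coord by (rule poisson_cong[OF cot.D HS eq_on_refl])
    also have "eq_on P E \<dots> (cot.pb (poisson p (?Q d + S d) (coord P A)))"
      by (rule poisson_pb[OF smHS smooth_sfun_coord[OF cot.D']])
    also have "eq_on P E \<dots> (cot.pb (?X d A))"
      by (rule cot.pb_cong[OF eq_on_sym[OF X']])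
    finally show ?thesis .
  qed
  from c2.vf_hamiltonian_pb[OF smX this]
  have Q: "eq_on c2.P c2.E (vf_hamiltonian (cotangent M) ?X c) (c2.cot.pb (vf_hamiltonian (cotangent M) ?X d))"
    by (simp only: vf_hamiltonian_eq cotangent_simps)
  have smG: "smooth_sfun p ?D' (\<Gamma> d a b e)" for a b e
    by (rule smooth_sfun_subset[OF Gamma_smooth[OF d] sub(2)])
  have parG: "has_parity p ?D' (p a \<noteq> (p b \<noteq> p e)) (\<Gamma> d a b e)" for a b e
    using G d unfolding linear_connection_def by (blast intro: has_parity_subset[OF _ sub(2)])
  have r: "eq_on c2.P c2.E (connection_hamiltonian M \<Gamma> c) (c2.cot.pb (connection_hamiltonian M \<Gamma> d))"
    unfolding connection_hamiltonian_eq
    by (rule connection_function_pb[OF smG parG connection_transformation[OF M G c d]])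
  have smQD: "smooth_sfun c2.P c2.E' (vf_hamiltonian (cotangent M) ?X d)"
    unfolding vf_hamiltonian_eq cotangent_simps
    by (intro smooth_sfun_sum[OF c2.cot.D'] smooth_sfun_mult[OF c2.cot.D'] smooth_sfun_lift[OF cot.D'] smX
        smooth_sfun_coord[OF c2.cot.D'])
  have smr: "smooth_sfun c2.P c2.E' (connection_hamiltonian M \<Gamma> d)"
    unfolding connection_hamiltonian_eq connection_function_def
    by (intro smooth_sfun_add[OF c2.cot.D'] smooth_sfun_sum[OF c2.cot.D'] smooth_sfun_mult[OF c2.cot.D']
        smooth_sfun_lift[OF cot.D'] smooth_sfun_lift[OF D'] smG smooth_sfun_coord[OF c2.cot.D'])
  have "eq_on c2.P c2.E (double_schouten_hamiltonian M Qhat S \<Gamma> c)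
      ((1/2) *\<^sub>R poisson P (c2.cot.pb (vf_hamiltonian (cotangent M) ?X d)) (c2.cot.pb (connection_hamiltonian M \<Gamma> d)))"
    unfolding double_schouten_hamiltonian_def by (intro eq_on_scaleR poisson_cong[OF c2.cot.D] Q r)
  also have "eq_on c2.P c2.E \<dots>
      ((1/2) *\<^sub>R c2.cot.pb (poisson P (vf_hamiltonian (cotangent M) ?X d) (connection_hamiltonian M \<Gamma> d)))"
    by (intro eq_on_scaleR c2.poisson_pb smQD smr)
  also have "eq_on c2.P c2.E \<dots> (c2.cot.pb (double_schouten_hamiltonian M Qhat S \<Gamma> d))"
    unfolding double_schouten_hamiltonian_def
    by (rule eq_on_sym[OF c2.cot.pb_scaleR[OF poisson_smooth[OF c2.cot.D' smQD smr]]])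
  finally show ?thesis .
qed

section \<open>Weight and fibre degree of the Hamiltonian in one chart\<close>

context
  fixes q s :: int and c
  assumes Q_weight: "vf_weight M q Qhat" and S_weight: "fun_weight (cotangent M) s S"
    and G_weight: "zero_weight_connection M \<Gamma>" and c: "c \<in> charts M"
begin

private abbreviation (input) "D \<equiv> chart_dom M c"
private abbreviation (input) "Ec \<equiv> cot_set p D"
private abbreviation (input) "EE \<equiv> cot_set (cot_odd p) Ec"
private abbreviation (input) "W \<equiv> wt (double M q s)"
private abbreviation (input) "WW \<equiv> wt (cotangent (double M q s))"

private lemma dom: "superdomain p D" "superdomain (cot_odd p) Ec" "superdomain (cot_odd (cot_odd p)) EE"
  by (intro superdomain_cot_set graded_manifold_superdomain[OF M c])+

text \<open>Both Hamiltonians weigh \<open>2 * q - s\<close> for \<open>W\<close>, and the bracket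
  on the double takes off \<open>q - s\<close>.\<close>

private lemma double_field_weight: "weights_in (cot_odd p) W Ec {q + W Z} (double_field M Qhat S c Z)"
proof -
  have Q: "weights_in (cot_odd p) W Ec {2 * q - s} (vf_hamiltonian M Qhat c)"
    unfolding vf_hamiltonian_eq
  proof (rule weights_in_sum[OF dom(2)])
    fix a
    have "weights_in p (wt M) D {q + wt M a} (Qhat c a)"
      using Q_weight c by (simp add: vf_weight_def fun_weight_def has_weight_iff)
    then have "weights_in (cot_odd p) W Ec {q + wt M a} (lift (Qhat c a))"
      using weights_in_lift_iff[OF dom(1), of W "wt M"] by simp
    moreover have "weights_in (cot_odd p) W Ec {q - s - wt M a} (coord (cot_odd p) (Inr a))"
      by (rule weights_in_coord[OF dom(2)]) simp
    ultimately show "weights_in (cot_odd p) W Ec {2 * q - s} (lift (Qhat c a) * coord (cot_odd p) (Inr a))"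
      by (rule weights_in_mult[OF dom(2)]) simp
  qed
  have "fibre_quadratic p (wt M) D (S c)"
  proof -
    obtain K where K: "\<And>A B. superfunction p (wt M) D (K A B)"
      "eq_on (cot_odd p) Ec (S c) ((1/2) *\<^sub>R (\<Sum>A\<in>UNIV. \<Sum>B\<in>UNIV. lift (K A B)
            * coord (cot_odd p) (Inr B) * coord (cot_odd p) (Inr A)))"
      using S(2) c unfolding quadratic_in_momenta_def by blast
    have "fibre_quadratic p (wt M) D (2 *\<^sub>R S c)"
      unfolding fibre_quadratic_def
      using K(1) eq_on_scaleR[OF K(2), of 2] by (intro exI[of _ K]) (simp add: superfunction_iff)
    from fibre_quadratic_scaleR[OF dom(1) this, of "1/2"] show ?thesis by simp
  qed
  moreover have "weights_in (cot_odd p) (wt (cotangent M)) Ec {s} (S c)"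
    using S_weight c by (simp add: fun_weight_def has_weight_iff)
  ultimately have "weights_in (cot_odd p) W Ec {s + 2 * (q - s)} (S c)"
    by (intro fibre_quadratic_weight[OF dom(1), where W = "wt (cotangent M)"]) simp_all
  then have S: "weights_in (cot_odd p) W Ec {2 * q - s} (S c)"
    by (simp add: algebra_simps)
  have Z: "weights_in (cot_odd p) W Ec {W Z} (coord (cot_odd p) Z)"
    by (rule weights_in_coord[OF dom(2)]) simp
  have "W (Inl a) + W (Inr a) = q - s" for a by simp
  note pw = weights_in_poisson[OF dom(2) this _ Z]
  have "weights_in (cot_odd p) W Ec {2 * q - s + W Z - (q - s)} (double_field M Qhat S c Z)"
    unfolding double_field_eq by (intro weights_in_add[OF dom(2)] pw Q S)
  then show ?thesis by (simp add: algebra_simps)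
qed

private lemma Gamma_weight: "weights_in p (wt M) D {wt M e - wt M a - wt M b} (\<Gamma> c a b e)"
  using G_weight c by (simp add: zero_weight_connection_def fun_weight_def has_weight_iff)

text \<open>A component of weight \<open>q + W Z\<close> meets a momentum of weight
  \<open>- W Z\<close>. In \<open>r\<close>, \<open>p_a\<close> and \<open>q^a\<close> weigh
  \<open>- w_a\<close> and \<open>w_a - (q - s)\<close>. In the term with \<open>\<Gamma>\<close>
  the base weights cancel too; \<open>y_e\<close> contributes \<open>q - s\<close> and the two
  momenta \<open>- 2 (q - s)\<close>. The bracket on the second cotangent bundle has weight
  0.\<close>

lemma double_schouten_hamiltonian_weight:
  "weights_in (cot_odd (cot_odd p)) WW EE {s} (double_schouten_hamiltonian M Qhat S \<Gamma> c)"
proof -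
  let ?z = "coord (cot_odd (cot_odd p))"
  have z: "weights_in (cot_odd (cot_odd p)) WW EE {WW A} (?z A)" for A
    by (rule weights_in_coord[OF dom(3)]) simp
  have Q: "weights_in (cot_odd (cot_odd p)) WW EE {q} (vf_hamiltonian (cotangent M) (double_field M Qhat S) c)"
    unfolding vf_hamiltonian_eq cotangent_simps
  proof (rule weights_in_sum[OF dom(3)])
    fix A
    have "weights_in (cot_odd (cot_odd p)) WW EE {q + W A} (lift (double_field M Qhat S c A))"
      using double_field_weight weights_in_lift_iff[OF dom(2), of WW W] by simp
    from weights_in_mult[OF dom(3) this z[of "Inr A"], of "{q}"]
    show "weights_in (cot_odd (cot_odd p)) WW EE {q} (lift (double_field M Qhat S c A) * ?z (Inr A))"
      by simp
  qed
  have r: "weights_in (cot_odd (cot_odd p)) WW EE {s - q} (connection_hamiltonian M \<Gamma> c)"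
    unfolding connection_hamiltonian_eq connection_function_def
  proof (intro weights_in_add[OF dom(3)] weights_in_sum[OF dom(3)])
    fix a b e
    show "weights_in (cot_odd (cot_odd p)) WW EE {s - q} (?z (Inr (Inl a)) * ?z (Inr (Inr a)))"
      by (rule weights_in_mult[OF dom(3) z z]) simp
    have "weights_in (cot_odd p) W Ec {wt M e - wt M a - wt M b} (lift (\<Gamma> c a b e))"
      using Gamma_weight weights_in_lift_iff[OF dom(1), of W "wt M"] by simp
    then have L: "weights_in (cot_odd (cot_odd p)) WW EE {wt M e - wt M a - wt M b} (lift (lift (\<Gamma> c a b e)))"
      using weights_in_lift_iff[OF dom(2), of WW W] by simp
    have "weights_in (cot_odd (cot_odd p)) WW EE {q - s - wt M a - wt M b}
        (lift (lift (\<Gamma> c a b e)) * ?z (Inl (Inr e)))"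
      by (rule weights_in_mult[OF dom(3) L z]) simp
    then have "weights_in (cot_odd (cot_odd p)) WW EE {- wt M a}
        (lift (lift (\<Gamma> c a b e)) * ?z (Inl (Inr e)) * ?z (Inr (Inr b)))"
      by (rule weights_in_mult[OF dom(3) _ z]) simp
    then show "weights_in (cot_odd (cot_odd p)) WW EE {s - q}
        (lift (lift (\<Gamma> c a b e)) * ?z (Inl (Inr e)) * ?z (Inr (Inr b)) * ?z (Inr (Inr a)))"
      by (rule weights_in_mult[OF dom(3) _ z]) simp
  qed
  have "weights_in (cot_odd (cot_odd p)) WW EE {q + (s - q) - 0}
      (poisson (cot_odd p) (vf_hamiltonian (cotangent M) (double_field M Qhat S) c) (connection_hamiltonian M \<Gamma> c))"
    by (rule weights_in_poisson[OF dom(3) _ Q r]) simp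
  then show ?thesis
    unfolding double_schouten_hamiltonian_def using weights_in_scaleR[OF dom(3)] by simp
qed

text \<open>The fibres are now those over the double, where \<open>y_e\<close> is a base coordinate.
  So \<open>\<Gamma>\<close> times \<open>y_e\<close> is constant along them and multiplies a
  product of two momenta.\<close>

lemma double_schouten_hamiltonian_quadratic:
  "fibre_quadratic (cot_odd p) W Ec
    (poisson (cot_odd p) (vf_hamiltonian (cotangent M) (double_field M Qhat S) c) (connection_hamiltonian M \<Gamma> c))"
proof (rule fibre_quadratic_poisson[OF dom(2)])
  show "fibre_linear (cot_odd p) W Ec (vf_hamiltonian (cotangent M) (double_field M Qhat S) c)"
    unfolding fibre_linear_def vf_hamiltonian_eq cotangent_simps
    using weights_in_mono[OF double_field_weight subset_UNIV]
    by (intro exI[of _ "double_field M Qhat S c"]) simp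
  have lin: "fibre_quadratic (cot_odd p) W Ec
      (coord (cot_odd (cot_odd p)) (Inr A) * coord (cot_odd (cot_odd p)) (Inr B))" for A B
    by (intro fibre_linear_mult fibre_linear_coord dom(2))
  show "fibre_quadratic (cot_odd p) W Ec (connection_hamiltonian M \<Gamma> c)"
    unfolding connection_hamiltonian_eq connection_function_def
  proof (intro fibre_quadratic_add[OF dom(2)] fibre_quadratic_sum[OF dom(2)] lin)
    fix a b e
    have "weights_in (cot_odd p) W Ec UNIV (lift (\<Gamma> c a b e))"
      using weights_in_mono[OF Gamma_weight subset_UNIV] weights_in_lift_iff[OF dom(1), of W "wt M"] by simp
    moreover have "weights_in (cot_odd p) W Ec UNIV (coord (cot_odd p) (Inr e))"
      by (rule weights_in_coord[OF dom(2)]) simp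
    ultimately have "weights_in (cot_odd p) W Ec UNIV (lift (\<Gamma> c a b e) * coord (cot_odd p) (Inr e))"
      by (rule weights_in_mult[OF dom(2)]) simp
    then have "fibre_constant (cot_odd p) W Ec (lift (lift (\<Gamma> c a b e)) * coord (cot_odd (cot_odd p)) (Inl (Inr e)))"
      unfolding fibre_constant_def
      by (intro exI[of _ "lift (\<Gamma> c a b e) * coord (cot_odd p) (Inr e)"]) (simp add: lift_mult lift_coord)
    from fibre_constant_mult_quadratic[OF dom(2) this lin[of "Inr b" "Inr a"]]
    show "fibre_quadratic (cot_odd p) W Ec (lift (lift (\<Gamma> c a b e)) * coord (cot_odd (cot_odd p)) (Inl (Inr e))
        * coord (cot_odd (cot_odd p)) (Inr (Inr b)) * coord (cot_odd (cot_odd p)) (Inr (Inr a)))"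
      by (simp only: mult.assoc)
  qed
qed

end

end

theorem proposition5p1:
  fixes M :: "('c, 'i::{finite,linorder}) atlas"
    and Qhat :: "'c \<Rightarrow> 'i \<Rightarrow> 'i sfun"
    and S :: "'c \<Rightarrow> ('i + 'i) sfun"
    and \<Gamma> :: "'c \<Rightarrow> 'i \<Rightarrow> 'i \<Rightarrow> 'i \<Rightarrow> 'i sfun"
    and q s :: int
  assumes "graded_QS_manifold M Qhat S"
    and "vf_weight M q Qhat"
    and "fun_weight (cotangent M) s S"
    and "linear_connection M \<Gamma>"
    and "zero_weight_connection M \<Gamma>"
  shows "double_schouten_hamiltonian M Qhat S \<Gamma> \<in> C_inf (cotangent (double M q s))
    \<and> quadratic_in_momenta (double M q s) (double_schouten_hamiltonian M Qhat S \<Gamma>)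
    \<and> fun_weight (cotangent (double M q s)) s (double_schouten_hamiltonian M Qhat S \<Gamma>)"
proof (intro conjI)
  note weight = double_schouten_hamiltonian_weight[OF assms(1,4,2,3,5)]
  show "fun_weight (cotangent (double M q s)) s (double_schouten_hamiltonian M Qhat S \<Gamma>)"
    unfolding fun_weight_def has_weight_iff using weight by simp
  show "double_schouten_hamiltonian M Qhat S \<Gamma> \<in> C_inf (cotangent (double M q s))"
    unfolding C_inf_def superfunction_iff
    using weights_in_mono[OF weight subset_UNIV] double_schouten_hamiltonian_transformation[OF assms(1,4)]
    by (simp add: transition_cotangent)
  show "quadratic_in_momenta (double M q s) (double_schouten_hamiltonian M Qhat S \<Gamma>)"
    unfolding quadratic_in_momenta_def
  proof
    fix c assume "c \<in> charts (double M q s)"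
    then have "c \<in> charts M" by simp
    from double_schouten_hamiltonian_quadratic[OF assms(1,4,2,3,5) this]
    obtain K where "\<And>A B. weights_in (cot_odd (odd_coord M)) (wt (double M q s)) (cot_set (odd_coord M) (chart_dom M c)) UNIV (K A B)"
      and "eq_on (cot_odd (cot_odd (odd_coord M))) (cot_set (cot_odd (odd_coord M)) (cot_set (odd_coord M) (chart_dom M c)))
        (poisson (cot_odd (odd_coord M)) (vf_hamiltonian (cotangent M) (double_field M Qhat S) c) (connection_hamiltonian M \<Gamma> c))
        (\<Sum>A\<in>UNIV. \<Sum>B\<in>UNIV. lift (K A B) * coord (cot_odd (cot_odd (odd_coord M))) (Inr B)
          * coord (cot_odd (cot_odd (odd_coord M))) (Inr A))"
      unfolding fibre_quadratic_def by blast
    \<comment> \<open>The factor 1/2 of \<open>S_D\<close> is the 1/2 in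
      \<open>quadratic_in_momenta\<close>, so the coefficients of the bracket serve
      unchanged.\<close>
    then show "\<exists>K. (\<forall>A B. superfunction (odd_coord (double M q s)) (wt (double M q s)) (chart_dom (double M q s) c) (K A B))
       \<and> eq_on (cot_odd (odd_coord (double M q s))) (cot_set (odd_coord (double M q s)) (chart_dom (double M q s) c))
           (double_schouten_hamiltonian M Qhat S \<Gamma> c)
           ((1/2) *\<^sub>R (\<Sum>A\<in>UNIV. \<Sum>B\<in>UNIV. lift (K A B)
              * coord (cot_odd (odd_coord (double M q s))) (Inr B) * coord (cot_odd (odd_coord (double M q s))) (Inr A)))"
      unfolding double_schouten_hamiltonian_def superfunction_iff double_simps
      by (intro exI[of _ K] conjI allI eq_on_scaleR)
  qed
qed

end
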